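(* The map sending the $\simeq$-equivalence class of $(a,b,c,\lambda,\delta)\in\mathbf{PM}$ to the isomorphism class of $W_\lambda^\delta(a,b,c)$ is a well-defined bijection from the set $\mathbf{PM}/\!\simeq$ of $\simeq$-equivalence classes of $\mathbf{PM}$ onto $\mathbf{IM}$.
   Context: $\mathbb F$ is an algebraically closed field and $q\in\mathbb F^\times$ is a root of unity of order $d$ with $d\notin\{1,2,4\}$; $d'=d$ if $d$ is odd, $d'=d/2$ if $d$ is even. $\sqrt{x}$ denotes a fixed square root of $x\in\mathbb F$. $\triangle_q$ is the unital associative $\mathbb F$-algebra with generators $A,B,C$ subject to: each of $A+\frac{qBC-q^{-1}CB}{q^2-q^{-2}}$, $B+\frac{qCA-q^{-1}AC}{q^2-q^{-2}}$, $C+\frac{qAB-q^{-1}BA}{q^2-q^{-2}}$ is central; $\alpha,\beta,\gamma$ are these times $q+q^{-1}$. For a $\triangle_q$-module $V$ and $\mu\in\mathbb F^\times$, $V(\mu)=\{v: Bv=(\mu+\mu^{-1})v\}$; $\mu$ is a marginal weight of $V$ if some nonzero $v\in V(\mu)$ satisfies $(B-\mu q^2-\mu^{-1}q^{-2})(B-\mu-\mu^{-1})Av=0$. For $(a,b,c,\lambda)\in(\mathbb F^\times)^4$, $i\in\mathbb N$: $\theta_i=a\lambda^{-1}q^{2i}+a^{-1}\lambda q^{-2i}$, $\theta_i^*=b\lambda^{-1}q^{2i}+b^{-1}\lambda q^{-2i}$, $\varphi_i=a^{-1}b^{-1}\lambda q(q^i-q^{-i})(\lambda^{-1}q^{i-1}-\lambda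 q^{1-i})(q^{-i}-abc\lambda^{-1}q^{i-1})(q^{-i}-abc^{-1}\lambda^{-1}q^{i-1})$. $M_\lambda(a,b,c)$ has basis $\{m_i\}_{i\in\mathbb N}$ with $(A-\theta_i)m_i=m_{i+1}$, $(B-\theta_i^* )m_i=\varphi_im_{i-1}$, and $\alpha,\beta,\gamma$ acting as $(b+b^{-1})(c+c^{-1})+(a+a^{-1})(\lambda q+\lambda^{-1}q^{-1})$, $(c+c^{-1})(a+a^{-1})+(b+b^{-1})(\lambda q+\lambda^{-1}q^{-1})$, $(a+a^{-1})(b+b^{-1})+(c+c^{-1})(\lambda q+\lambda^{-1}q^{-1})$. For $\delta\in\mathbb F$, $W_\lambda^\delta(a,b,c)$ is the quotient of $M_\lambda(a,b,c)$ by the span of $\{\delta m_i-m_{d'+i}\}_{i\in\mathbb N}$ (dimension $d'$). $\{\pm1\}$ acts on $(\mathbb F^\times)^4$ by $(-1)\cdot(a,b,c,\lambda)=(-a,-b,-c,-\lambda)$; $\mathfrak S_4$ acts on the right on $\{\pm1\}$-orbits $[\cdot]$ by $[a,b,c,\lambda](1\,2)=[a,b,c^{-1},\lambda]$, $[a,b,c,\lambda](3\,4)=[a^{-1},b,c,\lambda]$, $[a,b,c,\lambda](2\,3)=[a/s,b/s,c/s,\lambda/s]$, $s=\sqrt{abc\lambda q}$. $(a,b,c,\lambda)\approx(\bar a,\bar b,\bar c,\bar\lambda)$ if their orbits lie in the same $\mathfrak S_4$-orbit; $(a,b,c,\lambda,\delta)\simeq_{\pm,\mathfrak S_4}(\bar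 a,\bar b,\bar c,\bar\lambda,\bar\delta)$ if moreover $\delta+a^{d'}\lambda^{-d'}+a^{-d'}\lambda^{d'}=\bar\delta+\bar a^{d'}\bar\lambda^{-d'}+\bar a^{-d'}\bar\lambda^{d'}$. Define $(a,b,c,\lambda,\delta)\sim(\bar a,\bar b,\bar c,\bar\lambda,\bar\delta)$ if one of: (i) $(a,b,c,\lambda,\delta)\simeq_{\pm,\mathfrak S_4}(\bar a,\bar b,\bar c,\bar\lambda,\bar\delta)$; (ii) $(\bar a,\bar b,\bar c,\bar\lambda,\bar\delta)=(a^{-1},b,c,\lambda^{-1}q^{-2},\delta)$ and $\lambda^2\in\{q^{2i}:0\le i\le d'-2\}$; (iii) $(\bar a,\bar b,\bar c,\bar\lambda,\bar\delta)=(a^{-1},b^{-1},c,\lambda^{-1}q^{-2},\delta)$, $b^2\lambda^{-2}\notin\{q^{2(d'-i+1)}:0\le i\le d'-2\}$, and $\delta(b^{d'}\lambda^{-d'}-b^{-d'}\lambda^{d'})=a^{-d'}b^{-d'}(\lambda^{2d'}-1)(a^{d'}b^{d'}c^{d'}\lambda^{-d'}q^{d'}-1)(a^{d'}b^{d'}c^{-d'}\lambda^{-d'}q^{d'}-1)$. Let $\simeq$ be the equivalence relation on $(\mathbb F^\times)^4\times\mathbb F$ generated by $\sim$. $\mathbf{PM}$ is the set of $(a,b,c,\lambda,\delta)\in(\mathbb F^\times)^4\times\mathbb F$ such that for all $(\bar a,\bar b,\bar c,\bar\lambda,\bar\delta)\simeq_{\pm,\mathfrak S_4}(a,b,c,\lambda,\delta)$,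 $\bar\delta\ne0$ or $\bar\lambda^2\notin\{q^{2i}:0\le i\le d'-2\}$ (this set is closed under $\simeq$). $\mathbf{IM}$ is the set of isomorphism classes of $d'$-dimensional irreducible $\triangle_q$-modules having a marginal weight. *)

theory Defs
  imports "Jordan_Normal_Form.Matrix" "HOL-Computational_Algebra.Polynomial"
begin

definition alg_closed :: "'a::field itself \<Rightarrow> bool" where
  "alg_closed TYPE('a) \<longleftrightarrow> (\<forall>p::'a poly. degree p \<noteq> 0 \<longrightarrow> (\<exists>x. poly p x = 0))"

definition root_of_unity_order :: "'a::field \<Rightarrow> nat \<Rightarrow> bool" where
  "root_of_unity_order q d \<longleftrightarrow> 0 < d \<and> q ^ d = 1 \<and> (\<forall>k. 0 < k \<and> k < d \<longrightarrow> q ^ k \<noteq> 1)"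

definition dprime :: "nat \<Rightarrow> nat" where
  "dprime d = (if even d then d div 2 else d)"

section \<open>Finite-dimensional modules of the universal Askey-Wilson algebra\<close>

text \<open>A d-dimensional module is given by the matrices of A, B, C on F^n
  (with respect to some basis).\<close>

type_synonym 'a tmod = "'a mat \<times> 'a mat \<times> 'a mat"

definition is_tmod :: "'a::field \<Rightarrow> nat \<Rightarrow> 'a tmod \<Rightarrow> bool" where
  "is_tmod q n M \<longleftrightarrow> (case M of (A, B, C) \<Rightarrow>
     A \<in> carrier_mat n n \<and> B \<in> carrier_mat n n \<and> C \<in> carrier_mat n n \<and>
     (let k = inverse (q^2 - inverse q ^ 2);
          Oa = A + k \<cdot>\<^sub>m (q \<cdot>\<^sub>m (B * C) - inverse q \<cdot>\<^sub>m (C * B));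
          Ob = B + k \<cdot>\<^sub>m (q \<cdot>\<^sub>m (C * A) - inverse q \<cdot>\<^sub>m (A * C));
          Oc = C + k \<cdot>\<^sub>m (q \<cdot>\<^sub>m (A * B) - inverse q \<cdot>\<^sub>m (B * A))
      in (\<forall>Z \<in> {Oa, Ob, Oc}. \<forall>X \<in> {A, B, C}. Z * X = X * Z)))"

definition tmod_iso :: "nat \<Rightarrow> 'a::field tmod \<Rightarrow> 'a tmod \<Rightarrow> bool" where
  "tmod_iso n M N \<longleftrightarrow> (case M of (A, B, C) \<Rightarrow> case N of (A', B', C') \<Rightarrow>
     (\<exists>P \<in> carrier_mat n n. invertible_mat P \<and> P * A = A' * P \<and> P * B = B' * P \<and> P * C = C' * P))"

definition is_subspace :: "nat \<Rightarrow> 'a::field vec set \<Rightarrow> bool" where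
  "is_subspace n S \<longleftrightarrow> S \<subseteq> carrier_vec n \<and> 0\<^sub>v n \<in> S \<and>
     (\<forall>v\<in>S. \<forall>w\<in>S. v + w \<in> S) \<and> (\<forall>c. \<forall>v\<in>S. c \<cdot>\<^sub>v v \<in> S)"

definition tmod_irreducible :: "nat \<Rightarrow> 'a::field tmod \<Rightarrow> bool" where
  "tmod_irreducible n M \<longleftrightarrow> n > 0 \<and> (case M of (A, B, C) \<Rightarrow>
     (\<forall>S. is_subspace n S \<and> (\<forall>v\<in>S. A *\<^sub>v v \<in> S \<and> B *\<^sub>v v \<in> S \<and> C *\<^sub>v v \<in> S)
        \<longrightarrow> S = {0\<^sub>v n} \<or> S = carrier_vec n))"

definition is_marginal_weight :: "'a::field \<Rightarrow> nat \<Rightarrow> 'a tmod \<Rightarrow> 'a \<Rightarrow> bool" where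
  "is_marginal_weight q n M \<mu> \<longleftrightarrow> \<mu> \<noteq> 0 \<and> (case M of (A, B, C) \<Rightarrow>
     (\<exists>v \<in> carrier_vec n. v \<noteq> 0\<^sub>v n \<and> B *\<^sub>v v = (\<mu> + inverse \<mu>) \<cdot>\<^sub>v v \<and>
        (B - (\<mu> * q^2 + inverse \<mu> * inverse q ^ 2) \<cdot>\<^sub>m 1\<^sub>m n) *\<^sub>v
          ((B - (\<mu> + inverse \<mu>) \<cdot>\<^sub>m 1\<^sub>m n) *\<^sub>v (A *\<^sub>v v)) = 0\<^sub>v n))"

definition iso_class :: "'a::field \<Rightarrow> nat \<Rightarrow> 'a tmod \<Rightarrow> 'a tmod set" where
  "iso_class q n M = {N. is_tmod q n N \<and> tmod_iso n N M}"

definition IM :: "'a::field \<Rightarrow> nat \<Rightarrow> 'a tmod set set" where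
  "IM q d = {iso_class q (dprime d) M | M.
      is_tmod q (dprime d) M \<and> tmod_irreducible (dprime d) M \<and>
      (\<exists>\<mu>. is_marginal_weight q (dprime d) M \<mu>)}"

definition th :: "'a::field \<Rightarrow> 'a \<Rightarrow> 'a \<Rightarrow> nat \<Rightarrow> 'a" where
  "th q a l i = a * inverse l * q ^ (2*i) + inverse a * l * inverse q ^ (2*i)"

definition phi :: "'a::field \<Rightarrow> 'a \<Rightarrow> 'a \<Rightarrow> 'a \<Rightarrow> 'a \<Rightarrow> nat \<Rightarrow> 'a" where
  "phi q a b c l i = inverse a * inverse b * l * q *
     (q powi int i - q powi (- int i)) *
     (inverse l * q powi (int i - 1) - l * q powi (1 - int i)) *
     (q powi (- int i) - a * b * c * inverse l * q powi (int i - 1)) *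
     (q powi (- int i) - a * b * inverse c * inverse l * q powi (int i - 1))"

text \<open>Matrices of A, B, C on W, w.r.t. the basis given by the images of m_0, ..., m_{d'-1};
  in W one has m_{d'} = \<delta> m_0.  C is determined by the central element gamma, which acts on
  M (hence on W) as the given scalar.\<close>

definition W_A :: "'a::field \<Rightarrow> nat \<Rightarrow> 'a \<times> 'a \<times> 'a \<times> 'a \<times> 'a \<Rightarrow> 'a mat" where
  "W_A q n x = (case x of (a, b, c, l, \<delta>) \<Rightarrow>
     mat n n (\<lambda>(i, j). (if i = j then th q a l j else 0) + (if i = j + 1 then 1 else 0)
                       + (if j + 1 = n \<and> i = 0 then \<delta> else 0)))"

definition W_B :: "'a::field \<Rightarrow> nat \<Rightarrow> 'a \<times> 'a \<times> 'a \<times> 'a \<times> 'a \<Rightarrow> 'a mat" where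
  "W_B q n x = (case x of (a, b, c, l, \<delta>) \<Rightarrow>
     mat n n (\<lambda>(i, j). (if i = j then th q b l j else 0)
                       + (if j = i + 1 then phi q a b c l j else 0)))"

definition gamma_val :: "'a::field \<Rightarrow> 'a \<times> 'a \<times> 'a \<times> 'a \<times> 'a \<Rightarrow> 'a" where
  "gamma_val q x = (case x of (a, b, c, l, \<delta>) \<Rightarrow>
     (a + inverse a) * (b + inverse b) + (c + inverse c) * (l * q + inverse l * inverse q))"

definition W_C :: "'a::field \<Rightarrow> nat \<Rightarrow> 'a \<times> 'a \<times> 'a \<times> 'a \<times> 'a \<Rightarrow> 'a mat" where
  "W_C q n x = (gamma_val q x / (q + inverse q)) \<cdot>\<^sub>m 1\<^sub>m n
     - inverse (q^2 - inverse q ^ 2) \<cdot>\<^sub>m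
         (q \<cdot>\<^sub>m (W_A q n x * W_B q n x) - inverse q \<cdot>\<^sub>m (W_B q n x * W_A q n x))"

definition W :: "'a::field \<Rightarrow> nat \<Rightarrow> 'a \<times> 'a \<times> 'a \<times> 'a \<times> 'a \<Rightarrow> 'a tmod" where
  "W q d x = (W_A q (dprime d) x, W_B q (dprime d) x, W_C q (dprime d) x)"

definition nz4 :: "'a::field \<times> 'a \<times> 'a \<times> 'a \<Rightarrow> bool" where
  "nz4 y \<longleftrightarrow> (case y of (a, b, c, l) \<Rightarrow> a \<noteq> 0 \<and> b \<noteq> 0 \<and> c \<noteq> 0 \<and> l \<noteq> 0)"

definition nz5 :: "'a::field \<times> 'a \<times> 'a \<times> 'a \<times> 'a \<Rightarrow> bool" where
  "nz5 x \<longleftrightarrow> (case x of (a, b, c, l, \<delta>) \<Rightarrow> nz4 (a, b, c, l))"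

text \<open>One generator step: the {+-1}-action and the actions of the transpositions (1 2), (3 4),
  (2 3) generating S_4.  The S_4-orbits of {+-1}-orbits are the classes of the equivalence
  relation generated by these steps.  sr is a fixed square root function.\<close>

definition s4_step :: "('a::field \<Rightarrow> 'a) \<Rightarrow> 'a \<Rightarrow> 'a \<times> 'a \<times> 'a \<times> 'a \<Rightarrow> 'a \<times> 'a \<times> 'a \<times> 'a \<Rightarrow> bool" where
  "s4_step sr q y z \<longleftrightarrow> (case y of (a, b, c, l) \<Rightarrow>
     z = (-a, -b, -c, -l) \<or> z = (a, b, inverse c, l) \<or> z = (inverse a, b, c, l) \<or>
     (let s = sr (a * b * c * l * q) in z = (a / s, b / s, c / s, l / s)))"

definition approx4 :: "('a::field \<Rightarrow> 'a) \<Rightarrow> 'a \<Rightarrow> 'a \<times> 'a \<times> 'a \<times> 'a \<Rightarrow> 'a \<times> 'a \<times> 'a \<times> 'a \<Rightarrow> bool" where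
  "approx4 sr q y z \<longleftrightarrow> nz4 y \<and> nz4 z \<and>
     (\<lambda>u v. nz4 u \<and> nz4 v \<and> (s4_step sr q u v \<or> s4_step sr q v u))\<^sup>*\<^sup>* y z"

definition inv_delta :: "nat \<Rightarrow> 'a::field \<times> 'a \<times> 'a \<times> 'a \<times> 'a \<Rightarrow> 'a" where
  "inv_delta n x = (case x of (a, b, c, l, \<delta>) \<Rightarrow>
     \<delta> + a ^ n * inverse l ^ n + inverse a ^ n * l ^ n)"

definition simeq_pmS4 :: "('a::field \<Rightarrow> 'a) \<Rightarrow> 'a \<Rightarrow> nat
     \<Rightarrow> 'a \<times> 'a \<times> 'a \<times> 'a \<times> 'a \<Rightarrow> 'a \<times> 'a \<times> 'a \<times> 'a \<times> 'a \<Rightarrow> bool" where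
  "simeq_pmS4 sr q d x y \<longleftrightarrow> (case x of (a, b, c, l, \<delta>) \<Rightarrow> case y of (a', b', c', l', \<delta>') \<Rightarrow>
     approx4 sr q (a, b, c, l) (a', b', c', l') \<and>
     inv_delta (dprime d) x = inv_delta (dprime d) y)"

definition sim_basic :: "('a::field \<Rightarrow> 'a) \<Rightarrow> 'a \<Rightarrow> nat
     \<Rightarrow> 'a \<times> 'a \<times> 'a \<times> 'a \<times> 'a \<Rightarrow> 'a \<times> 'a \<times> 'a \<times> 'a \<times> 'a \<Rightarrow> bool" where
  "sim_basic sr q d x y \<longleftrightarrow> nz5 x \<and> nz5 y \<and> (case x of (a, b, c, l, \<delta>) \<Rightarrow>
     (let n = dprime d in
       simeq_pmS4 sr q d x y \<or>
       (y = (inverse a, b, c, inverse l * inverse q ^ 2, \<delta>) \<and>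
          (\<exists>i \<le> n - 2. l^2 = q ^ (2*i))) \<or>
       (y = (inverse a, inverse b, c, inverse l * inverse q ^ 2, \<delta>) \<and>
          \<not> (\<exists>i \<le> n - 2. b^2 * inverse l ^ 2 = q ^ (2 * (n - i + 1))) \<and>
          \<delta> * (b ^ n * inverse l ^ n - inverse b ^ n * l ^ n) =
            inverse a ^ n * inverse b ^ n * (l ^ (2*n) - 1) *
            (a ^ n * b ^ n * c ^ n * inverse l ^ n * q ^ n - 1) *
            (a ^ n * b ^ n * inverse c ^ n * inverse l ^ n * q ^ n - 1))))"

definition simeq :: "('a::field \<Rightarrow> 'a) \<Rightarrow> 'a \<Rightarrow> nat
     \<Rightarrow> 'a \<times> 'a \<times> 'a \<times> 'a \<times> 'a \<Rightarrow> 'a \<times> 'a \<times> 'a \<times> 'a \<times> 'a \<Rightarrow> bool" where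
  "simeq sr q d = (\<lambda>x y. sim_basic sr q d x y \<or> sim_basic sr q d y x)\<^sup>*\<^sup>*"

definition simeq_rel :: "('a::field \<Rightarrow> 'a) \<Rightarrow> 'a \<Rightarrow> nat
     \<Rightarrow> (('a \<times> 'a \<times> 'a \<times> 'a \<times> 'a) \<times> ('a \<times> 'a \<times> 'a \<times> 'a \<times> 'a)) set" where
  "simeq_rel sr q d = {(x, y). simeq sr q d x y}"

definition PM :: "('a::field \<Rightarrow> 'a) \<Rightarrow> 'a \<Rightarrow> nat \<Rightarrow> ('a \<times> 'a \<times> 'a \<times> 'a \<times> 'a) set" where
  "PM sr q d = {x. nz5 x \<and> (\<forall>y. simeq_pmS4 sr q d x y \<longrightarrow>
     (case y of (a, b, c, l, \<delta>) \<Rightarrow>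
        \<delta> \<noteq> 0 \<or> \<not> (\<exists>i \<le> dprime d - 2. l^2 = q ^ (2*i))))}"

end

theory Submission
  imports Defs "Jordan_Normal_Form.Char_Poly"
begin

text \<open>Put p = q^2, m = b/\<lambda> and x1, x2, x3, x4 = a/\<lambda>, 1/(a\<lambda>), bcq, bq/c, so that x1 x2 x3 x4 = m^2 p; the
  invariant of the last parameter is D = \<delta> + x1^n + x1^(-n).  Up to isomorphism the action of A and B on W depends
  only on m, D and the unordered quadruple of the x's, because these numbers are visible on one marginal vector v of
  weight m: the elementary symmetric functions of the x's are read off from the central elements and from the scalar
  c in B A v = \<theta> A v + c v, and D from the action of A alone.  Conversely an irreducible module with such a vector is
  W, the n-th power of the ladder built on v being the scalar \<delta>.  The module is irreducible iff D differs from
  x_i^n + x_j^n whenever x_i x_j p^k = p with 0 < k < n.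

  Hence two parameter tuples give isomorphic modules iff one module carries marginal vectors for both.  Writing a
  marginal vector of W in the ladder basis, its top position k usually gives the new weight m p^k, and then the new
  parameters arise from shifts of m, x_i, x_j by powers p^k with x_i x_j p^k = p; this is relation (ii).  The only
  other possibility is a vector of weight p/m reaching the last basis position: its coordinates satisfy a first-order
  recursion, and the closing condition of the recursion at the wrap-around is the equation in relation (iii).\<close>


section \<open>Rational identities\<close>

text \<open>\<open>C\<close> drops out at once: the scalar gamma expresses it through
  \<open>A\<close> and \<open>B\<close>, and centrality of alpha and beta becomes one cubic relation
  each. The obstacle is that \<open>theta m\<close> takes each value twice, at Q and at 1/(m^2 Q).
  So \<open>B\<close> may have repeated eigenvalues, and a marginal vector with top position k need
  not be a ladder vector. Eliminating its coordinates from the two top rows leaves a product of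
  factors 1 - x_i x_j p^(k-1), which vanishes exactly at pairs allowing a shift, but the elimination
  fails if the eigenvalues at k and k-2 agree or if m^2 p^k = p. The first case is settled by
  running through all orderings of the x's, the second by the bottom row or by a preliminary shift.
  The same analysis gives irreducibility: a nonzero vector of least top position in an invariant
  subspace is marginal, and marginal vectors generate. For weight p/m all rows except the bottom one
  hold identically. The bottom row equates \<delta> with a product of ratios over all n-th roots of
  unity, whence the n-th powers in (iii). The ratios need m^(2n) \<noteq> 1; otherwise shifts take
  over.\<close>

definition theta :: "'a::field \<Rightarrow> 'a \<Rightarrow> 'a" where
  "theta x Q = x * Q + inverse (x * Q)"

text \<open>The scalar \<phi>_i as a function of Q = p^i; u and v are the elementary symmetric functions of degree 1 and 2 of
  x2, x3, x4, whose product is m^2 p / x by the constraint on the parameters.\<close>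
definition varphi :: "'a::field \<Rightarrow> 'a \<Rightarrow> 'a \<Rightarrow> 'a \<Rightarrow> 'a \<Rightarrow> 'a \<Rightarrow> 'a" where
  "varphi p m x u v Q = p * (1 - Q) * (1 - x * u * Q / p + x^2 * v * Q^2 / p^2 - x^2 * m^2 * Q^3 / p^2) / (x * m * Q^2)"

text \<open>As a function of i, \<open>theta m (p^i)\<close> combines p^i and p^(-i), the
  characteristic roots of this recurrence. It kills the outermost ladder vector in the cubic
  relations.\<close>

lemma theta_recur: "p \<noteq> (0::'a::field) \<Longrightarrow> m \<noteq> 0 \<Longrightarrow> Q \<noteq> 0 \<Longrightarrow>
   theta m Q - (p + inverse p) * theta m (p * Q) + theta m (p * (p * Q)) = 0"
  by (simp add: theta_def field_simps power2_eq_square power3_eq_cube)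

text \<open>The conic through all pairs of consecutive eigenvalues. It kills the neighbour on the
  other side in the cubic relations.\<close>

lemma theta_quad: "p \<noteq> (0::'a::field) \<Longrightarrow> x \<noteq> 0 \<Longrightarrow> Q \<noteq> 0 \<Longrightarrow>
   theta x Q ^ 2 - (p + inverse p) * theta x Q * theta x (p * Q) + theta x (p * Q) ^2 + (p - inverse p)^2 = 0"
  by (simp add: theta_def field_simps power2_eq_square power3_eq_cube)

text \<open>Coefficient of the next ladder vector when the beta relation is applied to a ladder
  vector. The last bracket is the value of gamma: \<open>x + u\<close> and
  \<open>x * v + m^2*p / x\<close> are the symmetric functions of degree 1 and 3 of all four
  x's.\<close>

lemma rel1_up: 
  assumes "p \<noteq> (0::'a::field)" "m \<noteq> 0" "x \<noteq> 0" "Q \<noteq> 0"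
  shows "theta m Q * (theta x Q + theta x (p*Q)) + varphi p m x u v Q
      - (p + inverse p) * (theta x Q * theta m Q + varphi p m x u v (p*Q) + theta m (p*Q) * theta x (p*Q))
      + varphi p m x u v (p*(p*Q)) + (theta x Q + theta x (p*Q)) * theta m (p*Q)
      + (p - 2 + inverse p) * ((x + u + (x * v + m^2*p / x) / p) / m) = 0"
  using assms unfolding theta_def varphi_def
  by (simp add: divide_simps) (simp add: algebra_simps eval_nat_numeral)

text \<open>The diagonal coefficient of the beta relation. The vector in question has index
  \<open>p*Q\<close>, so that for the bottom vector \<open>Q\<close> is p^(-1) and no case
  distinction is needed.\<close>

lemma rel1_diag: 
  assumes "p \<noteq> (0::'a::field)" "m \<noteq> 0" "x \<noteq> 0" "Q \<noteq> 0"
  shows "theta m (p*Q) * theta x (p*Q)^2 + varphi p m x u v (p*Q) * (theta x Q + theta x (p*Q))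
      - (p + inverse p) * ((theta x (p*Q) * theta m (p*Q) + varphi p m x u v (p*(p*Q))) * theta x (p*Q) + theta x (p*Q) * varphi p m x u v (p*Q))
      + (theta x (p*Q) + theta x (p*(p*Q))) * varphi p m x u v (p*(p*Q)) + theta x (p*Q)^2 * theta m (p*Q)
      + (p - inverse p)^2 * theta m (p*Q)
      + (p - 2 + inverse p) * ((x + u + (x * v + m^2*p / x) / p) / m) * theta x (p*Q)
      - (p - inverse p) * (1 - inverse p) * ((x * u + v) + m^2 + p) / m = 0"
  using assms unfolding theta_def varphi_def
  by (simp add: divide_simps) (simp add: algebra_simps eval_nat_numeral)

text \<open>The diagonal coefficient of the alpha relation, indexed in the same way.\<close>

lemma rel2_diag: 
  assumes "p \<noteq> (0::'a::field)" "m \<noteq> 0" "x \<noteq> 0" "Q \<noteq> 0"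
  shows "theta x (p*Q) * theta m (p*Q)^2 + varphi p m x u v (p*(p*Q)) * (theta m (p*(p*Q)) + theta m (p*Q))
      - (p + inverse p) * (theta m (p*Q) * (theta x (p*Q) * theta m (p*Q) + varphi p m x u v (p*(p*Q))) + theta m (p*Q) * varphi p m x u v (p*Q))
      + varphi p m x u v (p*Q) * (theta m (p*Q) + theta m Q) + theta m (p*Q)^2 * theta x (p*Q)
      + (p - inverse p)^2 * theta x (p*Q)
      + (p - 2 + inverse p) * ((x + u + (x * v + m^2*p / x) / p) / m) * theta m (p*Q)
      - (p - inverse p) * (1 - inverse p) * (x + u + (x * v + m^2*p / x) / m^2) = 0"
  using assms unfolding theta_def varphi_def
  by (simp add: divide_simps) (simp add: algebra_simps eval_nat_numeral)

text \<open>The scalar in \<open>B A v\<close> for the bottom ladder vector. The left side singles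
  out \<open>x\<close>, the right side is e3 - e1 and symmetric in the four x's; this is why
  reordering them does not change the module.\<close>

lemma marginal_coeff:
  assumes "p \<noteq> (0::'a::field)" "m \<noteq> 0" "x \<noteq> 0"
  shows "theta x 1 * (theta m 1 - theta m p) + varphi p m x u v p = (inverse p - 1) * ((x * v + m^2*p/x) - (x+u)) / m"
  using assms unfolding theta_def varphi_def
  by (simp add: divide_simps) (simp add: algebra_simps eval_nat_numeral)


text \<open>Two disjoint pairs with product p/Q: solving both constraints for \<open>x2\<close> and
  \<open>x4\<close> leaves an identity in the free variables m, x1, x3, Q.\<close>

lemma double_aux: fixes m :: "'a::field"
  assumes "m \<noteq> 0" "x1 \<noteq> 0" "x3 \<noteq> 0" "Q \<noteq> 0"
  defines "p \<equiv> m^2*Q^2" and "x2 \<equiv> m^2*Q/x1" and "x4 \<equiv> m^2*Q/x3"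
  defines "S \<equiv> theta m" and "T \<equiv> theta x1" and "F \<equiv> varphi p m x1 (x2+x3+x4) (x2*x3+x2*x4+x3*x4)"
  defines "d2 \<equiv> S Q - S (Q/p^2)"
  shows "(p - 1) * (d2 * (T (Q/p) - T Q) + F (Q/p) - F (p*Q))
      = d2 * ((Q - 1) * ((x1 - x3) + m^2*Q * (inverse x1 - inverse x3)))"
  using assms(1-4) unfolding d2_def S_def T_def F_def theta_def varphi_def p_def x2_def x4_def
  by (simp add: divide_simps) (simp add: algebra_simps eval_nat_numeral)

text \<open>For Q = p^k the bracket on the right is the sum of theta x1 (p^j) - theta x3 (p^j) over
  j < k, which is a coordinate of the ladder vector built with \<open>x3\<close> in first
  place.\<close>

lemma double_id: fixes m :: "'a::field"
  assumes p: "p = m^2 * Q^2" and nz: "m \<noteq> 0" "x1 \<noteq> 0" "x2 \<noteq> 0" "x3 \<noteq> 0" "x4 \<noteq> 0" "Q \<noteq> 0" "p \<noteq> 1" 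
    and x12: "x1 * x2 * Q = p" and prod: "x1 * x2 * x3 * x4 = m^2*p"
  defines "S \<equiv> theta m" and "T \<equiv> theta x1" and "F \<equiv> varphi p m x1 (x2+x3+x4) (x2*x3+x2*x4+x3*x4)"
  defines "d2 \<equiv> S Q - S (Q/p^2)"
  shows "d2 * (T (Q/p) - T Q) + F (Q/p) - F (p*Q)
      = d2 * ((Q - 1) / (p - 1) * (x1 - x3) + (inverse Q - 1) / (inverse p - 1) * (inverse x1 - inverse x3))"
proof -
  have x2: "x2 = m^2 * Q / x1" using x12 nz p by (simp add: field_simps power2_eq_square)
  have "m^2 * Q * x3 * x4 = m^2 * p" using prod x2 nz by simp
  then have x4: "x4 = m^2 * Q / x3" using nz p by (simp add: field_simps power2_eq_square)
  have p1: "p - 1 \<noteq> 0" "1 - p \<noteq> 0" "p \<noteq> 0" using nz p by auto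
  have "(inverse Q - 1) / (inverse p - 1) = (1 - Q) * (p / Q) / (1 - p)"
    using nz p1 by (simp add: field_simps)
  also have "p / Q = m^2*Q" using p nz by (simp add: power2_eq_square)
  also have "(1 - Q) * (m^2*Q) / (1 - p) = (Q - 1) / (p - 1) * (m^2*Q)"
    using p1 by (simp add: divide_simps) (simp add: algebra_simps)
  finally have ratio: "(inverse Q - 1) / (inverse p - 1) = (Q - 1) / (p - 1) * (m^2*Q)" .
  have "d2 * ((Q - 1) / (p - 1) * (x1 - x3) + (inverse Q - 1) / (inverse p - 1) * (inverse x1 - inverse x3))
     = d2 * ((Q - 1) * ((x1 - x3) + m^2*Q * (inverse x1 - inverse x3))) / (p - 1)"
    unfolding ratio by (simp add: algebra_simps add_divide_distrib diff_divide_distrib)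
  also have "\<dots> = d2 * (T (Q/p) - T Q) + F (Q/p) - F (p*Q)"
  proof -
    have "(p - 1) * (d2 * (T (Q/p) - T Q) + F (Q/p) - F (p*Q))
      = d2 * ((Q - 1) * ((x1 - x3) + m^2*Q * (inverse x1 - inverse x3)))"
      using double_aux[of m x1 x3 Q] nz unfolding d2_def S_def T_def F_def x2 x4 p by simp
    then show ?thesis using p1 by (metis nonzero_mult_div_cancel_left)
  qed
  finally show ?thesis ..
qed

text \<open>With R = p^(k-2) the left side results from eliminating the two coordinates below the
  top from rows k and k-1 of a marginal vector. The cubic on the right splits over the pairs among
  the other three x's; the factor \<open>m^2 * p * R - 1\<close> marks the exceptional case m^2 p^k
  = p.\<close>

lemma bracket_id: fixes p u v :: "'a::field"
  assumes nz: "p \<noteq> 0" "m \<noteq> 0" "x \<noteq> 0" "R \<noteq> 0"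
  defines "S \<equiv> theta m" and "T \<equiv> theta x" and "F \<equiv> varphi p m x u v"
  defines "d1 \<equiv> S (p*(p*R)) - S (p*R)" and "d2 \<equiv> S (p*(p*R)) - S R"
  shows "d1 * d1 * T (p*(p*R)) * d2 + d1 * F (p*(p*R)) * d2
     + (S (p*R) - S (p*(p*(p*R)))) * d1 * (T (p*R) * d2 + F (p*R))
     - d1 * d2 * F (p*(p*(p*R))) - d1 * d2 * (S (p*(p*R)) - S (p*(p*(p*R)))) * T (p*(p*R))
     - d2 * (S (p*(p*R)) - S (p*(p*(p*R)))) * F (p*(p*R))
    = x * ((p-1)^4 * (p+1)^2 / (p^6 * R^2 * m^3) * (m^2 * p * R - 1))
      * (1 - v * (p*R) + u * (m^2*p/x) * (p*R)^2 - (m^2*p/x)^2 * (p*R)^3)" (is "?L = ?R")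
proof -
  define K where "K = (p-1)^4 * (p+1)^2 / (p^6 * R^2 * m^3) * (m^2 * p * R - 1)"
  define G where "G = (\<lambda>Q. p * (1 - Q) / (m * Q^2))"
  define Q0 where "Q0 = p*R"
  define Q1 where "Q1 = p*(p*R)"
  define Q2 where "Q2 = p*(p*(p*R))"
  define e where "e = S Q0 - S Q2"
  define f where "f = S Q1 - S Q2"
  have Qnz: "Q0 \<noteq> 0" "Q1 \<noteq> 0" "Q2 \<noteq> 0" using nz by (simp_all add: Q0_def Q1_def Q2_def)
  have F: "F Q = inverse x * G Q - u * (G Q * Q / p) + x * v * (G Q * Q^2 / p^2) - x * (G Q * m^2 * Q^3 / p^2)" 
    if "Q \<noteq> 0" for Q using nz that unfolding F_def varphi_def G_def 
    by (simp add: divide_simps) (simp add: algebra_simps eval_nat_numeral)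
  have T: "T Q = x * Q + inverse x * inverse Q" for Q by (simp add: T_def theta_def)
  note defs = d1_def d2_def e_def f_def G_def K_def Q0_def Q1_def Q2_def S_def theta_def
  have d1: "d1 = (p-1)*(m^2*p^3*R^2-1)/(m*p^2*R)" and d2: "d2 = (p^2-1)*(m^2*p^2*R^2-1)/(m*p^2*R)"
    and e: "e = - (p^2-1)*(m^2*p^4*R^2-1)/(m*p^3*R)" and f: "f = - (p-1)*(m^2*p^5*R^2-1)/(m*p^3*R)"
    using nz unfolding defs by (simp_all add: divide_simps) (simp_all add: algebra_simps eval_nat_numeral)
  note defs2 = d1 d2 e f G_def K_def Q0_def Q1_def Q2_def
  \<comment> \<open>The difference of the two sides is linear in \<open>inverse x\<close>,
    \<open>x\<close>, \<open>u\<close> and \<open>x * v\<close>. The facts \<open>c1\<close>,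
    \<open>c2\<close>, \<open>c3\<close> and \<open>c4\<close> say that the coefficients vanish,
    each being an identity in p, m, R alone.\<close>
  have c1: "d1*d1*d2*inverse Q1 + d1*d2*G Q1 + e*d1*(d2*inverse Q0 + G Q0) - d1*d2*G Q2 - d1*d2*f*inverse Q1 - d2*f*G Q1 
     + K * (m^4*p^5*R^3) = 0"
    using nz unfolding defs2 by (simp add: divide_simps) (simp add: algebra_simps eval_nat_numeral)
  have c2: "d1*d1*d2*Q1 - d1*d2*(G Q1 * m^2 * Q1^3/p^2) + e*d1*(d2*Q0 - G Q0 * m^2 * Q0^3/p^2) + d1*d2*(G Q2*m^2*Q2^3/p^2) 
     - d1*d2*f*Q1 + d2*f*(G Q1*m^2*Q1^3/p^2) - K = 0"
    using nz unfolding defs2 by (simp add: divide_simps) (simp add: algebra_simps eval_nat_numeral)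
  have c3: "- d1*d2*(G Q1*Q1/p) - e*d1*(G Q0*Q0/p) + d1*d2*(G Q2*Q2/p) + d2*f*(G Q1*Q1/p) - K*(m^2*p^3*R^2) = 0"
    using nz unfolding defs2 by (simp add: divide_simps) (simp add: algebra_simps eval_nat_numeral)
  have c4: "d1*d2*(G Q1*Q1^2/p^2) + e*d1*(G Q0*Q0^2/p^2) - d1*d2*(G Q2*Q2^2/p^2) - d2*f*(G Q1*Q1^2/p^2) + K*(p*R) = 0"
    using nz unfolding defs2 by (simp add: divide_simps) (simp add: algebra_simps eval_nat_numeral)
  have R: "?R = x * K - K * x * v * (p*R) + u * (K * (m^2*p^3*R^2)) - inverse x * (K * (m^4*p^5*R^3))"
    unfolding K_def[symmetric] using nz by (simp add: field_simps) (simp add: algebra_simps eval_nat_numeral)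
  have L: "?L = d1 * d1 * T Q1 * d2 + d1 * F Q1 * d2 + e * d1 * (T Q0 * d2 + F Q0) - d1 * d2 * F Q2 - d1*d2*f*T Q1 - d2*f*F Q1"
    unfolding e_def f_def Q0_def Q1_def Q2_def by simp
  have L': "?L = d1 * d1 * (x * Q1 + inverse x * inverse Q1) * d2 + d1 * (inverse x * G Q1 - u * (G Q1 * Q1 / p) + x * v * (G Q1 * Q1^2 / p^2) - x * (G Q1 * m^2 * Q1^3 / p^2)) * d2 
    + e * d1 * ((x * Q0 + inverse x * inverse Q0) * d2 + (inverse x * G Q0 - u * (G Q0 * Q0 / p) + x * v * (G Q0 * Q0^2 / p^2) - x * (G Q0 * m^2 * Q0^3 / p^2)))
    - d1 * d2 * (inverse x * G Q2 - u * (G Q2 * Q2 / p) + x * v * (G Q2 * Q2^2 / p^2) - x * (G Q2 * m^2 * Q2^3 / p^2)) 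
    - d1*d2*f*(x * Q1 + inverse x * inverse Q1) - d2*f*(inverse x * G Q1 - u * (G Q1 * Q1 / p) + x * v * (G Q1 * Q1^2 / p^2) - x * (G Q1 * m^2 * Q1^3 / p^2))"
    by (rule trans[OF L]) (simp only: T F[OF Qnz(1)] F[OF Qnz(2)] F[OF Qnz(3)])
  have "?L - ?R = inverse x * (d1*d1*d2*inverse Q1 + d1*d2*G Q1 + e*d1*(d2*inverse Q0 + G Q0) - d1*d2*G Q2 - d1*d2*f*inverse Q1 - d2*f*G Q1 
     + K * (m^4*p^5*R^3)) 
    + x * (d1*d1*d2*Q1 - d1*d2*(G Q1 * m^2 * Q1^3/p^2) + e*d1*(d2*Q0 - G Q0 * m^2 * Q0^3/p^2) + d1*d2*(G Q2*m^2*Q2^3/p^2) 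
     - d1*d2*f*Q1 + d2*f*(G Q1*m^2*Q1^3/p^2) - K)
    + u * (- d1*d2*(G Q1*Q1/p) - e*d1*(G Q0*Q0/p) + d1*d2*(G Q2*Q2/p) + d2*f*(G Q1*Q1/p) - K*(m^2*p^3*R^2))
    + x * v * (d1*d2*(G Q1*Q1^2/p^2) + e*d1*(G Q0*Q0^2/p^2) - d1*d2*(G Q2*Q2^2/p^2) - d2*f*(G Q1*Q1^2/p^2) + K*(p*R))"
    by (rule trans[OF arg_cong2[where f="(-)", OF L' R]])
       (simp add: algebra_simps)
  also have "\<dots> = 0" unfolding c1 c2 c3 c4 by simp
  finally show ?thesis by simp
qed


text \<open>The case k = 1 of the elimination, where only one coordinate lies below the top; the
  cubic is evaluated at p^0.\<close>

lemma bracket1_id: fixes p u v :: "'a::field"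
  assumes "p \<noteq> 0" "m \<noteq> 0" "x \<noteq> 0"
  defines "S \<equiv> theta m" and "T \<equiv> theta x" and "F \<equiv> varphi p m x u v"
  defines "d1 \<equiv> S p - S 1"
  shows "d1 * d1 * T p + d1 * F p
     + (S 1 - S (p*p)) * d1 * T 1
     - d1 * F (p*p) - d1 * (S p - S (p*p)) * T p
     - (S p - S (p*p)) * F p
    = x * (p-1)^3 * (p+1) / (p^3 * m^2)
      * (1 - v + u * (m^2*p/x) - (m^2*p/x)^2)"
  using assms(1-3) unfolding d1_def S_def T_def F_def theta_def varphi_def
  by (simp add: divide_simps) (simp add: algebra_simps eval_nat_numeral)


text \<open>Here Q = p^k and m^2 p^k = p, so that 1/m^2 = p^(k-1). The elimination now uses row 0 in
  place of row k-1, and the cubic reappears with argument 1/m^2.\<close>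

lemma exceptional_aux: fixes m u v :: "'a::field"
  assumes "m \<noteq> 0" "x \<noteq> 0" "Q \<noteq> 0"
  defines "p \<equiv> m^2 * Q"
  defines "S \<equiv> theta m" and "T \<equiv> theta x" and "F \<equiv> varphi p m x u v"
  defines "d1 \<equiv> S Q - S (inverse (m^2))"
  shows "d1 * (F p + T p * (S Q - S 1) + (S 1 - S (p*Q)) * T 1 - F (p*Q) - (S Q - S (p*Q)) * T Q)
       - (S Q - S (p*Q)) * F Q
      = d1 * (x * m * (p^2-1) / p^2 * (1 - v / m^2 + u * (m^2*p/x) / m^4 - (m^2*p/x)^2 / m^6))"
proof -
  define iQ where "iQ = inverse Q"
  define im where "im = inverse m"
  define ix where "ix = inverse x"
  have i: "Q * iQ = 1" "m * im = 1" "x * ix = 1" using assms(1-3) by (simp_all add: iQ_def im_def ix_def)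
  have F: "F R = p * (1 - R) * (ix - u * R / p + x * v * R^2 / p^2 - x * m^2 * R^3 / p^2) / (m * R^2)" if "R \<noteq> 0" for R
    using assms(1-3) that unfolding F_def varphi_def ix_def p_def 
    by (simp add: divide_simps) (simp add: algebra_simps eval_nat_numeral)
  have Fp: "F p = (1 - m^2*Q) * (ix - u + x * v - x * m^4 * Q) * im^3*iQ"
    using assms(1-3) unfolding F_def varphi_def ix_def im_def iQ_def p_def 
    by (simp add: divide_simps) (simp add: algebra_simps eval_nat_numeral)
  have FpQ: "F (p*Q) = (1 - m^2*Q^2) * (ix - u * Q + x * v * Q^2 - x * m^4 * Q^4) * im^3 * iQ^3"
    using assms(1-3) unfolding F_def varphi_def ix_def im_def iQ_def p_def 
    by (simp add: divide_simps) (simp add: algebra_simps eval_nat_numeral)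
  have FQ: "F Q = (1 - Q) * (m^2 * ix - u + x * v *im^2 - x * Q) * im * iQ"
    using assms(1-3) unfolding F_def varphi_def ix_def im_def iQ_def p_def 
    by (simp add: divide_simps) (simp add: algebra_simps eval_nat_numeral)
  have S: "S R = m * R + im * inverse R" for R by (simp add: S_def theta_def im_def)
  have T: "T R = x * R + ix * inverse R" for R by (simp add: T_def theta_def ix_def)
  have r: "x * m * (p^2-1) / p^2 * (1 - v / m^2 + u * (m^2*p/x) / m^4 - (m^2*p/x)^2 / m^6)
     = m * (m^4*Q^2 - 1) * im^4 * iQ^2 * (x - x * v * im^2 + u * Q - m^2 * ix * Q^2)"
    using assms(1-3) unfolding ix_def im_def iQ_def p_def 
    by (simp add: divide_simps) (simp add: algebra_simps eval_nat_numeral)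
  have Tp: "T p = x * m^2*Q + ix * im^2 * iQ" and TQ: "T Q = x * Q + ix * iQ" and T1: "T 1 = x + ix"
    by (simp_all add: T p_def iQ_def im_def power2_eq_square)
  define s1 where "s1 = S Q - S 1"
  define s2 where "s2 = S 1 - S (p*Q)"
  define f where "f = S Q - S (p*Q)"
  define k where "k = m * (m^4*Q^2 - 1) * im^4 * iQ^2"
  define a where "a = (1 - m^2*Q) * im^3*iQ"
  define b where "b = (1 - m^2*Q^2) * im^3*iQ^3"
  define c where "c = (1 - Q) * im*iQ"
  note defs = d1_def s1_def s2_def f_def k_def a_def b_def c_def S_def theta_def p_def im_def iQ_def
  have c1: "d1*(a + s1*im^2*iQ + s2 - b - f*iQ) - f*c*m^2 + d1*k*m^2*Q^2 = 0"
    using assms(1-3) unfolding defs by (simp add: divide_simps) (simp add: algebra_simps eval_nat_numeral)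
  have c2: "d1*(- a*m^4*Q + s1*m^2*Q + s2 + b*m^4*Q^4 - f*Q) + f*c*Q - d1*k = 0"
    using assms(1-3) unfolding defs by (simp add: divide_simps) (simp add: algebra_simps eval_nat_numeral)
  have c3: "d1*(- a + b*Q) + f*c - d1*k*Q = 0"
    using assms(1-3) unfolding defs by (simp add: divide_simps) (simp add: algebra_simps eval_nat_numeral)
  have c4: "d1*(a - b*Q^2) - f*c*im^2 + d1*k*im^2 = 0"
    using assms(1-3) unfolding defs by (simp add: divide_simps) (simp add: algebra_simps eval_nat_numeral)
  have L: "d1 * (F p + T p * s1 + s2 * T 1 - F (p*Q) - f * T Q) - f * F Q
     - d1 * (k * (x - x * v * im^2 + u * Q - m^2 * ix * Q^2))
     = ix * (d1*(a + s1*im^2*iQ + s2 - b - f*iQ) - f*c*m^2 + d1*k*m^2*Q^2)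
     + x * (d1*(- a*m^4*Q + s1*m^2*Q + s2 + b*m^4*Q^4 - f*Q) + f*c*Q - d1*k)
     + u * (d1*(- a + b*Q) + f*c - d1*k*Q)
     + x * v * (d1*(a - b*Q^2) - f*c*im^2 + d1*k*im^2)"
  proof -
    have F1: "F p = a * (ix - u + x * v - x * m^4 * Q)" by (simp add: Fp a_def)
    have F2: "F (p*Q) = b * (ix - u * Q + x * v * Q^2 - x * m^4 * Q^4)" by (simp add: FpQ b_def)
    have F3: "F Q = c * (m^2 * ix - u + x * v *im^2 - x * Q)" by (simp add: FQ c_def)
    show ?thesis unfolding F1 F2 F3 Tp TQ T1 by (simp add: algebra_simps)
  qed
  then have "d1 * (F p + T p * s1 + s2 * T 1 - F (p*Q) - f * T Q) - f * F Q
     = d1 * (k * (x - x * v * im^2 + u * Q - m^2 * ix * Q^2))"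
    unfolding c1 c2 c3 c4 by simp
  then show ?thesis unfolding r k_def[symmetric] s1_def[symmetric] s2_def[symmetric] f_def[symmetric]
    by simp
qed

text \<open>A row of the equations for a marginal vector of weight p/m, divided by its coordinate
  and multiplied by \<open>1 - p^2/(m^2*Q)\<close>. The arguments \<open>inverse p\<close> and
  \<open>inverse p^2\<close> are p^(n-1) and p^(n-2), and \<open>c\<close> is the marginal
  coefficient of the reflected parameters.\<close>

lemma reflect_id: fixes p u v :: "'a::field"
  assumes "p \<noteq> 0" "m \<noteq> 0" "x \<noteq> 0" "Q \<noteq> 0"
  defines "c \<equiv> (inverse p - 1) * (p^2*(x + u) / m^2 - (x * v + m^2*p / x) / m^2) / (p / m)"
  shows "(theta m Q - theta m (inverse p^2)) * theta x Q * (1 - p^2/(m^2*Q))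
      + (theta m Q - theta m (inverse p^2)) * (p^2 / Q^2 / (x * m^2) * (1 - x * u * Q / p + x^2 * v * Q^2 / p^2 - x^2 * m^2 * Q^3 / p^2))
      + (varphi p m x u v (p*Q) + theta x (p*Q) * (theta m (inverse p) - theta m Q) - c) * (1 - p^2/(m^2*Q)) = 0"
  using assms(1-4) unfolding c_def theta_def varphi_def
  by (simp add: divide_simps) (simp add: algebra_simps eval_nat_numeral)

section \<open>Linearity of the action of matrices on vectors\<close>

lemma mv_add: "A \<in> carrier_mat n n \<Longrightarrow> v \<in> carrier_vec n \<Longrightarrow> w \<in> carrier_vec n \<Longrightarrow>
   A *\<^sub>v (v + w) = A *\<^sub>v v + A *\<^sub>v (w :: 'a::field vec)"
  by (simp add: mult_add_distrib_mat_vec)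

lemma mv_minus: "A \<in> carrier_mat n n \<Longrightarrow> v \<in> carrier_vec n \<Longrightarrow> w \<in> carrier_vec n \<Longrightarrow>
   A *\<^sub>v (v - w) = A *\<^sub>v v - A *\<^sub>v (w :: 'a::field vec)"
  by (simp add: mult_minus_distrib_mat_vec)

lemma mv_smult: "A \<in> carrier_mat n n \<Longrightarrow> v \<in> carrier_vec n \<Longrightarrow>
   A *\<^sub>v (c \<cdot>\<^sub>v v) = c \<cdot>\<^sub>v (A *\<^sub>v (v :: 'a::field vec))"
  by (simp add: mult_mat_vec)

lemma mv_mult: "A \<in> carrier_mat n n \<Longrightarrow> B \<in> carrier_mat n n \<Longrightarrow> v \<in> carrier_vec n \<Longrightarrow>
   (A * B) *\<^sub>v v = A *\<^sub>v (B *\<^sub>v (v :: 'a::field vec))"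
  by simp

lemma mv_smult_mat: "A \<in> carrier_mat n n \<Longrightarrow> v \<in> carrier_vec n \<Longrightarrow>
   (c \<cdot>\<^sub>m A) *\<^sub>v v = c \<cdot>\<^sub>v (A *\<^sub>v (v :: 'a::field vec))"
  by (auto simp: intro!: eq_vecI)

lemma mv_carrier: "A \<in> carrier_mat n n \<Longrightarrow> v \<in> carrier_vec n \<Longrightarrow> A *\<^sub>v v \<in> carrier_vec n"
  by simp

lemma mat_eqI_mv:
  assumes "A \<in> carrier_mat n n" "B \<in> carrier_mat n n"
    and "\<And>j. j < n \<Longrightarrow> A *\<^sub>v unit_vec n j = B *\<^sub>v (unit_vec n j :: 'a::field vec)"
  shows "A = B"
proof (rule eq_matI)
  fix i j assume ij: "i < dim_row B" "j < dim_col B"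
  then have "(A *\<^sub>v unit_vec n j) $ i = (B *\<^sub>v unit_vec n j) $ i" using assms(3)[of j] assms(2) by simp
  then show "A $$ (i,j) = B $$ (i,j)" using assms(1,2) ij by (simp add: scalar_prod_right_unit[where n=n])
qed (use assms in auto)


text \<open>Centrality of \<beta> with C eliminated through \<gamma>: g is the value of \<gamma>, and b is that of \<beta> up to a constant factor.\<close>
definition rel :: "'a::field \<Rightarrow> nat \<Rightarrow> 'a mat \<Rightarrow> 'a mat \<Rightarrow> 'a \<Rightarrow> 'a \<Rightarrow> bool" where
  "rel p n A B g b \<longleftrightarrow> (\<forall>v\<in>carrier_vec n. 
     A *\<^sub>v (A *\<^sub>v (B *\<^sub>v v)) - (p + inverse p) \<cdot>\<^sub>v (A *\<^sub>v (B *\<^sub>v (A *\<^sub>v v))) + B *\<^sub>v (A *\<^sub>v (A *\<^sub>v v))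
       + (p - inverse p)^2 \<cdot>\<^sub>v (B *\<^sub>v v) + ((p - 2 + inverse p) * g) \<cdot>\<^sub>v (A *\<^sub>v v)
     = b \<cdot>\<^sub>v v)"

text \<open>In terms of all four x's, \<open>x + u\<close>, \<open>x * u + v\<close> and
  \<open>x * v + m^2*p / x\<close> are the elementary symmetric functions of degree 1, 2 and 3.
  Hence gamma, beta and alpha take values symmetric in the x's.\<close>

definition gam :: "'a::field \<Rightarrow> 'a \<Rightarrow> 'a \<Rightarrow> 'a \<Rightarrow> 'a \<Rightarrow> 'a" where
  "gam p m x u v = (x + u + (x * v + m^2*p / x) / p) / m"

definition bet :: "'a::field \<Rightarrow> 'a \<Rightarrow> 'a \<Rightarrow> 'a \<Rightarrow> 'a \<Rightarrow> 'a" where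
  "bet p m x u v = (p - inverse p) * (1 - inverse p) * ((x * u + v) + m^2 + p) / m"

definition alp :: "'a::field \<Rightarrow> 'a \<Rightarrow> 'a \<Rightarrow> 'a \<Rightarrow> 'a \<Rightarrow> 'a" where
  "alp p m x u v = (p - inverse p) * (1 - inverse p) * (x + u + (x * v + m^2*p / x) / m^2)"

locale pair =
  fixes n :: nat and A B :: "'a::field mat" and p :: 'a
  assumes A [simp]: "A \<in> carrier_mat n n" and B [simp]: "B \<in> carrier_mat n n" and p0: "p \<noteq> 0"
begin

abbreviation "V \<equiv> (carrier_vec n :: 'a vec set)"

lemma AV [simp]: "v \<in> V \<Longrightarrow> A *\<^sub>v v \<in> V" and BV [simp]: "v \<in> V \<Longrightarrow> B *\<^sub>v v \<in> V"
  by (simp_all add: mv_carrier)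

lemmas lins = mv_add[OF A] mv_minus[OF A] mv_smult[OF A] mv_add[OF B] mv_minus[OF B] mv_smult[OF B]

lemma dims [simp]: "dim_row A = n" "dim_col A = n" "dim_row B = n" "dim_col B = n"
  by (rule carrier_matD[OF A] carrier_matD[OF B])+

lemma relD: 
  assumes "rel p n A B g b" "v \<in> V" "r < n"
  shows "(A *\<^sub>v (A *\<^sub>v (B *\<^sub>v v))) $ r - (p + inverse p) * (A *\<^sub>v (B *\<^sub>v (A *\<^sub>v v))) $ r + (B *\<^sub>v (A *\<^sub>v (A *\<^sub>v v))) $ r
       + (p - inverse p)^2 * (B *\<^sub>v v) $ r + ((p - 2 + inverse p) * g) * (A *\<^sub>v v) $ r - b * v $ r = 0"
proof -
  have "(A *\<^sub>v (A *\<^sub>v (B *\<^sub>v v)) - (p + inverse p) \<cdot>\<^sub>v (A *\<^sub>v (B *\<^sub>v (A *\<^sub>v v))) + B *\<^sub>v (A *\<^sub>v (A *\<^sub>v v))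
       + (p - inverse p)^2 \<cdot>\<^sub>v (B *\<^sub>v v) + ((p - 2 + inverse p) * g) \<cdot>\<^sub>v (A *\<^sub>v v)) $ r
     = (b \<cdot>\<^sub>v v) $ r"
    using assms(1,2) unfolding rel_def by auto
  then show ?thesis using assms(2,3) A B by (simp del: index_mult_mat_vec)
qed

end

definition ladA :: "'a::field \<Rightarrow> 'a mat \<Rightarrow> 'a \<Rightarrow> (nat \<Rightarrow> 'a vec) \<Rightarrow> bool" where
  "ladA p A x f \<longleftrightarrow> (\<forall>i. A *\<^sub>v f i = theta x (p^i) \<cdot>\<^sub>v f i + f (Suc i))"

text \<open>At i = 0 the truncated predecessor \<open>f (i - 1)\<close> is harmless, since
  \<open>varphi\<close> vanishes at Q = 1.\<close>

definition lowB :: "'a::field \<Rightarrow> 'a mat \<Rightarrow> 'a \<Rightarrow> 'a \<Rightarrow> 'a \<Rightarrow> 'a \<Rightarrow> (nat \<Rightarrow> 'a vec) \<Rightarrow> nat \<Rightarrow> bool" where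
  "lowB p B m x u v f i \<longleftrightarrow> B *\<^sub>v f i = theta m (p^i) \<cdot>\<^sub>v f i + varphi p m x u v (p^i) \<cdot>\<^sub>v f (i - 1)"

context pair
begin

definition E :: "'a \<Rightarrow> 'a \<Rightarrow> 'a vec \<Rightarrow> nat \<Rightarrow> 'a" where
 "E g b v r = (A *\<^sub>v (A *\<^sub>v (B *\<^sub>v v))) $ r - (p + inverse p) * (A *\<^sub>v (B *\<^sub>v (A *\<^sub>v v))) $ r + (B *\<^sub>v (A *\<^sub>v (A *\<^sub>v v))) $ r
       + (p - inverse p)^2 * (B *\<^sub>v v) $ r + ((p - 2 + inverse p) * g) * (A *\<^sub>v v) $ r - b * v $ r"

text \<open>On a chain the defect of the beta relation at step i equals the defect of the two-term
  formula for \<open>B\<close> at step i + 2. Read one way this propagates the formula, read the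
  other way it verifies the relation for the ladder matrices.\<close>

lemma E_ladder:
  assumes f: "\<And>i. f i \<in> V" and lad: "ladA p A x f" and low: "lowB p B m x u w f i" "lowB p B m x u w f (Suc i)"
    and nz: "m \<noteq> 0" "x \<noteq> 0" and r: "r < n"
  shows "E (gam p m x u w) (bet p m x u w) (f i) r
     = (B *\<^sub>v f (Suc (Suc i))) $ r - (theta m (p^Suc (Suc i)) \<cdot>\<^sub>v f (Suc (Suc i)) + varphi p m x u w (p^Suc (Suc i)) \<cdot>\<^sub>v f (Suc i)) $ r"
proof -
  define T where "T j = theta x (p^j)" for j
  define S where "S j = theta m (p^j)" for j
  define F where "F j = varphi p m x u w (p^j)" for j
  \<comment> \<open>The value at index i - 1 without truncated subtraction; it only ever occurs
    multiplied by \<open>F i\<close>, which is 0 at i = 0.\<close>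
  define T' where "T' = theta x (p^i / p)"
  have Af: "A *\<^sub>v f j = T j \<cdot>\<^sub>v f j + f (Suc j)" for j using lad by (simp add: ladA_def T_def)
  have B0: "B *\<^sub>v f i = S i \<cdot>\<^sub>v f i + F i \<cdot>\<^sub>v f (i-1)" and B1: "B *\<^sub>v f (Suc i) = S (Suc i) \<cdot>\<^sub>v f (Suc i) + F (Suc i) \<cdot>\<^sub>v f i"
    using low by (simp_all add: lowB_def S_def F_def)
  have F0: "F 0 = 0" by (simp add: F_def varphi_def)
  have repA: "F i \<cdot>\<^sub>v (A *\<^sub>v f (i - 1)) = F i \<cdot>\<^sub>v (T' \<cdot>\<^sub>v f (i-1) + f i)"
  proof (cases i)
    case 0 
    have "dim_vec (f 0) = n" using f[of 0] by simp
    with 0 show ?thesis by (auto simp: F0 smult_vec_def)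
  next
    case (Suc j) then show ?thesis using p0 by (simp add: Af T_def T'_def)
  qed
  have fr: "dim_vec (f j) = n" for j using f[of j] by simp
  have AAB: "A *\<^sub>v (A *\<^sub>v (B *\<^sub>v f i)) = S i \<cdot>\<^sub>v (T i \<cdot>\<^sub>v (T i \<cdot>\<^sub>v f i + f (Suc i)) + (T (Suc i) \<cdot>\<^sub>v f (Suc i) + f (Suc (Suc i))))
      + F i \<cdot>\<^sub>v (T' \<cdot>\<^sub>v (T' \<cdot>\<^sub>v f (i-1) + f i) + (T i \<cdot>\<^sub>v f i + f (Suc i)))"
  proof -
    have "A *\<^sub>v (F i \<cdot>\<^sub>v (A *\<^sub>v f (i - 1))) = F i \<cdot>\<^sub>v (T' \<cdot>\<^sub>v (A *\<^sub>v f (i-1)) + (T i \<cdot>\<^sub>v f i + f (Suc i)))"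
      unfolding repA using f by (simp add: lins Af)
    also have "\<dots> = T' \<cdot>\<^sub>v (F i \<cdot>\<^sub>v (A *\<^sub>v f (i-1))) + F i \<cdot>\<^sub>v (T i \<cdot>\<^sub>v f i + f (Suc i))"
      using f by (auto simp: smult_add_distrib_vec[of _ n] smult_smult_assoc mult.commute)
    also have "\<dots> = F i \<cdot>\<^sub>v (T' \<cdot>\<^sub>v (T' \<cdot>\<^sub>v f (i-1) + f i) + (T i \<cdot>\<^sub>v f i + f (Suc i)))"
      unfolding repA using f by (auto simp: smult_add_distrib_vec[of _ n] smult_smult_assoc mult_ac)
    finally show ?thesis using f by (simp add: B0 lins Af)
  qed
  have ABA: "A *\<^sub>v (B *\<^sub>v (A *\<^sub>v f i)) = T i \<cdot>\<^sub>v (S i \<cdot>\<^sub>v (T i \<cdot>\<^sub>v f i + f (Suc i)) + F i \<cdot>\<^sub>v (T' \<cdot>\<^sub>v f (i-1) + f i)) 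
      + (S (Suc i) \<cdot>\<^sub>v (T (Suc i) \<cdot>\<^sub>v f (Suc i) + f (Suc (Suc i))) + F (Suc i) \<cdot>\<^sub>v (T i \<cdot>\<^sub>v f i + f (Suc i)))"
    using f by (simp add: B0 B1 lins Af repA[unfolded Af One_nat_def])
  have BAA: "B *\<^sub>v (A *\<^sub>v (A *\<^sub>v f i)) = T i \<cdot>\<^sub>v (T i \<cdot>\<^sub>v (S i \<cdot>\<^sub>v f i + F i \<cdot>\<^sub>v f (i-1)) + (S (Suc i) \<cdot>\<^sub>v f (Suc i) + F (Suc i) \<cdot>\<^sub>v f i)) 
      + (T (Suc i) \<cdot>\<^sub>v (S (Suc i) \<cdot>\<^sub>v f (Suc i) + F (Suc i) \<cdot>\<^sub>v f i) + B *\<^sub>v f (Suc (Suc i)))"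
    using f by (simp add: B0 B1 lins Af)
  have i1: "(T i) = theta x (p * (p^i/p))" "S i = theta m (p * (p^i/p))" "F i = varphi p m x u w (p * (p^i/p))"
    "T (Suc i) = theta x (p * (p * (p^i/p)))" "F (Suc i) = varphi p m x u w (p * (p * (p^i/p)))"
    using p0 by (simp_all add: T_def S_def F_def)
  have Qnz: "p^i \<noteq> 0" "p^i/p \<noteq> 0" using p0 by auto
  define g where "g = (p - 2 + inverse p) * gam p m x u w"
  define b where "b = bet p m x u w"
  define k where "k = (p - inverse p)^2"
  define t where "t = p + inverse p"
  \<comment> \<open>The facts \<open>c2\<close>, \<open>c1\<close>, \<open>c0\<close>,
    \<open>cm\<close> are the coefficients of the vectors with index i+2, i+1, i and i-1.\<close>
  have c2: "S i - t * S (Suc i) + S (Suc (Suc i)) = 0"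
    using theta_recur[OF p0 nz(1) Qnz(1)] by (simp add: S_def t_def)
  have c1: "S i * (T i + T (Suc i)) + F i - t * (T i * S i + F (Suc i) + S (Suc i) * T (Suc i)) + F (Suc (Suc i))
      + (T i + T (Suc i)) * S (Suc i) + g = 0"
    using rel1_up[OF p0 nz Qnz(1), of u w] by (simp add: S_def T_def F_def t_def g_def gam_def)
  have c0: "S i * T i^2 + F i * (T' + T i) - t * ((T i * S i + F (Suc i)) * T i + T i * F i) + (T i + T (Suc i)) * F (Suc i)
     + T i^2 * S i + k * S i + g * T i - b = 0"
    using rel1_diag[OF p0 nz Qnz(2), of u w] unfolding i1[symmetric] T'_def[symmetric] 
    by (simp add: t_def g_def gam_def b_def bet_def k_def)
  have cm: "T'^2 - t * T' * T i + T i^2 + k = 0"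
    using theta_quad[OF p0 nz(2) Qnz(2)] unfolding i1[symmetric] T'_def[symmetric] by (simp add: t_def k_def)
  define a2 where "a2 = f (Suc (Suc i)) $ r"
  define a1 where "a1 = f (Suc i) $ r"
  define a0 where "a0 = f i $ r"
  define am where "am = f (i - Suc 0) $ r"
  define B2 where "B2 = (B *\<^sub>v f (Suc (Suc i))) $ r"
  note adefs = a2_def[symmetric] a1_def[symmetric] a0_def[symmetric] am_def[symmetric] B2_def[symmetric]
  have "E (gam p m x u w) (bet p m x u w) (f i) r - (B2 - (S (Suc (Suc i)) * a2 + F (Suc (Suc i)) * a1))
    = a2 * (S i - t * S (Suc i) + S (Suc (Suc i)))
    + a1 * (S i * (T i + T (Suc i)) + F i - t * (T i * S i + F (Suc i) + S (Suc i) * T (Suc i)) + F (Suc (Suc i))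
      + (T i + T (Suc i)) * S (Suc i) + g)
    + a0 * (S i * T i^2 + F i * (T' + T i) - t * ((T i * S i + F (Suc i)) * T i + T i * F i) + (T i + T (Suc i)) * F (Suc i)
     + T i^2 * S i + k * S i + g * T i - b)
    + am * F i * (T'^2 - t * T' * T i + T i^2 + k)"
    unfolding E_def AAB ABA BAA unfolding B0 Af t_def[symmetric] k_def[symmetric] g_def[symmetric] b_def[symmetric]
    using r fr by (simp add: adefs del: index_mult_mat_vec) (simp add: algebra_simps power2_eq_square)
  then have "E (gam p m x u w) (bet p m x u w) (f i) r = B2 - (S (Suc (Suc i)) * a2 + F (Suc (Suc i)) * a1)"
    unfolding c2 c1 c0 cm by simp
  then show ?thesis using r fr by (simp add: B2_def a2_def a1_def S_def F_def del: index_mult_mat_vec)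
qed

definition E2 :: "'a \<Rightarrow> 'a \<Rightarrow> 'a vec \<Rightarrow> nat \<Rightarrow> 'a" where
 "E2 g b v r = (B *\<^sub>v (B *\<^sub>v (A *\<^sub>v v))) $ r - (p + inverse p) * (B *\<^sub>v (A *\<^sub>v (B *\<^sub>v v))) $ r + (A *\<^sub>v (B *\<^sub>v (B *\<^sub>v v))) $ r
       + (p - inverse p)^2 * (A *\<^sub>v v) $ r + ((p - 2 + inverse p) * g) * (B *\<^sub>v v) $ r - b * v $ r"

text \<open>Alpha imposes no further condition: once \<open>A\<close> and \<open>B\<close> act by
  the ladder formulas, the four coefficients at indices i+1 down to i-2 vanish by the same
  identities with the roles of the two eigenvalue sequences exchanged.\<close>

lemma E2_ladder:
  assumes f: "\<And>i. f i \<in> V" and lad: "ladA p A x f" and low: "\<And>i. lowB p B m x u w f i"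
    and nz: "m \<noteq> 0" "x \<noteq> 0" and r: "r < n"
  shows "E2 (gam p m x u w) (alp p m x u w) (f i) r = 0"
proof -
  define T where "T j = theta x (p^j)" for j
  define S where "S j = theta m (p^j)" for j
  define F where "F j = varphi p m x u w (p^j)" for j
  define T' where "T' = theta x (p^i / p)"
  define S' where "S' = theta m (p^i / p)"
  define F' where "F' = varphi p m x u w (p^i / p)"
  define T'' where "T'' = theta x (p^i / p / p)"
  have Af: "A *\<^sub>v f j = T j \<cdot>\<^sub>v f j + f (Suc j)" for j using lad by (simp add: ladA_def T_def)
  have B0: "B *\<^sub>v f i = S i \<cdot>\<^sub>v f i + F i \<cdot>\<^sub>v f (i-1)" and B1: "B *\<^sub>v f (Suc i) = S (Suc i) \<cdot>\<^sub>v f (Suc i) + F (Suc i) \<cdot>\<^sub>v f i"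
    using low[of i] low[of "Suc i"] by (simp_all add: lowB_def S_def F_def)
  have fr: "dim_vec (f j) = n" for j using f[of j] by simp
  have F0: "F 0 = 0" by (simp add: F_def varphi_def)
  have F10: "i = 1 \<Longrightarrow> F' = 0" using p0 by (simp add: F'_def varphi_def)
  have repA: "F i \<cdot>\<^sub>v (A *\<^sub>v f (i - 1)) = F i \<cdot>\<^sub>v (T' \<cdot>\<^sub>v f (i-1) + f i)"
    and repB: "F i \<cdot>\<^sub>v (B *\<^sub>v f (i - 1)) = F i \<cdot>\<^sub>v (S' \<cdot>\<^sub>v f (i-1) + F' \<cdot>\<^sub>v f (i - 1 - 1))"
  proof (atomize (full), cases i)
    case 0 then show "F i \<cdot>\<^sub>v (A *\<^sub>v f (i - 1)) = F i \<cdot>\<^sub>v (T' \<cdot>\<^sub>v f (i-1) + f i) 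
       \<and> F i \<cdot>\<^sub>v (B *\<^sub>v f (i - 1)) = F i \<cdot>\<^sub>v (S' \<cdot>\<^sub>v f (i-1) + F' \<cdot>\<^sub>v f (i - 1 - 1))" 
      using fr[of 0] by (auto simp: F0 smult_vec_def)
  next
    case (Suc j) then show "F i \<cdot>\<^sub>v (A *\<^sub>v f (i - 1)) = F i \<cdot>\<^sub>v (T' \<cdot>\<^sub>v f (i-1) + f i) 
       \<and> F i \<cdot>\<^sub>v (B *\<^sub>v f (i - 1)) = F i \<cdot>\<^sub>v (S' \<cdot>\<^sub>v f (i-1) + F' \<cdot>\<^sub>v f (i - 1 - 1))" 
      using p0 low[of j] by (simp add: Af T_def T'_def lowB_def S'_def F'_def)
  qed
  have Amm: "F i \<cdot>\<^sub>v (F' \<cdot>\<^sub>v (A *\<^sub>v f (i - 1 - 1))) = F i \<cdot>\<^sub>v (F' \<cdot>\<^sub>v (T'' \<cdot>\<^sub>v f (i-1-1) + f (i - 1)))"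
  proof (cases "i < 2")
    case True
    then have "i = 0 \<or> i = 1" by auto
    then have "F i = 0 \<or> F' = 0" using F0 F10 by auto
    then show ?thesis using fr by (auto simp: smult_vec_def)
  next
    case False
    define j where "j = i - 2"
    have "i = Suc (Suc j)" using False j_def by simp
    then show ?thesis using p0 by (simp add: Af T_def T''_def)
  qed
  let ?m = "f (i - 1)" and ?mm = "f (i - 1 - 1)"
  have BB: "B *\<^sub>v (B *\<^sub>v f i) = S i \<cdot>\<^sub>v (S i \<cdot>\<^sub>v f i + F i \<cdot>\<^sub>v ?m) + F i \<cdot>\<^sub>v (S' \<cdot>\<^sub>v ?m + F' \<cdot>\<^sub>v ?mm)"
  proof -
    have "B *\<^sub>v (B *\<^sub>v f i) = S i \<cdot>\<^sub>v (S i \<cdot>\<^sub>v f i + F i \<cdot>\<^sub>v ?m) + F i \<cdot>\<^sub>v (B *\<^sub>v ?m)" using f by (simp add: B0 lins)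
    then show ?thesis unfolding repB .
  qed
  have BBA: "B *\<^sub>v (B *\<^sub>v (A *\<^sub>v f i)) = T i \<cdot>\<^sub>v (S i \<cdot>\<^sub>v (S i \<cdot>\<^sub>v f i + F i \<cdot>\<^sub>v ?m) + F i \<cdot>\<^sub>v (S' \<cdot>\<^sub>v ?m + F' \<cdot>\<^sub>v ?mm))
     + (S (Suc i) \<cdot>\<^sub>v (S (Suc i) \<cdot>\<^sub>v f (Suc i) + F (Suc i) \<cdot>\<^sub>v f i) + F (Suc i) \<cdot>\<^sub>v (S i \<cdot>\<^sub>v f i + F i \<cdot>\<^sub>v ?m))"
  proof -
    have "B *\<^sub>v (B *\<^sub>v (A *\<^sub>v f i)) = T i \<cdot>\<^sub>v (B *\<^sub>v (B *\<^sub>v f i)) + B *\<^sub>v (B *\<^sub>v f (Suc i))" using f by (simp add: Af lins)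
    then show ?thesis unfolding BB using f by (simp add: B0 B1 lins)
  qed
  have BAB: "B *\<^sub>v (A *\<^sub>v (B *\<^sub>v f i)) = S i \<cdot>\<^sub>v (T i \<cdot>\<^sub>v (S i \<cdot>\<^sub>v f i + F i \<cdot>\<^sub>v ?m) + (S (Suc i) \<cdot>\<^sub>v f (Suc i) + F (Suc i) \<cdot>\<^sub>v f i))
     + (T' \<cdot>\<^sub>v (F i \<cdot>\<^sub>v (S' \<cdot>\<^sub>v ?m + F' \<cdot>\<^sub>v ?mm)) + F i \<cdot>\<^sub>v (S i \<cdot>\<^sub>v f i + F i \<cdot>\<^sub>v ?m))"
  proof -
    have "B *\<^sub>v (F i \<cdot>\<^sub>v (A *\<^sub>v ?m)) = T' \<cdot>\<^sub>v (F i \<cdot>\<^sub>v (B *\<^sub>v ?m)) + F i \<cdot>\<^sub>v (B *\<^sub>v f i)"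
      unfolding repA using f by (auto simp: lins smult_add_distrib_vec[of _ n] smult_smult_assoc mult_ac)
    then have 1: "B *\<^sub>v (F i \<cdot>\<^sub>v (A *\<^sub>v ?m)) = T' \<cdot>\<^sub>v (F i \<cdot>\<^sub>v (S' \<cdot>\<^sub>v ?m + F' \<cdot>\<^sub>v ?mm)) + F i \<cdot>\<^sub>v (S i \<cdot>\<^sub>v f i + F i \<cdot>\<^sub>v ?m)"
      unfolding repB B0 .
    have "B *\<^sub>v (A *\<^sub>v (B *\<^sub>v f i)) = S i \<cdot>\<^sub>v (B *\<^sub>v (A *\<^sub>v f i)) + B *\<^sub>v (F i \<cdot>\<^sub>v (A *\<^sub>v ?m))"
      unfolding B0 using f by (simp add: lins)
    then show ?thesis unfolding 1 using f by (simp add: Af B0 B1 lins)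
  qed
  have ABB: "A *\<^sub>v (B *\<^sub>v (B *\<^sub>v f i)) = S i \<cdot>\<^sub>v (S i \<cdot>\<^sub>v (T i \<cdot>\<^sub>v f i + f (Suc i)) + F i \<cdot>\<^sub>v (T' \<cdot>\<^sub>v ?m + f i))
     + (S' \<cdot>\<^sub>v (F i \<cdot>\<^sub>v (T' \<cdot>\<^sub>v ?m + f i)) + F i \<cdot>\<^sub>v (F' \<cdot>\<^sub>v (T'' \<cdot>\<^sub>v ?mm + ?m)))"
  proof -
    have "F i \<cdot>\<^sub>v (A *\<^sub>v (S' \<cdot>\<^sub>v ?m + F' \<cdot>\<^sub>v ?mm)) = S' \<cdot>\<^sub>v (F i \<cdot>\<^sub>v (A *\<^sub>v ?m)) + F i \<cdot>\<^sub>v (F' \<cdot>\<^sub>v (A *\<^sub>v ?mm))"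
      using f by (auto simp: lins smult_add_distrib_vec[of _ n] smult_smult_assoc mult_ac)
    then have 1: "F i \<cdot>\<^sub>v (A *\<^sub>v (S' \<cdot>\<^sub>v ?m + F' \<cdot>\<^sub>v ?mm)) = S' \<cdot>\<^sub>v (F i \<cdot>\<^sub>v (T' \<cdot>\<^sub>v ?m + f i)) + F i \<cdot>\<^sub>v (F' \<cdot>\<^sub>v (T'' \<cdot>\<^sub>v ?mm + ?m))"
      unfolding repA Amm .
    have "A *\<^sub>v (B *\<^sub>v (B *\<^sub>v f i)) = S i \<cdot>\<^sub>v (S i \<cdot>\<^sub>v (A *\<^sub>v f i) + F i \<cdot>\<^sub>v (A *\<^sub>v ?m)) + F i \<cdot>\<^sub>v (A *\<^sub>v (S' \<cdot>\<^sub>v ?m + F' \<cdot>\<^sub>v ?mm))"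
      unfolding BB using f by (simp add: lins)
    then show ?thesis unfolding 1 unfolding repA unfolding Af .
  qed
  have i1: "(T i) = theta x (p * (p^i/p))" "S i = theta m (p * (p^i/p))" "F i = varphi p m x u w (p * (p^i/p))"
    "S (Suc i) = theta m (p * (p * (p^i/p)))" "T (Suc i) = theta x (p * (p * (p^i/p)))" "F (Suc i) = varphi p m x u w (p * (p * (p^i/p)))"
    using p0 by (simp_all add: T_def S_def F_def)
  have i2: "T' = theta x (p * (p^i/p/p))" using p0 by (simp add: T'_def)
  have Qnz: "p^i \<noteq> 0" "p^i/p \<noteq> 0" "p^i/p/p \<noteq> 0" using p0 by auto
  define g where "g = (p - 2 + inverse p) * gam p m x u w"
  define b where "b = alp p m x u w"
  define k where "k = (p - inverse p)^2"
  define t where "t = p + inverse p"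
  have c1: "S (Suc i)^2 - t * S i * S (Suc i) + S i^2 + k = 0"
    using theta_quad[OF p0 nz(1) Qnz(1)] by (simp add: S_def t_def k_def algebra_simps)
  have c0: "T i * S i^2 + F (Suc i) * (S (Suc i) + S i) - t * (S i * (T i * S i + F (Suc i)) + S i * F i)
      + F i * (S i + S') + S i^2 * T i + k * T i + g * S i - b = 0"
    using rel2_diag[OF p0 nz Qnz(2), of u w] unfolding i1[symmetric] S'_def[symmetric]
    by (simp add: t_def g_def gam_def b_def alp_def k_def)
  have cm: "S' * (T' + T i) + F' - t * (T' * S' + F i + S i * T i) + F (Suc i) + (T' + T i) * S i + g = 0"
    using rel1_up[OF p0 nz Qnz(2), of u w] unfolding i1[symmetric] T'_def[symmetric] S'_def[symmetric] F'_def[symmetric]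
    by (simp add: t_def g_def gam_def)
  have cmm: "T'' - t * T' + T i = 0"
    using theta_recur[OF p0 nz(2) Qnz(3)] p0 by (simp add: T''_def T'_def T_def t_def)
  define a1 where "a1 = f (Suc i) $ r"
  define a0 where "a0 = f i $ r"
  define am where "am = f (i - 1) $ r"
  define amm where "amm = f (i - 1 - 1) $ r"
  note adefs = a1_def[symmetric] a0_def[symmetric] am_def[symmetric] amm_def[symmetric]
  have "E2 (gam p m x u w) (alp p m x u w) (f i) r
    = a1 * (S (Suc i)^2 - t * S i * S (Suc i) + S i^2 + k)
    + a0 * (T i * S i^2 + F (Suc i) * (S (Suc i) + S i) - t * (S i * (T i * S i + F (Suc i)) + S i * F i)
      + F i * (S i + S') + S i^2 * T i + k * T i + g * S i - b)
    + am * F i * (S' * (T' + T i) + F' - t * (T' * S' + F i + S i * T i) + F (Suc i) + (T' + T i) * S i + g)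
    + amm * F i * F' * (T'' - t * T' + T i)"
    unfolding E2_def ABB BAB BBA unfolding B0 Af t_def[symmetric] k_def[symmetric] g_def[symmetric] b_def[symmetric]
    using r fr by (simp only: index_add_vec index_smult_vec carrier_vecD adefs index_smult_vec(2) index_add_vec(2)) (simp add: algebra_simps power2_eq_square)
  then show ?thesis unfolding c1 c0 cm cmm by simp
qed
end

context pair
begin

text \<open>The relations propagate the two-term action of B along the chain of A.\<close>
lemma low_chain:
  assumes f: "\<And>i. f i \<in> V" and lad: "ladA p A x f" 
    and r: "rel p n A B (gam p m x u w) (bet p m x u w)"
    and nz: "m \<noteq> 0" "x \<noteq> 0" 
    and start: "B *\<^sub>v f 0 = theta m 1 \<cdot>\<^sub>v f 0" "B *\<^sub>v f 1 = theta m p \<cdot>\<^sub>v f 1 + varphi p m x u w p \<cdot>\<^sub>v f 0"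
  shows "lowB p B m x u w f i"
proof -
  have "lowB p B m x u w f i \<and> lowB p B m x u w f (Suc i)"
  proof (induction i)
    case 0
    have "dim_vec (f 0) = n" using f[of 0] by simp
    then have "varphi p m x u w 1 \<cdot>\<^sub>v f 0 = 0\<^sub>v n" by (auto simp: varphi_def)
    then show ?case using start f by (simp add: lowB_def)
  next
    case (Suc i)
    have "lowB p B m x u w f (Suc (Suc i))" unfolding lowB_def
    proof (rule eq_vecI)
      fix k assume "k < dim_vec (theta m (p ^ Suc (Suc i)) \<cdot>\<^sub>v f (Suc (Suc i)) + varphi p m x u w (p ^ Suc (Suc i)) \<cdot>\<^sub>v f (Suc (Suc i) - 1))"
      then have k: "k < n" using f[of "Suc i"] by simp
      have "E (gam p m x u w) (bet p m x u w) (f i) k = 0" using relD[OF r f k] by (simp add: E_def)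
      then show "(B *\<^sub>v f (Suc (Suc i))) $ k = (theta m (p ^ Suc (Suc i)) \<cdot>\<^sub>v f (Suc (Suc i)) + varphi p m x u w (p ^ Suc (Suc i)) \<cdot>\<^sub>v f (Suc (Suc i) - 1)) $ k"
        using E_ladder[OF f lad _ _ nz k] Suc.IH by simp
    qed (use f[of "Suc i"] in simp)
    with Suc.IH show ?case by blast
  qed
  then show ?thesis ..
qed

text \<open>The left side of the relation is the action of the single matrix \<open>M\<close>, so it
  suffices to test basis vectors.\<close>

lemma rel_linear_ext:
  assumes "\<And>j r. j < n \<Longrightarrow> r < n \<Longrightarrow> E g b (unit_vec n j) r = 0"
  shows "rel p n A B g b"
proof -
  let ?t = "p + inverse p"
  define M where "M = A * (A * B) - ?t \<cdot>\<^sub>m (A * (B * A)) + B * (A * A) + (p - inverse p)^2 \<cdot>\<^sub>m B + ((p - 2 + inverse p) * g) \<cdot>\<^sub>m A"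
  have c: "A * (A * B) \<in> carrier_mat n n" "A * (B * A) \<in> carrier_mat n n" "B * (A * A) \<in> carrier_mat n n" by (simp_all add: mult_carrier_mat[OF A] mult_carrier_mat[OF B])
  have c2: "A * (A * B) - ?t \<cdot>\<^sub>m (A * (B * A)) \<in> carrier_mat n n" 
    by (rule minus_carrier_mat[OF smult_carrier_mat[OF c(2)]])
  have c3: "A * (A * B) - ?t \<cdot>\<^sub>m (A * (B * A)) + B * (A * A) \<in> carrier_mat n n" 
    by (rule add_carrier_mat[OF c(3)])
  have c4: "A * (A * B) - ?t \<cdot>\<^sub>m (A * (B * A)) + B * (A * A) + (p - inverse p)^2 \<cdot>\<^sub>m B \<in> carrier_mat n n" 
    by (rule add_carrier_mat[OF smult_carrier_mat[OF B]])
  have M: "M \<in> carrier_mat n n" unfolding M_def by (rule add_carrier_mat[OF smult_carrier_mat[OF A]])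
  have Mv: "M *\<^sub>v v = A *\<^sub>v (A *\<^sub>v (B *\<^sub>v v)) - ?t \<cdot>\<^sub>v (A *\<^sub>v (B *\<^sub>v (A *\<^sub>v v))) + B *\<^sub>v (A *\<^sub>v (A *\<^sub>v v))
       + (p - inverse p)^2 \<cdot>\<^sub>v (B *\<^sub>v v) + ((p - 2 + inverse p) * g) \<cdot>\<^sub>v (A *\<^sub>v v)" if v: "v \<in> V" for v
  proof -
    have "M *\<^sub>v v = (A * (A * B)) *\<^sub>v v - (?t \<cdot>\<^sub>m (A * (B * A))) *\<^sub>v v + (B * (A * A)) *\<^sub>v v + ((p - inverse p)^2 \<cdot>\<^sub>m B) *\<^sub>v v + (((p - 2 + inverse p) * g) \<cdot>\<^sub>m A) *\<^sub>v v"
      unfolding M_def 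
      by (simp only: add_mult_distrib_mat_vec[OF c4 smult_carrier_mat[OF A] v] add_mult_distrib_mat_vec[OF c3 smult_carrier_mat[OF B] v]
        add_mult_distrib_mat_vec[OF c2 c(3) v] minus_mult_distrib_mat_vec[OF c(1) smult_carrier_mat[OF c(2)] v])
    then show ?thesis
      by (simp only: mv_smult_mat[OF A v] mv_smult_mat[OF B v] mv_smult_mat[OF c(2) v] mv_mult[OF A _ v] mv_mult[OF B _ v] mult_carrier_mat[OF A] A B AV v
        mv_mult[OF A mult_carrier_mat[OF A B] v] mv_mult[OF A mult_carrier_mat[OF B A] v] mv_mult[OF B mult_carrier_mat[OF A A] v])
  qed
  have "M = b \<cdot>\<^sub>m 1\<^sub>m n"
  proof (rule mat_eqI_mv[OF M])
    fix j assume j: "j < n"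
    show "M *\<^sub>v unit_vec n j = b \<cdot>\<^sub>m 1\<^sub>m n *\<^sub>v unit_vec n j"
    proof (rule eq_vecI)
      fix r assume "r < dim_vec (b \<cdot>\<^sub>m 1\<^sub>m n *\<^sub>v unit_vec n j)"
      then have r: "r < n" by simp
      have "(b \<cdot>\<^sub>m 1\<^sub>m n *\<^sub>v unit_vec n j) $ r = b * unit_vec n j $ r"
        using r by (simp add: mv_smult_mat[where n=n] del: index_mult_mat_vec)
      moreover have "(M *\<^sub>v unit_vec n j) $ r - b * unit_vec n j $ r = 0"
        using assms[OF j r] r unfolding E_def by (simp add: Mv del: index_mult_mat_vec)
      ultimately show "(M *\<^sub>v unit_vec n j) $ r = (b \<cdot>\<^sub>m 1\<^sub>m n *\<^sub>v unit_vec n j) $ r" by simp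
    qed (use M in auto)
  qed simp
  then show ?thesis unfolding rel_def using Mv by (auto simp: mv_smult_mat[where n=n])
qed
end

section \<open>Chains and cyclic vectors\<close>

lemma subspace_finite_comb:
  assumes S: "is_subspace n S" and u: "\<And>j. j < n \<Longrightarrow> unit_vec n j \<in> S"
  shows "S = (carrier_vec n :: 'a::field vec set)"
proof
  show "S \<subseteq> carrier_vec n" using S by (simp add: is_subspace_def)
  show "carrier_vec n \<subseteq> S"
  proof
    fix v :: "'a vec" assume v: "v \<in> carrier_vec n"
    have "k \<le> n \<Longrightarrow> vec n (\<lambda>i. if i < k then v $ i else 0) \<in> S" for k
    proof (induction k)
      case 0
      have "vec n (\<lambda>i. if i < 0 then v $ i else 0) = 0\<^sub>v n" by auto
      then show ?case using S by (simp add: is_subspace_def zero_vec_def)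
    next
      case (Suc k)
      have "vec n (\<lambda>i. if i < Suc k then v $ i else 0) = vec n (\<lambda>i. if i < k then v $ i else 0) + v $ k \<cdot>\<^sub>v unit_vec n k"
        by (rule eq_vecI) (use Suc.prems in \<open>auto simp: less_Suc_eq\<close>)
      then show ?case using Suc S u[of k] by (simp add: is_subspace_def)
    qed
    from this[of n] have "vec n (\<lambda>i. if i < n then v $ i else 0) \<in> S" by simp
    moreover have "vec n (\<lambda>i. if i < n then v $ i else 0) = v" using v by auto
    ultimately show "v \<in> S" by simp
  qed
qed

lemma subspaceD:
  assumes "is_subspace n S"
  shows "v \<in> S \<Longrightarrow> v \<in> carrier_vec n" "0\<^sub>v n \<in> S" "v \<in> S \<Longrightarrow> w \<in> S \<Longrightarrow> v + w \<in> S" "v \<in> S \<Longrightarrow> c \<cdot>\<^sub>v v \<in> S"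
  using assms by (auto simp: is_subspace_def)

lemma subspace_minus:
  assumes "is_subspace n S" "v \<in> S" "w \<in> S" shows "v - w \<in> (S :: 'a::field vec set)"
proof -
  have "v - w = v + (-1) \<cdot>\<^sub>v w" 
    using subspaceD(1)[OF assms(1,2)] subspaceD(1)[OF assms(1,3)] by auto
  then show ?thesis using assms subspaceD by metis
qed

lemma surj_invertible:
  assumes P: "P \<in> carrier_mat n n" and s: "\<And>w. w \<in> carrier_vec n \<Longrightarrow> \<exists>v\<in>carrier_vec n. P *\<^sub>v v = (w :: 'a::field vec)"
  obtains Q where "Q \<in> carrier_mat n n" "P * Q = 1\<^sub>m n" "Q * P = 1\<^sub>m n"
proof -
  have "\<forall>j. \<exists>v. v \<in> carrier_vec n \<and> P *\<^sub>v v = unit_vec n j" using s by (meson unit_vec_carrier)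
  then obtain g where g: "\<And>j. g j \<in> carrier_vec n" "\<And>j. P *\<^sub>v g j = unit_vec n j" by metis
  define Q where "Q = mat n n (\<lambda>(i,j). g j $ i)"
  have Q: "Q \<in> carrier_mat n n" by (simp add: Q_def)
  have Qe: "Q *\<^sub>v unit_vec n j = g j" if "j < n" for j
    by (rule eq_vecI) (use g(1)[of j] that in \<open>auto simp: Q_def scalar_prod_right_unit\<close>)
  have "P * Q = 1\<^sub>m n"
    by (rule mat_eqI_mv[where n=n]) (use P Q in \<open>simp_all add: mv_mult[of _ n] Qe g mult_carrier_mat\<close>)
  moreover from mat_mult_left_right_inverse[OF P Q this] have "Q * P = 1\<^sub>m n" .
  ultimately show ?thesis using that Q by blast
qed

lemma invertible_matI: 
  assumes "P \<in> carrier_mat n n" "Q \<in> carrier_mat n n" "P * Q = 1\<^sub>m n" "Q * P = 1\<^sub>m n"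
  shows "invertible_mat P"
  unfolding invertible_mat_def inverts_mat_def using assms by auto

text \<open>Cyclicity under \<open>A\<close> alone: any property that defines an
  \<open>A\<close>-stable subspace spreads from \<open>v\<close> to the whole space.\<close>

definition gen :: "nat \<Rightarrow> 'a::field mat \<Rightarrow> 'a vec \<Rightarrow> bool" where
  "gen n A v \<longleftrightarrow> (\<forall>S. is_subspace n S \<and> (\<forall>w\<in>S. A *\<^sub>v w \<in> S) \<and> v \<in> S \<longrightarrow> S = carrier_vec n)"

text \<open>The Newton basis for \<open>A\<close> with nodes \<open>theta x (p^j)\<close>. The
  parameter \<open>x\<close> stays free, so that ladders with different first parameters can be
  built on the same vector.\<close>

definition chain :: "'a::field \<Rightarrow> 'a mat \<Rightarrow> 'a \<Rightarrow> 'a vec \<Rightarrow> nat \<Rightarrow> 'a vec" where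
  "chain p A x v = rec_nat v (\<lambda>i w. A *\<^sub>v w - theta x (p^i) \<cdot>\<^sub>v w)"

lemma chain_0 [simp]: "chain p A x v 0 = v"
  and chain_Suc: "chain p A x v (Suc i) = A *\<^sub>v chain p A x v i - theta x (p^i) \<cdot>\<^sub>v chain p A x v i"
  by (simp_all add: chain_def)

lemma chain_carrier [simp]: "A \<in> carrier_mat n n \<Longrightarrow> v \<in> carrier_vec n \<Longrightarrow> chain p A x v i \<in> carrier_vec n"
  by (induction i) (simp_all add: chain_Suc mv_carrier)

lemma chain_ladA: 
  assumes "A \<in> carrier_mat n n" "v \<in> carrier_vec n" shows "ladA p A x (chain p A x v)"
  unfolding ladA_def
proof
  fix i
  show "A *\<^sub>v chain p A x v i = theta x (p ^ i) \<cdot>\<^sub>v chain p A x v i + chain p A x v (Suc i)"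
    by (rule eq_vecI) (use chain_carrier[OF assms, of p x i] assms in \<open>auto simp: chain_Suc simp del: chain_carrier\<close>)
qed

lemma chain_add: "A \<in> carrier_mat n n \<Longrightarrow> v \<in> carrier_vec n \<Longrightarrow> w \<in> carrier_vec n \<Longrightarrow>
  chain p A x (v + w) i = chain p A x v i + (chain p A x w i :: 'a::field vec)"
proof (induction i)
  case (Suc i)
  define a b where "a = chain p A x v i" and "b = chain p A x w i"
  have ab: "a \<in> carrier_vec n" "b \<in> carrier_vec n" using Suc.prems by (simp_all add: a_def b_def)
  have d: "dim_vec a = n" "dim_vec b = n" "dim_row A = n" using ab Suc.prems(1) by simp_all
  show ?case unfolding chain_Suc Suc.IH[OF Suc.prems] a_def[symmetric] b_def[symmetric] mv_add[OF Suc.prems(1) ab]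
    by (rule eq_vecI) (use d in \<open>simp_all add: ring_distribs del: index_mult_mat_vec\<close>)
qed simp

lemma chain_smult: "A \<in> carrier_mat n n \<Longrightarrow> v \<in> carrier_vec n \<Longrightarrow> 
  chain p A x (c \<cdot>\<^sub>v v) i = c \<cdot>\<^sub>v (chain p A x v i :: 'a::field vec)"
proof (induction i)
  case (Suc i)
  define a where "a = chain p A x v i"
  have a: "a \<in> carrier_vec n" using Suc.prems by (simp add: a_def)
  have d: "dim_vec a = n" "dim_row A = n" using a Suc.prems(1) by simp_all
  show ?case unfolding chain_Suc Suc.IH[OF Suc.prems] a_def[symmetric] mv_smult[OF Suc.prems(1) a]
    by (rule eq_vecI) (use d in \<open>simp_all add: right_diff_distrib mult.left_commute del: index_mult_mat_vec\<close>)
qed simp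

lemma chain_comm: "A \<in> carrier_mat n n \<Longrightarrow> v \<in> carrier_vec n \<Longrightarrow> 
  chain p A x (A *\<^sub>v v) i = A *\<^sub>v (chain p A x v i :: 'a::field vec)"
  by (induction i) (simp_all add: chain_Suc mv_minus[of _ n] mv_smult[of _ n] mv_carrier)

section \<open>Polynomials in A applied to a vector\<close>

primrec polact :: "nat \<Rightarrow> 'a::field mat \<Rightarrow> 'a vec \<Rightarrow> 'a list \<Rightarrow> 'a vec" where
  "polact n A v [] = 0\<^sub>v n"
| "polact n A v (a # as) = a \<cdot>\<^sub>v v + A *\<^sub>v polact n A v as"

definition act :: "nat \<Rightarrow> 'a::field mat \<Rightarrow> 'a poly \<Rightarrow> 'a vec \<Rightarrow> 'a vec" where
  "act n A f v = polact n A v (coeffs f)"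

context 
  fixes n and A :: "'a::field mat" and v :: "'a vec"
  assumes A: "A \<in> carrier_mat n n" and v: "v \<in> carrier_vec n"
begin

lemma mv_0: "A *\<^sub>v 0\<^sub>v n = 0\<^sub>v n" using A by auto

lemma act_0 [simp]: "act n A 0 v = 0\<^sub>v n" by (simp add: act_def)

lemma polact_carrier: "polact n A v as \<in> carrier_vec n" using A v by (induction as) (auto simp: mv_carrier)

lemma act_carrier [simp]: "act n A f v \<in> carrier_vec n" by (simp add: act_def polact_carrier)

lemma act_pCons: "act n A (pCons a f) v = a \<cdot>\<^sub>v v + A *\<^sub>v act n A f v"
proof (cases "a = 0 \<and> f = 0")
  case True then show ?thesis using v by (auto simp: mv_0 smult_vec_def)
next
  case False then show ?thesis by (auto simp: act_def)
qed

lemma act_add: "act n A (f + g) v = act n A f v + act n A g v"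
proof (induction f g rule: poly_induct2)
  case 0 then show ?case by (simp add: act_0)
next
  case (pCons a f b g)
  show ?case unfolding add_pCons act_pCons pCons
    by (rule eq_vecI) (use A v in \<open>simp_all add: mv_add[of _ n] algebra_simps del: index_mult_mat_vec\<close>)
qed

lemma act_smult: "act n A (smult c f) v = c \<cdot>\<^sub>v act n A f v"
proof (induction f)
  case 0 then show ?case by (auto simp: act_0)
next
  case (pCons a f)
  show ?case unfolding smult_pCons act_pCons pCons
    by (rule eq_vecI) (use A v in \<open>simp_all add: mv_smult[of _ n] algebra_simps del: index_mult_mat_vec\<close>)
qed

lemma act_linear_factor: "act n A ([:- c, 1:] * f) v = A *\<^sub>v act n A f v - c \<cdot>\<^sub>v act n A f v"
proof -
  define a where "a = act n A f v"
  have a: "a \<in> carrier_vec n" by (simp add: a_def)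
  have e: "[:- c, 1:] * f = smult (- c) f + pCons 0 f" by simp
  have d: "dim_vec a = n" "dim_row A = n" "dim_vec v = n" using a A v by simp_all
  show ?thesis unfolding e act_add act_smult act_pCons a_def[symmetric]
    by (rule eq_vecI) (use d in \<open>simp_all del: index_mult_mat_vec\<close>)
qed

text \<open>Turns questions about chains with different \<open>x\<close> into the comparison of two
  explicit polynomials.\<close>

lemma act_chain: "chain p A x v i = act n A (\<Prod>j<i. [:- theta x (p^j), 1:]) v"
proof (induction i)
  case 0
  show ?case using A v by (auto simp: one_pCons act_pCons act_0 mv_0)
next
  case (Suc i)
  have "(\<Prod>j<Suc i. [:- theta x (p^j), 1:]) = [:- theta x (p^i), 1:] * (\<Prod>j<i. [:- theta x (p^j), 1:])"
    by (simp add: mult.commute)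
  then show ?case by (simp only: chain_Suc Suc act_linear_factor)
qed

end

section \<open>Primitive n-th roots of unity and coincidences of eigenvalues\<close>

locale root_unity =
  fixes p :: "'a::field" and n :: nat
  assumes n3: "n \<ge> 3" and pn: "p ^ n = 1" and pk: "\<And>k. 0 < k \<Longrightarrow> k < n \<Longrightarrow> p ^ k \<noteq> 1"
begin

lemma p0: "p \<noteq> 0"
proof assume "p = 0" with pn n3 show False by (simp add: power_0_left) qed

lemma pow_mod: "p ^ i = p ^ (i mod n)"
proof -
  have "p ^ i = p ^ (n * (i div n) + i mod n)" by simp
  also have "\<dots> = p ^ (i mod n)" unfolding power_add power_mult pn by simp
  finally show ?thesis .
qed

lemma pow_add_n [simp]: "p ^ (n + i) = p ^ i" "p ^ (i + n) = p ^ i"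
  by (simp_all add: power_add pn)

lemma pow_eq_less: "i < n \<Longrightarrow> j < n \<Longrightarrow> p ^ i = p ^ j \<Longrightarrow> i = j"
proof (induction i j rule: linorder_wlog)
  case (le i j)
  have "p ^ j = p ^ i * p ^ (j - i)" using le(1) by (simp add: power_add[symmetric])
  then have "p ^ (j - i) = 1" using le p0 by simp
  then show ?case using pk[of "j - i"] le by force
next
  case (sym a b) then show ?case by auto
qed

lemma p1: "p \<noteq> 1" using pk[of 1] n3 by simp
lemma p2: "p ^ 2 \<noteq> 1" using pk[of 2] n3 by simp
lemma p2': "p * p \<noteq> 1" using p2 by (simp add: power2_eq_square)

lemma inj_pow: "inj_on (\<lambda>j. p ^ j) {..<n}" by (auto simp: inj_on_def dest: pow_eq_less)

text \<open>Both sides are monic of degree n and vanish at the n distinct powers of p, so their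
  difference has too many roots for its degree.\<close>

lemma prod_poly: "(\<Prod>j<n. [:- (p^j), 1:]) = monom 1 n - 1"
proof (rule ccontr)
  define f where "f = (\<Prod>j<n. [:- (p^j), 1:])"
  define g where "g = monom (1::'a) n - 1"
  assume "\<not> ?thesis"
  then have nz: "f - g \<noteq> 0" by (simp add: f_def g_def)
  have df: "degree f = n" unfolding f_def by (subst degree_prod_eq_sum_degree) auto
  have dg: "degree g \<le> n" unfolding g_def by (intro degree_diff_le degree_monom_le) simp
  have lf: "coeff f n = 1" 
  proof -
    have "lead_coeff f = 1" unfolding f_def by (subst lead_coeff_prod) simp
    then show ?thesis using df by simp
  qed
  have lg: "coeff g n = 1" using n3 by (simp add: g_def)
  have "degree (f - g) \<le> n" using df dg by (intro degree_diff_le) auto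
  moreover have "degree (f - g) \<noteq> n" using lf lg nz by (metis coeff_diff diff_self leading_coeff_0_iff)
  ultimately have "degree (f - g) < n" by simp
  moreover have "(\<lambda>j. p ^ j) ` {..<n} \<subseteq> {x. poly (f - g) x = 0}"
  proof (clarsimp simp: f_def g_def poly_prod poly_monom)
    fix j assume "j < n"
    then have "(\<Prod>i<n. p ^ j - p ^ i) = 0" by (intro prod_zero) auto
    moreover have "(p ^ j) ^ n = 1" by (metis pn power_mult power_one mult.commute)
    ultimately show "(\<Prod>x<n. p ^ j - p ^ x) = (p ^ j) ^ n - 1" by simp
  qed
  then have "card ((\<lambda>j. p ^ j) ` {..<n}) \<le> card {x. poly (f - g) x = 0}"
    by (intro card_mono poly_roots_finite nz)
  then have "n \<le> card {x. poly (f - g) x = 0}" by (simp add: card_image inj_pow)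
  moreover have "card {x. poly (f - g) x = 0} \<le> degree (f - g)" by (rule poly_roots_degree[OF nz])
  ultimately show False by simp
qed

lemma prod_sub: "(\<Prod>j<n. t - s * p^j) = t ^ n - s ^ n"
proof (cases "s = 0")
  case True then show ?thesis using n3 by (simp add: power_0_left)
next
  case False
  have "(\<Prod>j<n. t - s * p^j) = (\<Prod>j<n. s * (t/s - p^j))" using False by (intro prod.cong) (auto simp: algebra_simps)
  also have "\<dots> = s ^ n * poly (\<Prod>j<n. [:- (p^j), 1:]) (t/s)" by (simp add: prod.distrib poly_prod)
  also have "\<dots> = t ^ n - s ^ n" unfolding prod_poly using False by (simp add: poly_monom field_simps)
  finally show ?thesis .
qed

lemma prod_one_sub: "(\<Prod>j<n. 1 - s * p^j) = 1 - s ^ n" using prod_sub[of 1 s] by simp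

lemma root_ex: "t ^ n = 1 \<Longrightarrow> \<exists>k<n. t = p ^ k"
proof -
  assume "t ^ n = 1"
  then have "(\<Prod>j<n. t - 1 * p^j) = 0" unfolding prod_sub by simp
  then show ?thesis by auto
qed

text \<open>The second solution, at 1/(m^2 Q), is the source of all degenerate cases below.\<close>

lemma theta_eq_iff: 
  assumes "m \<noteq> (0::'a)" "Q \<noteq> 0" "R \<noteq> 0"
  shows "theta m Q = theta m R \<longleftrightarrow> Q = R \<or> m^2 * Q * R = 1"
proof -
  have "m * Q * R * (theta m Q - theta m R) = (Q - R) * (m^2 * Q * R - 1)"
    using assms by (simp add: theta_def field_simps power2_eq_square)
  then show ?thesis using assms by auto
qed

end

section \<open>The matrices of A and B\<close>

lemma alg_closed_infinite:
  assumes "alg_closed TYPE('a::field)" shows "infinite (UNIV :: 'a set)"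
proof
  assume fin: "finite (UNIV :: 'a set)"
  \<comment> \<open>Over a finite field this polynomial is the constant function 1.\<close>
  define f where "f = (\<Prod>a\<in>(UNIV::'a set). [:- a, 1:]) + 1"
  have d: "degree (\<Prod>a\<in>(UNIV::'a set). [:- a, 1:]) = card (UNIV :: 'a set)"
    by (subst degree_prod_eq_sum_degree) auto
  have c: "card (UNIV :: 'a set) > 0" using fin by (simp add: card_gt_0_iff)
  have "degree f = card (UNIV :: 'a set)" unfolding f_def using d c by (subst degree_add_eq_left) auto
  then obtain x where "poly f x = 0" using assms c unfolding alg_closed_def by (metis less_irrefl)
  moreover have "poly f x = 1" unfolding f_def using fin by (auto simp: poly_prod)
  ultimately show False by simp
qed

lemma alg_closed_sqrt:
  assumes "alg_closed TYPE('a::field)" shows "\<exists>s::'a. s * s + b * s + c = 0"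
proof -
  have "degree [:c, b, 1:] \<noteq> 0" by simp
  then obtain s where "poly [:c,b,1:] s = 0" using assms unfolding alg_closed_def by blast
  then show ?thesis by (intro exI[of _ s]) (simp add: algebra_simps)
qed

locale root_unity_closed = root_unity p n for p :: "'a::field" and n :: nat + assumes ac: "alg_closed TYPE('a)"
begin

text \<open>Each factor splits as (tau - x Q)(tau x Q - 1)/(tau x Q) with Q = p^j; the product over
  all n-th roots of unity then replaces every linear factor by a difference of n-th powers.\<close>

lemma chain_poly_eval:
  assumes "x \<noteq> 0" "\<tau> \<noteq> (0::'a)"
  shows "(\<Prod>j<n. (\<tau> + inverse \<tau>) - theta x (p^j)) = \<tau>^n + inverse (\<tau>^n) - x^n - inverse (x^n)"
proof -
  have "(\<Prod>j<n. (\<tau> + inverse \<tau>) - theta x (p^j)) = (\<Prod>j<n. (\<tau> - x * p^j) * (inverse (\<tau> * x) * inverse (p^j) * (\<tau> * x * p^j - 1)))"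
    using assms p0 by (intro prod.cong) (auto simp: theta_def field_simps)
  also have "\<dots> = (\<tau>^n - x^n) * (inverse (\<tau>*x) ^ n * (\<Prod>j<n. inverse (p^j) * (\<tau> * x * p^j - 1)))"
    by (simp add: prod.distrib prod_sub mult.assoc power_mult_distrib)
  also have "(\<Prod>j<n. inverse (p^j) * (\<tau> * x * p^j - 1)) = (\<Prod>j<n. \<tau> * x - inverse p ^ j)"
    using p0 by (intro prod.cong) (auto simp: field_simps)
  also have "\<dots> = (\<Prod>j<n. \<tau> * x - 1 * p ^ j)"
  proof -
    \<comment> \<open>Inversion permutes the roots of unity: exponent j goes to n - j, and 0 is
      fixed.\<close>
    have "(\<Prod>j<n. \<tau> * x - inverse p ^ j) = (\<Prod>j\<in>{..<n}. \<tau> * x - p ^ (if j = 0 then 0 else n - j))"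
    proof (rule prod.cong)
      fix j assume "j \<in> {..<n}"
      then have "p ^ j * p ^ (n - j) = 1" by (simp add: power_add[symmetric] pn)
      then have "inverse p ^ j = p ^ (n - j)" using p0 by (metis inverse_unique power_inverse)
      then show "\<tau> * x - inverse p ^ j = \<tau> * x - p ^ (if j = 0 then 0 else n - j)" by (simp add: pn)
    qed simp
    also have "\<dots> = (\<Prod>j\<in>{..<n}. \<tau> * x - p ^ j)"
      by (rule prod.reindex_bij_witness[of _ "\<lambda>j. if j = 0 then 0 else n - j" "\<lambda>j. if j = 0 then 0 else n - j"]) (use n3 in auto)
    finally show ?thesis by simp
  qed
  also have "\<dots> = (\<tau> * x) ^ n - 1" unfolding prod_sub by simp
  finally show ?thesis using assms by (simp add: field_simps power_mult_distrib)
qed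

text \<open>By algebraic closure every t has the form tau + 1/tau, so the evaluation formula makes
  the two polynomials agree as functions, and the field is infinite.\<close>

lemma chain_poly_indep:
  assumes "x \<noteq> 0" "y \<noteq> (0::'a)"
  shows "(\<Prod>j<n. [:- theta x (p^j), 1:]) + [:x^n + inverse (x^n):] = (\<Prod>j<n. [:- theta y (p^j), 1:]) + [:y^n + inverse (y^n):]"
    (is "?f = ?g")
proof -
  have "poly ?f t = poly ?g t" for t
  proof -
    obtain \<tau> where t: "\<tau> * \<tau> + (- t) * \<tau> + 1 = 0" using alg_closed_sqrt[OF ac, of "- t" 1] by auto
    then have t0: "\<tau> \<noteq> 0" by auto
    have tt: "t = \<tau> + inverse \<tau>" using t t0 by (simp add: field_simps)
    show ?thesis unfolding tt using chain_poly_eval[OF assms(1) t0] chain_poly_eval[OF assms(2) t0]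
      by (simp add: poly_prod)
  qed
  then have "{t. poly (?f - ?g) t = 0} = UNIV" by simp
  then have "?f - ?g = 0" using alg_closed_infinite[OF ac] poly_roots_finite[of "?f - ?g"] by metis
  then show ?thesis by simp
qed

text \<open>Explains the correction term in D: the n-th chain step is a scalar whose dependence on
  \<open>x\<close> is exactly x^n + x^(-n).\<close>

lemma chain_indep:
  assumes "A \<in> carrier_mat n n" "v \<in> carrier_vec n" "x \<noteq> 0" "y \<noteq> (0::'a)" "chain p A x v n = (D - x^n - inverse (x^n)) \<cdot>\<^sub>v v"
  shows "chain p A y v n = (D - y^n - inverse (y^n)) \<cdot>\<^sub>v v"
proof -
  have c: "act n A [:k:] v = k \<cdot>\<^sub>v v" for k using assms(1,2) by (auto simp: act_pCons act_0 mv_0)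
  have "chain p A x v n + (x^n + inverse (x^n)) \<cdot>\<^sub>v v = chain p A y v n + (y^n + inverse (y^n)) \<cdot>\<^sub>v v"
    using arg_cong[OF chain_poly_indep[OF assms(3,4)], of "\<lambda>f. act n A f v"]
    unfolding act_chain[OF assms(1,2)] act_add[OF assms(1,2)] c by simp
  then have e: "(chain p A x v n + (x^n + inverse (x^n)) \<cdot>\<^sub>v v) $ i = (chain p A y v n + (y^n + inverse (y^n)) \<cdot>\<^sub>v v) $ i" for i by simp
  have d: "dim_vec (chain p A y v n) = n" "dim_vec v = n" using assms(1,2) chain_carrier[OF assms(1,2), of p y n] by simp_all
  show ?thesis
  proof (rule eq_vecI)
    fix i assume "i < dim_vec ((D - y^n - inverse (y^n)) \<cdot>\<^sub>v v)"
    then have "(D - x^n - inverse (x^n)) * v $ i + (x^n + inverse (x^n)) * v $ i = chain p A y v n $ i + (y^n + inverse (y^n)) * v $ i"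
      using e[of i] d unfolding assms(5) by simp
    then show "chain p A y v n $ i = ((D - y^n - inverse (y^n)) \<cdot>\<^sub>v v) $ i"
      using \<open>i < _\<close> by (simp add: algebra_simps)
  qed (use d in simp)
qed

end

definition matA :: "'a::field \<Rightarrow> nat \<Rightarrow> 'a \<Rightarrow> 'a \<Rightarrow> 'a mat" where
  "matA p n x d = mat n n (\<lambda>(i, j). (if i = j then theta x (p^j) else 0) + (if i = j + 1 then 1 else 0)
                       + (if j + 1 = n \<and> i = 0 then d else 0))"

definition matB :: "'a::field \<Rightarrow> nat \<Rightarrow> 'a \<Rightarrow> 'a \<Rightarrow> 'a \<Rightarrow> 'a \<Rightarrow> 'a mat" where
  "matB p n m x u w = mat n n (\<lambda>(i, j). (if i = j then theta m (p^j) else 0) + (if j = i + 1 then varphi p m x u w (p^j) else 0))"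

text \<open>Sharper than the condition defining a marginal weight, which only puts (B - theta m p) A
  v into the eigenspace of \<open>theta m 1\<close>, possibly of dimension above 1. Here it has to
  be a multiple of \<open>v\<close> itself, and the factor \<open>c\<close> becomes an
  invariant.\<close>

definition marginal_vec :: "'a::field \<Rightarrow> nat \<Rightarrow> 'a mat \<Rightarrow> 'a mat \<Rightarrow> 'a \<Rightarrow> 'a \<Rightarrow> 'a vec \<Rightarrow> bool" where
  "marginal_vec p n A B m c v \<longleftrightarrow> v \<in> carrier_vec n \<and> v \<noteq> 0\<^sub>v n \<and> B *\<^sub>v v = theta m 1 \<cdot>\<^sub>v v \<and>
     B *\<^sub>v (A *\<^sub>v v) = theta m p \<cdot>\<^sub>v (A *\<^sub>v v) + c \<cdot>\<^sub>v v"

definition marginal_coeff :: "'a::field \<Rightarrow> 'a \<Rightarrow> 'a \<Rightarrow> 'a \<Rightarrow> 'a" where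
  "marginal_coeff p m e1 e3 = (inverse p - 1) * (e3 - e1) / m"

text \<open>In the notation of the paper p = q^2, m = b/\<lambda>, x1 = a/\<lambda>, x2 = 1/(a\<lambda>), x3 = bcq, x4 = bq/c, and D is the
  quantity preserved by the equivalences of 5-tuples.\<close>
locale w_module = root_unity_closed p n for p :: "'a::field" and n :: nat +
  fixes m x1 x2 x3 x4 D :: 'a
  assumes nz: "m \<noteq> 0" "x1 \<noteq> 0" "x2 \<noteq> 0" "x3 \<noteq> 0" "x4 \<noteq> 0" and prod: "x1 * x2 * x3 * x4 = m^2 * p"
begin

definition u where "u = x2 + x3 + x4"
definition w where "w = x2 * x3 + x2 * x4 + x3 * x4"
definition \<delta> where "\<delta> = D - x1 ^ n - inverse (x1 ^ n)"
definition A where "A = matA p n x1 \<delta>"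
definition B where "B = matB p n m x1 u w"
definition e1 where "e1 = x1 + x2 + x3 + x4"
definition e2 where "e2 = x1*x2 + x1*x3 + x1*x4 + x2*x3 + x2*x4 + x3*x4"
definition e3 where "e3 = x1*x2*x3 + x1*x2*x4 + x1*x3*x4 + x2*x3*x4"
definition gm where "gm = (e1 + e3 / p) / m"
definition bt where "bt = (p - inverse p) * (1 - inverse p) * (e2 + m^2 + p) / m"
definition al where "al = (p - inverse p) * (1 - inverse p) * (e1 + e3 / m^2)"
definition F where "F i = varphi p m x1 u w (p^i)"
definition T where "T i = theta x1 (p^i)"
definition S where "S i = theta m (p^i)"
text \<open>The ladder basis continued to all indices by m_(n+i) = \<delta> m_i, so that statements
  about infinite chains apply to it.\<close>

definition eb where "eb i = \<delta> ^ (i div n) \<cdot>\<^sub>v unit_vec n (i mod n)"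

lemma xw: "m^2 * p / x1 = x2 * x3 * x4"
  using prod nz by (simp add: field_simps)

lemma gam_gm: "gam p m x1 u w = gm" unfolding gam_def xw by (simp add: gm_def u_def w_def e1_def e3_def algebra_simps)
lemma bet_bt: "bet p m x1 u w = bt" by (simp add: bet_def bt_def u_def w_def e2_def algebra_simps)
lemma alp_al: "alp p m x1 u w = al" unfolding alp_def xw by (simp add: al_def u_def w_def e1_def e3_def algebra_simps)

lemma marginal_coeff_eq: "T 0 * (S 0 - S 1) + F 1 = marginal_coeff p m e1 e3"
proof -
  have "T 0 * (S 0 - S 1) + F 1 = (inverse p - 1) * ((x1 * w + x2*x3*x4) - (x1+u)) / m"
    using marginal_coeff[OF p0 nz(1,2), of u w] unfolding xw by (simp add: T_def S_def F_def)
  then show ?thesis by (simp add: marginal_coeff_def e1_def e3_def u_def w_def algebra_simps)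
qed

text \<open>The product constraint splits the cubic into one factor for each pair containing
  \<open>x1\<close>. A zero of \<open>F\<close> inside the ladder is thus precisely a pair that
  allows a shift.\<close>

lemma F_factor: "F i = p * (1 - p^i) * (1 - x1 * x2 * p^i / p) * (1 - x1 * x3 * p^i / p) * (1 - x1 * x4 * p^i / p) / (x1 * m * (p^i)^2)"
proof -
  define Q where "Q = p^i/p"
  have Q: "p^i = p * Q" using p0 by (simp add: Q_def)
  have "x1^2 * m^2 * (p*Q)^3 / p^2 = x1^2 * (m^2*p) * Q^3" using p0 by (simp add: field_simps power2_eq_square power3_eq_cube)
  also have "\<dots> = x1^3 * x2 * x3 * x4 * Q^3" unfolding prod[symmetric] by (simp add: power2_eq_square power3_eq_cube)
  finally have "1 - x1 * u * (p*Q) / p + x1^2 * w * (p*Q)^2 / p^2 - x1^2 * m^2 * (p*Q)^3 / p^2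
     = (1 - x1 * x2 * Q) * (1 - x1 * x3 * Q) * (1 - x1 * x4 * Q)"
    using p0 by (simp add: u_def w_def power_mult_distrib) (simp add: algebra_simps power2_eq_square power3_eq_cube)
  then show ?thesis unfolding F_def varphi_def Q using p0 by (simp add: mult.assoc)
qed

lemma F_zero: "F 0 = 0" by (simp add: F_factor)
lemma F_n: "F n = 0" by (simp add: F_factor pn)

lemma F_eq_0_iff:
  assumes "0 < i" "i < n"
  shows "F i = 0 \<longleftrightarrow> x1 * x2 * p^i = p \<or> x1 * x3 * p^i = p \<or> x1 * x4 * p^i = p"
proof -
  have "1 - p^i \<noteq> 0" using pk[OF assms] by simp
  moreover have "1 - y * p^i / p = 0 \<longleftrightarrow> y * p^i = p" for y using p0 by (auto simp: field_simps)
  ultimately show ?thesis unfolding F_factor using p0 nz by simp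
qed

lemma A_carrier [simp]: "A \<in> carrier_mat n n" and B_carrier [simp]: "B \<in> carrier_mat n n"
  by (simp_all add: A_def B_def matA_def matB_def)

sublocale pair n A B p by standard (simp_all add: p0)

lemma A_coord: 
  assumes v: "v \<in> carrier_vec n" and i: "i < n" 
  shows "(A *\<^sub>v v) $ i = T i * v $ i + (if i = 0 then \<delta> * v $ (n - 1) else v $ (i - 1))"
proof -
  have "(A *\<^sub>v v) $ i = (\<Sum>j<n. ((if i = j then T j else 0) + (if i = j + 1 then 1 else 0) + (if j + 1 = n \<and> i = 0 then \<delta> else 0)) * v $ j)"
    using v i unfolding T_def by (simp add: A_def matA_def scalar_prod_def atLeast0LessThan)
  also have "\<dots> = (\<Sum>j<n. if j = i then T j * v $ j else 0) + (\<Sum>j<n. if i = j + 1 then v $ j else 0) 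
      + (\<Sum>j<n. if j = n - 1 then (if i = 0 then \<delta> * v $ j else 0) else 0)"
    unfolding sum.distrib[symmetric] using n3 by (intro sum.cong) (auto simp: algebra_simps)
  also have "(\<Sum>j<n. if i = j + 1 then v $ j else 0) = (if i = 0 then 0 else v $ (i - 1))"
  proof (cases i)
    case (Suc k)
    then have "(\<Sum>j<n. if i = j + 1 then v $ j else 0) = (\<Sum>j<n. if j = k then v $ j else 0)" by (intro sum.cong) auto
    then show ?thesis using Suc i by simp
  qed simp
  finally show ?thesis using i n3 by simp
qed

lemma B_coord: 
  assumes v: "v \<in> carrier_vec n" and i: "i < n" 
  shows "(B *\<^sub>v v) $ i = S i * v $ i + (if i + 1 < n then F (i + 1) * v $ (i + 1) else 0)"
proof -
  have "(B *\<^sub>v v) $ i = (\<Sum>j<n. ((if i = j then S j else 0) + (if j = i + 1 then F j else 0)) * v $ j)"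
    using v i unfolding S_def F_def by (simp add: B_def matB_def scalar_prod_def atLeast0LessThan)
  also have "\<dots> = (\<Sum>j<n. if j = i then S j * v $ j else 0) + (\<Sum>j<n. if j = i + 1 then F j * v $ j else 0)"
    unfolding sum.distrib[symmetric] by (intro sum.cong) (auto simp: algebra_simps)
  finally show ?thesis using i by (simp add: sum.delta)
qed

lemma per: "T (i mod n) = T i" "S (i mod n) = S i" "F (i mod n) = F i"
  by (simp_all add: T_def S_def F_def pow_mod[symmetric])

lemma eb_carrier [simp]: "eb i \<in> carrier_vec n" by (simp add: eb_def)
lemma eb_dim [simp]: "dim_vec (eb i) = n" by (simp add: eb_def)
lemma eb_less: "i < n \<Longrightarrow> eb i = unit_vec n i" by (auto simp: eb_def)
lemma eb_n: "eb (n + i) = \<delta> \<cdot>\<^sub>v eb i" using n3 by (simp add: eb_def smult_smult_assoc)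

lemma A_unit: "i < n \<Longrightarrow> A *\<^sub>v unit_vec n i = T i \<cdot>\<^sub>v unit_vec n i + eb (Suc i)"
proof (rule eq_vecI)
  fix j assume "i < n" "j < dim_vec (T i \<cdot>\<^sub>v unit_vec n i + eb (Suc i))"
  then have j: "j < n" and i: "i < n" by (simp_all add: eb_def)
  have "eb (Suc i) $ j = (if Suc i = n then (if j = 0 then \<delta> else 0) else (if j = Suc i then 1 else 0))"
  proof (cases "Suc i = n")
    case True then show ?thesis using j n3 eb_n[of 0] by (simp add: eb_less)
  next
    case False then show ?thesis using i j by (simp add: eb_less)
  qed
  then show "(A *\<^sub>v unit_vec n i) $ j = (T i \<cdot>\<^sub>v unit_vec n i + eb (Suc i)) $ j"
    using i j n3 by (auto simp: A_coord simp del: index_mult_mat_vec)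
qed (simp add: eb_def)

lemma lad_eb: "ladA p A x1 eb"
  unfolding ladA_def
proof
  fix i
  have i: "i mod n < n" using n3 by simp
  have "eb (Suc i) = \<delta> ^ (i div n) \<cdot>\<^sub>v eb (Suc (i mod n))"
    using n3 by (simp add: eb_def mod_Suc div_Suc smult_smult_assoc mult.commute)
  then show "A *\<^sub>v eb i = theta x1 (p ^ i) \<cdot>\<^sub>v eb i + eb (Suc i)"
    using A_unit[OF i] by (simp add: eb_def[of i] lins per smult_add_distrib_vec[of _ n] smult_smult_assoc mult.commute T_def[symmetric])
qed

lemma B_unit: "i < n \<Longrightarrow> B *\<^sub>v unit_vec n i = S i \<cdot>\<^sub>v unit_vec n i + F i \<cdot>\<^sub>v unit_vec n (i - 1)"
  by (rule eq_vecI) (auto simp: B_coord F_zero simp del: index_mult_mat_vec)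

lemma low_eb: "lowB p B m x1 u w eb i"
proof -
  have i: "i mod n < n" using n3 by simp
  have "F i \<cdot>\<^sub>v eb (i - 1) = F i \<cdot>\<^sub>v (\<delta> ^ (i div n) \<cdot>\<^sub>v unit_vec n (i mod n - 1))"
  \<comment> \<open>At a multiple of n the predecessor belongs to the previous period, but there
    \<open>F\<close> vanishes.\<close>
  proof (cases "i mod n = 0")
    case True then have "F i = 0" using per(3)[of i] F_zero by simp
    then show ?thesis by (auto simp: eb_def)
  next
    case False
    then obtain k where k: "i mod n = Suc k" by (cases "i mod n") auto
    have "i - 1 = n * (i div n) + k" using k by (metis add_diff_inverse_nat diff_Suc_1 div_mult_mod_eq k less_Suc_eq_0_disj mult.commute mod_less_eq_dividend not_less_eq_eq add_Suc_right plus_1_eq_Suc)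
    moreover have "k < n" using i k by simp
    ultimately show ?thesis using k by (simp add: eb_def)
  qed
  then show ?thesis unfolding lowB_def S_def[symmetric] F_def[symmetric] eb_def[of i]
    using B_unit[OF i] by (simp add: lins per smult_add_distrib_vec[of _ n] smult_smult_assoc mult.commute)
qed

lemma rel1: "rel p n A B gm bt"
proof (rule rel_linear_ext)
  fix j r assume j: "j < n" "r < n"
  show "E gm bt (unit_vec n j) r = 0"
    using E_ladder[OF eb_carrier lad_eb low_eb low_eb nz(1,2) j(2), of j] low_eb[of "Suc (Suc j)"]
    unfolding gam_gm bet_bt eb_less[OF j(1)] by (simp add: lowB_def del: index_mult_mat_vec)
qed

sublocale sw: pair n B A p by standard (simp_all add: p0)

lemma rel2: "rel p n B A gm al"
proof (rule sw.rel_linear_ext)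
  fix j r assume j: "j < n" "r < n"
  show "sw.E gm al (unit_vec n j) r = 0"
    using E2_ladder[OF eb_carrier lad_eb low_eb nz(1,2) j(2), of j]
    unfolding gam_gm alp_al eb_less[OF j(1)] sw.E_def E2_def .
qed

end

section \<open>Isomorphisms of matrix pairs\<close>

definition iso :: "nat \<Rightarrow> 'a::field mat \<Rightarrow> 'a mat \<Rightarrow> 'a mat \<Rightarrow> 'a mat \<Rightarrow> 'a mat \<Rightarrow> 'a mat \<Rightarrow> bool" where
  "iso n P Q A B A' B' \<longleftrightarrow> P \<in> carrier_mat n n \<and> Q \<in> carrier_mat n n \<and> P * Q = 1\<^sub>m n \<and> Q * P = 1\<^sub>m n \<and>
     A \<in> carrier_mat n n \<and> B \<in> carrier_mat n n \<and> A' \<in> carrier_mat n n \<and> B' \<in> carrier_mat n n \<and>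
     P * A = A' * P \<and> P * B = B' * P"

lemma hom_mv:
  assumes P: "P \<in> carrier_mat n n" and A: "A \<in> carrier_mat n n" "A' \<in> carrier_mat n n" and h: "P * A = A' * P" and v: "v \<in> carrier_vec n"
  shows "P *\<^sub>v (A *\<^sub>v v) = A' *\<^sub>v (P *\<^sub>v (v :: 'a::field vec))"
  using arg_cong[OF h, of "\<lambda>M. M *\<^sub>v v"] unfolding mv_mult[OF P A(1) v] mv_mult[OF A(2) P v] .

lemma isoD:
  assumes "iso n P Q A B A' B'"
  shows "P \<in> carrier_mat n n" "Q \<in> carrier_mat n n" "A \<in> carrier_mat n n" "B \<in> carrier_mat n n" "A' \<in> carrier_mat n n" "B' \<in> carrier_mat n n"
    "v \<in> carrier_vec n \<Longrightarrow> P *\<^sub>v (Q *\<^sub>v v) = v" "v \<in> carrier_vec n \<Longrightarrow> Q *\<^sub>v (P *\<^sub>v v) = v"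
    "v \<in> carrier_vec n \<Longrightarrow> P *\<^sub>v (A *\<^sub>v v) = A' *\<^sub>v (P *\<^sub>v v)" "v \<in> carrier_vec n \<Longrightarrow> P *\<^sub>v (B *\<^sub>v v) = B' *\<^sub>v (P *\<^sub>v v)"
proof -
  note i = assms[unfolded iso_def]
  show c: "P \<in> carrier_mat n n" "Q \<in> carrier_mat n n" "A \<in> carrier_mat n n" "B \<in> carrier_mat n n" "A' \<in> carrier_mat n n" "B' \<in> carrier_mat n n"
    using i by blast+
  assume v: "v \<in> carrier_vec n"
  have "P * Q = 1\<^sub>m n" "Q * P = 1\<^sub>m n" using i by blast+
  then show "P *\<^sub>v (Q *\<^sub>v v) = v" "Q *\<^sub>v (P *\<^sub>v v) = v" 
    using mv_mult[OF c(1,2) v] mv_mult[OF c(2,1) v] one_mult_mat_vec[OF v] by metis+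
  show "P *\<^sub>v (A *\<^sub>v v) = A' *\<^sub>v (P *\<^sub>v v)" "P *\<^sub>v (B *\<^sub>v v) = B' *\<^sub>v (P *\<^sub>v v)"
    by (rule hom_mv[OF c(1,3,5) _ v] hom_mv[OF c(1,4,6) _ v], use i in blast)+
qed

lemma iso_sym:
  assumes i: "iso n P Q A B A' B'" shows "iso n Q P A' B' A B"
proof -
  note c = isoD(1-6)[OF i]
  have "Q * X' = X * Q" if X: "X \<in> carrier_mat n n" "X' \<in> carrier_mat n n" "P * X = X' * P" for X X'
  proof -
    show ?thesis
    proof (rule mat_eqI_mv[where n=n])
      fix j
      let ?e = "unit_vec n j :: 'a vec" and ?y = "Q *\<^sub>v (unit_vec n j :: 'a vec)"
      have y: "?y \<in> carrier_vec n" using c by (simp add: mv_carrier)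
      have "X' *\<^sub>v ?e = P *\<^sub>v (X *\<^sub>v ?y)" using isoD(7)[OF i, of ?e] mv_mult[OF c(1) X(1) y] mv_mult[OF X(2) c(1) y] X(3) by simp
      then have "Q *\<^sub>v (X' *\<^sub>v ?e) = X *\<^sub>v ?y" using isoD(8)[OF i, of "X *\<^sub>v ?y"] X y by (simp add: mv_carrier)
      then show "Q * X' *\<^sub>v ?e = X * Q *\<^sub>v ?e" using c X by (simp add: mv_mult[where n=n])
    qed (use c X in \<open>simp_all add: mult_carrier_mat\<close>)
  qed
  then show ?thesis using i unfolding iso_def by blast
qed

lemma iso_trans:
  assumes i: "iso n P Q A B A' B'" and j: "iso n P' Q' A' B' A'' B''" shows "iso n (P' * P) (Q * Q') A B A'' B''"
proof -
  note c = isoD(1-6)[OF i] isoD(1-6)[OF j]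
  have one: "P * Q = 1\<^sub>m n" "Q * P = 1\<^sub>m n" "P' * Q' = 1\<^sub>m n" "Q' * P' = 1\<^sub>m n" using i j by (simp_all add: iso_def)
  have d: "P' * P \<in> carrier_mat n n" "Q * Q' \<in> carrier_mat n n" using c by (auto intro: mult_carrier_mat)
  have PP: "P' * P *\<^sub>v v = P' *\<^sub>v (P *\<^sub>v v)" and QQ: "Q * Q' *\<^sub>v v = Q *\<^sub>v (Q' *\<^sub>v v)" if "v \<in> carrier_vec n" for v :: "'a vec"
    using c that by (simp_all add: mv_mult[where n=n])
  note cc = mv_carrier[OF c(1)] mv_carrier[OF c(2)] mv_carrier[OF c(3)] mv_carrier[OF c(4)] mv_carrier[OF c(5)] mv_carrier[OF c(6)] 
    mv_carrier[OF c(7)] mv_carrier[OF c(8)]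
  have "P' * P * (Q * Q') = 1\<^sub>m n" 
    by (rule mat_eqI_mv[OF mult_carrier_mat[OF d] one_carrier_mat]) (simp only: one_mult_mat_vec unit_vec_carrier mv_mult[OF d] PP QQ cc isoD(7)[OF i] isoD(7)[OF j])
  moreover have "Q * Q' * (P' * P) = 1\<^sub>m n" 
    by (rule mat_eqI_mv[OF mult_carrier_mat[OF d(2,1)] one_carrier_mat]) (simp only: one_mult_mat_vec unit_vec_carrier mv_mult[OF d(2,1)] PP QQ cc isoD(8)[OF i] isoD(8)[OF j])
  moreover have "P' * P * A = A'' * (P' * P)" 
    by (rule mat_eqI_mv[OF mult_carrier_mat[OF d(1) c(3)] mult_carrier_mat[OF c(11) d(1)]]) (simp only: unit_vec_carrier mv_mult[OF d(1) c(3)] mv_mult[OF c(11) d(1)] PP cc isoD(9)[OF i] isoD(9)[OF j])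
  moreover have "P' * P * B = B'' * (P' * P)" 
    by (rule mat_eqI_mv[OF mult_carrier_mat[OF d(1) c(4)] mult_carrier_mat[OF c(12) d(1)]]) (simp only: unit_vec_carrier mv_mult[OF d(1) c(4)] mv_mult[OF c(12) d(1)] PP cc isoD(10)[OF i] isoD(10)[OF j])
  ultimately show ?thesis unfolding iso_def by (intro conjI c d)
qed

lemma mv_zero: "A \<in> carrier_mat n n \<Longrightarrow> A *\<^sub>v 0\<^sub>v n = (0\<^sub>v n :: 'a::field vec)" by auto

lemma iso_marginal_vec:
  assumes i: "iso n P Q A B A' B'" and v: "marginal_vec p n A B m c v"
  shows "marginal_vec p n A' B' m c (P *\<^sub>v v)"
proof -
  have V: "v \<in> carrier_vec n" using v by (simp add: marginal_vec_def)
  have "P *\<^sub>v v \<noteq> 0\<^sub>v n" 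
  proof
    assume "P *\<^sub>v v = 0\<^sub>v n"
    then have "v = Q *\<^sub>v 0\<^sub>v n" using isoD(8)[OF i V] by simp
    then show False using v mv_zero[OF isoD(2)[OF i]] by (simp add: marginal_vec_def)
  qed
  moreover have "B' *\<^sub>v (P *\<^sub>v v) = P *\<^sub>v (B *\<^sub>v v)" "A' *\<^sub>v (P *\<^sub>v v) = P *\<^sub>v (A *\<^sub>v v)" 
    using isoD(9,10)[OF i V] by simp_all
  moreover have "B' *\<^sub>v (P *\<^sub>v (A *\<^sub>v v)) = P *\<^sub>v (B *\<^sub>v (A *\<^sub>v v))" using isoD(10)[OF i] V isoD(3)[OF i] by (simp add: mv_carrier)
  ultimately show ?thesis using v V isoD(1,3)[OF i] unfolding marginal_vec_def
    by (simp add: mv_carrier mv_smult[where n=n] mv_add[where n=n])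
qed

lemma subspace_preimage:
  assumes S: "is_subspace n S" and P: "P \<in> carrier_mat n n"
  shows "is_subspace n {v \<in> carrier_vec n. P *\<^sub>v v \<in> (S :: 'a::field vec set)}"
  using S P unfolding is_subspace_def by (auto simp: mv_add[where n=n] mv_smult[where n=n] mv_zero)

lemma iso_gen:
  assumes i: "iso n P Q A B A' B'" and g: "gen n A v" and V: "v \<in> carrier_vec n"
  shows "gen n A' (P *\<^sub>v v)"
  unfolding gen_def
proof (intro allI impI, elim conjE)
  fix S assume S: "is_subspace n S" "\<forall>w\<in>S. A' *\<^sub>v w \<in> S" "P *\<^sub>v v \<in> S"
  let ?S = "{v \<in> carrier_vec n. P *\<^sub>v v \<in> S}"
  have "?S = carrier_vec n"
    using g subspace_preimage[OF S(1) isoD(1)[OF i]] S V isoD(9)[OF i] isoD(3)[OF i] unfolding gen_def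
    by (metis (no_types, lifting) mem_Collect_eq mv_carrier)
  then have "P *\<^sub>v (Q *\<^sub>v w) \<in> S" if "w \<in> carrier_vec n" for w using that isoD(2)[OF i] mv_carrier by blast
  then have "carrier_vec n \<subseteq> S" using isoD(7)[OF i] by auto
  then show "S = carrier_vec n" using S(1) by (auto simp: is_subspace_def)
qed

lemma gen_scale:
  assumes "gen n A (c \<cdot>\<^sub>v v)" shows "gen n A v"
  using assms unfolding gen_def by (meson subspaceD(4))

lemma image_subspace:
  assumes P: "P \<in> carrier_mat n n"
  shows "is_subspace n ((\<lambda>v. P *\<^sub>v v) ` (carrier_vec n :: 'a::field vec set))"
  unfolding is_subspace_def
proof (intro conjI ballI allI)
  show "(\<lambda>v. P *\<^sub>v v) ` carrier_vec n \<subseteq> carrier_vec n" using P by (auto simp: mv_carrier)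
  show "0\<^sub>v n \<in> (\<lambda>v. P *\<^sub>v v) ` carrier_vec n" using mv_zero[OF P] by (metis image_eqI zero_carrier_vec)
  fix v w assume "v \<in> (\<lambda>v. P *\<^sub>v v) ` carrier_vec n" "w \<in> (\<lambda>v. P *\<^sub>v v) ` carrier_vec n"
  then obtain a b where "a \<in> carrier_vec n" "b \<in> carrier_vec n" "v = P *\<^sub>v a" "w = P *\<^sub>v b" by auto
  then show "v + w \<in> (\<lambda>v. P *\<^sub>v v) ` carrier_vec n" using mv_add[OF P] by (metis add_carrier_vec image_eqI)
next
  fix c and v assume "v \<in> (\<lambda>v. P *\<^sub>v v) ` carrier_vec n"
  then obtain a where "a \<in> carrier_vec n" "v = P *\<^sub>v a" by auto
  then show "c \<cdot>\<^sub>v v \<in> (\<lambda>v. P *\<^sub>v v) ` carrier_vec n" using mv_smult[OF P] by (metis smult_carrier_vec image_eqI)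
qed

lemma hom_surj_iso:
  assumes P: "P \<in> carrier_mat n n" and AB: "A \<in> carrier_mat n n" "B \<in> carrier_mat n n" "A' \<in> carrier_mat n n" "B' \<in> carrier_mat n n" 
    and h: "P * A = A' * P" "P * B = B' * P"
    and s: "(\<lambda>v. P *\<^sub>v v) ` (carrier_vec n :: 'a::field vec set) = carrier_vec n"
  shows "\<exists>Q. iso n P Q A B A' B'"
proof -
  have "\<exists>v\<in>carrier_vec n. P *\<^sub>v v = w" if "w \<in> carrier_vec n" for w using s that by (metis image_iff)
  then obtain Q where "Q \<in> carrier_mat n n" "P * Q = 1\<^sub>m n" "Q * P = 1\<^sub>m n" using surj_invertible[OF P] by metis
  then show ?thesis using assms unfolding iso_def by blast
qed

section \<open>The universal property of the ladder module\<close>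

context w_module begin

lemma chain_eb: "chain p A x1 (unit_vec n 0) i = eb i"
proof (induction i)
  case 0 then show ?case using n3 by (simp add: eb_less)
next
  case (Suc i)
  have "A *\<^sub>v eb i = T i \<cdot>\<^sub>v eb i + eb (Suc i)" using lad_eb by (simp add: ladA_def T_def)
  then show ?case unfolding chain_Suc Suc T_def[symmetric] by (auto intro!: eq_vecI simp del: index_mult_mat_vec)
qed

lemma unit_step: "Suc i < n \<Longrightarrow> unit_vec n (Suc i) = A *\<^sub>v unit_vec n i - T i \<cdot>\<^sub>v unit_vec n i"
  using A_unit[of i] by (auto intro!: eq_vecI simp: eb_less simp del: index_mult_mat_vec)

lemma subspace_units:
  assumes S: "is_subspace n U" "\<forall>w\<in>U. A *\<^sub>v w \<in> U" "unit_vec n k \<in> U"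
  shows "k + i < n \<Longrightarrow> unit_vec n (k + i) \<in> U"
proof (induction i)
  case (Suc i)
  then have "unit_vec n (k + i) \<in> U" by simp
  then have "A *\<^sub>v unit_vec n (k + i) - T (k + i) \<cdot>\<^sub>v unit_vec n (k + i) \<in> U" using S by (intro subspace_minus[OF S(1)] subspaceD(4)[OF S(1)]) auto
  then show ?case using unit_step[of "k+i"] Suc.prems by simp
qed (use S in simp)

lemma gen0: "gen n A (unit_vec n 0)"
  unfolding gen_def using subspace_units[of _ 0] by (auto intro!: subspace_finite_comb)

text \<open>For nonzero \<delta> the ladder closes up to a cycle: climbing from position k reaches a
  nonzero multiple of the bottom vector.\<close>

lemma gen_unit: "k < n \<Longrightarrow> \<delta> \<noteq> 0 \<Longrightarrow> gen n A (unit_vec n k)"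
  unfolding gen_def
proof (intro allI impI, elim conjE)
  fix U assume k: "k < n" and d: "\<delta> \<noteq> 0" and U: "is_subspace n U" "\<forall>w\<in>U. A *\<^sub>v w \<in> U" "unit_vec n k \<in> U"
  have last: "unit_vec n (n - 1) \<in> U" using subspace_units[OF U, of "n - 1 - k"] k by simp
  then have "A *\<^sub>v unit_vec n (n - 1) - T (n - 1) \<cdot>\<^sub>v unit_vec n (n - 1) \<in> U" 
    using U by (intro subspace_minus[OF U(1)] subspaceD(4)[OF U(1)]) auto
  also have "A *\<^sub>v unit_vec n (n - 1) - T (n - 1) \<cdot>\<^sub>v unit_vec n (n - 1) = \<delta> \<cdot>\<^sub>v unit_vec n 0"
    using A_unit[of "n - 1"] n3 eb_n[of 0] by (auto intro!: eq_vecI simp: eb_less simp del: index_mult_mat_vec)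
  finally have "inverse \<delta> \<cdot>\<^sub>v (\<delta> \<cdot>\<^sub>v unit_vec n 0) \<in> U" by (rule subspaceD(4)[OF U(1)])
  then have "unit_vec n 0 \<in> U" using d by (simp add: smult_smult_assoc)
  then show "U = carrier_vec n" using gen0 U unfolding gen_def by blast
qed

text \<open>The vectors with this property for \<open>x1\<close> form an \<open>A\<close>-stable
  subspace containing the cyclic vector; independence of the first parameter does the rest. So D can
  be read off from \<open>A\<close> alone.\<close>

lemma chain_all:
  assumes v: "v \<in> V" and x: "x \<noteq> 0"
  shows "chain p A x v n = (D - x^n - inverse (x^n)) \<cdot>\<^sub>v v"
proof -
  let ?S = "{v \<in> V. chain p A x1 v n = \<delta> \<cdot>\<^sub>v v}"
  have "is_subspace n ?S"
    unfolding is_subspace_def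
  proof (intro conjI ballI allI)
    have "chain p A x1 (0 \<cdot>\<^sub>v unit_vec n 0) n = 0 \<cdot>\<^sub>v chain p A x1 (unit_vec n 0) n" by (rule chain_smult[where n=n]) simp_all
    moreover have "0 \<cdot>\<^sub>v w = 0\<^sub>v n" if "w \<in> V" for w :: "'a vec" using that by auto
    ultimately have "chain p A x1 (0\<^sub>v n) n = 0\<^sub>v n" by (simp add: chain_eb)
    then show "0\<^sub>v n \<in> ?S" by auto
  qed (auto simp: chain_add[where n=n] chain_smult[where n=n] smult_add_distrib_vec[of _ n] smult_smult_assoc mult.commute)
  moreover have "\<forall>w\<in>?S. A *\<^sub>v w \<in> ?S" by (auto simp: chain_comm[where n=n] lins)
  moreover have "unit_vec n 0 \<in> ?S" using eb_n[of 0] n3 by (simp add: chain_eb eb_less)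
  ultimately have "?S = V" using gen0 unfolding gen_def by blast
  then have "chain p A x1 v n = \<delta> \<cdot>\<^sub>v v" using v by blast
  then show ?thesis using chain_indep[OF A_carrier v nz(2) x, of D] by (simp add: \<delta>_def)
qed

definition cv where "cv = marginal_coeff p m e1 e3"

text \<open>A zero of \<open>F\<close> makes the k-th ladder vector an eigenvector of
  \<open>B\<close>, and \<open>A\<close> maps it to a combination of itself and its
  successor.\<close>

lemma unit_marginal_vec:
  assumes k: "k < n" and F: "F k = 0"
  shows "marginal_vec p n A B (m * p^k) (T k * (S k - S (Suc k)) + F (Suc k)) (unit_vec n k)"
proof -
  have th: "theta (m * p^k) 1 = S k" "theta (m * p^k) p = S (Suc k)" by (simp_all add: S_def theta_def mult_ac)
  have 1: "B *\<^sub>v unit_vec n k = S k \<cdot>\<^sub>v unit_vec n k" using B_unit[OF k] F by (auto intro!: eq_vecI simp del: index_mult_mat_vec)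
  have 2: "B *\<^sub>v eb (Suc k) = S (Suc k) \<cdot>\<^sub>v eb (Suc k) + F (Suc k) \<cdot>\<^sub>v unit_vec n k"
    using low_eb[of "Suc k"] k by (simp add: lowB_def S_def F_def eb_less)
  have "B *\<^sub>v (A *\<^sub>v unit_vec n k) = T k \<cdot>\<^sub>v (S k \<cdot>\<^sub>v unit_vec n k) + (S (Suc k) \<cdot>\<^sub>v eb (Suc k) + F (Suc k) \<cdot>\<^sub>v unit_vec n k)"
    unfolding A_unit[OF k] by (simp add: lins 1 2)
  moreover have "unit_vec n k \<noteq> (0\<^sub>v n :: 'a vec)" using k by simp
  ultimately show ?thesis unfolding marginal_vec_def th A_unit[OF k]
    by (auto intro!: eq_vecI simp: 1 algebra_simps simp del: index_mult_mat_vec)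
qed

lemma mvec0: "marginal_vec p n A B m cv (unit_vec n 0)"
  using unit_marginal_vec[of 0] n3 marginal_coeff_eq by (simp add: F_zero cv_def)

text \<open>The marginal vector starts a chain on which the beta relation forces the action of
  \<open>B\<close>; the n-th step closes the chain in the same way as in W. The images of the basis
  vectors are the members of this chain.\<close>

lemma hom_ex:
  assumes AB: "A' \<in> carrier_mat n n" "B' \<in> carrier_mat n n" and r: "rel p n A' B' gm bt" and mv: "marginal_vec p n A' B' m cv v" 
    and ch: "chain p A' x1 v n = \<delta> \<cdot>\<^sub>v v"
  shows "\<exists>P\<in>carrier_mat n n. P * A = A' * P \<and> P * B = B' * P \<and> (\<forall>i<n. P *\<^sub>v unit_vec n i = chain p A' x1 v i)"
proof -
  interpret W: pair n A' B' p by standard (use AB p0 in auto)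
  have v: "v \<in> V" using mv by (simp add: marginal_vec_def)
  define f where "f = chain p A' x1 v"
  have f: "f i \<in> V" for i using AB v by (simp add: f_def)
  have lad: "ladA p A' x1 f" unfolding f_def by (rule chain_ladA[OF AB(1) v])
  have lad': "A' *\<^sub>v f i = T i \<cdot>\<^sub>v f i + f (Suc i)" for i using lad by (simp add: ladA_def T_def)
  have f0: "f 0 = v" and f1: "f 1 = A' *\<^sub>v v - T 0 \<cdot>\<^sub>v v" by (simp_all add: f_def chain_Suc T_def)
  have Bv: "B' *\<^sub>v v = S 0 \<cdot>\<^sub>v v" using mv by (simp add: marginal_vec_def S_def)
  have BAv: "B' *\<^sub>v (A' *\<^sub>v v) = S 1 \<cdot>\<^sub>v (A' *\<^sub>v v) + (T 0 * (S 0 - S 1) + F 1) \<cdot>\<^sub>v v" 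
    using mv unfolding marginal_coeff_eq cv_def by (simp add: marginal_vec_def S_def)
  have low: "lowB p B' m x1 u w f i" for i
  proof (rule W.low_chain[OF f lad _ nz(1,2)])
    show "rel p n A' B' (gam p m x1 u w) (bet p m x1 u w)" using r unfolding gam_gm bet_bt .
    show "B' *\<^sub>v f 0 = theta m 1 \<cdot>\<^sub>v f 0" using Bv by (simp add: f0 S_def)
    have "B' *\<^sub>v f 1 = S 1 \<cdot>\<^sub>v f 1 + F 1 \<cdot>\<^sub>v f 0"
      unfolding f1 f0 using v AB by (auto intro!: eq_vecI simp: W.lins Bv BAv algebra_simps simp del: index_mult_mat_vec)
    then show "B' *\<^sub>v f 1 = theta m p \<cdot>\<^sub>v f 1 + varphi p m x1 u w p \<cdot>\<^sub>v f 0" by (simp add: S_def F_def)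
  qed
  have low': "B' *\<^sub>v f i = S i \<cdot>\<^sub>v f i + F i \<cdot>\<^sub>v f (i - 1)" for i using low[of i] by (simp add: lowB_def S_def F_def)
  define P where "P = mat n n (\<lambda>(i,j). f j $ i)"
  have P: "P \<in> carrier_mat n n" by (simp add: P_def)
  have Pu: "P *\<^sub>v unit_vec n j = f j" if "j < n" for j
    by (rule eq_vecI) (use f[of j] that in \<open>auto simp: P_def scalar_prod_right_unit\<close>)
  \<comment> \<open>The wrap-around: the successor of the last basis vector is \<delta> times the
    first, which is matched by \<open>ch\<close>.\<close>
  have Pe: "P *\<^sub>v eb (Suc j) = f (Suc j)" if "j < n" for j
  proof (cases "Suc j < n")
    case True then show ?thesis by (simp add: eb_less Pu)
  next
    case False
    then have "Suc j = n" using that by simp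
    then have "eb (Suc j) = \<delta> \<cdot>\<^sub>v unit_vec n 0" "f (Suc j) = \<delta> \<cdot>\<^sub>v v" using eb_n[of 0] n3 ch by (simp_all add: eb_less f_def)
    then show ?thesis using mv_smult[OF P, of "unit_vec n 0" \<delta>] Pu[of 0] n3 by (simp add: f0)
  qed
  have "P * A = A' * P"
    by (rule mat_eqI_mv[OF mult_carrier_mat[OF P A_carrier] mult_carrier_mat[OF AB(1) P]]) (use P AB in \<open>simp_all add: mv_mult[where n=n] A_unit mv_add[where n=n] mv_smult[where n=n] Pu Pe lad'\<close>)
  moreover have "P * B = B' * P"
    by (rule mat_eqI_mv[OF mult_carrier_mat[OF P B_carrier] mult_carrier_mat[OF AB(2) P]]) (use P AB in \<open>simp_all add: mv_mult[where n=n] B_unit mv_add[where n=n] mv_smult[where n=n] Pu low'\<close>)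
  ultimately show ?thesis using P Pu unfolding f_def by blast
qed

lemma iso_ex:
  assumes AB: "A' \<in> carrier_mat n n" "B' \<in> carrier_mat n n" and r: "rel p n A' B' gm bt" and mv: "marginal_vec p n A' B' m cv v" 
    and ch: "chain p A' x1 v n = \<delta> \<cdot>\<^sub>v v" and g: "gen n A' v"
  shows "\<exists>P Q. iso n P Q A B A' B' \<and> (\<forall>i<n. P *\<^sub>v unit_vec n i = chain p A' x1 v i)"
proof -
  obtain P where P: "P\<in>carrier_mat n n" "P * A = A' * P" "P * B = B' * P" "\<forall>i<n. P *\<^sub>v unit_vec n i = chain p A' x1 v i"
    using hom_ex[OF AB r mv ch] by auto
  let ?S = "(\<lambda>v. P *\<^sub>v v) ` V"
  have "is_subspace n ?S" by (rule image_subspace[OF P(1)])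
  moreover have "\<forall>w\<in>?S. A' *\<^sub>v w \<in> ?S" using hom_mv[OF P(1) A_carrier AB(1) P(2)] AV by (metis (no_types, lifting) image_iff)
  moreover have "P *\<^sub>v unit_vec n 0 = v" using P(4) n3 by simp
  then have "v \<in> ?S" using unit_vec_carrier by blast
  ultimately have "?S = V" using g unfolding gen_def by blast
  then show ?thesis using hom_surj_iso[OF P(1) A_carrier B_carrier AB P(2,3)] P(4) by blast
qed

end

section \<open>Marginal vectors of the matrix pair\<close>

context w_module begin

text \<open>Normal form of a marginal vector of weight m p^k, with top position k and top coordinate
  1. Position 0 is left out because it only gives the bottom ladder vector.\<close>

definition mg :: "nat \<Rightarrow> 'a \<Rightarrow> 'a vec \<Rightarrow> bool" where
  "mg k c v \<longleftrightarrow> v \<in> V \<and> 0 < k \<and> k < n \<and> v $ k = 1 \<and> (\<forall>i. k < i \<and> i < n \<longrightarrow> v $ i = 0) \<and>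
     B *\<^sub>v v = S k \<cdot>\<^sub>v v \<and> B *\<^sub>v (A *\<^sub>v v) = S (Suc k) \<cdot>\<^sub>v (A *\<^sub>v v) + c \<cdot>\<^sub>v v"

lemma th_S: "theta (m * p^k) 1 = S k" "theta (m * p^k) p = S (Suc k)" 
  by (simp_all add: S_def theta_def mult_ac)

lemma mg_marginal_vec: "mg k c v \<Longrightarrow> marginal_vec p n A B (m * p^k) c v"
  unfolding mg_def marginal_vec_def th_S by auto

lemma S_eq_iff: "S i = S j \<longleftrightarrow> p^i = p^j \<or> m^2 * p^i * p^j = 1"
  unfolding S_def using theta_eq_iff[of m "p^i" "p^j"] nz p0 by simp

lemma eig_coord:
  assumes v: "v \<in> V" and B: "B *\<^sub>v v = t \<cdot>\<^sub>v v" and i: "i < n"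
  shows "(t - S i) * v $ i = (if Suc i < n then F (Suc i) * v $ (Suc i) else 0)"
proof -
  have "(B *\<^sub>v v) $ i = t * v $ i" using v i unfolding B by simp
  then show ?thesis using B_coord[OF v i] by (auto simp: algebra_simps split: if_splits)
qed

context
  fixes k c v assumes mg: "mg k c v"
begin

lemma mgD: "v \<in> V" "0 < k" "k < n" "v $ k = 1" "\<And>i. k < i \<Longrightarrow> i < n \<Longrightarrow> v $ i = 0" "B *\<^sub>v v = S k \<cdot>\<^sub>v v"
   "B *\<^sub>v (A *\<^sub>v v) = S (Suc k) \<cdot>\<^sub>v (A *\<^sub>v v) + c \<cdot>\<^sub>v v"
  using mg by (auto simp: mg_def)

lemma mg_e: "i < k \<Longrightarrow> (S k - S i) * v $ i = F (Suc i) * v $ (Suc i)"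
  using eig_coord[OF mgD(1,6), of i] mgD(3) by simp

text \<open>What the subdiagonal of \<open>A\<close> contributes to row i; the corner entry \<delta>
  is kept apart.\<close>

definition pre :: "nat \<Rightarrow> 'a" where "pre i = (if i = 0 then 0 else v $ (i - 1))"

lemma Sn: "S (Suc k) = S 0" if "Suc k = n" using that per(2)[of "Suc k"] by simp

lemma mg_A: "i < n \<Longrightarrow> i \<le> k \<Longrightarrow> (A *\<^sub>v v) $ i = T i * v $ i + pre i + (if i = 0 \<and> Suc k = n then \<delta> else 0)"
  using A_coord[OF mgD(1), of i] mgD(4,5) mgD(3) by (cases "Suc k = n") (auto simp: pre_def)

lemma mg_top: "c = (S k - S (Suc k)) * (T k + pre k) + F (Suc k)"
proof -
  have k: "k < n" "0 < k" using mgD by auto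
  have 1: "(B *\<^sub>v (A *\<^sub>v v)) $ k = S (Suc k) * (A *\<^sub>v v) $ k + c"
    unfolding mgD(7) using mgD(1,3,4) by (simp del: index_mult_mat_vec)
  have 2: "(A *\<^sub>v v) $ k = T k + pre k" using mg_A[of k] k mgD(4) by simp
  show ?thesis
  proof (cases "Suc k < n")
    case True
    have "(A *\<^sub>v v) $ (Suc k) = 1" using A_coord[OF mgD(1) True] mgD(4) mgD(5)[OF _ True] by simp
    then show ?thesis using 1 B_coord[OF AV[OF mgD(1)] k(1)] True unfolding 2 by (simp add: algebra_simps)
  next
    case False
    then have "F (Suc k) = 0" using k F_n by (metis Suc_lessI)
    then show ?thesis using 1 B_coord[OF AV[OF mgD(1)] k(1)] False unfolding 2 by (simp add: algebra_simps)
  qed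
qed

lemma mg_i: 
  assumes i: "i < k"
  shows "(S i - S (Suc k)) * (T i * v $ i + pre i) + F (Suc i) * (T (Suc i) * v $ (Suc i) + v $ i) = c * v $ i"
proof -
  have k: "k < n" "0 < k" "i < n" "Suc i < n" using mgD i by auto
  have 1: "(B *\<^sub>v (A *\<^sub>v v)) $ i = S (Suc k) * (A *\<^sub>v v) $ i + c * v $ i"
    unfolding mgD(7) using mgD(1,3) i by (simp del: index_mult_mat_vec)
  have 2: "(A *\<^sub>v v) $ (Suc i) = T (Suc i) * v $ (Suc i) + v $ i" using mg_A[of "Suc i"] k i by (simp add: pre_def)
  \<comment> \<open>The corner entry reaches row 0 only if the top is n - 1; then
    \<open>S (Suc k)\<close> equals \<open>S 0\<close> and the factor in front removes it.\<close>
  have 3: "(S i - S (Suc k)) * (A *\<^sub>v v) $ i = (S i - S (Suc k)) * (T i * v $ i + pre i)"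
    using mg_A[of i] k i Sn by auto
  have 4: "(B *\<^sub>v (A *\<^sub>v v)) $ i = S i * (A *\<^sub>v v) $ i + F (Suc i) * (T (Suc i) * v $ (Suc i) + v $ i)" 
    using B_coord[OF AV[OF mgD(1)] k(3)] k(4) unfolding 2[symmetric] by (simp del: index_mult_mat_vec)
  define a where "a = (A *\<^sub>v v) $ i"
  show ?thesis using 1 unfolding 4 3[symmetric] a_def[symmetric] by (simp add: algebra_simps)
qed

lemma mg_pre: "F k \<noteq> 0 \<Longrightarrow> v $ (k-1) \<noteq> 0 \<and> S k \<noteq> S (k-1) \<and> (S k - S (k - 1)) * v $ (k - 1) = F k"
  using mg_e[of "k - 1"] mgD(2,4) by auto

lemma mg_B0: "k \<ge> 2 \<Longrightarrow> F k \<noteq> 0 \<Longrightarrow> S k = S (k - 2) \<Longrightarrow> F (k - 1) = 0"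
  using mg_e[of "k - 2"] mg_pre by (auto simp: numeral_2_eq_2 Suc_diff_Suc)

lemma three_factor: "1 - w * y + u * (m^2*p/x1) * y^2 - (m^2*p/x1)^2 * y^3 = (1 - x2*x3*y) * (1 - x2*x4*y) * (1 - x3*x4*y)"
  unfolding xw u_def w_def by (simp add: algebra_simps power2_eq_square power3_eq_cube)

lemma three_zero: "(1 - x2*x3*(p^k/p)) * (1 - x2*x4*(p^k/p)) * (1 - x3*x4*(p^k/p)) = 0 \<Longrightarrow>
   x2*x3*p^k = p \<or> x2*x4*p^k = p \<or> x3*x4*p^k = p"
proof -
  have "1 - y * (p^k/p) = 0 \<longleftrightarrow> y * p^k = p" for y using p0 by (auto simp: field_simps)
  then show "(1 - x2*x3*(p^k/p)) * (1 - x2*x4*(p^k/p)) * (1 - x3*x4*(p^k/p)) = 0 \<Longrightarrow> ?thesis" by simp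
qed

text \<open>A nonzero \<open>F k\<close> determines the coordinate below the top; substituting it
  into rows 1 and 0 leaves the identity for k = 1, whose cubic must vanish.\<close>

lemma mg_B1:
  assumes k1: "k = 1" and Fk: "F k \<noteq> 0"
  shows "x2*x3*p^k = p \<or> x2*x4*p^k = p \<or> x3*x4*p^k = p"
proof -
  define e where "e = v $ 0"
  define d1 where "d1 = S 1 - S 0"
  have e: "e \<noteq> 0" "d1 \<noteq> 0" "d1 * e = F 1" using mg_pre[OF Fk] k1 by (auto simp: e_def d1_def)
  have pr: "pre k = e" "pre 0 = 0" "v $ 1 = 1" using k1 mgD(4) by (auto simp: pre_def e_def)
  have c: "c = (S 1 - S 2) * (T 1 + e) + F 2" using mg_top k1 pr by (simp add: numeral_2_eq_2)
  have "(S 0 - S 2) * (T 0 * e) + F 1 * (T 1 + e) = c * e"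
    using mg_i[of 0] k1 pr by (simp add: e_def numeral_2_eq_2)
  then have "e * ((S 0 - S 2) * T 0 + d1 * (T 1 + e) - (S 1 - S 2) * (T 1 + e) - F 2) = 0"
    unfolding c e(3)[symmetric] by (simp add: algebra_simps)
  then have "d1 * ((S 0 - S 2) * T 0 + d1 * (T 1 + e) - (S 1 - S 2) * (T 1 + e) - F 2) = 0" using e by simp
  then have "d1 * d1 * T 1 + d1 * F 1 + (S 0 - S 2) * d1 * T 0 - d1 * F 2 - d1 * (S 1 - S 2) * T 1 - (S 1 - S 2) * F 1 = 0"
    unfolding e(3)[symmetric] by (simp add: algebra_simps)
  moreover have "d1 * d1 * T 1 + d1 * F 1 + (S 0 - S 2) * d1 * T 0 - d1 * F 2 - d1 * (S 1 - S 2) * T 1 - (S 1 - S 2) * F 1 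
     = x1 * (p-1)^3 * (p+1) / (p^3 * m^2) * (1 - w * 1 + u * (m^2*p/x1) * 1^2 - (m^2*p/x1)^2 * 1^3)"
    using bracket1_id[OF p0 nz(1,2), of u w] by (simp add: d1_def S_def T_def F_def power2_eq_square)
  moreover have "p - 1 \<noteq> 0" using p1 by simp
  moreover have "p + 1 \<noteq> 0" using p2' by (metis (no_types) add.inverse_unique add.commute mult_minus1 minus_mult_minus mult_1)
  ultimately have "(1 - x2*x3*1) * (1 - x2*x4*1) * (1 - x3*x4*1) = 0" 
    unfolding three_factor using nz p0 by simp
  then show ?thesis using k1 p0 by auto
qed

lemma pp1: "p + 1 \<noteq> 0" "p - 1 \<noteq> 0"
  using p2' p1 by (auto simp: add_eq_0_iff2)

text \<open>A nonzero \<open>F k\<close> excludes the pairs with \<open>x1\<close>; solving for the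
  two coordinates below the top, which needs the eigenvalue at k to differ from those at k-1 and
  k-2, leaves the cubic for the remaining pairs.\<close>

lemma mg_B2:
  assumes k2: "k \<ge> 2" and Fk: "F k \<noteq> 0" and d: "S k \<noteq> S (k - 2)" and ne: "m^2 * p^k \<noteq> p"
  shows "x2*x3*p^k = p \<or> x2*x4*p^k = p \<or> x3*x4*p^k = p"
proof -
  obtain j where j: "k = Suc (Suc j)" using k2 by (metis Suc_diff_Suc add_2_eq_Suc le_add_diff_inverse)
  define e where "e = v $ (Suc j)"
  define g where "g = v $ j"
  define d1 where "d1 = S k - S (Suc j)"
  define d2 where "d2 = S k - S j"
  have e: "e \<noteq> 0" "d1 \<noteq> 0" "d1 * e = F k" using mg_pre[OF Fk] j by (auto simp: e_def d1_def)
  have g: "d2 \<noteq> 0" "d2 * g = F (Suc j) * e" using d mg_e[of j] j by (auto simp: d2_def g_def e_def)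
  have pr: "pre k = e" "pre (Suc j) = g" using j by (auto simp: pre_def e_def g_def)
  have c: "c = (S k - S (Suc k)) * (T k + e) + F (Suc k)" using mg_top pr by simp
  have 1: "(S (Suc j) - S (Suc k)) * (T (Suc j) * e + g) + F k * (T k + e) = c * e"
    using mg_i[of "Suc j"] j pr mgD(4) by (simp add: e_def)
  have "e * (d1 * (T k + e) * d2 + (S (Suc j) - S (Suc k)) * (T (Suc j) * d2 + F (Suc j)) - c * d2)
      = d2 * ((S (Suc j) - S (Suc k)) * (T (Suc j) * e) + d1 * e * (T k + e) - c * e) + (S (Suc j) - S (Suc k)) * (F (Suc j) * e)" by (simp add: algebra_simps)
  also have "\<dots> = d2 * ((S (Suc j) - S (Suc k)) * (T (Suc j) * e + g) + F k * (T k + e) - c * e)"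
    unfolding g(2)[symmetric] e(3) by (simp add: algebra_simps)
  also have "\<dots> = 0" unfolding 1 by simp
  finally have "d1 * (d1 * (T k + e) * d2 + (S (Suc j) - S (Suc k)) * (T (Suc j) * d2 + F (Suc j)) - c * d2) = 0" using e by simp
  moreover have "d1 * (d1 * (T k + e) * d2 + (S (Suc j) - S (Suc k)) * (T (Suc j) * d2 + F (Suc j)) - c * d2)
     = d1 * d1 * T k * d2 + d1 * (d1 * e) * d2 + (S (Suc j) - S (Suc k)) * d1 * (T (Suc j) * d2 + F (Suc j)) 
      - d1 * d2 * F (Suc k) - d1 * d2 * (S k - S (Suc k)) * T k - d2 * (S k - S (Suc k)) * (d1 * e)"
    unfolding c by (simp add: algebra_simps)
  ultimately have 2: "d1 * d1 * T k * d2 + d1 * F k * d2 + (S (Suc j) - S (Suc k)) * d1 * (T (Suc j) * d2 + F (Suc j)) 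
      - d1 * d2 * F (Suc k) - d1 * d2 * (S k - S (Suc k)) * T k - d2 * (S k - S (Suc k)) * F k = 0"
    unfolding e(3) by simp
  have "d1 * d1 * T k * d2 + d1 * F k * d2 + (S (Suc j) - S (Suc k)) * d1 * (T (Suc j) * d2 + F (Suc j)) 
      - d1 * d2 * F (Suc k) - d1 * d2 * (S k - S (Suc k)) * T k - d2 * (S k - S (Suc k)) * F k
     = x1 * ((p-1)^4 * (p+1)^2 / (p^6 * (p^j)^2 * m^3) * (m^2 * p * p^j - 1))
      * (1 - w * (p*p^j) + u * (m^2*p/x1) * (p*p^j)^2 - (m^2*p/x1)^2 * (p*p^j)^3)"
    using bracket_id[OF p0 nz(1,2), of "p^j" u w] p0 by (simp add: d1_def d2_def S_def T_def F_def j)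
  then have "x1 * ((p-1)^4 * (p+1)^2 / (p^6 * (p^j)^2 * m^3) * (m^2 * p * p^j - 1))
      * ((1 - x2*x3*(p*p^j)) * (1 - x2*x4*(p*p^j)) * (1 - x3*x4*(p*p^j))) = 0"
    unfolding 2 three_factor by simp
  moreover have "m^2 * p * p^j - 1 \<noteq> 0" 
  proof
    assume "m^2 * p * p^j - 1 = 0"
    then have "p * (m^2 * p * p^j) = p" by simp
    then show False using ne by (simp add: j mult_ac)
  qed
  ultimately have "(1 - x2*x3*(p*p^j)) * (1 - x2*x4*(p*p^j)) * (1 - x3*x4*(p*p^j)) = 0" using nz p0 pp1 by auto
  moreover have "p*p^j = p^k/p" using p0 by (simp add: j)
  ultimately show ?thesis using three_zero by simp
qed

text \<open>In this case the combination of rows k and k-1 carries a vanishing prefactor. Row 0,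
  divided by the nonzero bottom coordinate, replaces row k-1.\<close>

lemma mg_exc:
  assumes k2: "k \<ge> 2" and ex: "m^2 * p^k = p" and Fk: "F k \<noteq> 0" and v0: "v $ 0 \<noteq> 0"
  shows "x2*x3*p^k = p \<or> x2*x4*p^k = p \<or> x3*x4*p^k = p"
proof -
  define e where "e = v $ (k - 1)"
  define d1 where "d1 = S k - S (k-1)"
  have e: "e \<noteq> 0" "d1 \<noteq> 0" "d1 * e = F k" using mg_pre[OF Fk] by (auto simp: e_def d1_def)
  have c: "c = (S k - S (Suc k)) * (T k + e) + F (Suc k)" using mg_top k2 by (simp add: pre_def e_def)
  have 1: "(S k - S 0) * v $ 0 = F 1 * v $ 1" using mg_e[of 0] k2 by simp
  have "(S 0 - S (Suc k)) * (T 0 * v $ 0) + F 1 * (T 1 * v $ 1 + v $ 0) = c * v $ 0"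
    using mg_i[of 0] k2 by (simp add: pre_def)
  also have "F 1 * (T 1 * v $ 1 + v $ 0) = T 1 * (F 1 * v $ 1) + F 1 * v $ 0" by (simp add: algebra_simps)
  also have "\<dots> = (T 1 * (S k - S 0) + F 1) * v $ 0" unfolding 1[symmetric] by (simp add: algebra_simps)
  finally have "v $ 0 * ((S 0 - S (Suc k)) * T 0 + T 1 * (S k - S 0) + F 1 - c) = 0" by (simp add: algebra_simps)
  then have "(S 0 - S (Suc k)) * T 0 + T 1 * (S k - S 0) + F 1 - c = 0" using v0 by simp
  then have "d1 * ((S 0 - S (Suc k)) * T 0 + T 1 * (S k - S 0) + F 1 - c) = 0" by simp
  then have 2: "d1 * (F 1 + T 1 * (S k - S 0) + (S 0 - S (Suc k)) * T 0 - F (Suc k) - (S k - S (Suc k)) * T k) - (S k - S (Suc k)) * F k = 0"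
    unfolding c e(3)[symmetric] by (simp add: algebra_simps)
  have im: "inverse (m^2) = p^k/p" using ex nz p0 by (simp add: field_simps)
  have ik: "p^k/p = p^(k-1)" using k2 p0 by (cases k) auto
  have "d1 * (F 1 + T 1 * (S k - S 0) + (S 0 - S (Suc k)) * T 0 - F (Suc k) - (S k - S (Suc k)) * T k) - (S k - S (Suc k)) * F k
     = d1 * (x1 * m * (p^2-1) / p^2 * (1 - w / m^2 + u * (m^2*p/x1) / m^4 - (m^2*p/x1)^2 / m^6))"
    using exceptional_aux[OF nz(1,2), of "p^k" u w] p0 unfolding ex im ik by (simp add: d1_def S_def T_def F_def)
  moreover have "1 - w / m^2 + u * (m^2*p/x1) / m^4 - (m^2*p/x1)^2 / m^6 
     = 1 - w * (p^k/p) + u * (m^2*p/x1) * (p^k/p)^2 - (m^2*p/x1)^2 * (p^k/p)^3"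
    unfolding im[symmetric] by (simp add: field_simps power_mult[symmetric] flip: power_mult)
  ultimately have "d1 * (x1 * m * (p^2-1) / p^2 * ((1 - x2*x3*(p^k/p)) * (1 - x2*x4*(p^k/p)) * (1 - x3*x4*(p^k/p)))) = 0"
    using 2 unfolding three_factor by simp
  then have "(1 - x2*x3*(p^k/p)) * (1 - x2*x4*(p^k/p)) * (1 - x3*x4*(p^k/p)) = 0" using e nz p2 p0 by simp
  then show ?thesis by (rule three_zero)
qed

text \<open>The eigenvalue equation carries nonzero coordinates downward from the top until some
  \<open>F i\<close> vanishes.\<close>

lemma mg_F0: "v $ 0 = 0 \<Longrightarrow> \<exists>i. 0 < i \<and> i \<le> k \<and> F i = 0"
proof (rule ccontr)
  assume v0: "v $ 0 = 0" and "\<not> ?thesis"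
  then have F: "F i \<noteq> 0" if "0 < i" "i \<le> k" for i using that by blast
  have "i \<le> k \<Longrightarrow> v $ (k - i) \<noteq> 0" for i
  proof (induction i)
    case 0 then show ?case using mgD by simp
  next
    case (Suc i)
    then have "Suc (k - Suc i) = k - i" by simp
    then show ?case using mg_e[of "k - Suc i"] Suc F[of "k - i"] by auto
  qed
  from this[of k] v0 show False by simp
qed

end
end

section \<open>Links between parameter tuples\<close>

context root_unity begin

text \<open>The swaps are the action of the symmetric group; the shift is relation (ii), up to a swap, and k - 1 is the
  exponent i occurring there.\<close>
inductive link :: "'a \<times> 'a \<times> 'a \<times> 'a \<times> 'a \<times> 'a \<Rightarrow> 'a \<times> 'a \<times> 'a \<times> 'a \<times> 'a \<times> 'a \<Rightarrow> bool" where
  swap12: "link (m, a, b, c, d, D) (m, b, a, c, d, D)"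
| swap23: "link (m, a, b, c, d, D) (m, a, c, b, d, D)"
| swap34: "link (m, a, b, c, d, D) (m, a, b, d, c, D)"
| shift: "0 < k \<Longrightarrow> k < n \<Longrightarrow> a * b * p^k = p \<Longrightarrow> link (m, a, b, c, d, D) (m * p^k, a * p^k, b * p^k, c, d, D)"

text \<open>If a b p^k = p, then b^n = a^(-n), so D = a^n + b^n says that \<delta> is 0 for the
  ladder with \<open>a\<close> and \<open>b\<close> in front; the ladder vectors from position k on
  then span a submodule.\<close>

definition irr_quad :: "'a \<Rightarrow> 'a \<Rightarrow> 'a \<Rightarrow> 'a \<Rightarrow> 'a \<Rightarrow> bool" where
  "irr_quad a b c d D \<longleftrightarrow> (\<forall>k. 0 < k \<and> k < n \<longrightarrow>
     (a*b*p^k = p \<longrightarrow> D \<noteq> a^n + b^n) \<and> (a*c*p^k = p \<longrightarrow> D \<noteq> a^n + c^n) \<and> (a*d*p^k = p \<longrightarrow> D \<noteq> a^n + d^n) \<and>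
     (b*c*p^k = p \<longrightarrow> D \<noteq> b^n + c^n) \<and> (b*d*p^k = p \<longrightarrow> D \<noteq> b^n + d^n) \<and> (c*d*p^k = p \<longrightarrow> D \<noteq> c^n + d^n))"

text \<open>The orderings that bring a chosen pair, or a chosen entry, to the front.\<close>

lemma link_perms:
  "link\<^sup>*\<^sup>* (m, a, b, c, d, D) (m, a, c, b, d, D)"
  "link\<^sup>*\<^sup>* (m, a, b, c, d, D) (m, a, d, b, c, D)"
  "link\<^sup>*\<^sup>* (m, a, b, c, d, D) (m, b, a, c, d, D)"
  "link\<^sup>*\<^sup>* (m, a, b, c, d, D) (m, b, c, a, d, D)"
  "link\<^sup>*\<^sup>* (m, a, b, c, d, D) (m, b, d, a, c, D)"
  "link\<^sup>*\<^sup>* (m, a, b, c, d, D) (m, c, d, a, b, D)"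
  "link\<^sup>*\<^sup>* (m, a, b, c, d, D) (m, c, a, b, d, D)"
  "link\<^sup>*\<^sup>* (m, a, b, c, d, D) (m, d, a, b, c, D)"
proof -
  note l = r_into_rtranclp[of link]
  have s: "link\<^sup>*\<^sup>* (m, a, b, c, d, D) (m, b, a, c, d, D)" "link\<^sup>*\<^sup>* (m, a, b, c, d, D) (m, a, c, b, d, D)" 
     "link\<^sup>*\<^sup>* (m, a, b, c, d, D) (m, a, b, d, c, D)" for a b c d
    by (intro l swap12 swap23 swap34)+
  note t = rtranclp_trans[of link]
  have 1: "link\<^sup>*\<^sup>* (m, a, b, c, d, D) (m, b, c, a, d, D)" for a b c d by (rule t[OF s(1)[of a b c d] s(2)])
  have 2: "link\<^sup>*\<^sup>* (m, a, b, c, d, D) (m, a, d, b, c, D)" for a b c d by (rule t[OF s(3)[of a b c d] s(2)])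
  have 3: "link\<^sup>*\<^sup>* (m, a, b, c, d, D) (m, c, a, b, d, D)" for a b c d by (rule t[OF s(2)[of a b c d] s(1)])
  have 4: "link\<^sup>*\<^sup>* (m, a, b, c, d, D) (m, d, a, b, c, D)" for a b c d by (rule t[OF 2[of a b c d] s(1)])
  have 5: "link\<^sup>*\<^sup>* (m, a, b, c, d, D) (m, b, d, a, c, D)" for a b c d by (rule t[OF s(1)[of a b c d] 2])
  have 6: "link\<^sup>*\<^sup>* (m, a, b, c, d, D) (m, c, d, a, b, D)" for a b c d by (rule t[OF 3[of a b c d] 2])
  show "link\<^sup>*\<^sup>* (m, a, b, c, d, D) (m, a, c, b, d, D)"
  "link\<^sup>*\<^sup>* (m, a, b, c, d, D) (m, a, d, b, c, D)"
  "link\<^sup>*\<^sup>* (m, a, b, c, d, D) (m, b, a, c, d, D)"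
  "link\<^sup>*\<^sup>* (m, a, b, c, d, D) (m, b, c, a, d, D)"
  "link\<^sup>*\<^sup>* (m, a, b, c, d, D) (m, b, d, a, c, D)"
  "link\<^sup>*\<^sup>* (m, a, b, c, d, D) (m, c, d, a, b, D)"
  "link\<^sup>*\<^sup>* (m, a, b, c, d, D) (m, c, a, b, d, D)"
  "link\<^sup>*\<^sup>* (m, a, b, c, d, D) (m, d, a, b, c, D)"
    by (rule s 1 2 3 4 5 6)+
qed

lemma pow_n_pow [simp]: "(p^k)^n = 1" by (metis mult.commute pn power_mult power_one)

lemma pair_powers: 
  assumes "a * b * p^k = p" shows "a^n * b^n = 1"
proof -
  have "(a * b * p^k)^n = 1" using assms pn by simp
  then show ?thesis by (simp add: power_mult_distrib)
qed

lemma pow_neg: "k < n \<Longrightarrow> p^k * p^(n-k) = 1" by (simp add: power_add[symmetric] pn)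

lemma irr_quad_shift:
  assumes k: "0 < k" "k < n" "a * b * p^k = p" and P: "irr_quad a b c d D"
  shows "irr_quad (a*p^k) (b*p^k) c d D"
proof -
  have ab: "a^n * b^n = 1" by (rule pair_powers[OF k(3)])
  have D0: "D \<noteq> a^n + b^n" using P k by (auto simp: irr_quad_def)
  have two: "D \<noteq> x^n + y^n" if "0 < j" "j < n" "x * p^k * y * p^j = p" "x \<noteq> 0" "x' \<noteq> 0" "x^n * x'^n = 1" "D \<noteq> x^n + x'^n"
     "\<And>i. 0 < i \<Longrightarrow> i < n \<Longrightarrow> x * y * p^i = p \<Longrightarrow> D \<noteq> x^n + y^n" for x x' y j
  \<comment> \<open>Exponents add up modulo n. If they cancel, the condition for (x, y) says
    nothing, but then y^n = x^(-n) = x'^n, and the condition known for the shifted pair itself takes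
    over.\<close>
  proof (cases "(k + j) mod n = 0")
    case True
    have "x * y * p^(k+j) = p" using that(3) by (simp add: power_add mult_ac)
    then have "x * y = p" using True pow_mod[of "k+j"] by simp
    then have "x^n * y^n = 1" by (metis pn power_mult_distrib)
    then have "x'^n = y^n" using that(4-6) by (metis mult_left_cancel power_not_zero)
    then show ?thesis using that(7) by simp
  next
    case False
    have "x * y * p^(k+j) = p" using that(3) by (simp add: power_add mult_ac)
    then have "x * y * p^((k+j) mod n) = p" using pow_mod[of "k+j"] by simp
    then show ?thesis using that(8)[of "(k+j) mod n"] False n3 by simp
  qed
  have nz: "a \<noteq> 0" "b \<noteq> 0" using k(3) p0 by auto
  have ba: "b^n * a^n = 1" "D \<noteq> b^n + a^n" using ab D0 by (simp_all add: mult.commute add.commute)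
  have P': "\<And>i. 0 < i \<Longrightarrow> i < n \<Longrightarrow> a * c * p^i = p \<Longrightarrow> D \<noteq> a^n + c^n" "\<And>i. 0 < i \<Longrightarrow> i < n \<Longrightarrow> a * d * p^i = p \<Longrightarrow> D \<noteq> a^n + d^n"
    "\<And>i. 0 < i \<Longrightarrow> i < n \<Longrightarrow> b * c * p^i = p \<Longrightarrow> D \<noteq> b^n + c^n" "\<And>i. 0 < i \<Longrightarrow> i < n \<Longrightarrow> b * d * p^i = p \<Longrightarrow> D \<noteq> b^n + d^n"
    "\<And>i. 0 < i \<Longrightarrow> i < n \<Longrightarrow> c * d * p^i = p \<Longrightarrow> D \<noteq> c^n + d^n"
    using P unfolding irr_quad_def by blast+
  show ?thesis unfolding irr_quad_def
  proof (intro allI impI, elim conjE, intro conjI impI)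
    fix j assume j: "0 < j" "j < n"
    have e: "(a * p^k)^n = a^n" "(b*p^k)^n = b^n" by (simp_all add: power_mult_distrib)
    note X = e
    show "D \<noteq> (a * p^k)^n + (b*p^k)^n" using D0 unfolding X .
    show "a * p ^ k * c * p ^ j = p \<Longrightarrow> D \<noteq> (a * p ^ k) ^ n + c ^ n" unfolding X using two[OF j _ nz ab D0] P'(1) by blast
    show "a * p ^ k * d * p ^ j = p \<Longrightarrow> D \<noteq> (a * p ^ k) ^ n + d ^ n" unfolding X using two[OF j _ nz ab D0] P'(2) by blast
    show "b * p ^ k * c * p ^ j = p \<Longrightarrow> D \<noteq> (b * p ^ k) ^ n + c ^ n" unfolding X using two[OF j _ nz(2,1) ba] P'(3) by blast
    show "b * p ^ k * d * p ^ j = p \<Longrightarrow> D \<noteq> (b * p ^ k) ^ n + d ^ n" unfolding X using two[OF j _ nz(2,1) ba] P'(4) by blast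
    show "c * d * p ^ j = p \<Longrightarrow> D \<noteq> c ^ n + d ^ n" using P'(5)[OF j] .
  qed
qed

lemma irr_quad_swaps: "irr_quad a b c d D \<Longrightarrow> irr_quad b a c d D" "irr_quad a b c d D \<Longrightarrow> irr_quad a c b d D" "irr_quad a b c d D \<Longrightarrow> irr_quad a b d c D"
  unfolding irr_quad_def by (simp_all add: mult.commute add.commute)

lemma link_irr_quad: "link (m, a, b, c, d, D) (m', a', b', c', d', D') \<Longrightarrow> irr_quad a b c d D \<Longrightarrow> irr_quad a' b' c' d' D'"
  by (cases rule: link.cases) (auto intro: irr_quad_swaps irr_quad_shift)

definition admissible :: "'a \<times> 'a \<times> 'a \<times> 'a \<times> 'a \<times> 'a \<Rightarrow> bool" where
  "admissible r \<longleftrightarrow> (case r of (m, a, b, c, d, D) \<Rightarrow> m \<noteq> 0 \<and> a \<noteq> 0 \<and> b \<noteq> 0 \<and> c \<noteq> 0 \<and> d \<noteq> 0 \<and> a*b*c*d = m^2*p)"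

lemma link_admissible: "link r r' \<Longrightarrow> admissible r \<Longrightarrow> admissible r'"
  by (cases rule: link.cases) (auto simp: admissible_def p0 mult_ac power_mult_distrib power2_eq_square)

definition irr_params where "irr_params r \<longleftrightarrow> admissible r \<and> (case r of (m, a, b, c, d, D) \<Rightarrow> irr_quad a b c d D)"

lemma link_irr_params: "link r r' \<Longrightarrow> irr_params r \<Longrightarrow> irr_params r'"
  unfolding irr_params_def using link_admissible link_irr_quad by (cases r; cases r') blast

lemma links_irr_params: "link\<^sup>*\<^sup>* r r' \<Longrightarrow> irr_params r \<Longrightarrow> irr_params r'"
  by (induction rule: rtranclp_induct) (auto intro: link_irr_params)

end

lemma (in root_unity_closed) w_moduleI: "admissible (m, a, b, c, d, D) \<Longrightarrow> w_module p n m a b c d"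
  by unfold_locales (auto simp: admissible_def)

section \<open>Reordering the x's\<close>

context w_module begin

text \<open>The ladder with first parameter \<open>y\<close> on the bottom vector is unitriangular
  in the original ladder; the entry just below the diagonal accumulates the differences of the
  diagonal entries of \<open>A\<close>.\<close>

lemma chain_coord:
  assumes "k < n"
  shows "chain p A y (unit_vec n 0) k $ k = 1" "k < i \<Longrightarrow> i < n \<Longrightarrow> chain p A y (unit_vec n 0) k $ i = 0"
    "0 < k \<Longrightarrow> chain p A y (unit_vec n 0) k $ (k - 1) = (\<Sum>j<k. T j - theta y (p^j))"
proof -
  have "chain p A y (unit_vec n 0) k $ k = 1 \<and> (\<forall>i. k < i \<and> i < n \<longrightarrow> chain p A y (unit_vec n 0) k $ i = 0) \<and>
    (0 < k \<longrightarrow> chain p A y (unit_vec n 0) k $ (k - 1) = (\<Sum>j<k. T j - theta y (p^j)))" using assms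
  proof (induction k)
    case 0 then show ?case by simp
  next
    case (Suc k)
    define f where "f = chain p A y (unit_vec n 0) k"
    have f: "f \<in> V" by (simp add: f_def)
    have IH: "f $ k = 1" "\<And>i. k < i \<Longrightarrow> i < n \<Longrightarrow> f $ i = 0" "0 < k \<Longrightarrow> f $ (k - 1) = (\<Sum>j<k. T j - theta y (p^j))"
      using Suc by (auto simp: f_def)
    have st: "chain p A y (unit_vec n 0) (Suc k) $ i = (T i - theta y (p^k)) * f $ i + f $ (i - 1)" if "0 < i" "i < n" for i
      using A_coord[OF f that(2)] that f unfolding chain_Suc f_def[symmetric] by (simp add: algebra_simps del: index_mult_mat_vec)
    have st0: "chain p A y (unit_vec n 0) (Suc k) $ 0 = (T 0 - theta y (p^k)) * f $ 0" if "k = 0"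
      using A_coord[OF f, of 0] that f IH(2)[of "n - 1"] n3 unfolding chain_Suc f_def[symmetric] by (simp add: algebra_simps del: index_mult_mat_vec)
    have 3: "chain p A y (unit_vec n 0) (Suc k) $ k = (\<Sum>j<Suc k. T j - theta y (p^j))"
    proof (cases "k = 0")
      case True then show ?thesis using st0 IH(1) by simp
    next
      case False then show ?thesis using st[of k] IH(1,3) Suc.prems by simp
    qed
    show ?case using st IH Suc.prems 3 by auto
  qed
  then show "chain p A y (unit_vec n 0) k $ k = 1" "k < i \<Longrightarrow> i < n \<Longrightarrow> chain p A y (unit_vec n 0) k $ i = 0"
    "0 < k \<Longrightarrow> chain p A y (unit_vec n 0) k $ (k - 1) = (\<Sum>j<k. T j - theta y (p^j))" by auto
qed

lemma top_ex:
  assumes v: "v \<in> V" "v \<noteq> 0\<^sub>v n"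
  obtains k where "k < n" "v $ k \<noteq> 0" "\<And>i. k < i \<Longrightarrow> i < n \<Longrightarrow> v $ i = 0"
proof -
  let ?X = "{i. i < n \<and> v $ i \<noteq> 0}"
  have fin: "finite ?X" by simp
  have "?X \<noteq> {}" using v by (auto intro!: eq_vecI)
  then have "Max ?X \<in> ?X" by (rule Max_in[OF fin])
  moreover have "v $ i = 0" if "Max ?X < i" "i < n" for i using Max_ge[OF fin, of i] that by (metis (mono_tags, lifting) CollectI leD)
  ultimately show ?thesis using that[of "Max ?X"] by blast
qed

text \<open>Gamma, beta, the marginal coefficient and D depend only on the symmetric functions, so
  the bottom vector fulfils the hypotheses of the universal property for the other ordering as
  well.\<close>

lemma perm_iso:
  assumes y: "w_module p n m y1 y2 y3 y4" and e: "y1+y2+y3+y4 = e1" "y1*y2 + y1*y3 + y1*y4 + y2*y3 + y2*y4 + y3*y4 = e2"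
     "y1*y2*y3 + y1*y2*y4 + y1*y3*y4 + y2*y3*y4 = e3"
  shows "\<exists>P Q. iso n P Q (w_module.A p n y1 D) (w_module.B p n m y1 y2 y3 y4) A B \<and> (\<forall>i<n. P *\<^sub>v unit_vec n i = chain p A y1 (unit_vec n 0) i)"
proof -
  interpret y: w_module p n m y1 y2 y3 y4 D by (rule y)
  have gm: "y.gm = gm" "y.bt = bt" "y.cv = cv" using e
    by (simp_all add: y.gm_def gm_def y.bt_def bt_def y.cv_def cv_def y.e1_def y.e2_def y.e3_def)
  show ?thesis
  proof (rule y.iso_ex)
    show "rel p n A B y.gm y.bt" using rel1 by (simp add: gm)
    show "marginal_vec p n A B m y.cv (unit_vec n 0)" using mvec0 by (simp add: gm)
    show "chain p A y1 (unit_vec n 0) n = y.\<delta> \<cdot>\<^sub>v unit_vec n 0" using chain_all[OF unit_vec_carrier y.nz(2)] by (simp add: y.\<delta>_def)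
    show "gen n A (unit_vec n 0)" by (rule gen0)
  qed auto
qed

lemma mg_I:
  assumes "marginal_vec p n A B (m * p^k) c v" "0 < k" "k < n" "v $ k = 1" "\<And>i. k < i \<Longrightarrow> i < n \<Longrightarrow> v $ i = 0"
  shows "mg k c v"
  using assms unfolding mg_def marginal_vec_def th_S by auto

text \<open>The isomorphism is unitriangular, hence it respects the top position and the top
  coordinate of a vector.\<close>

lemma perm_mg:
  assumes y: "w_module p n m y1 y2 y3 y4" and e: "y1+y2+y3+y4 = e1" "y1*y2 + y1*y3 + y1*y4 + y2*y3 + y2*y4 + y3*y4 = e2"
     "y1*y2*y3 + y1*y2*y4 + y1*y3*y4 + y2*y3*y4 = e3" and mg: "mg k c v"
  shows "\<exists>P Q v'. iso n P Q (w_module.A p n y1 D) (w_module.B p n m y1 y2 y3 y4) A B \<and> (\<forall>i<n. P *\<^sub>v unit_vec n i = chain p A y1 (unit_vec n 0) i)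
     \<and> w_module.mg p n m y1 y2 y3 y4 D k c v' \<and> P *\<^sub>v v' = v"
proof -
  interpret y: w_module p n m y1 y2 y3 y4 D by (rule y)
  obtain P Q where i: "iso n P Q y.A y.B A B" and P: "\<And>i. i < n \<Longrightarrow> P *\<^sub>v unit_vec n i = chain p A y1 (unit_vec n 0) i"
    using perm_iso[OF assms(1-4)] by auto
  define v' where "v' = Q *\<^sub>v v"
  have V: "v \<in> V" and k: "0 < k" "k < n" using mg by (auto simp: mg_def)
  have V': "v' \<in> V" unfolding v'_def using isoD(2)[OF i] V by (simp add: mv_carrier)
  have Pv: "P *\<^sub>v v' = v" unfolding v'_def by (rule isoD(7)[OF i V])
  have mv: "marginal_vec p n y.A y.B (m * p^k) c v'" unfolding v'_def by (rule iso_marginal_vec[OF iso_sym[OF i] mg_marginal_vec[OF mg]])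
  then have "v' \<noteq> 0\<^sub>v n" by (simp add: marginal_vec_def)
  then obtain l where l: "l < n" "v' $ l \<noteq> 0" "\<And>i. l < i \<Longrightarrow> i < n \<Longrightarrow> v' $ i = 0" using top_ex[OF V'] by blast
  have Pc: "P $$ (a,b) = chain p A y1 (unit_vec n 0) b $ a" if "a < n" "b < n" for a b
    using arg_cong[OF P[OF that(2)], of "\<lambda>v. v $ a"] isoD(1)[OF i] that by (simp add: scalar_prod_right_unit)
  have Pvi: "v $ a = (\<Sum>b<n. chain p A y1 (unit_vec n 0) b $ a * v' $ b)" if "a < n" for a
  proof -
    have "v $ a = (\<Sum>b<n. P $$ (a,b) * v' $ b)" unfolding Pv[symmetric] using that V' isoD(1)[OF i] by (simp add: scalar_prod_def atLeast0LessThan)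
    then show ?thesis using Pc[OF that] by simp
  qed
  have vl: "v $ l = v' $ l"
  proof -
    have "v $ l = (\<Sum>b<n. if b = l then v' $ b else 0)" unfolding Pvi[OF l(1)]
    proof (rule sum.cong)
      fix b assume "b \<in> {..<n}" then have b: "b < n" by simp
      show "chain p A y1 (unit_vec n 0) b $ l * v' $ b = (if b = l then v' $ b else 0)"
        using chain_coord(1)[OF b, where y=y1] chain_coord(2)[OF b, where y=y1 and i=l] l b by (cases b l rule: linorder_cases) auto
    qed simp
    then show ?thesis using l(1) by simp
  qed
  have va: "v $ a = 0" if "l < a" "a < n" for a
    unfolding Pvi[OF that(2)]
  proof (rule sum.neutral, rule)
    fix b assume "b \<in> {..<n}" then have b: "b < n" by simp
    show "chain p A y1 (unit_vec n 0) b $ a * v' $ b = 0" using chain_coord(2)[OF b, where y=y1 and i=a] l(3)[of b] b that by (cases "l < b") auto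
  qed
  have "l = k" using va vl l mg unfolding mg_def by (metis linorder_neqE_nat zero_neq_one)
  then have "y.mg k c v'" using l vl mg k by (intro y.mg_I[OF mv]) (auto simp: mg_def)
  then show ?thesis using i P Pv by blast
qed

end

context root_unity begin

definition es3 :: "'a \<Rightarrow> 'a \<Rightarrow> 'a \<Rightarrow> 'a \<Rightarrow> 'a" where "es3 a b c d = a*b*c + a*b*d + a*c*d + b*c*d"
definition es2 :: "'a \<Rightarrow> 'a \<Rightarrow> 'a \<Rightarrow> 'a \<Rightarrow> 'a" where "es2 a b c d = a*b + a*c + a*d + b*c + b*d + c*d"

text \<open>Only weight and marginal coefficient are recorded: together with the isomorphism
  invariants gamma, beta and D they determine the linked tuple up to order.\<close>

definition linked :: "'a \<times> 'a \<times> 'a \<times> 'a \<times> 'a \<times> 'a \<Rightarrow> 'a \<Rightarrow> 'a \<Rightarrow> bool" where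
  "linked r \<nu> cc \<longleftrightarrow> (\<exists>a b c d D. link\<^sup>*\<^sup>* r (\<nu>, a, b, c, d, D) \<and> cc = marginal_coeff p \<nu> (a+b+c+d) (es3 a b c d))"

lemma linked_link: "link\<^sup>*\<^sup>* r r' \<Longrightarrow> linked r' \<nu> cc \<Longrightarrow> linked r \<nu> cc"
proof -
  assume l: "link\<^sup>*\<^sup>* r r'" and "linked r' \<nu> cc"
  then obtain a b c d D where "link\<^sup>*\<^sup>* r' (\<nu>, a, b, c, d, D)" and c: "cc = marginal_coeff p \<nu> (a+b+c+d) (es3 a b c d)" by (auto simp: linked_def)
  then have "link\<^sup>*\<^sup>* r (\<nu>, a, b, c, d, D)" using l by simp
  then show ?thesis unfolding linked_def using c by blast
qed

end

lemma marginal_vec_unique: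
  assumes "marginal_vec p n A B m c v" "marginal_vec p n A B m c' v" "A \<in> carrier_mat n n" "B \<in> carrier_mat n n"
  shows "c = c'"
proof (rule ccontr)
  assume ne: "c \<noteq> c'"
  have v: "v \<in> carrier_vec n" "v \<noteq> 0\<^sub>v n" using assms by (auto simp: marginal_vec_def)
  obtain i where i: "i < n" "v $ i \<noteq> 0" using v by (metis carrier_vecD eq_vecI index_zero_vec(1) index_zero_vec(2))
  have "theta m p \<cdot>\<^sub>v (A *\<^sub>v v) + c \<cdot>\<^sub>v v = theta m p \<cdot>\<^sub>v (A *\<^sub>v v) + c' \<cdot>\<^sub>v v" using assms by (simp add: marginal_vec_def)
  from arg_cong[OF this, of "\<lambda>w. w $ i"] have "c * v $ i = c' * v $ i" using v i assms(3) by (simp del: index_mult_mat_vec)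
  then show False using i ne by simp
qed

context w_module begin

lemma e3_es: "e3 = es3 x1 x2 x3 x4" and e2_es: "e2 = es2 x1 x2 x3 x4" by (simp_all add: e3_def es3_def e2_def es2_def)

lemma admissible: "admissible (m, x1, x2, x3, x4, D)" using nz prod by (simp add: admissible_def)

section \<open>Shifting along a pair\<close>

context
  fixes k assumes k: "0 < k" "k < n" and x12: "x1 * x2 * p^k = p"
begin

lemma shift_w_module: "w_module p n (m*p^k) (x1*p^k) (x2*p^k) x3 x4"
  by (rule w_moduleI[where D=D]) (rule link_admissible[OF shift[OF k x12] admissible])

lemma shift_F: "F k = 0" using F_eq_0_iff[OF k] x12 by simp

interpretation y: w_module p n "m*p^k" "x1*p^k" "x2*p^k" x3 x4 D by (rule shift_w_module)

lemma shift_T: "y.T 0 = T k" "y.S 0 = S k" "y.S (Suc 0) = S (Suc k)"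
  by (simp_all add: y.T_def T_def y.S_def S_def theta_def mult_ac)

text \<open>Since x1 x2 = p / p^k, the factor 1 - p^(k+1) and the factor of the pair (x1, x2) change
  places.\<close>

lemma shift_F1: "y.F (Suc 0) = F (Suc k)"
proof -
  define Q where "Q = p^k"
  have Q: "Q \<noteq> 0" using p0 by (simp add: Q_def)
  have x: "x1 * x2 = p / Q" using x12 Q by (simp add: Q_def field_simps)
  have 1: "x1 * Q * (x2 * Q) * p / p = p * Q" "x1 * x2 * (p * Q) / p = p" "x1 * Q * x3 * p / p = x1 * x3 * (p * Q)/p" "x1 * Q * x4 * p / p = x1 * x4 * (p * Q)/p"
    using x Q p0 by (simp_all add: mult_ac)
  show ?thesis unfolding y.F_factor F_factor unfolding power_Suc power_0 mult_1_right Q_def[symmetric] 1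
    using Q p0 by (simp add: power2_eq_square mult_ac)
qed

lemma shift_sym: "y.gm = gm" "y.bt = bt"
proof -
  define Q where "Q = p^k"
  have Q: "Q \<noteq> 0" using p0 by (simp add: Q_def)
  have x1': "x1 = p / (Q * x2)" using x12 Q nz by (simp add: Q_def field_simps)
  have x3': "x3 = m^2 * Q / x4" using prod Q nz p0 unfolding x1' by (simp add: field_simps)
  have ne: "m \<noteq> 0" "x2 \<noteq> 0" "x4 \<noteq> 0" using nz by auto
  show "y.gm = gm" unfolding y.gm_def gm_def y.e1_def e1_def y.e3_def e3_def
    unfolding Q_def[symmetric] unfolding x1' x3' using Q ne p0 by (simp add: divide_simps) (simp add: algebra_simps eval_nat_numeral)
  have "(y.e2 + (m * p^k)^2 + p) / (m * p^k) = (e2 + m^2 + p) / m" unfolding y.e2_def e2_def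
    unfolding Q_def[symmetric] unfolding x1' x3' using Q ne p0 by (simp add: divide_simps) (simp add: algebra_simps eval_nat_numeral)
  then show "y.bt = bt" unfolding y.bt_def bt_def by (metis times_divide_eq_right)
qed

lemma shift_marginal_vec: "marginal_vec p n A B (m*p^k) y.cv (unit_vec n k)"
  using unit_marginal_vec[OF k(2) shift_F] y.marginal_coeff_eq unfolding y.cv_def shift_T shift_F1 One_nat_def by simp

lemma shift_mvec': "marginal_vec p n A B (m*p^k) (marginal_coeff p (m*p^k) (x1*p^k + x2*p^k + x3 + x4) (es3 (x1*p^k) (x2*p^k) x3 x4)) (unit_vec n k)"
  using shift_marginal_vec unfolding y.cv_def y.e1_def y.e3_def es3_def .

text \<open>The k-th ladder vector is a marginal vector for the shifted tuple; nonzero \<delta>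
  makes it cyclic.\<close>

lemma shift_iso:
  assumes d: "\<delta> \<noteq> 0"
  shows "\<exists>P Q. iso n P Q (w_module.A p n (x1*p^k) D) (w_module.B p n (m*p^k) (x1*p^k) (x2*p^k) x3 x4) A B \<and> P *\<^sub>v unit_vec n 0 = unit_vec n k"
proof -
  have "\<exists>P Q. iso n P Q y.A y.B A B \<and> (\<forall>i<n. P *\<^sub>v unit_vec n i = chain p A (x1*p^k) (unit_vec n k) i)"
  proof (rule y.iso_ex)
    show "rel p n A B y.gm y.bt" using rel1 by (simp add: shift_sym)
    show "marginal_vec p n A B (m*p^k) y.cv (unit_vec n k)" by (rule shift_marginal_vec)
    show "chain p A (x1*p^k) (unit_vec n k) n = y.\<delta> \<cdot>\<^sub>v unit_vec n k" 
      using chain_all[OF unit_vec_carrier y.nz(2)] by (simp add: y.\<delta>_def)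
    show "gen n A (unit_vec n k)" by (rule gen_unit[OF k(2) d])
  qed auto
  then show ?thesis using n3 by (metis chain_0 not_gr_zero not_numeral_le_zero)
qed

lemma shift_linked: "linked (m, x1, x2, x3, x4, D) (m*p^k) (marginal_coeff p (m*p^k) (x1*p^k + x2*p^k + x3 + x4) (es3 (x1*p^k) (x2*p^k) x3 x4))"
  unfolding linked_def using shift[OF k x12] by blast

lemma unit_linked:
  assumes "marginal_vec p n A B (m*p^k) c (unit_vec n k)"
  shows "linked (m, x1, x2, x3, x4, D) (m*p^k) c"
  using marginal_vec_unique[OF assms shift_mvec'] shift_linked by simp

end

lemma delta_ne:
  assumes "x1 * x2 * p^k = p" "D \<noteq> x1^n + x2^n" shows "\<delta> \<noteq> 0"
proof -
  have "x2^n = inverse (x1^n)" using pair_powers[OF assms(1)] nz by (metis inverse_unique)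
  then show ?thesis using assms(2) by (auto simp: \<delta>_def diff_eq_eq add.commute)
qed

lemma geo: "(\<Sum>j<k. T j - theta y (p^j)) = (p^k - 1)/(p - 1) * (x1 - y) + (inverse (p^k) - 1) / (inverse p - 1) * (inverse x1 - inverse y)"
proof -
  have ip: "inverse p \<noteq> 1" using p1 by (metis inverse_eq_1_iff)
  have "(\<Sum>j<k. T j - theta y (p^j)) = (\<Sum>j<k. p^j * (x1 - y) + inverse p^j * (inverse x1 - inverse y))"
    by (rule sum.cong) (simp_all add: T_def theta_def power_inverse algebra_simps)
  also have "\<dots> = (\<Sum>j<k. p^j) * (x1 - y) + (\<Sum>j<k. inverse p^j) * (inverse x1 - inverse y)"
    by (simp add: sum.distrib sum_distrib_right)
  also have "(\<Sum>j<k. p^j) = (p^k - 1)/(p - 1)" by (rule geometric_sum[OF p1])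
  also have "(\<Sum>j<k. inverse p^j) = (inverse p^k - 1)/(inverse p - 1)" by (rule geometric_sum[OF ip])
  finally show ?thesis by (simp add: power_inverse)
qed

text \<open>Because \<open>F k\<close> is 0, a nonzero coordinate below the top forces the
  eigenvalues at k and k-1 to agree, that is m^2 p^(2k) = p. The product constraint then makes (x3,
  x4) a pair for the same k, and the coordinate must be that of the k-th ladder vector with
  \<open>x3\<close> in front.\<close>

lemma mg_double:
  assumes mg: "mg k c v" and x12: "x1 * x2 * p^k = p" and ne: "v $ (k-1) \<noteq> 0"
  shows "v $ (k - 1) = (\<Sum>j<k. T j - theta x3 (p^j))" "x3 * x4 * p^k = p" "m^2 * p^k * p^k = p"
proof -
  have k: "0 < k" "k < n" using mg by (auto simp: mg_def)
  have Fk: "F k = 0" using F_eq_0_iff[OF k] x12 by simp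
  define e where "e = v $ (k - 1)"
  obtain l where l: "k = Suc l" using k by (metis Suc_pred)
  have vk: "v $ k = 1" using mgD[OF mg] by simp
  have "S k = S l" using mg_e[OF mg, of l] Fk l ne by simp
  then have "p^k = p^l \<or> m^2 * p^k * p^l = 1" by (simp add: S_eq_iff)
  moreover have "p^k \<noteq> p^l" using p0 p1 by (simp add: l)
  ultimately have mm: "m^2 * p^k * p^l = 1" by simp
  then have "p * (m^2 * p^k * p^l) = p" by simp
  then show mp: "m^2 * p^k * p^k = p" by (simp add: l mult_ac)
  show x34: "x3 * x4 * p^k = p"
  proof -
    have "(x1 * x2 * p^k) * (x3 * x4 * p^k) = (x1*x2*x3*x4) * p^k * p^k" by (simp add: mult_ac)
    also have "\<dots> = p * (m^2 * p^k * p^k)" unfolding prod by (simp add: mult_ac)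
    finally have "p * (x3 * x4 * p^k) = p * p" unfolding x12 mp .
    then show ?thesis using p0 by simp
  qed
  define d2 where "d2 = S k - S (Suc k)"
  have Skl: "S k = S l" using mm S_eq_iff by blast
  have d2: "d2 \<noteq> 0"
  proof
    assume "d2 = 0"
    then have "p^k = p^Suc k \<or> m^2 * p^k * p^Suc k = 1" unfolding d2_def using S_eq_iff[of k "Suc k"] by simp
    moreover have "p^k \<noteq> p^Suc k" using p0 p1 by simp
    ultimately have "p * (m^2 * p^k * p^k) = 1" using p0 by (simp add: mult_ac)
    then show False unfolding mp using p2' by simp
  qed
  have c: "c = d2 * (T k + e) + F (Suc k)" using mg_top[OF mg] k by (simp add: pre_def[OF mg] e_def d2_def)
  have eq1: "d2 * (T l * e + pre v l) = c * e"
    using mg_i[OF mg, of l] l Fk Skl by (simp add: e_def d2_def)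
  \<comment> \<open>The eigenvalues at l-1 and k+1 agree, so \<open>d2\<close> is also the factor in
    the eigenvalue equation for row l-1.\<close>
  have eq2: "d2 * pre v l = F l * e"
  proof (cases l)
    case 0 then show ?thesis by (simp add: pre_def[OF mg] F_zero)
  next
    case (Suc j)
    have "m^2 * p^j * p^Suc k = 1" using mm by (simp add: l Suc mult_ac)
    then have "S j = S (Suc k)" using S_eq_iff by blast
    then show ?thesis using mg_e[OF mg, of j] Suc l by (simp add: pre_def[OF mg] e_def d2_def)
  qed
  have "e * (d2 * T l + F l) = d2 * (T l * e + pre v l)" using eq2 by (simp add: algebra_simps)
  also have "\<dots> = e * (d2 * (T k + e) + F (Suc k))" unfolding eq1 c by simp
  finally have eq3: "d2 * T l + F l = d2 * (T k + e) + F (Suc k)" using ne by (simp add: e_def)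
  have "d2 * e = d2 * (T l - T k) + F l - F (Suc k)" using eq3 by (simp add: algebra_simps)
  also have "\<dots> = d2 * ((p^k - 1) / (p - 1) * (x1 - x3) + (inverse (p^k) - 1) / (inverse p - 1) * (inverse x1 - inverse x3))"
  proof -
    have pl: "p^k/p = p^l" using p0 by (simp add: l)
    have d2': "theta m (p^k) - theta m (p^k/p^2) = d2"
    proof -
      have "m\<^sup>2 * (p^k / p\<^sup>2) * (p^Suc k) = 1" using mp p0 by (simp add: power2_eq_square field_simps)
      then have "theta m (p^k/p^2) = theta m (p^Suc k)" using theta_eq_iff[of m "p^k/p^2" "p^Suc k"] nz p0 by simp
      then show ?thesis by (simp add: d2_def S_def)
    qed
    have "p = m^2 * (p^k)^2" using mp by (simp add: power2_eq_square mult.assoc)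
    from double_id[OF this nz(1,2,3,4,5) _ p1 x12 prod] p0
    show ?thesis unfolding d2' pl T_def F_def u_def w_def by simp
  qed
  also have "\<dots> = d2 * (\<Sum>j<k. T j - theta x3 (p^j))" unfolding geo ..
  finally show "v $ (k - 1) = (\<Sum>j<k. T j - theta x3 (p^j))" using d2 by (simp add: e_def)
qed

end

section \<open>Marginal vectors of weight m p^k are linked and cyclic\<close>

context w_module begin

lemma eq_unit: 
  assumes "v \<in> V" "k < n" "v $ k = 1" "\<And>i. i < n \<Longrightarrow> i \<noteq> k \<Longrightarrow> v $ i = 0"
  shows "v = unit_vec n k"
  by (rule eq_vecI) (use assms in auto)

text \<open>Besides the k-th ladder vector only one other vector is possible, namely the k-th ladder
  vector of the ordering that starts with \<open>x3\<close> and \<open>x4\<close>. Either one comes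
  from a shift.\<close>

lemma mg_stepA:
  assumes mg: "mg k c v" and x12: "x1 * x2 * p^k = p" and PM: "irr_quad x1 x2 x3 x4 D"
  shows "linked (m, x1, x2, x3, x4, D) (m * p^k) c \<and> gen n A v"
proof -
  have k: "0 < k" "k < n" using mg by (auto simp: mg_def)
  note D = mgD[OF mg]
  have Fk: "F k = 0" by (rule shift_F[OF k x12])
  let ?X = "{i. i < k \<and> v $ i \<noteq> 0}"
  show ?thesis
  proof (cases "?X = {}")
    case True
    have "v $ i = 0" if "i < n" "i \<noteq> k" for i
      using True D(5)[of i] that by (cases "i < k") auto
    then have v: "v = unit_vec n k" by (rule eq_unit[OF D(1) k(2) D(4)])
    have "\<delta> \<noteq> 0" using delta_ne[OF x12] PM k x12 unfolding irr_quad_def by blast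
    then show ?thesis using unit_linked[OF k x12] mg_marginal_vec[OF mg] gen_unit[OF k(2)] unfolding v by blast
  next
    case False
    have fin: "finite ?X" by simp
    define i where "i = Max ?X"
    have i: "i < k" "v $ i \<noteq> 0" using Max_in[OF fin False] by (auto simp: i_def)
    have above: "v $ j = 0" if "i < j" "j < k" for j 
      using Max_ge[OF fin, of j] that unfolding i_def by (metis (mono_tags, lifting) CollectI leD)
    show ?thesis
    proof (cases "Suc i = k")
      \<comment> \<open>A gap below the top: the eigenvalue equation gives m^2 p^k p^i = 1, and row
        i+1 of the second equation gives the same with both exponents raised by 1, so p^2 =
        1.\<close>
      case False
      then have ik: "Suc i < k" using i by simp
      have "(S k - S i) * v $ i = 0" using mg_e[OF mg i(1)] above[of "Suc i"] ik by simp
      then have "S k = S i" using i by simp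
      then have mm: "m^2 * p^k * p^i = 1" unfolding S_eq_iff using pow_eq_less[of k i] k i by auto
      have "F (Suc (Suc i)) * v $ (Suc (Suc i)) = 0" using Fk above[of "Suc (Suc i)"] ik by (cases "Suc (Suc i) = k") auto
      then have X: "v $ Suc (Suc i) * (T (Suc (Suc i)) * F (Suc (Suc i))) = 0" by auto
      have "v $ i * S (Suc i) + v $ Suc (Suc i) * (T (Suc (Suc i)) * F (Suc (Suc i))) = v $ i * S (Suc k)"
        using mg_i[OF mg ik] above[of "Suc i"] ik by (simp add: pre_def[OF mg] algebra_simps)
      then have "v $ i * S (Suc i) = v $ i * S (Suc k)" unfolding X by simp
      then have "p^Suc i = p^Suc k \<or> m^2 * p^Suc i * p^Suc k = 1" using i S_eq_iff[of "Suc i" "Suc k"] by simp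
      moreover have "p^Suc i \<noteq> p^Suc k" using pow_eq_less[of k i] k i p0 by auto
      ultimately have "(m^2 * p^k * p^i) * (p * p) = 1" by (simp add: mult_ac)
      then show ?thesis unfolding mm using p2' by simp
    next
      case True
      then have ne: "v $ (k - 1) \<noteq> 0" using i by auto
      note dbl = mg_double[OF mg x12 ne]
      have y: "w_module p n m x3 x4 x1 x2" using nz prod by unfold_locales (simp_all add: mult_ac)
      interpret y: w_module p n m x3 x4 x1 x2 D by (rule y)
      have es: "x3+x4+x1+x2 = e1" "x3*x4 + x3*x1 + x3*x2 + x4*x1 + x4*x2 + x1*x2 = e2" "x3*x4*x1 + x3*x4*x2 + x3*x1*x2 + x4*x1*x2 = e3"
        by (simp_all add: e1_def e2_def e3_def algebra_simps)
      obtain P Q where iso: "iso n P Q y.A y.B A B" and P: "P *\<^sub>v unit_vec n k = chain p A x3 (unit_vec n 0) k"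
        using perm_iso[OF y es] k by blast
      define w' where "w' = chain p A x3 (unit_vec n 0) k"
      define c' where "c' = marginal_coeff p (m*p^k) (x3*p^k + x4*p^k + x1 + x2) (es3 (x3*p^k) (x4*p^k) x1 x2)"
      have "marginal_vec p n y.A y.B (m*p^k) c' (unit_vec n k)" unfolding c'_def by (rule y.shift_mvec'[OF k dbl(2)])
      then have mw: "marginal_vec p n A B (m*p^k) c' w'" using iso_marginal_vec[OF iso] P unfolding w'_def by metis
      have w': "w' \<in> V" "w' $ k = 1" "\<And>i. k < i \<Longrightarrow> i < n \<Longrightarrow> w' $ i = 0" "w' $ (k - 1) = v $ (k - 1)"
        using chain_coord[OF k(2), where y=x3] k dbl(1) by (auto simp: w'_def)
      have Bw: "B *\<^sub>v w' = S k \<cdot>\<^sub>v w'" using mw unfolding marginal_vec_def th_S by simp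
      \<comment> \<open>Both vectors agree from position k-1 upward. A nonzero difference would be
        an eigenvector with top j < k-1, but the only other position with the eigenvalue of k is
        k-1.\<close>
      have vw: "v = w'"
      proof (rule ccontr)
        assume "v \<noteq> w'"
        define z where "z = v - w'"
        have z: "z \<in> V" "z \<noteq> 0\<^sub>v n" 
        proof -
          show "z \<in> V" using D(1) w'(1) by (simp add: z_def)
          show "z \<noteq> 0\<^sub>v n"
          proof
            assume z0: "z = 0\<^sub>v n"
            have "v = w'"
            proof (rule eq_vecI)
              fix i assume "i < dim_vec w'"
              then have "i < n" using w'(1) by simp
              then show "v $ i = w' $ i" using arg_cong[OF z0, of "\<lambda>z. z $ i"] D(1) w'(1) by (simp add: z_def)
            qed (use D(1) w'(1) in simp)
            then show False using \<open>v \<noteq> w'\<close> by simp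
          qed
        qed
        have Bz: "B *\<^sub>v z = S k \<cdot>\<^sub>v z" using D(1,6) w'(1) Bw by (auto intro!: eq_vecI simp: z_def lins algebra_simps simp del: index_mult_mat_vec)
        have zi: "z $ i = v $ i - w' $ i" if "i < n" for i using that D(1) w'(1) by (simp add: z_def)
        obtain j where j: "j < n" "z $ j \<noteq> 0" "\<And>i. j < i \<Longrightarrow> i < n \<Longrightarrow> z $ i = 0" using top_ex[OF z] by blast
        have "j < k - 1"
        proof (rule ccontr)
          assume "\<not> j < k - 1"
          then have "j = k - 1 \<or> j = k \<or> k < j" by auto
          then have "z $ j = 0" using zi[OF j(1)] w' D(4,5) j(1) by auto
          then show False using j by simp
        qed
        have "(S k - S j) * z $ j = 0" using eig_coord[OF z(1) Bz j(1)] j(3)[of "Suc j"] by simp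
        then have "S k = S j" using j by simp
        then have "m^2 * p^k * p^j = 1" unfolding S_eq_iff using pow_eq_less[of k j] k \<open>j < k - 1\<close> j by auto
        then have "m^2 * p^k * p^k * p^j = p^k" by (simp add: mult_ac)
        then have "p^Suc j = p^k" unfolding dbl(3) by simp
        then have "Suc j = k" using k \<open>j < k - 1\<close> by (intro pow_eq_less) auto
        then show False using \<open>j < k - 1\<close> by simp
      qed
      have cc: "c = c'" using marginal_vec_unique[OF mg_marginal_vec[OF mg] mw[folded vw]] by simp
      have "linked (m, x3, x4, x1, x2, D) (m*p^k) c" unfolding cc c'_def by (rule y.shift_linked[OF k dbl(2)])
      then have "linked (m, x1, x2, x3, x4, D) (m*p^k) c" by (rule linked_link[OF link_perms(6)])
      moreover have "y.\<delta> \<noteq> 0" using y.delta_ne[OF dbl(2)] PM k dbl(2) unfolding irr_quad_def by blast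
      then have "gen n A w'" using iso_gen[OF iso y.gen_unit[OF k(2)]] unfolding w'_def P[symmetric] by simp
      ultimately show ?thesis unfolding vw by simp
    qed
  qed
qed

lemma perm_transfer:
  assumes y: "w_module p n m y1 y2 y3 y4" and e: "y1+y2+y3+y4 = e1" "y1*y2 + y1*y3 + y1*y4 + y2*y3 + y2*y4 + y3*y4 = e2"
     "y1*y2*y3 + y1*y2*y4 + y1*y3*y4 + y2*y3*y4 = e3" and l: "link\<^sup>*\<^sup>* (m, x1, x2, x3, x4, D) (m, y1, y2, y3, y4, D)"
    and g: "\<And>v'. w_module.mg p n m y1 y2 y3 y4 D k c v' \<Longrightarrow> linked (m, y1, y2, y3, y4, D) (m * p^k) c \<and> gen n (w_module.A p n y1 D) v'"
    and mg: "mg k c v"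
  shows "linked (m, x1, x2, x3, x4, D) (m * p^k) c \<and> gen n A v"
proof -
  obtain P Q v' where i: "iso n P Q (w_module.A p n y1 D) (w_module.B p n m y1 y2 y3 y4) A B" and mg': "w_module.mg p n m y1 y2 y3 y4 D k c v'" and P: "P *\<^sub>v v' = v"
    using perm_mg[OF y e mg] by blast
  interpret y: w_module p n m y1 y2 y3 y4 D by (rule y)
  show ?thesis using g[OF mg'] iso_gen[OF i] y.mgD(1)[OF mg'] P linked_link[OF l] by blast
qed

lemma irr_quad_perms:
  "irr_quad a b c d D \<Longrightarrow> irr_quad a c b d D" "irr_quad a b c d D \<Longrightarrow> irr_quad a d b c D" "irr_quad a b c d D \<Longrightarrow> irr_quad b c a d D" 
  "irr_quad a b c d D \<Longrightarrow> irr_quad b d a c D" "irr_quad a b c d D \<Longrightarrow> irr_quad c d a b D" "irr_quad a b c d D \<Longrightarrow> irr_quad b a c d D"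
  "irr_quad a b c d D \<Longrightarrow> irr_quad c a b d D" "irr_quad a b c d D \<Longrightarrow> irr_quad d a b c D"
  by (auto simp: irr_quad_def mult.commute add.commute)

lemma w_module_perms:
  "w_module p n m x1 x3 x2 x4" "w_module p n m x1 x4 x2 x3" "w_module p n m x2 x3 x1 x4" "w_module p n m x2 x4 x1 x3" "w_module p n m x3 x4 x1 x2"
  "w_module p n m x2 x1 x3 x4" "w_module p n m x3 x1 x2 x4" "w_module p n m x4 x1 x2 x3"
  using nz prod by (unfold_locales; simp add: mult_ac)+

lemmas e_defs = e1_def e2_def e3_def

lemma mg_pairs:
  assumes mg: "mg k c v" and PM: "irr_quad x1 x2 x3 x4 D"
    and pr: "x1*x2*p^k = p \<or> x1*x3*p^k = p \<or> x1*x4*p^k = p \<or> x2*x3*p^k = p \<or> x2*x4*p^k = p \<or> x3*x4*p^k = p"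
  shows "linked (m, x1, x2, x3, x4, D) (m * p^k) c \<and> gen n A v"
  using pr
proof (elim disjE)
  assume "x1*x2*p^k = p" then show ?thesis using mg_stepA[OF mg _ PM] by simp
next
  assume x: "x1*x3*p^k = p"
  show ?thesis by (rule perm_transfer[OF w_module_perms(1) _ _ _ link_perms(1) w_module.mg_stepA[OF w_module_perms(1) _ x irr_quad_perms(1)[OF PM]] mg]) (simp_all add: e_defs algebra_simps)
next
  assume x: "x1*x4*p^k = p"
  show ?thesis by (rule perm_transfer[OF w_module_perms(2) _ _ _ link_perms(2) w_module.mg_stepA[OF w_module_perms(2) _ x irr_quad_perms(2)[OF PM]] mg]) (simp_all add: e_defs algebra_simps)
next
  assume x: "x2*x3*p^k = p"
  show ?thesis by (rule perm_transfer[OF w_module_perms(3) _ _ _ link_perms(4) w_module.mg_stepA[OF w_module_perms(3) _ x irr_quad_perms(3)[OF PM]] mg]) (simp_all add: e_defs algebra_simps)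
next
  assume x: "x2*x4*p^k = p"
  show ?thesis by (rule perm_transfer[OF w_module_perms(4) _ _ _ link_perms(5) w_module.mg_stepA[OF w_module_perms(4) _ x irr_quad_perms(4)[OF PM]] mg]) (simp_all add: e_defs algebra_simps)
next
  assume x: "x3*x4*p^k = p"
  show ?thesis by (rule perm_transfer[OF w_module_perms(5) _ _ _ link_perms(6) w_module.mg_stepA[OF w_module_perms(5) _ x irr_quad_perms(5)[OF PM]] mg]) (simp_all add: e_defs algebra_simps)
qed

text \<open>If there is no pair at k, then \<open>F k\<close> is nonzero in every ordering, the
  eigenvalues at k and k-2 agree, and \<open>F (k - 1)\<close> vanishes in every ordering. So each x
  has a partner for the exponent k-1, which is refuted by combinatorics.\<close>

lemma mg_nonexc:
  assumes mg: "mg k c v" and PM: "irr_quad x1 x2 x3 x4 D" and ne: "k = 1 \<or> m^2 * p^k \<noteq> p"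
  shows "linked (m, x1, x2, x3, x4, D) (m * p^k) c \<and> gen n A v"
proof (cases "x1*x2*p^k = p \<or> x1*x3*p^k = p \<or> x1*x4*p^k = p \<or> x2*x3*p^k = p \<or> x2*x4*p^k = p \<or> x3*x4*p^k = p")
  case True then show ?thesis by (rule mg_pairs[OF mg PM])
next
  case np: False
  have k: "0 < k" "k < n" using mg by (auto simp: mg_def)
  have Fk: "F k \<noteq> 0" using F_eq_0_iff[OF k] np by blast
  have k2: "k \<ge> 2" using mg_B1[OF mg _ Fk] np k by (cases "k = 1") auto
  then have Sk: "S k = S (k - 2)" using mg_B2[OF mg k2 Fk] np ne by (metis numeral_One numeral_le_iff semiring_norm(69))
  obtain j where j: "k = Suc (Suc j)" using k2 by (metis Suc_diff_Suc add_2_eq_Suc le_add_diff_inverse)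
  have "p^k \<noteq> p^j" using p0 p2' by (simp add: j mult.assoc[symmetric])
  then have mm: "m^2 * p^k * p^j = 1" using Sk S_eq_iff[of k j] p0 by (simp add: j)
  define P where "P = p^Suc j"
  have P: "p^k = p * P" "p^(k-1) = P" by (simp_all add: P_def j)
  note P' = P(2)[unfolded One_nat_def]
  have P0: "P \<noteq> 0" using p0 by (simp add: P_def)
  have mP: "m^2 * P * P = 1" using mm by (simp add: P_def j mult_ac)
  have k1: "0 < k - 1" "k - 1 < n" using k2 k by auto
  have c1: "x1*x2*P = p \<or> x1*x3*P = p \<or> x1*x4*P = p" 
    using mg_B0[OF mg k2 Fk Sk] F_eq_0_iff[OF k1] by (simp add: P')
  have c2: "x2*x1*P = p \<or> x2*x3*P = p \<or> x2*x4*P = p"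
  proof -
    interpret y: w_module p n m x2 x1 x3 x4 D by (rule w_module_perms)
    obtain v' where mg': "y.mg k c v'" using perm_mg[OF w_module_perms(6) _ _ _ mg] by (auto simp: e_defs algebra_simps)
    have "y.F k \<noteq> 0" using y.F_eq_0_iff[OF k] np by (simp add: mult.commute)
    then show ?thesis using y.mg_B0[OF mg' k2] Sk y.F_eq_0_iff[OF k1] by (simp add: P' y.S_def S_def)
  qed
  have c3: "x3*x1*P = p \<or> x3*x2*P = p \<or> x3*x4*P = p"
  proof -
    interpret y: w_module p n m x3 x1 x2 x4 D by (rule w_module_perms)
    obtain v' where mg': "y.mg k c v'" using perm_mg[OF w_module_perms(7) _ _ _ mg] by (auto simp: e_defs algebra_simps)
    have "y.F k \<noteq> 0" using y.F_eq_0_iff[OF k] np by (simp add: mult.commute)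
    then show ?thesis using y.mg_B0[OF mg' k2] Sk y.F_eq_0_iff[OF k1] by (simp add: P' y.S_def S_def)
  qed
  have c4: "x4*x1*P = p \<or> x4*x2*P = p \<or> x4*x3*P = p"
  proof -
    interpret y: w_module p n m x4 x1 x2 x3 D by (rule w_module_perms)
    obtain v' where mg': "y.mg k c v'" using perm_mg[OF w_module_perms(8) _ _ _ mg] by (auto simp: e_defs algebra_simps)
    have "y.F k \<noteq> 0" using y.F_eq_0_iff[OF k] np by (simp add: mult.commute)
    then show ?thesis using y.mg_B0[OF mg' k2] Sk y.F_eq_0_iff[OF k1] by (simp add: P' y.S_def S_def)
  qed
  \<comment> \<open>Two disjoint pairs at exponent k-1 contradict m^2 p^(2k-2) = 1.\<close>
  have matching: False if "a*b*P = p" "c*d*P = p" "a*b*c*d = m^2*p" for a b c d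
  proof -
    have "p * p = a*b*c*d * P * P" using that(1,2) by (metis mult.assoc mult.commute mult.left_commute)
    also have "\<dots> = p * (m^2*P*P)" unfolding that(3) by (simp add: mult_ac)
    finally show False unfolding mP using p0 p1 by simp
  qed
  \<comment> \<open>One entry paired with all others makes these others equal, and two of them then
    form a pair at exponent k.\<close>
  have star: "b*c*p^k = p" if "a*b*P = p" "a*c*P = p" "a*d*P = p" "a*b*c*d = m^2*p" for a b c d
  proof -
    have a0: "a \<noteq> 0" using that(1) p0 by auto
    have "a*b*P = a*c*P" "a*b*P = a*d*P" using that by simp_all
    then have bcd: "c = b" "d = b" using a0 P0 by simp_all
    have "m^2 * p * P * P = (a * b * P) * (b * b * P)" unfolding that(4)[symmetric] bcd by (simp add: mult_ac)
    then have "p * (b*b*P) = p * (m^2 * P * P)" unfolding that(1) by (auto simp: mult_ac)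
    then have "b*b*P = 1" unfolding mP using p0 by simp
    then show ?thesis unfolding bcd P by (simp add: mult_ac)
  qed
  have pr: "x1*x3*x2*x4 = m^2*p" "x1*x4*x2*x3 = m^2*p" "x2*x1*x3*x4 = m^2*p" "x3*x1*x2*x4 = m^2*p" "x4*x1*x2*x3=m^2*p" using prod by (simp_all add: mult_ac)
  note M = matching[OF _ _ prod] matching[OF _ _ pr(1)] matching[OF _ _ pr(2)]
  note St = star[OF _ _ _ prod] star[OF _ _ _ pr(3)] star[OF _ _ _ pr(4)] star[OF _ _ _ pr(5)]
  \<comment> \<open>A graph on four vertices without isolated vertex contains a perfect matching or
    a star.\<close>
  have False using c1 c2 c3 c4 M St np by (metis mult.commute)
  then show ?thesis ..
qed


text \<open>The eigenvalue at the top position l leaves the weights m p^l and 1/(m p^l). The row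
  above the top compares the next eigenvalues and excludes the second one because p^2 \<noteq> 1,
  unless l = n-1 and there is no such row; then 1/(m p^l) = p/m.\<close>

lemma top_cases:
  assumes mv: "marginal_vec p n A B \<nu> c v" and n0: "\<nu> \<noteq> 0"
  obtains t l where "t \<noteq> 0" "l < n" "marginal_vec p n A B \<nu> c (t \<cdot>\<^sub>v v)" "(t \<cdot>\<^sub>v v) $ l = 1" "\<And>i. l < i \<Longrightarrow> i < n \<Longrightarrow> (t \<cdot>\<^sub>v v) $ i = 0"
    "\<nu> = m * p^l \<or> l = n - 1 \<and> \<nu> = p / m"
proof -
  have v: "v \<in> V" "v \<noteq> 0\<^sub>v n" "B *\<^sub>v v = theta \<nu> 1 \<cdot>\<^sub>v v" "B *\<^sub>v (A *\<^sub>v v) = theta \<nu> p \<cdot>\<^sub>v (A *\<^sub>v v) + c \<cdot>\<^sub>v v"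
    using mv by (auto simp: marginal_vec_def)
  obtain l where l: "l < n" "v $ l \<noteq> 0" "\<And>i. l < i \<Longrightarrow> i < n \<Longrightarrow> v $ i = 0" using top_ex[OF v(1,2)] by blast
  define t where "t = inverse (v $ l)"
  define v' where "v' = t \<cdot>\<^sub>v v"
  have t: "t \<noteq> 0" using l by (simp add: t_def)
  have v': "v' \<in> V" "v' $ l = 1" "\<And>i. l < i \<Longrightarrow> i < n \<Longrightarrow> v' $ i = 0"
    using v l by (auto simp: v'_def t_def)
  have v'0: "v' \<noteq> 0\<^sub>v n" using v'(2) l(1) by auto
  have B1: "B *\<^sub>v v' = theta \<nu> 1 \<cdot>\<^sub>v v'" using v by (simp add: v'_def lins smult_smult_assoc mult.commute)
  have B2: "B *\<^sub>v (A *\<^sub>v v') = theta \<nu> p \<cdot>\<^sub>v (A *\<^sub>v v') + c \<cdot>\<^sub>v v'" 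
    using v by (simp add: v'_def lins smult_smult_assoc mult.commute smult_add_distrib_vec[of _ n])
  have mv': "marginal_vec p n A B \<nu> c v'" using v'(1) v'0 B1 B2 by (simp add: marginal_vec_def)
  have "(theta \<nu> 1 - S l) * v' $ l = 0" using eig_coord[OF v'(1) B1 l(1)] v'(3) by auto
  then have S: "theta \<nu> 1 = S l" using v' by simp
  have "theta (m*p^l) (\<nu>/(m*p^l)) = theta (m*p^l) 1" using S th_S(1)[of l] nz p0 by (simp add: theta_def)
  then have "\<nu> / (m*p^l) = 1 \<or> (m*p^l)^2 * (\<nu>/(m*p^l)) * 1 = 1" 
    using theta_eq_iff[of "m*p^l" "\<nu>/(m*p^l)" 1] nz p0 n0 by simp
  then have cases: "\<nu> = m*p^l \<or> m * p^l * \<nu> = 1" using nz p0 by (auto simp: power2_eq_square mult.assoc)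
  have fin: "\<nu> = m*p^l \<or> l = n - 1 \<and> \<nu> = p/m"
  proof (cases "\<nu> = m*p^l")
    case False
    then have mn: "m * p^l * \<nu> = 1" using cases by simp
    show ?thesis
    proof (cases "Suc l < n")
      case True
      have AVl: "(A *\<^sub>v v') $ (Suc l) = 1" using A_coord[OF v'(1) True] v'(2) v'(3)[OF _ True] by simp
      have "(A *\<^sub>v v') $ (Suc (Suc l)) = 0" if "Suc (Suc l) < n" using A_coord[OF v'(1) that] v'(3)[of "Suc (Suc l)"] v'(3)[of "Suc l"] that by simp
      then have "(B *\<^sub>v (A *\<^sub>v v')) $ (Suc l) = S (Suc l)" using B_coord[OF AV[OF v'(1)] True] AVl by auto
      moreover have "(B *\<^sub>v (A *\<^sub>v v')) $ (Suc l) = theta \<nu> p" unfolding B2 using v'(1) v'(3)[OF _ True] True AVl by (simp del: index_mult_mat_vec)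
      ultimately have "theta \<nu> p = S (Suc l)" by simp
      then have "theta (m*p^l) (\<nu>*p/(m*p^l)) = theta (m*p^l) p" using th_S(2)[of l] nz p0 by (simp add: theta_def)
      then have "\<nu>*p / (m*p^l) = p \<or> (m*p^l)^2 * (\<nu>*p/(m*p^l)) * p = 1" 
        using theta_eq_iff[of "m*p^l" "\<nu>*p/(m*p^l)" p] nz p0 n0 by simp
      moreover have "\<nu>*p / (m*p^l) = p \<longleftrightarrow> \<nu> = m*p^l" using nz p0 by (auto simp: field_simps)
      moreover have "(m*p^l)^2 * (\<nu>*p/(m*p^l)) * p = m * p^l * \<nu> * (p * p)" using nz p0 by (simp add: power2_eq_square)
      ultimately have "\<nu> = m*p^l \<or> m * p^l * \<nu> * (p * p) = 1" by metis
      then show ?thesis unfolding mn using p2' by simp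
    next
      case l1: False
      then have "Suc l = n" using l(1) by simp
      then have l1: "l = n - 1" "p^l * p = 1" using pn by (auto simp: power_Suc2[symmetric] simp del: power_Suc)
      have "m * \<nu> = m * p^l * \<nu> * p" using l1 by (simp add: mult_ac)
      then have "m * \<nu> = p" unfolding mn by simp
      then show ?thesis using l1 nz by (simp add: field_simps)
    qed
  qed simp
  show ?thesis using that[OF t l(1)] mv' v' fin unfolding v'_def by blast
qed

text \<open>A shift by a smaller exponent i turns the top position into k-i and m^2 p^k = p into (m
  p^i)^2 p^(k-i) = p p^i, which differs from p. So the ordinary case applies to the shifted
  tuple.\<close>

lemma mg_exc_shift:
  assumes mg: "mg k c v" and i: "0 < i" "i < k" and x12: "x1 * x2 * p^i = p" and mm: "m^2 * p^k = p" and PM: "irr_quad x1 x2 x3 x4 D"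
  shows "linked (m, x1, x2, x3, x4, D) (m * p^k) c \<and> gen n A v"
proof -
  have k: "0 < k" "k < n" using mg by (auto simp: mg_def)
  have i': "i < n" using i k by simp
  have d: "\<delta> \<noteq> 0" using delta_ne[OF x12] PM i i' x12 unfolding irr_quad_def by blast
  have z: "w_module p n (m*p^i) (x1*p^i) (x2*p^i) x3 x4" by (rule shift_w_module[OF i(1) i' x12])
  interpret z: w_module p n "m*p^i" "x1*p^i" "x2*p^i" x3 x4 D by (rule z)
  obtain P Q where iso: "iso n P Q z.A z.B A B" using shift_iso[OF i(1) i' x12 d] by auto
  define v' where "v' = Q *\<^sub>v v"
  have V: "v \<in> V" using mg by (simp add: mg_def)
  have mv: "marginal_vec p n z.A z.B (m * p^k) c v'" unfolding v'_def by (rule iso_marginal_vec[OF iso_sym[OF iso] mg_marginal_vec[OF mg]])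
  have V': "v' \<in> V" using mv by (simp add: marginal_vec_def)
  obtain t l where tl: "t \<noteq> 0" "l < n" "marginal_vec p n z.A z.B (m*p^k) c (t \<cdot>\<^sub>v v')" "(t \<cdot>\<^sub>v v') $ l = 1" "\<And>i. l < i \<Longrightarrow> i < n \<Longrightarrow> (t \<cdot>\<^sub>v v') $ i = 0"
     and or: "m * p^k = m*p^i * p^l \<or> l = n - 1 \<and> m*p^k = p / (m*p^i)"
    using z.top_cases[OF mv] nz p0 by auto
  have split: "p^k = p^i * p^(k - i)" using i by (simp add: power_add[symmetric])
  have l: "l = k - i"
    using or
  proof
    assume "m * p^k = m*p^i * p^l"
    then have "p^(k-i) = p^l" using nz p0 split by simp
    then show ?thesis using pow_eq_less[of "k-i" l] tl(2) k by simp
  next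
    assume "l = n - 1 \<and> m*p^k = p / (m*p^i)"
    then have "(m^2 * p^k) * p^i = p" using nz p0 by (simp add: field_simps power2_eq_square)
    then have "p^i = 1" unfolding mm using p0 by simp
    then show ?thesis using pk[OF i(1) i'] by simp
  qed
  have e: "m * p^k = m*p^i*p^(k-i)" using split by simp
  have "z.mg (k-i) c (t \<cdot>\<^sub>v v')" using tl i k unfolding l by (intro z.mg_I) (auto simp: e[symmetric])
  moreover have "irr_quad (x1*p^i) (x2*p^i) x3 x4 D" by (rule irr_quad_shift[OF i(1) i' x12 PM])
  moreover have "(m*p^i)^2 * p^(k-i) \<noteq> p"
  proof
    assume "(m*p^i)^2 * p^(k-i) = p"
    then have "(m^2 * p^k) * p^i = p" unfolding split by (simp add: power2_eq_square mult_ac)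
    then have "p^i = 1" unfolding mm using p0 by simp
    then show False using pk[OF i(1) i'] by simp
  qed
  ultimately have "linked (m*p^i, x1*p^i, x2*p^i, x3, x4, D) (m*p^k) c" "gen n z.A (t \<cdot>\<^sub>v v')" unfolding e using z.mg_nonexc[of "k - i" c] by blast+
  then have "linked (m, x1, x2, x3, x4, D) (m*p^k) c" "gen n z.A v'" 
    using linked_link[OF r_into_rtranclp[of link, OF shift[OF i(1) i' x12]]] gen_scale by blast+
  then show ?thesis using iso_gen[OF iso _ V'] isoD(7)[OF iso V] unfolding v'_def by simp
qed

lemma mg_all:
  assumes mg: "mg k c v" and PM: "irr_quad x1 x2 x3 x4 D"
  shows "linked (m, x1, x2, x3, x4, D) (m * p^k) c \<and> gen n A v"
proof (cases "k = 1 \<or> m^2 * p^k \<noteq> p")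
  case True then show ?thesis by (rule mg_nonexc[OF mg PM])
next
  case exc: False
  have k: "0 < k" "k < n" using mg by (auto simp: mg_def)
  show ?thesis
  proof (cases "x1*x2*p^k = p \<or> x1*x3*p^k = p \<or> x1*x4*p^k = p \<or> x2*x3*p^k = p \<or> x2*x4*p^k = p \<or> x3*x4*p^k = p")
    case True then show ?thesis by (rule mg_pairs[OF mg PM])
  next
    case np: False
    have Fk: "F k \<noteq> 0" using F_eq_0_iff[OF k] np by blast
    \<comment> \<open>The bottom coordinate must vanish, so the recursion breaks off at some i < k;
      this zero of \<open>F\<close> supplies the preliminary shift.\<close>
    have "v $ 0 = 0" using mg_exc[OF mg _ _ Fk] exc k np by force
    then obtain i where i: "0 < i" "i \<le> k" "F i = 0" using mg_F0[OF mg] by blast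
    then have ik: "i < k" using Fk by (cases "i = k") auto
    have mm: "m^2 * p^k = p" using exc by simp
    from i have "x1 * x2 * p^i = p \<or> x1 * x3 * p^i = p \<or> x1 * x4 * p^i = p" using F_eq_0_iff[of i] ik k by auto
    then show ?thesis
    proof (elim disjE)
      assume "x1 * x2 * p^i = p" then show ?thesis by (rule mg_exc_shift[OF mg i(1) ik _ mm PM])
    next
      assume x: "x1 * x3 * p^i = p"
      show ?thesis by (rule perm_transfer[OF w_module_perms(1) _ _ _ link_perms(1) w_module.mg_exc_shift[OF w_module_perms(1) _ i(1) ik x mm irr_quad_perms(1)[OF PM]] mg]) (simp_all add: e_defs algebra_simps)
    next
      assume x: "x1 * x4 * p^i = p"
      show ?thesis by (rule perm_transfer[OF w_module_perms(2) _ _ _ link_perms(2) w_module.mg_exc_shift[OF w_module_perms(2) _ i(1) ik x mm irr_quad_perms(2)[OF PM]] mg]) (simp_all add: e_defs algebra_simps)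
    qed
  qed
qed

lemma marginal_vec_full:
  assumes mv: "marginal_vec p n A B (m*p^l) c v" and l: "l < n" "v $ l = 1" "\<And>i. l < i \<Longrightarrow> i < n \<Longrightarrow> v $ i = 0" and PM: "irr_quad x1 x2 x3 x4 D"
  shows "linked (m, x1, x2, x3, x4, D) (m*p^l) c \<and> gen n A v"
proof (cases "l = 0")
  case True
  have v: "v = unit_vec n 0" by (rule eq_unit) (use l mv True in \<open>auto simp: marginal_vec_def\<close>)
  have "c = cv" using marginal_vec_unique[OF mv[unfolded v] _ A_carrier B_carrier, of cv] mvec0 True by simp
  then have "linked (m, x1, x2, x3, x4, D) m c" unfolding linked_def cv_def e1_def e3_es by blast
  then show ?thesis using gen0 True v by simp
next
  case False
  then show ?thesis using mg_all[OF mg_I[OF mv _ l] PM] by simp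
qed

end

section \<open>The exceptional marginal vector\<close>

lemma (in root_unity) prod_inv_sub: "(\<Prod>j<n. 1 - s * inverse (p^j)) = 1 - s^n"
proof -
  have "(\<Prod>j<n. 1 - s * inverse (p^j)) = (\<Prod>j\<in>{..<n}. 1 - s * p ^ (if j = 0 then 0 else n - j))"
  proof (rule prod.cong)
    fix j assume "j \<in> {..<n}"
    then have "p ^ j * p ^ (n - j) = 1" by (simp add: power_add[symmetric] pn)
    then have "inverse (p ^ j) = p ^ (n - j)" using p0 by (metis inverse_unique)
    then show "1 - s * inverse (p^j) = 1 - s * p ^ (if j = 0 then 0 else n - j)" by (simp add: pn)
  qed simp
  also have "\<dots> = (\<Prod>j\<in>{..<n}. 1 - s * p ^ j)"
    by (rule prod.reindex_bij_witness[of _ "\<lambda>j. if j = 0 then 0 else n - j" "\<lambda>j. if j = 0 then 0 else n - j"]) (use n3 in auto)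
  finally show ?thesis using prod_one_sub by simp
qed

text \<open>The exponent of the product is n(n-1)/2, which is only guaranteed to be a multiple of n
  after doubling.\<close>

lemma (in root_unity) prod_pows: "(\<Prod>j<n. p^j)^2 = 1"
proof -
  have "2 * (\<Sum>j<k. j) = k * (k - 1)" for k :: nat
  proof (induction k)
    case (Suc k) then show ?case by (cases k) (auto simp: algebra_simps)
  qed simp
  then have "(\<Sum>j<n. j) * 2 = n * (n - 1)" by (simp add: mult.commute)
  moreover have "(\<Prod>j<n. p^j) = p ^ (\<Sum>j<n. j)" by (simp add: power_sum)
  ultimately have "(\<Prod>j<n. p^j)^2 = (p ^ n) ^ (n - 1)" by (simp add: power_mult[symmetric])
  then show ?thesis by (simp add: pn)
qed

lemma (in root_unity) pow_n1: "p^(n-1) = inverse p" "p^(n-2) = inverse (p^2)"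
proof -
  have "p^(n-1) * p = 1" using n3 pn by (metis One_nat_def Suc_diff_1 Suc_le_lessD le_trans one_le_numeral power_Suc2 not_less_eq_eq le_add1 less_le_trans zero_less_numeral)
  then show "p^(n-1) = inverse p" by (metis inverse_unique mult.commute)
  have "p^(n-2) * p^2 = p^(n-2+2)" by (simp only: power_add)
  also have "n - 2 + 2 = n" using n3 by simp
  finally have "p^(n-2) * p^2 = 1" unfolding pn .
  then show "p^(n-2) = inverse (p^2)" by (metis inverse_unique mult.commute)
qed

context w_module begin

text \<open>For the reflected entries p/x_i the symmetric functions of degree 1 and 3 are e3/m^2 and
  p^2 e1/m^2.\<close>

definition c3 where "c3 = marginal_coeff p (p/m) (e3/m^2) (p^2*e1/m^2)"
definition N where "N = (m^2)^n"
definition E1 where "E1 = x1^n + x2^n + x3^n + x4^n"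
definition E3 where "E3 = es3 (x1^n) (x2^n) (x3^n) (x4^n)"

lemma th_nu: "theta (p/m) 1 = S (n-1)" "theta (p/m) p = S (n-2)"
  unfolding S_def theta_def pow_n1 using p0 nz by (simp_all add: field_simps power2_eq_square)

text \<open>If m^(2n) = 1, the eigenvalue at n-1 recurs at another position, so the downward
  recursion survives only if some \<open>F i\<close> vanishes. After the shift by this i the weight
  p/m is no longer p divided by the first parameter, and the vector becomes an ordinary one.\<close>

lemma marginal_vec_bad:
  assumes mv: "marginal_vec p n A B (p/m) c v" and v1: "v $ (n-1) = 1" and ne: "p/m \<noteq> m*p^(n-1)" and N1: "N = 1" and PM: "irr_quad x1 x2 x3 x4 D"
  shows "linked (m, x1, x2, x3, x4, D) (p/m) c \<and> gen n A v"
proof -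
  have V: "v \<in> V" using mv by (simp add: marginal_vec_def)
  have Bv: "B *\<^sub>v v = S (n-1) \<cdot>\<^sub>v v" using mv by (simp add: marginal_vec_def th_nu)
  have coord: "(S (n-1) - S i) * v $ i = F (Suc i) * v $ (Suc i)" if "Suc i < n" for i
    using eig_coord[OF V Bv, of i] that by simp
  have "(m^2 * p^(n-1))^n = 1" using N1 by (simp add: power_mult_distrib N_def)
  then obtain l where l: "l < n" "m^2 * p^(n-1) = p^l" using root_ex by blast
  define k where "k = (n - l) mod n"
  have k: "k < n" using n3 by (simp add: k_def)
  have "p^l * p^k = 1" using pow_neg[OF l(1)] unfolding k_def by (simp add: pow_mod[symmetric])
  then have mk: "m^2 * p^(n-1) * p^k = 1" unfolding l by simp
  then have Sk: "S (n-1) = S k" using S_eq_iff by blast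
  have kn: "k \<noteq> n - 1"
  proof
    assume "k = n - 1"
    then have "m^2 * p^(n-1) * inverse p = 1" using mk pow_n1 by simp
    then have "m * p^(n-1) = p/m" using nz p0 by (simp add: field_simps power2_eq_square)
    then show False using ne by simp
  qed
  have "\<exists>i. 0 < i \<and> i < n \<and> F i = 0"
  proof (rule ccontr)
    assume "\<not> ?thesis"
    then have F: "F i \<noteq> 0" if "0 < i" "i < n" for i using that by blast
    have "i \<le> n - 1 \<Longrightarrow> v $ (n - 1 - i) \<noteq> 0" for i
    proof (induction i)
      case 0 then show ?case using v1 by simp
    next
      case (Suc i)
      then have "Suc (n - 1 - Suc i) = n - 1 - i" by simp
      then show ?case using coord[of "n - 1 - Suc i"] Suc F[of "n - 1 - i"] by auto
    qed
    from this[of "n - 1 - Suc k"] have "v $ (Suc k) \<noteq> 0" using k kn by (simp add: Suc_diff_Suc)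
    moreover have "Suc k < n" using k kn by linarith
    ultimately show False using coord[of k] F[of "Suc k"] Sk by auto
  qed
  then obtain i where i: "0 < i" "i < n" "x1*x2*p^i = p \<or> x1*x3*p^i = p \<or> x1*x4*p^i = p" using F_eq_0_iff by blast
  have main: "linked (m, y1, y2, y3, y4, D) (p/m) c \<and> gen n (w_module.A p n y1 D) v'" 
    if y: "w_module p n m y1 y2 y3 y4" and mv': "marginal_vec p n (w_module.A p n y1 D) (w_module.B p n m y1 y2 y3 y4) (p/m) c v'"
      and x: "y1 * y2 * p^i = p" and PM': "irr_quad y1 y2 y3 y4 D" for y1 y2 y3 y4 v'
  proof -
    interpret y: w_module p n m y1 y2 y3 y4 D by (rule y)
    have d: "y.\<delta> \<noteq> 0" using y.delta_ne[OF x] PM' i x unfolding irr_quad_def by blast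
    have z: "w_module p n (m*p^i) (y1*p^i) (y2*p^i) y3 y4" by (rule y.shift_w_module[OF i(1,2) x])
    interpret z: w_module p n "m*p^i" "y1*p^i" "y2*p^i" y3 y4 D by (rule z)
    obtain P Q where iso: "iso n P Q z.A z.B y.A y.B" using y.shift_iso[OF i(1,2) x d] by auto
    have V': "v' \<in> V" using mv' by (simp add: marginal_vec_def)
    have mq: "marginal_vec p n z.A z.B (p/m) c (Q *\<^sub>v v')" by (rule iso_marginal_vec[OF iso_sym[OF iso] mv'])
    have VQ: "Q *\<^sub>v v' \<in> V" using mq by (simp add: marginal_vec_def)
    have nu0: "p/m \<noteq> 0" using nz p0 by simp
    obtain t l where tl: "t \<noteq> 0" "l < n" "marginal_vec p n z.A z.B (p/m) c (t \<cdot>\<^sub>v (Q *\<^sub>v v'))" "(t \<cdot>\<^sub>v (Q *\<^sub>v v')) $ l = 1" "\<And>i. l < i \<Longrightarrow> i < n \<Longrightarrow> (t \<cdot>\<^sub>v (Q *\<^sub>v v')) $ i = 0"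
      and or: "p/m = m*p^i * p^l \<or> l = n - 1 \<and> p/m = p / (m*p^i)"
      using z.top_cases[OF mq nu0] by metis
    have pi: "p/m \<noteq> p/(m*p^i)" using pk[OF i(1,2)] nz p0 by (auto simp: field_simps)
    then have nu: "p/m = m*p^i * p^l" using or by blast
    have PMz: "irr_quad (y1*p^i) (y2*p^i) y3 y4 D" by (rule irr_quad_shift[OF i(1,2) x PM'])
    have "linked (m*p^i, y1*p^i, y2*p^i, y3, y4, D) (p/m) c \<and> gen n z.A (t \<cdot>\<^sub>v (Q *\<^sub>v v'))"
      unfolding nu by (rule z.marginal_vec_full[OF tl(3)[unfolded nu] tl(2,4,5) PMz])
    then have "linked (m, y1, y2, y3, y4, D) (p/m) c" "gen n z.A (Q *\<^sub>v v')" 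
      using linked_link[OF r_into_rtranclp[of link, OF shift[OF i(1,2) x]]] gen_scale by blast+
    then show ?thesis using iso_gen[OF iso _ VQ] isoD(7)[OF iso V'] by simp
  qed
  have trans: "linked (m, x1, x2, x3, x4, D) (p/m) c \<and> gen n A v"
    if y: "w_module p n m y1 y2 y3 y4" and e: "y1+y2+y3+y4 = e1" "y1*y2 + y1*y3 + y1*y4 + y2*y3 + y2*y4 + y3*y4 = e2"
     "y1*y2*y3 + y1*y2*y4 + y1*y3*y4 + y2*y3*y4 = e3" and lk: "link\<^sup>*\<^sup>* (m, x1, x2, x3, x4, D) (m, y1, y2, y3, y4, D)" 
     and x: "y1 * y2 * p^i = p" and PM': "irr_quad y1 y2 y3 y4 D" for y1 y2 y3 y4
  proof -
    obtain P Q where iso: "iso n P Q (w_module.A p n y1 D) (w_module.B p n m y1 y2 y3 y4) A B" using perm_iso[OF y e] by blast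
    have mq: "marginal_vec p n (w_module.A p n y1 D) (w_module.B p n m y1 y2 y3 y4) (p/m) c (Q *\<^sub>v v)" by (rule iso_marginal_vec[OF iso_sym[OF iso] mv])
    have VQ: "Q *\<^sub>v v \<in> V" using mq by (simp add: marginal_vec_def)
    from main[OF y mq x PM'] show ?thesis using linked_link[OF lk] iso_gen[OF iso _ VQ] isoD(7)[OF iso V] by auto
  qed
  from i(3) show ?thesis
  proof (elim disjE)
    assume "x1*x2*p^i = p"
    from main[OF w_module_axioms mv this PM] show ?thesis .
  next
    assume x: "x1*x3*p^i = p"
    show ?thesis by (rule trans[OF w_module_perms(1) _ _ _ link_perms(1) x irr_quad_perms(1)[OF PM]]) (simp_all add: e_defs algebra_simps)
  next
    assume x: "x1*x4*p^i = p"
    show ?thesis by (rule trans[OF w_module_perms(2) _ _ _ link_perms(2) x irr_quad_perms(2)[OF PM]]) (simp_all add: e_defs algebra_simps)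
  qed
qed

section \<open>Weight p/m when m^(2n) differs from 1\<close>

context
  assumes N1: "N \<noteq> 1"
begin

definition d2 where "d2 i = 1 - p^2/(m^2 * p^i)"
text \<open>The ratio of coordinates i-1 and i of an eigenvector for the eigenvalue at n-1. The
  factor 1 - p^i common to \<open>F i\<close> and the eigenvalue difference is cancelled, so that
  \<open>r 0\<close> is meaningful: it describes the step across the wrap-around.\<close>

definition r where "r i = p^2 / (p^i)^2 / (x1 * m^2) * ((1 - x1*x2*p^i/p) * (1 - x1*x3*p^i/p) * (1 - x1*x4*p^i/p)) / d2 i"

lemma d2_ne: "d2 i \<noteq> 0"
proof
  assume "d2 i = 0"
  then have e: "m^2 * p^i = p^2" using nz p0 by (simp add: d2_def field_simps)
  have "(m^2 * p^i)^n = 1" unfolding e by simp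
  then show False using N1 by (simp add: N_def power_mult_distrib)
qed

lemma S_ne: "i < n \<Longrightarrow> j < n \<Longrightarrow> i \<noteq> j \<Longrightarrow> S i \<noteq> S j"
proof
  assume "i < n" "j < n" "i \<noteq> j" "S i = S j"
  then have "m^2 * p^i * p^j = 1" using S_eq_iff pow_eq_less by blast
  then have "(m^2 * p^i * p^j)^n = 1" by simp
  then show False using N1 by (simp add: N_def power_mult_distrib)
qed

lemma r_F: "r (Suc i) * (S (n-1) - S i) = F (Suc i)"
proof -
  define Q where "Q = p^i"
  have Q: "Q \<noteq> 0" "p ^ Suc i = p * Q" using p0 by (simp_all add: Q_def)
  have "S (n-1) - S i = (m / p) * (1 - p*Q) * d2 (Suc i)"
    unfolding S_def theta_def pow_n1 d2_def Q Q_def[symmetric] using Q p0 nz by (simp add: divide_simps) (simp add: algebra_simps eval_nat_numeral)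
  then have "r (Suc i) * (S (n-1) - S i) = p^2 / (p^Suc i)^2 / (x1 * m^2) * ((1 - x1*x2*p^Suc i/p) * (1 - x1*x3*p^Suc i/p) * (1 - x1*x4*p^Suc i/p)) * ((m/p) * (1 - p*Q))"
    unfolding r_def using d2_ne[of "Suc i"] by simp
  also have "\<dots> = F (Suc i)" unfolding F_factor unfolding Q using nz p0 Q by (simp add: divide_simps) (simp add: algebra_simps eval_nat_numeral)
  finally show ?thesis .
qed

text \<open>Row i of the second marginal equation divided by coordinate i. It holds for every i, so
  the only condition left is that the actual corner entry agrees with what \<open>r 0\<close>
  predicts.\<close>

lemma bracket3: "(S i - S (n-2)) * (T i + r i) + F (Suc i) + T (Suc i) * (S (n-1) - S i) - c3 = 0"
proof -
  define Q where "Q = p^i"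
  have Q: "Q \<noteq> 0" "p ^ Suc i = p * Q" using p0 by (simp_all add: Q_def)
  have f: "1 - x1 * u * Q / p + x1^2 * w * Q^2 / p^2 - x1^2 * m^2 * Q^3 / p^2 = (1 - x1*x2*Q/p) * (1 - x1*x3*Q/p) * (1 - x1*x4*Q/p)"
  proof -
    have "x1^2 * m^2 * Q^3 / p^2 = x1^2 * (m^2*p) * Q^3/p^3" using p0 by (simp add: field_simps power2_eq_square power3_eq_cube)
    also have "\<dots> = x1^2 * (x1*x2*x3*x4) * Q^3/p^3" unfolding prod ..
    finally show ?thesis using p0 by (auto simp: u_def w_def field_simps power2_eq_square power3_eq_cube)
  qed
  have c: "(inverse p - 1) * (p^2*(x1 + u) / m^2 - (x1 * w + m^2*p / x1) / m^2) / (p / m) = c3"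
    unfolding c3_def marginal_coeff_def xw by (simp add: u_def w_def e1_def e3_def algebra_simps)
  have th2: "theta m (inverse p^2) = S (n-2)" "theta m (inverse p) = S (n-1)" by (simp_all only: S_def pow_n1 power_inverse)
  have rr: "p^2 / Q^2 / (x1 * m^2) * ((1 - x1*x2*Q/p) * (1 - x1*x3*Q/p) * (1 - x1*x4*Q/p)) = r i * d2 i"
    unfolding r_def Q_def using d2_ne[of i] by simp
  have tt: "theta m Q = S i" "theta x1 Q = T i" "varphi p m x1 u w (p*Q) = F (Suc i)" "theta x1 (p*Q) = T (Suc i)" "1 - p^2/(m^2*Q) = d2 i"
    by (simp_all add: S_def T_def F_def d2_def Q_def)
  have "(S i - S (n-2)) * T i * d2 i + (S i - S (n-2)) * (r i * d2 i) + (F (Suc i) + T (Suc i) * (S (n-1) - S i) - c3) * d2 i = 0"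
    using reflect_id[OF p0 nz(1,2) Q(1), of u w] unfolding f c th2 rr tt .
  then have "d2 i * ((S i - S (n-2)) * (T i + r i) + F (Suc i) + T (Suc i) * (S (n-1) - S i) - c3) = 0"
    by (simp add: algebra_simps)
  then show ?thesis using d2_ne[of i] by simp
qed

text \<open>Every linear factor of \<open>r\<close> runs over all n-th roots of unity and
  contributes a difference of n-th powers.\<close>

lemma prod_r: "(\<Prod>i<n. r i) * (x1^n * (N - 1)) = (1 - x1^n*x2^n) * (1 - x1^n*x3^n) * (1 - x1^n*x4^n)"
proof -
  have N0: "N \<noteq> 0" using nz by (simp add: N_def)
  have f: "(\<Prod>i<n. 1 - a * b * p^i/p) = 1 - a^n*b^n" for a b :: 'a
  proof -
    have "(\<Prod>i<n. 1 - a * b * p^i/p) = (\<Prod>i<n. 1 - (a*b/p) * p^i)" by (simp add: mult_ac)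
    also have "\<dots> = 1 - (a*b/p)^n" by (rule prod_one_sub)
    finally show ?thesis by (simp add: power_divide power_mult_distrib pn)
  qed
  have g: "(\<Prod>i<n. d2 i) = 1 - 1/N"
  proof -
    have "(\<Prod>i<n. d2 i) = (\<Prod>i<n. 1 - (p^2/m^2) * inverse (p^i))" by (simp add: d2_def field_simps)
    also have "\<dots> = 1 - (p^2/m^2)^n" by (rule prod_inv_sub)
    also have "(p^2/m^2)^n = 1/N" by (simp add: power_divide N_def)
    finally show ?thesis .
  qed
  have h: "(\<Prod>i<n. p^2 / (p^i)^2 / (x1 * m^2)) = 1 / (x1^n * N)"
  proof -
    have "(\<Prod>i<n. p^2 / (p^i)^2 / (x1 * m^2)) = (p^2)^n / (\<Prod>i<n. p^i)^2 / (x1*m^2)^n"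
      by (simp add: prod_dividef prod_power_distrib prod.distrib)
    then show ?thesis unfolding prod_pows by (simp add: N_def power_mult_distrib)
  qed
  have "(\<Prod>i<n. r i) = 1 / (x1^n * N) * ((1 - x1^n*x2^n) * (1 - x1^n*x3^n) * (1 - x1^n*x4^n)) / (1 - 1/N)"
    unfolding r_def prod_dividef prod.distrib f g h[symmetric] ..
  moreover have "1 - 1/N \<noteq> 0" using N1 N0 by simp
  ultimately show ?thesis using N0 nz N1 by (simp add: divide_simps)
qed

text \<open>Clearing the denominator x1^n (N - 1) and cancelling x1^n turns the closing condition
  into one symmetric in the x's.\<close>

lemma D_iff: "\<delta> = (\<Prod>i<n. r i) \<longleftrightarrow> D * (N - 1) = E3 - E1"
proof -
  have x0: "x1^n * (N - 1) \<noteq> 0" using nz N1 by simp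
  have PN: "x1^n * x2^n * x3^n * x4^n = N" using arg_cong[OF prod, of "\<lambda>t. t^n"] by (simp add: power_mult_distrib N_def pn)
  define X1 X2 X3 X4 where X: "X1 = x1^n" "X2 = x2^n" "X3 = x3^n" "X4 = x4^n"
  have X0: "X1 \<noteq> 0" using nz X by simp
  have PX: "X1 * (X2 * X3 * X4) = N" using PN X by (simp add: mult_ac)
  have "\<delta> = (\<Prod>i<n. r i) \<longleftrightarrow> \<delta> * (X1 * (N-1)) = (1 - X1*X2) * (1 - X1*X3) * (1 - X1*X4)"
    using prod_r x0 unfolding X by (metis mult_right_cancel)
  also have "\<delta> * (X1 * (N-1)) = X1 * (D * (N - 1)) - (X1^2 + 1) * (N - 1)"
    unfolding \<delta>_def X(1)[symmetric] using X0 by (simp add: field_simps power2_eq_square)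
  also have "(1 - X1*X2) * (1 - X1*X3) * (1 - X1*X4) = X1 * (E3 - E1) - (X1^2+1) * (N-1)"
    unfolding E3_def E1_def es3_def X[symmetric] PX[symmetric] by (simp add: algebra_simps power2_eq_square)
  also have "(X1 * (D * (N - 1)) - (X1^2 + 1) * (N - 1) = X1 * (E3 - E1) - (X1^2+1) * (N-1)) \<longleftrightarrow> D * (N - 1) = E3 - E1"
    using X0 by simp
  finally show ?thesis .
qed

text \<open>In row 0 the matrix supplies \<delta> where the uniform formula would have
  \<open>r 0\<close> times coordinate 0, which is the product of all ratios; this discrepancy is the
  extra term.\<close>

lemma reflect_coords:
  assumes V: "v \<in> V" and v1: "v $ (n-1) = 1" and Bv: "B *\<^sub>v v = S (n-1) \<cdot>\<^sub>v v"
  shows "i < n \<Longrightarrow> v $ i = (\<Prod>j\<in>{Suc i..<n}. r j)"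
    and "0 < i \<Longrightarrow> i < n \<Longrightarrow> (B *\<^sub>v (A *\<^sub>v v)) $ i = S (n-2) * (A *\<^sub>v v) $ i + c3 * v $ i"
    and "(B *\<^sub>v (A *\<^sub>v v)) $ 0 = S (n-2) * (A *\<^sub>v v) $ 0 + c3 * v $ 0 + (S 0 - S (n-2)) * (\<delta> - (\<Prod>j<n. r j))"
proof -
  have coord: "(S (n-1) - S i) * v $ i = F (Suc i) * v $ (Suc i)" if "Suc i < n" for i
    using eig_coord[OF V Bv, of i] that by simp
  have step: "v $ i = r (Suc i) * v $ (Suc i)" if "Suc i < n" for i
  proof -
    have "(S (n-1) - S i) * v $ i = (S (n-1) - S i) * (r (Suc i) * v $ (Suc i))" unfolding coord[OF that] r_F[symmetric] by simp
    then show ?thesis using S_ne[of "n-1" i] that by simp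
  qed
  have prods: "v $ i = (\<Prod>j\<in>{Suc i..<n}. r j)" if "i < n" for i
    using that
  proof (induction "n - 1 - i" arbitrary: i)
    case 0 then have "i = n - 1" "{Suc i..<n} = {}" by auto
    then show ?case using v1 by simp
  next
    case (Suc k)
    then have "Suc i < n" "k = n - 1 - Suc i" by simp_all
    then show ?case using Suc(1)[of "Suc i"] step[of i] prod.atLeast_Suc_lessThan[of "Suc i" n r] by simp
  qed
  show "i < n \<Longrightarrow> v $ i = (\<Prod>j\<in>{Suc i..<n}. r j)" by (rule prods)
  have Ai: "(A *\<^sub>v v) $ i = (T i + r i) * v $ i" if "0 < i" "i < n" for i
    using A_coord[OF V that(2)] that step[of "i - 1"] by (simp add: algebra_simps del: index_mult_mat_vec)
  have BA: "(B *\<^sub>v (A *\<^sub>v v)) $ i = S i * (A *\<^sub>v v) $ i + (F (Suc i) + T (Suc i) * (S (n-1) - S i)) * v $ i" if "i < n" for i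
  proof (cases "Suc i < n")
    case True
    have Asi: "(A *\<^sub>v v) $ (Suc i) = T (Suc i) * v $ (Suc i) + v $ i" using A_coord[OF V True] by simp
    have "F (Suc i) * (A *\<^sub>v v) $ (Suc i) = T (Suc i) * (F (Suc i) * v $ (Suc i)) + F (Suc i) * v $ i" unfolding Asi by (simp add: algebra_simps)
    then show ?thesis using B_coord[OF AV[OF V] that] True unfolding coord[OF True, symmetric] by (simp add: algebra_simps del: index_mult_mat_vec)
  next
    case False
    then have "Suc i = n" "i = n - 1" using that by auto
    then show ?thesis using B_coord[OF AV[OF V] that] F_n by (simp del: index_mult_mat_vec)
  qed
  show "0 < i \<Longrightarrow> i < n \<Longrightarrow> (B *\<^sub>v (A *\<^sub>v v)) $ i = S (n-2) * (A *\<^sub>v v) $ i + c3 * v $ i"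
  proof -
    assume i: "0 < i" "i < n"
    have "(B *\<^sub>v (A *\<^sub>v v)) $ i - (S (n-2) * (A *\<^sub>v v) $ i + c3 * v $ i) 
       = v $ i * ((S i - S (n-2)) * (T i + r i) + F (Suc i) + T (Suc i) * (S (n-1) - S i) - c3)"
      unfolding BA[OF i(2)] Ai[OF i] by (simp add: algebra_simps)
    then show ?thesis unfolding bracket3 by simp
  qed
  have A0: "(A *\<^sub>v v) $ 0 = T 0 * v $ 0 + \<delta>" using A_coord[OF V, of 0] v1 n3 by simp
  have r0: "r 0 * v $ 0 = (\<Prod>j<n. r j)" using prods[of 0] n3 prod.atLeast_Suc_lessThan[of 0 n r] by (simp add: atLeast0LessThan)
  have n0: "0 < n" using n3 by simp
  have "(B *\<^sub>v (A *\<^sub>v v)) $ 0 - (S (n-2) * (A *\<^sub>v v) $ 0 + c3 * v $ 0) 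
       = v $ 0 * ((S 0 - S (n-2)) * (T 0 + r 0) + F (Suc 0) + T (Suc 0) * (S (n-1) - S 0) - c3) + (S 0 - S (n-2)) * (\<delta> - r 0 * v $ 0)"
      unfolding BA[OF n0] A0 by (simp add: algebra_simps)
  then show "(B *\<^sub>v (A *\<^sub>v v)) $ 0 = S (n-2) * (A *\<^sub>v v) $ 0 + c3 * v $ 0 + (S 0 - S (n-2)) * (\<delta> - (\<Prod>j<n. r j))"
    unfolding bracket3 r0 by (simp add: algebra_simps del: index_mult_mat_vec)
qed

lemma reflect_bwd:
  assumes mv: "marginal_vec p n A B (p/m) c v" and v1: "v $ (n-1) = 1"
  shows "D * (N - 1) = E3 - E1" "c = c3"
proof -
  have V: "v \<in> V" and Bv: "B *\<^sub>v v = S (n-1) \<cdot>\<^sub>v v" and BA: "B *\<^sub>v (A *\<^sub>v v) = S (n-2) \<cdot>\<^sub>v (A *\<^sub>v v) + c \<cdot>\<^sub>v v"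
    using mv by (simp_all add: marginal_vec_def th_nu)
  have BAi: "(B *\<^sub>v (A *\<^sub>v v)) $ i = S (n-2) * (A *\<^sub>v v) $ i + c * v $ i" if "i < n" for i
    unfolding BA using that V by (simp del: index_mult_mat_vec)
  show c: "c = c3" using reflect_coords(2)[OF V v1 Bv, of "n-1"] BAi[of "n-1"] n3 v1 by simp
  have "(S 0 - S (n-2)) * (\<delta> - (\<Prod>j<n. r j)) = 0" using reflect_coords(3)[OF V v1 Bv] BAi[of 0] n3 unfolding c by (simp del: index_mult_mat_vec)
  moreover have "S 0 \<noteq> S (n-2)" using S_ne[of 0 "n-2"] n3 by simp
  ultimately have "\<delta> = (\<Prod>j<n. r j)" by simp
  then show "D * (N - 1) = E3 - E1" using D_iff by simp
qed

lemma reflect_fwd: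
  assumes "D * (N - 1) = E3 - E1"
  shows "\<exists>v. marginal_vec p n A B (p/m) c3 v"
proof -
  define v where "v = vec n (\<lambda>i. \<Prod>j\<in>{Suc i..<n}. r j)"
  have V: "v \<in> V" by (simp add: v_def)
  have v1: "v $ (n-1) = 1" using n3 by (simp add: v_def)
  have step: "v $ i = r (Suc i) * v $ (Suc i)" if "Suc i < n" for i
    using that prod.atLeast_Suc_lessThan[of "Suc i" n r] by (simp add: v_def)
  have Bv: "B *\<^sub>v v = S (n-1) \<cdot>\<^sub>v v"
  proof (rule eq_vecI)
    fix i assume "i < dim_vec (S (n-1) \<cdot>\<^sub>v v)"
    then have i: "i < n" using V by simp
    show "(B *\<^sub>v v) $ i = (S (n-1) \<cdot>\<^sub>v v) $ i"
    proof (cases "Suc i < n")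
      case True
      have "F (Suc i) * v $ (Suc i) = (S (n-1) - S i) * v $ i" unfolding r_F[symmetric] step[OF True] by simp
      then show ?thesis using B_coord[OF V i] True i V by (simp add: algebra_simps del: index_mult_mat_vec)
    next
      case False
      then have "i = n - 1" using i by simp
      then show ?thesis using B_coord[OF V i] False i V by (simp del: index_mult_mat_vec)
    qed
  qed (use V in simp)
  have d: "\<delta> = (\<Prod>j<n. r j)" using assms D_iff by simp
  have "B *\<^sub>v (A *\<^sub>v v) = S (n-2) \<cdot>\<^sub>v (A *\<^sub>v v) + c3 \<cdot>\<^sub>v v"
  proof (rule eq_vecI)
    fix i assume "i < dim_vec (S (n-2) \<cdot>\<^sub>v (A *\<^sub>v v) + c3 \<cdot>\<^sub>v v)"
    then have i: "i < n" using V by simp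
    show "(B *\<^sub>v (A *\<^sub>v v)) $ i = (S (n-2) \<cdot>\<^sub>v (A *\<^sub>v v) + c3 \<cdot>\<^sub>v v) $ i"
      using reflect_coords(2,3)[OF V v1 Bv] d i V by (cases "i = 0") (simp_all del: index_mult_mat_vec)
  qed (use V in simp)
  moreover have "v \<noteq> 0\<^sub>v n" using v1 n3 by auto
  ultimately show ?thesis using V Bv unfolding marginal_vec_def th_nu by blast
qed

end
end

section \<open>Irreducibility\<close>

lemma vec_minus_0: "v \<in> carrier_vec n \<Longrightarrow> w \<in> carrier_vec n \<Longrightarrow> v - w = 0\<^sub>v n \<Longrightarrow> v = (w :: 'a::field vec)"
proof -
  assume v: "v \<in> carrier_vec n" and w: "w \<in> carrier_vec n" and z: "v - w = 0\<^sub>v n"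
  show "v = w"
  proof (rule eq_vecI)
    fix i assume "i < dim_vec w"
    then show "v $ i = w $ i" using arg_cong[OF z, of "\<lambda>u. u $ i"] v w by simp
  qed (use v w in simp)
qed

definition irr :: "nat \<Rightarrow> 'a::field mat \<Rightarrow> 'a mat \<Rightarrow> bool" where
  "irr n A B \<longleftrightarrow> (\<forall>U. is_subspace n U \<and> (\<forall>v\<in>U. A *\<^sub>v v \<in> U \<and> B *\<^sub>v v \<in> U) \<longrightarrow> U = {0\<^sub>v n} \<or> U = carrier_vec n)"

lemma iso_irr:
  assumes i: "iso n P Q A B A' B'" and r: "irr n A B" shows "irr n A' B'"
  unfolding irr_def
proof (intro allI impI, elim conjE)
  fix U assume U: "is_subspace n U" "\<forall>v\<in>U. A' *\<^sub>v v \<in> U \<and> B' *\<^sub>v v \<in> U"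
  let ?U = "{v \<in> carrier_vec n. P *\<^sub>v v \<in> U}"
  have "\<forall>v\<in>?U. A *\<^sub>v v \<in> ?U \<and> B *\<^sub>v v \<in> ?U"
    using U(2) isoD(9,10)[OF i] isoD(3,4)[OF i] by (auto simp: mv_carrier)
  then have "?U = {0\<^sub>v n} \<or> ?U = carrier_vec n" using r subspace_preimage[OF U(1) isoD(1)[OF i]] unfolding irr_def by blast
  then show "U = {0\<^sub>v n} \<or> U = carrier_vec n"
  proof
    assume a: "?U = {0\<^sub>v n}"
    have "w = 0\<^sub>v n" if "w \<in> U" for w
    proof -
      have w: "w \<in> carrier_vec n" using that U(1) subspaceD by blast
      have "Q *\<^sub>v w \<in> ?U" using that w isoD(7)[OF i w] isoD(2)[OF i] by (simp add: mv_carrier)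
      then have "Q *\<^sub>v w = 0\<^sub>v n" using a by blast
      then show ?thesis using isoD(7)[OF i w] mv_zero[OF isoD(1)[OF i]] by simp
    qed
    then show ?thesis using subspaceD(2)[OF U(1)] by blast
  next
    assume a: "?U = carrier_vec n"
    have "w \<in> U" if w: "w \<in> carrier_vec n" for w
      using a isoD(7)[OF i w] mv_carrier[OF isoD(2)[OF i] w] by (metis (no_types, lifting) mem_Collect_eq)
    then show ?thesis using subspaceD(1)[OF U(1)] by blast
  qed
qed

context w_module begin

text \<open>Take a vector of least top position k in a nonzero invariant subspace.
  \<open>B v - S k v\<close> and a suitable combination of \<open>B A v\<close>, \<open>A v\<close>
  and \<open>v\<close> have smaller top positions, hence vanish. So \<open>v\<close> is marginal of
  weight m p^k and generates everything.\<close>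

lemma irreducible:
  assumes PM: "irr_quad x1 x2 x3 x4 D"
  shows "irr n A B"
  unfolding irr_def
proof (intro allI impI, elim conjE)
  fix U assume U: "is_subspace n U" and inv: "\<forall>v\<in>U. A *\<^sub>v v \<in> U \<and> B *\<^sub>v v \<in> U"
  show "U = {0\<^sub>v n} \<or> U = carrier_vec n"
  proof (cases "\<forall>v\<in>U. v = 0\<^sub>v n")
    case True then show ?thesis using subspaceD(2)[OF U] by blast
  next
    case False
    then obtain z0 where z0: "z0 \<in> U" "z0 \<noteq> 0\<^sub>v n" by blast
    define Z where "Z k \<longleftrightarrow> k < n \<and> (\<exists>v\<in>U. v $ k \<noteq> 0 \<and> (\<forall>i. k < i \<and> i < n \<longrightarrow> v $ i = 0))" for k
    have UV: "v \<in> U \<Longrightarrow> v \<in> V" for v using subspaceD(1)[OF U] .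
    have Zex: "\<exists>k. Z k \<and> v $ k \<noteq> 0" if "v \<in> U" "v \<noteq> 0\<^sub>v n" for v
      using top_ex[OF UV[OF that(1)] that(2)] that(1) unfolding Z_def by metis
    define k where "k = (LEAST k. Z k)"
    have Zk: "Z k" unfolding k_def using Zex[OF z0] by (metis LeastI)
    have low: "v = 0\<^sub>v n" if v: "v \<in> U" "\<And>i. k \<le> i \<Longrightarrow> i < n \<Longrightarrow> v $ i = 0" for v
    proof (rule ccontr)
      assume "v \<noteq> 0\<^sub>v n"
      then obtain l where "Z l" "v $ l \<noteq> 0" using Zex v by blast
      moreover from this have "l < n" by (simp add: Z_def)
      ultimately have "l < k" using v(2) by (meson not_le)
      then show False using \<open>Z l\<close> not_less_Least[of l Z] unfolding k_def by simp
    qed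
    obtain v0 where v0: "k < n" "v0 \<in> U" "v0 $ k \<noteq> 0" "\<And>i. k < i \<Longrightarrow> i < n \<Longrightarrow> v0 $ i = 0" using Zk unfolding Z_def by blast
    define v where "v = inverse (v0 $ k) \<cdot>\<^sub>v v0"
    have v: "v \<in> U" "v $ k = 1" "\<And>i. k < i \<Longrightarrow> i < n \<Longrightarrow> v $ i = 0"
      using v0 UV[OF v0(2)] subspaceD(4)[OF U] by (auto simp: v_def)
    note V = UV[OF v(1)]
    have AU: "A *\<^sub>v v \<in> U" "B *\<^sub>v v \<in> U" "B *\<^sub>v (A *\<^sub>v v) \<in> U" using inv v by auto
    have Bv0: "B *\<^sub>v v - S k \<cdot>\<^sub>v v = 0\<^sub>v n"
    proof (rule low)
      show "B *\<^sub>v v - S k \<cdot>\<^sub>v v \<in> U" using AU v subspace_minus[OF U] subspaceD(4)[OF U] by blast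
      fix i assume i: "k \<le> i" "i < n"
      then show "(B *\<^sub>v v - S k \<cdot>\<^sub>v v) $ i = 0" using B_coord[OF V i(2)] V v(2,3) by (cases "i = k") (auto simp del: index_mult_mat_vec)
    qed
    have Bv: "B *\<^sub>v v = S k \<cdot>\<^sub>v v" by (rule vec_minus_0[OF BV[OF V] _ Bv0]) (simp add: V)
    define y where "y = B *\<^sub>v (A *\<^sub>v v) - S (Suc k) \<cdot>\<^sub>v (A *\<^sub>v v)"
    have yU: "y \<in> U" using AU subspace_minus[OF U] subspaceD(4)[OF U] unfolding y_def by blast
    have yV: "y \<in> V" using UV[OF yU] .
    have yi: "y $ i = (S i - S (Suc k)) * (A *\<^sub>v v) $ i + (if i + 1 < n then F (i + 1) * (A *\<^sub>v v) $ (i + 1) else 0)" if "i < n" for i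
      using B_coord[OF AV[OF V] that] that V by (auto simp: y_def algebra_simps simp del: index_mult_mat_vec)
    have Ai: "(A *\<^sub>v v) $ i = 0" if "Suc k < i" "i < n" for i using A_coord[OF V that(2)] v(3)[of i] v(3)[of "i - 1"] that by auto
    have y0: "y $ i = 0" if "k < i" "i < n" for i
      using yi[OF that(2)] Ai[of i] Ai[of "Suc i"] that by (cases "i = Suc k") auto
    define c where "c = y $ k"
    have "y - c \<cdot>\<^sub>v v = 0\<^sub>v n"
    proof (rule low)
      show "y - c \<cdot>\<^sub>v v \<in> U" using yU v subspace_minus[OF U] subspaceD(4)[OF U] by blast
      fix i assume i: "k \<le> i" "i < n"
      then show "(y - c \<cdot>\<^sub>v v) $ i = 0" using V yV v(2,3) y0[of i] by (cases "i = k") (auto simp: c_def)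
    qed
    then have "(y - c \<cdot>\<^sub>v v) $ i = 0" if "i < n" for i using that by simp
    then have yc: "y $ i = c * v $ i" if "i < n" for i using that V yV by simp
    have BA: "B *\<^sub>v (A *\<^sub>v v) = S (Suc k) \<cdot>\<^sub>v (A *\<^sub>v v) + c \<cdot>\<^sub>v v"
      by (rule eq_vecI) (use yc V in \<open>auto simp: y_def algebra_simps simp del: index_mult_mat_vec\<close>)
    have "v \<noteq> 0\<^sub>v n" using v(2) v0(1) by auto
    then have "marginal_vec p n A B (m*p^k) c v" unfolding marginal_vec_def th_S using V Bv BA by blast
    then have "gen n A v" using marginal_vec_full[OF _ v0(1) v(2,3) PM] by blast
    then show ?thesis using U inv v(1) unfolding gen_def by blast
  qed
qed

text \<open>The pair makes \<open>F k\<close> zero, so \<open>B\<close> does not descend below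
  position k; with \<delta> = 0 neither does \<open>A\<close>. The vectors supported from k on form
  the submodule.\<close>

lemma reducible:
  assumes x12: "x1 * x2 * p^k = p" "0 < k" "k < n" and d: "\<delta> = 0"
  shows "\<not> irr n A B"
proof
  assume irr: "irr n A B"
  define U where "U = {v \<in> V. \<forall>i<k. v $ i = 0}"
  have Fk: "F k = 0" by (rule shift_F[OF x12(2,3,1)])
  have "is_subspace n U" unfolding is_subspace_def U_def using x12 by auto
  moreover have "A *\<^sub>v v \<in> U \<and> B *\<^sub>v v \<in> U" if "v \<in> U" for v
  proof -
    have v: "v \<in> V" "\<And>i. i < k \<Longrightarrow> v $ i = 0" using that by (auto simp: U_def)
    have "(A *\<^sub>v v) $ i = 0 \<and> (B *\<^sub>v v) $ i = 0" if i: "i < k" for i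
    proof -
      have "F (Suc i) * v $ (Suc i) = 0" using v(2)[of "Suc i"] Fk i by (cases "Suc i = k") auto
      then show ?thesis using A_coord[OF v(1), of i] B_coord[OF v(1), of i] v(2)[of i] v(2)[of "i - 1"] d i x12 by (auto simp del: index_mult_mat_vec)
    qed
    then show ?thesis using v(1) unfolding U_def by simp
  qed
  ultimately have "U = {0\<^sub>v n} \<or> U = V" using irr unfolding irr_def by blast
  moreover have "unit_vec n k \<in> U" "unit_vec n k \<noteq> (0\<^sub>v n :: 'a vec)" using x12 by (auto simp: U_def)
  moreover have "unit_vec n 0 \<notin> U" "unit_vec n 0 \<in> V" using x12 by (auto simp: U_def)
  ultimately show False by blast
qed

lemma delta_0:
  assumes "x1 * x2 * p^k = p" "D = x1^n + x2^n" shows "\<delta> = 0"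
proof -
  have "x2^n = inverse (x1^n)" using pair_powers[OF assms(1)] nz by (metis inverse_unique)
  then have "D - x1^n - inverse (x1^n) = 0" using assms(2) by simp
  then show ?thesis by (simp only: \<delta>_def)
qed

text \<open>For each pair the module is rewritten with that pair in front, where a violated
  condition makes \<delta> vanish.\<close>

lemma irr_irr_quad:
  assumes irr: "irr n A B" shows "irr_quad x1 x2 x3 x4 D"
proof -
  have main: "D \<noteq> y1^n + y2^n" if y: "w_module p n m y1 y2 y3 y4" and e: "y1+y2+y3+y4 = e1" "y1*y2 + y1*y3 + y1*y4 + y2*y3 + y2*y4 + y3*y4 = e2"
     "y1*y2*y3 + y1*y2*y4 + y1*y3*y4 + y2*y3*y4 = e3" and k: "0 < k" "k < n" "y1*y2*p^k = p" for y1 y2 y3 y4 k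
  proof
    assume D: "D = y1^n + y2^n"
    interpret y: w_module p n m y1 y2 y3 y4 D by (rule y)
    obtain P Q where iso: "iso n P Q y.A y.B A B" using perm_iso[OF y e] by blast
    from iso_irr[OF iso_sym[OF iso] irr] y.reducible[OF k(3,1,2) y.delta_0[OF k(3) D]] show False by simp
  qed
  show ?thesis unfolding irr_quad_def
  proof (intro allI impI, elim conjE, intro conjI impI)
    fix k assume k: "0 < k" "k < n"
    show "x1*x2*p^k = p \<Longrightarrow> D \<noteq> x1^n + x2^n" by (rule main[OF w_module_axioms _ _ _ k]) (simp_all add: e_defs algebra_simps)
    show "x1*x3*p^k = p \<Longrightarrow> D \<noteq> x1^n + x3^n" by (rule main[OF w_module_perms(1) _ _ _ k]) (simp_all add: e_defs algebra_simps)
    show "x1*x4*p^k = p \<Longrightarrow> D \<noteq> x1^n + x4^n" by (rule main[OF w_module_perms(2) _ _ _ k]) (simp_all add: e_defs algebra_simps)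
    show "x2*x3*p^k = p \<Longrightarrow> D \<noteq> x2^n + x3^n" by (rule main[OF w_module_perms(3) _ _ _ k]) (simp_all add: e_defs algebra_simps)
    show "x2*x4*p^k = p \<Longrightarrow> D \<noteq> x2^n + x4^n" by (rule main[OF w_module_perms(4) _ _ _ k]) (simp_all add: e_defs algebra_simps)
    show "x3*x4*p^k = p \<Longrightarrow> D \<noteq> x3^n + x4^n" by (rule main[OF w_module_perms(5) _ _ _ k]) (simp_all add: e_defs algebra_simps)
  qed
qed

end

text \<open>An eigenspace of \<open>X\<close> is stable under the commuting family, hence is
  everything.\<close>

lemma schur:
  assumes ac: "alg_closed TYPE('a::field)" and n: "0 < n" and X: "X \<in> carrier_mat n n" and Y: "\<And>Y. Y \<in> YY \<Longrightarrow> Y \<in> carrier_mat n n"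
    and c: "\<And>Y v. Y \<in> YY \<Longrightarrow> v \<in> carrier_vec n \<Longrightarrow> X *\<^sub>v (Y *\<^sub>v v) = Y *\<^sub>v (X *\<^sub>v v)" 
    and irr: "\<And>U. is_subspace n U \<Longrightarrow> (\<And>Y v. Y \<in> YY \<Longrightarrow> v \<in> U \<Longrightarrow> Y *\<^sub>v v \<in> U) \<Longrightarrow> U = {0\<^sub>v n} \<or> U = carrier_vec n"
  shows "\<exists>z::'a. \<forall>v\<in>carrier_vec n. X *\<^sub>v v = z \<cdot>\<^sub>v v"
proof -
  have "degree (char_poly X) \<noteq> 0" using degree_monic_char_poly[OF X] n by simp
  then obtain z where "poly (char_poly X) z = 0" using ac unfolding alg_closed_def by blast
  then have "eigenvalue X z" using eigenvalue_root_char_poly[OF X] by simp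
  then obtain v where v: "v \<in> carrier_vec n" "v \<noteq> 0\<^sub>v n" "X *\<^sub>v v = z \<cdot>\<^sub>v v"
    using X unfolding eigenvalue_def eigenvector_def by auto
  define U where "U = {v \<in> carrier_vec n. X *\<^sub>v v = z \<cdot>\<^sub>v v}"
  have "U = {0\<^sub>v n} \<or> U = carrier_vec n"
  proof (rule irr)
    show "is_subspace n U" unfolding is_subspace_def U_def using X
      by (auto simp: mv_zero mv_add[where n=n] mv_smult[where n=n] smult_add_distrib_vec[of _ n] smult_smult_assoc mult.commute)
    fix Z v assume Z: "Z \<in> YY" and v: "v \<in> U"
    have vc: "v \<in> carrier_vec n" "X *\<^sub>v v = z \<cdot>\<^sub>v v" using v by (simp_all add: U_def)
    show "Z *\<^sub>v v \<in> U" using mv_carrier[OF Y[OF Z] vc(1)] c[OF Z vc(1)] mv_smult[OF Y[OF Z] vc(1)] vc(2) by (simp add: U_def)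
  qed
  moreover have "v \<in> U" using v by (simp add: U_def)
  ultimately have "U = carrier_vec n" using v by auto
  then show ?thesis unfolding U_def by blast
qed

lemma alg_closed_splits:
  assumes ac: "alg_closed TYPE('a::field)" 
  shows "degree (f :: 'a poly) = k \<Longrightarrow> \<exists>xs. length xs = k \<and> f = smult (lead_coeff f) (\<Prod>x\<leftarrow>xs. [:- x, 1:])"
proof (induction k arbitrary: f)
  case 0 
  then obtain c where "f = [:c:]" by (rule degree_eq_zeroE)
  then show ?case by simp
next
  case (Suc k)
  then obtain x where "poly f x = 0" using ac unfolding alg_closed_def by (metis nat.distinct(1))
  then obtain g where g: "f = [:- x, 1:] * g" by (metis dvdE poly_eq_0_iff_dvd)
  have "g \<noteq> 0" using Suc.prems g by auto
  then have dg: "degree g = k" using Suc.prems g degree_mult_eq[of "[:-x,1:]" g] by simp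
  from Suc.IH[OF dg] obtain xs where xs: "length xs = k" "g = smult (lead_coeff g) (\<Prod>x\<leftarrow>xs. [:- x, 1:])" by blast
  have lc: "lead_coeff f = lead_coeff g" unfolding g lead_coeff_mult by simp
  have gg: "g = smult (lead_coeff f) (\<Prod>x\<leftarrow>xs. [:- x, 1:])" unfolding lc by (rule xs(2))
  have "[:- x, 1:] * g = smult (lead_coeff f) (\<Prod>x\<leftarrow>x # xs. [:- x, 1:])" by (subst gg) simp
  then have "f = smult (lead_coeff f) (\<Prod>x\<leftarrow>x # xs. [:- x, 1:])" by (rule trans[OF g])
  then show ?case using xs(1) by (intro exI[of _ "x # xs"]) simp
qed

lemma quartic_roots:
  assumes ac: "alg_closed TYPE('a::field)"
  shows "\<exists>x1 x2 x3 x4 :: 'a. x1 + x2 + x3 + x4 = e1 \<and> x1*x2 + x1*x3 + x1*x4 + x2*x3 + x2*x4 + x3*x4 = e2 \<and>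
    x1*x2*x3 + x1*x2*x4 + x1*x3*x4 + x2*x3*x4 = e3 \<and> x1*x2*x3*x4 = e4"
proof -
  define f where "f = [:e4, - e3, e2, - e1, 1:]"
  have "degree f = 4" by (simp add: f_def)
  then obtain xs where xs: "length xs = 4" "f = smult (lead_coeff f) (\<Prod>x\<leftarrow>xs. [:- x, 1:])" using alg_closed_splits[OF ac] by blast
  obtain x1 x2 x3 x4 where x: "xs = [x1, x2, x3, x4]" using xs(1) by (auto simp: numeral_eq_Suc length_Suc_conv)
  have "lead_coeff f = 1" by (simp add: f_def)
  then have "f = [:- x1, 1:] * ([:- x2, 1:] * ([:- x3, 1:] * [:- x4, 1:]))" using xs(2) x by simp
  then have "e4 = x1*x2*x3*x4 \<and> e3 = x1*x2*x3 + x1*x2*x4 + x1*x3*x4 + x2*x3*x4 \<and> e2 = x1*x2 + x1*x3 + x1*x4 + x2*x3 + x2*x4 + x3*x4 \<and> e1 = x1 + x2 + x3 + x4"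
    unfolding f_def by (simp add: algebra_simps)
  then show ?thesis by metis
qed

section \<open>Recognition by a marginal vector\<close>

lemma annihilating_poly:
  assumes N: "N \<in> carrier_mat n n" and v: "v \<in> carrier_vec n"
  shows "\<exists>f. f \<noteq> 0 \<and> act n N f v = 0\<^sub>v (n :: nat) \<and> (v :: 'a::field vec) = v"
proof -
  define pw where "pw j = ((\<lambda>w. N *\<^sub>v w) ^^ j) v" for j
  have pw: "pw j \<in> carrier_vec n" for j using N v by (induction j) (auto simp: pw_def mv_carrier)
  \<comment> \<open>The n + 1 vectors v, N v, ..., N^n v as columns, padded by a zero row; the
    square matrix is singular and a kernel vector lists the coefficients of the polynomial.\<close>
  define M where "M = mat (Suc n) (Suc n) (\<lambda>(i,j). if i < n then pw j $ i else 0)"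
  have M: "M \<in> carrier_mat (Suc n) (Suc n)" by (simp add: M_def)
  have "transpose_mat M *\<^sub>v unit_vec (Suc n) n = 0\<^sub>v (Suc n)"
    by (rule eq_vecI) (auto simp: M_def scalar_prod_right_unit)
  moreover have "unit_vec (Suc n) n \<noteq> (0\<^sub>v (Suc n) :: 'a vec)" by simp
  ultimately have "det (transpose_mat M) = 0"
    using det_0_iff_vec_prod_zero[of "transpose_mat M" "Suc n"] M unit_vec_carrier by (metis transpose_carrier_mat)
  then have "det M = 0" using det_transpose[OF M] by simp
  then obtain y where y: "y \<in> carrier_vec (Suc n)" "y \<noteq> 0\<^sub>v (Suc n)" "M *\<^sub>v y = 0\<^sub>v (Suc n)"
    using det_0_iff_vec_prod_zero[OF M] by auto
  define f where "f = (\<Sum>j<Suc n. monom (y $ j) j)"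
  have am: "act n N (monom c j) v = c \<cdot>\<^sub>v pw j" for c j
  proof (induction j)
    case 0
    have "monom c 0 = pCons c 0" by (simp add: monom_0)
    then show ?case using N v by (auto simp: act_pCons act_0 mv_0 pw_def)
  next
    case (Suc j)
    have e: "monom c (Suc j) = pCons 0 (monom c j)" by (simp add: monom_Suc)
    have "act n N (monom c (Suc j)) v = 0 \<cdot>\<^sub>v v + N *\<^sub>v (c \<cdot>\<^sub>v pw j)" unfolding e act_pCons[OF N v] Suc ..
    also have "\<dots> = c \<cdot>\<^sub>v pw (Suc j)" using v N pw[of j] mv_smult[OF N pw[of j]] by (auto intro!: eq_vecI simp: pw_def simp del: index_mult_mat_vec)
    finally show ?case .
  qed
  have as: "k \<le> Suc n \<Longrightarrow> i < n \<Longrightarrow> act n N (\<Sum>j<k. monom (y $ j) j) v $ i = (\<Sum>j<k. y $ j * pw j $ i)" for k i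
  proof (induction k)
    case 0 then show ?case using act_0[OF N v] by simp
  next
    case (Suc k)
    then show ?case using carrier_vecD[OF act_carrier[OF N v]] pw[of k] by (simp add: act_add[OF N v] am)
  qed
  have "act n N f v = 0\<^sub>v n"
  proof (rule eq_vecI)
    fix i assume "i < dim_vec (0\<^sub>v n :: 'a vec)"
    then have i: "i < n" by simp
    have "(\<Sum>j<Suc n. pw j $ i * y $ j) = (M *\<^sub>v y) $ i"
      using i y(1) by (simp add: M_def scalar_prod_def atLeast0LessThan)
    also have "\<dots> = 0" unfolding y(3) using i by simp
    finally show "act n N f v $ i = 0\<^sub>v n $ i" using as[of "Suc n" i] i unfolding f_def by (simp add: mult.commute)
  qed (use act_carrier[OF N v] in simp)
  moreover have "f \<noteq> 0"
  proof
    assume "f = 0"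
    have "coeff f j = y $ j" if "j < Suc n" for j
      unfolding f_def coeff_sum coeff_monom using that by (simp add: sum.delta)
    then have "y = 0\<^sub>v (Suc n)" using \<open>f = 0\<close> y(1) by (auto intro!: eq_vecI)
    then show False using y by simp
  qed
  ultimately show ?thesis by blast
qed

text \<open>Linear factors are stripped from an annihilating polynomial; at the first factor whose
  removal leaves a nonzero vector, that vector is an eigenvector, and it stays in
  \<open>U\<close>.\<close>

lemma subspace_eigenvector:
  assumes ac: "alg_closed TYPE('a::field)" and N: "N \<in> carrier_mat n n" and U: "is_subspace n U" "\<And>w. w \<in> U \<Longrightarrow> N *\<^sub>v w \<in> U"
    and v: "v \<in> U" "v \<noteq> 0\<^sub>v n"
  shows "\<exists>w\<in>U. \<exists>z::'a. w \<noteq> 0\<^sub>v n \<and> N *\<^sub>v w = z \<cdot>\<^sub>v w"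
proof -
  have V: "v \<in> carrier_vec n" using subspaceD(1)[OF U(1) v(1)] .
  have actU: "act n N f v \<in> U" for f
  proof (induction f)
    case 0 then show ?case using act_0[OF N V] subspaceD(2)[OF U(1)] by simp
  next
    case (pCons a f) then show ?case unfolding act_pCons[OF N V] using U v subspaceD(3,4)[OF U(1)] by blast
  qed
  have "f \<noteq> 0 \<Longrightarrow> act n N f v = 0\<^sub>v n \<Longrightarrow> ?thesis" for f
  proof (induction "degree f" arbitrary: f rule: less_induct)
    case less
    show ?case
    proof (cases "degree f = 0")
      case True
      then obtain c where c: "f = [:c:]" by (rule degree_eq_zeroE)
      then have "act n N f v = c \<cdot>\<^sub>v v" using N V by (auto simp: act_pCons act_0 mv_0)
      then have "c \<cdot>\<^sub>v v = 0\<^sub>v n" using less by simp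
      moreover have "c \<noteq> 0" using less c by auto
      ultimately have "inverse c \<cdot>\<^sub>v (0\<^sub>v n) = v" by (metis left_inverse one_smult_vec smult_smult_assoc)
      then have "v = 0\<^sub>v n" by auto
      then show ?thesis using v by simp
    next
      case False
      then obtain z where "poly f z = 0" using ac unfolding alg_closed_def by blast
      then obtain g where g: "f = [:- z, 1:] * g" by (metis dvdE poly_eq_0_iff_dvd)
      have g0: "g \<noteq> 0" using less g by auto
      then have dg: "degree g < degree f" using g degree_mult_eq[of "[:-z,1:]" g] by simp
      have gU: "act n N g v \<in> U" by (rule actU)
      have gV: "act n N g v \<in> carrier_vec n" using N V by simp
      show ?thesis
      proof (cases "act n N g v = 0\<^sub>v n")
        case True then show ?thesis using less(1)[OF dg g0] by simp
      next
        case False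
        have z0: "N *\<^sub>v act n N g v - z \<cdot>\<^sub>v act n N g v = 0\<^sub>v n" using less(3) unfolding g act_linear_factor[OF N V] .
        have "N *\<^sub>v act n N g v = z \<cdot>\<^sub>v act n N g v" by (rule vec_minus_0[OF mv_carrier[OF N gV] _ z0]) (simp add: gV)
        then show ?thesis using gU False by blast
      qed
    qed
  qed
  then show ?thesis using annihilating_poly[OF N V] by blast
qed

text \<open>On the eigenspace of \<open>B\<close> for \<tau> the alpha relation reads (B - tp)(B -
  tm) A w = K w. Subtracting it from the marginal condition gives (\<tau> - tm)(B - tp) A v = K v,
  which settles the case of distinct \<tau> and \<open>tm\<close> with the given vector.\<close>

lemma (in pair) marginal_vec_from_marginal:
  assumes ac: "alg_closed TYPE('a)" and r2: "rel p n B A g a" and nu: "\<nu> \<noteq> 0" and v: "v \<in> V" "v \<noteq> 0\<^sub>v n" "B *\<^sub>v v = theta \<nu> 1 \<cdot>\<^sub>v v"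
    and mg: "B *\<^sub>v (B *\<^sub>v (A *\<^sub>v v)) + (theta \<nu> 1 * theta \<nu> p) \<cdot>\<^sub>v (A *\<^sub>v v) = (theta \<nu> 1 + theta \<nu> p) \<cdot>\<^sub>v (B *\<^sub>v (A *\<^sub>v v))"
  shows "\<exists>c v'. marginal_vec p n A B \<nu> c v'"
proof -
  interpret sw: pair n B A p by standard (simp_all add: p0)
  define \<tau> where "\<tau> = theta \<nu> 1"
  define tp where "tp = theta \<nu> p"
  define tm where "tm = theta \<nu> (inverse p)"
  define K where "K = a - (p - 2 + inverse p) * g * \<tau>"
  have ip: "inverse p \<noteq> 0" using p0 by simp
  have t1: "(p + inverse p) * \<tau> = tp + tm"
    using theta_recur[OF p0 nu ip] p0 by (simp add: \<tau>_def tp_def tm_def algebra_simps)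
  have t2: "tp * tm = \<tau>^2 + (p - inverse p)^2"
    using p0 nu by (simp add: \<tau>_def tp_def tm_def theta_def field_simps power2_eq_square)
  have rel: "(B *\<^sub>v (B *\<^sub>v (A *\<^sub>v w))) $ i - (tp + tm) * (B *\<^sub>v (A *\<^sub>v w)) $ i + tp * tm * (A *\<^sub>v w) $ i = K * w $ i"
    if w: "w \<in> V" "B *\<^sub>v w = \<tau> \<cdot>\<^sub>v w" and i: "i < n" for w i
  proof -
    have "(B *\<^sub>v (A *\<^sub>v (B *\<^sub>v w))) $ i = \<tau> * (B *\<^sub>v (A *\<^sub>v w)) $ i" "(A *\<^sub>v (B *\<^sub>v (B *\<^sub>v w))) $ i = \<tau>^2 * (A *\<^sub>v w) $ i" "(B *\<^sub>v w) $ i = \<tau> * w $ i"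
      using w i by (simp_all add: lins power2_eq_square del: index_mult_mat_vec)
    then show ?thesis using sw.relD[OF r2 w(1) i] unfolding t1[symmetric] t2 by (simp add: K_def algebra_simps del: index_mult_mat_vec)
  qed
  have mgi: "(B *\<^sub>v (B *\<^sub>v (A *\<^sub>v v))) $ i = (\<tau> + tp) * (B *\<^sub>v (A *\<^sub>v v)) $ i - \<tau> * tp * (A *\<^sub>v v) $ i" if "i < n" for i
    using arg_cong[OF mg, of "\<lambda>w. w $ i"] v(1) that unfolding \<tau>_def[symmetric] tp_def[symmetric] by (simp add: algebra_simps del: index_mult_mat_vec)
  have key: "(\<tau> - tm) * ((B *\<^sub>v (A *\<^sub>v v)) $ i - tp * (A *\<^sub>v v) $ i) = K * v $ i" if "i < n" for i
    using rel[OF v(1) _ that] v(3) mgi[OF that] unfolding \<tau>_def[symmetric] by (simp add: algebra_simps del: index_mult_mat_vec)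
  show ?thesis
  proof (cases "\<tau> = tm")
    case False
    define c where "c = K / (\<tau> - tm)"
    have "B *\<^sub>v (A *\<^sub>v v) = tp \<cdot>\<^sub>v (A *\<^sub>v v) + c \<cdot>\<^sub>v v"
    proof (rule eq_vecI)
      fix i assume "i < dim_vec (tp \<cdot>\<^sub>v (A *\<^sub>v v) + c \<cdot>\<^sub>v v)"
      then have i: "i < n" using v(1) by simp
      have "(\<tau> - tm) * ((B *\<^sub>v (A *\<^sub>v v)) $ i - tp * (A *\<^sub>v v) $ i) = (\<tau> - tm) * (c * v $ i)" unfolding key[OF i] c_def using False by simp
      then have "(B *\<^sub>v (A *\<^sub>v v)) $ i - tp * (A *\<^sub>v v) $ i = c * v $ i" using False by (metis mult_left_cancel right_minus_eq)
      then show "(B *\<^sub>v (A *\<^sub>v v)) $ i = (tp \<cdot>\<^sub>v (A *\<^sub>v v) + c \<cdot>\<^sub>v v) $ i" using i v(1) by (simp add: algebra_simps del: index_mult_mat_vec)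
    qed (use v in simp)
    then show ?thesis using v unfolding marginal_vec_def tp_def by blast
  next
    case True
    obtain i where i: "i < n" "v $ i \<noteq> 0" using v by (metis carrier_vecD eq_vecI index_zero_vec(1) index_zero_vec(2))
    have K0: "K = 0" using key[OF i(1)] i True by simp
    \<comment> \<open>If \<tau> = \<open>tm\<close>, then K = 0 and (B - tp) A maps the eigenspace
      for \<tau> to itself. An eigenvector of it there is the required vector, possibly different
      from \<open>v\<close>.\<close>
    define N where "N = B * A - tp \<cdot>\<^sub>m A"
    have BA: "B * A \<in> carrier_mat n n" by (rule mult_carrier_mat[OF B A])
    have N: "N \<in> carrier_mat n n" unfolding N_def by (rule minus_carrier_mat[OF smult_carrier_mat[OF A]])
    have Nw: "N *\<^sub>v w = B *\<^sub>v (A *\<^sub>v w) - tp \<cdot>\<^sub>v (A *\<^sub>v w)" if "w \<in> V" for w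
      unfolding N_def minus_mult_distrib_mat_vec[OF BA smult_carrier_mat[OF A] that] mv_smult_mat[OF A that] mv_mult[OF B A that] ..
    define U where "U = {w \<in> V. B *\<^sub>v w = \<tau> \<cdot>\<^sub>v w}"
    have "is_subspace n U" unfolding is_subspace_def U_def
      by (auto simp: mv_zero[OF B] lins smult_add_distrib_vec[of _ n] smult_smult_assoc mult.commute)
    moreover have "N *\<^sub>v w \<in> U" if w: "w \<in> U" for w
    proof -
      have wV: "w \<in> V" "B *\<^sub>v w = \<tau> \<cdot>\<^sub>v w" using w by (auto simp: U_def)
      have NV: "N *\<^sub>v w \<in> V" by (rule mv_carrier[OF N wV(1)])
      have "B *\<^sub>v (N *\<^sub>v w) = \<tau> \<cdot>\<^sub>v (N *\<^sub>v w)"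
      proof (rule eq_vecI)
        fix i assume "i < dim_vec (\<tau> \<cdot>\<^sub>v (N *\<^sub>v w))"
        then have i: "i < n" using N by auto
        show "(B *\<^sub>v (N *\<^sub>v w)) $ i = (\<tau> \<cdot>\<^sub>v (N *\<^sub>v w)) $ i"
          using rel[OF wV i] wV(1) i unfolding K0 Nw[OF wV(1)] True by (simp add: lins algebra_simps del: index_mult_mat_vec)
      qed (use NV N in auto)
      then show ?thesis using NV by (simp add: U_def)
    qed
    moreover have "v \<in> U" using v by (simp add: U_def \<tau>_def)
    ultimately obtain w z where w: "w \<in> U" "w \<noteq> 0\<^sub>v n" "N *\<^sub>v w = z \<cdot>\<^sub>v w" using subspace_eigenvector[OF ac N] v(2) by blast
    have wV: "w \<in> V" "B *\<^sub>v w = \<tau> \<cdot>\<^sub>v w" using w by (auto simp: U_def)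
    have "B *\<^sub>v (A *\<^sub>v w) = tp \<cdot>\<^sub>v (A *\<^sub>v w) + z \<cdot>\<^sub>v w"
    proof (rule eq_vecI)
      fix i assume "i < dim_vec (tp \<cdot>\<^sub>v (A *\<^sub>v w) + z \<cdot>\<^sub>v w)"
      then have i: "i < n" using wV(1) by simp
      show "(B *\<^sub>v (A *\<^sub>v w)) $ i = (tp \<cdot>\<^sub>v (A *\<^sub>v w) + z \<cdot>\<^sub>v w) $ i"
        using arg_cong[OF w(3), of "\<lambda>u. u $ i"] i wV(1) unfolding Nw[OF wV(1)] by (simp add: algebra_simps del: index_mult_mat_vec)
    qed (use wV in simp)
    then show ?thesis using wV w(2) unfolding marginal_vec_def tp_def \<tau>_def by blast
  qed
qed

context root_unity_closed begin

text \<open>The data g, b, c of the given pair prescribe the symmetric functions of the x's, which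
  are then found as roots of a quartic. The relation provides the ladder, and Schur's lemma shows
  that its n-th step is a scalar, which defines D.\<close>

lemma classify:
  assumes AB: "A \<in> carrier_mat n n" "B \<in> carrier_mat n n" and r1: "rel p n A B g b" and mv: "marginal_vec p n A B m c v" and m0: "m \<noteq> 0" and irr: "irr n A B"
  shows "\<exists>x1 x2 x3 x4 D. admissible (m, x1, x2, x3, x4, D) \<and> (x1+x2+x3+x4 + es3 x1 x2 x3 x4 / p) / m = g \<and>
     (\<exists>P Q. iso n P Q (w_module.A p n x1 D) (w_module.B p n m x1 x2 x3 x4) A B)"
proof -
  interpret pair n A B p by standard (use AB p0 in auto)
  have pp: "p + 1 \<noteq> 0" "p - 1 \<noteq> 0" using p2' p1 by (auto simp: add_eq_0_iff2)
  have ipn: "inverse p - 1 \<noteq> 0" using p1 by (metis eq_iff_diff_eq_0 inverse_eq_1_iff)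
  have ipp: "1 + inverse p \<noteq> 0" using pp(1) p0 by (simp add: field_simps)
  \<comment> \<open>\<open>K\<close> is e3 - e1 as read off from c; together with g = (e1 + e3/p)/m
    it gives a linear system with determinant 1 + 1/p, nonzero as p^2 \<noteq> 1. The degree-4
    symmetric function is set to m^2 p.\<close>
  define K where "K = c * m / (inverse p - 1)"
  define e1 where "e1 = (g * m - K / p) / (1 + inverse p)"
  define e3 where "e3 = K + e1"
  define e2 where "e2 = b * m / ((p - inverse p) * (1 - inverse p)) - m^2 - p"
  have "p * (p - inverse p) \<noteq> 0" using p2' p0 by (simp add: right_diff_distrib)
  then have ne2: "(p - inverse p) * (1 - inverse p) \<noteq> 0" using ipn by auto
  have gE: "(e1 + e3 / p) / m = g" 
  proof -
    have "e1 * (1 + inverse p) = g * m - K / p" using ipp by (simp add: e1_def)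
    then show ?thesis unfolding e3_def using m0 p0 by (simp add: field_simps)
  qed
  have cE: "marginal_coeff p m e1 e3 = c" unfolding marginal_coeff_def e3_def K_def using ipn m0 by simp
  have bE: "(p - inverse p) * (1 - inverse p) * (e2 + m^2 + p) / m = b" unfolding e2_def using ne2 m0 by simp
  obtain x1 x2 x3 x4 where x: "x1 + x2 + x3 + x4 = e1" "x1*x2 + x1*x3 + x1*x4 + x2*x3 + x2*x4 + x3*x4 = e2"
    "x1*x2*x3 + x1*x2*x4 + x1*x3*x4 + x2*x3*x4 = e3" "x1*x2*x3*x4 = m^2*p" using quartic_roots[OF ac] by metis
  have xnz: "x1 \<noteq> 0" "x2 \<noteq> 0" "x3 \<noteq> 0" "x4 \<noteq> 0" using x(4) m0 p0 by auto
  have v: "v \<in> V" "v \<noteq> 0\<^sub>v n" using mv by (auto simp: marginal_vec_def)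
  define f where "f = chain p A x1 v"
  have f: "f i \<in> V" for i using v by (simp add: f_def)
  have lad: "ladA p A x1 f" unfolding f_def by (rule chain_ladA[OF A v(1)])
  define u where "u = x2 + x3 + x4"
  define w where "w = x2*x3 + x2*x4 + x3*x4"
  have xw: "m^2 * p / x1 = x2*x3*x4" using x(4) xnz by (simp add: field_simps)
  have ggam: "gam p m x1 u w = g" and bbet: "bet p m x1 u w = b"
    unfolding gam_def bet_def xw gE[symmetric] bE[symmetric] x(1-3)[symmetric] by (simp_all add: u_def w_def algebra_simps)
  have cF: "theta x1 1 * (theta m 1 - theta m p) + varphi p m x1 u w p = c"
    unfolding marginal_coeff[OF p0 m0 xnz(1)] xw cE[symmetric] marginal_coeff_def x(1,3)[symmetric] by (simp add: u_def w_def algebra_simps)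
  have low: "lowB p B m x1 u w f i" for i
  proof (rule low_chain[OF f lad _ m0 xnz(1)])
    show "rel p n A B (gam p m x1 u w) (bet p m x1 u w)" unfolding ggam bbet by (rule r1)
    show "B *\<^sub>v f 0 = theta m 1 \<cdot>\<^sub>v f 0" using mv by (simp add: f_def marginal_vec_def)
    have f1: "f 1 = A *\<^sub>v v - theta x1 1 \<cdot>\<^sub>v v" "f 0 = v" by (simp_all add: f_def chain_Suc)
    have Bv: "B *\<^sub>v v = theta m 1 \<cdot>\<^sub>v v" "B *\<^sub>v (A *\<^sub>v v) = theta m p \<cdot>\<^sub>v (A *\<^sub>v v) + c \<cdot>\<^sub>v v" using mv by (simp_all add: marginal_vec_def)
    show "B *\<^sub>v f 1 = theta m p \<cdot>\<^sub>v f 1 + varphi p m x1 u w p \<cdot>\<^sub>v f 0"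
      unfolding f1 cF[symmetric] using v(1) by (auto intro!: eq_vecI simp: lins Bv cF[symmetric] algebra_simps simp del: index_mult_mat_vec)
  qed
  define T S F where "T i = theta x1 (p^i)" and "S i = theta m (p^i)" and "F i = varphi p m x1 u w (p^i)" for i
  have Af: "A *\<^sub>v f i = T i \<cdot>\<^sub>v f i + f (Suc i)" for i using lad by (simp add: ladA_def T_def)
  have Bf: "B *\<^sub>v f i = S i \<cdot>\<^sub>v f i + F i \<cdot>\<^sub>v f (i - 1)" for i using low[of i] by (simp add: lowB_def S_def F_def)
  have per: "T (n + i) = T i" "S (n + i) = S i" "F (n + i) = F i" for i by (simp_all add: T_def S_def F_def)
  have F0: "F 0 = 0" by (simp add: F_def varphi_def)
  \<comment> \<open>\<open>L\<close> is a polynomial in \<open>A\<close>, so it commutes with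
    \<open>A\<close>. On the ladder it is the index shift by n, and the coefficients of
    \<open>B\<close> have period n, so it commutes with \<open>B\<close> too.\<close>
  define L where "L w = chain p A x1 w n" for w
  have Lf: "L (f i) = f (n + i)" for i
  proof (induction i)
    case 0 then show ?case by (simp add: L_def f_def)
  next
    case (Suc i)
    have "f (Suc i) = A *\<^sub>v f i + (- T i) \<cdot>\<^sub>v f i" unfolding Af using f[of i] f[of "Suc i"] by (auto intro!: eq_vecI)
    then have "L (f (Suc i)) = A *\<^sub>v L (f i) + (- T i) \<cdot>\<^sub>v L (f i)"
      unfolding L_def using f[of i] by (simp add: chain_add[OF A] chain_smult[OF A] chain_comm[OF A])
    also have "\<dots> = f (n + Suc i)" unfolding Suc Af per using f[of "n+i"] f[of "Suc (n+i)"] by (auto intro!: eq_vecI)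
    finally show ?case .
  qed
  have LV: "w \<in> V \<Longrightarrow> L w \<in> V" for w by (simp add: L_def)
  have LB: "L (B *\<^sub>v f i) = B *\<^sub>v L (f i)" for i
  proof -
    have "L (B *\<^sub>v f i) = S i \<cdot>\<^sub>v f (n + i) + F i \<cdot>\<^sub>v f (n + (i - 1))"
      unfolding Bf using f Lf unfolding L_def by (simp add: chain_add[OF A] chain_smult[OF A])
    also have "\<dots> = S (n+i) \<cdot>\<^sub>v f (n + i) + F (n+i) \<cdot>\<^sub>v f (n + i - 1)"
    proof (cases i)
      case 0
      have "dim_vec (f n) = n" "dim_vec (f (n - 1)) = n" using f[of n] f[of "n-1"] by simp_all
      then show ?thesis using 0 per[of 0] F0 by (auto intro!: eq_vecI)
    next
      case (Suc j) then show ?thesis by (simp add: per del: add_Suc_right)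
    qed
    also have "\<dots> = B *\<^sub>v L (f i)" unfolding Lf Bf ..
    finally show ?thesis .
  qed
  \<comment> \<open>The span of the ladder, as the least subspace containing it; irreducibility
    makes it the whole space.\<close>
  define U0 where "U0 = {x \<in> V. \<forall>U. is_subspace n U \<and> (\<forall>i. f i \<in> U) \<longrightarrow> x \<in> U}"
  have sU0: "is_subspace n U0" unfolding U0_def is_subspace_def by auto
  have fU0: "f i \<in> U0" for i using f by (simp add: U0_def)
  have U0min: "is_subspace n U \<Longrightarrow> (\<And>i. f i \<in> U) \<Longrightarrow> U0 \<subseteq> U" for U unfolding U0_def by blast
  have inv: "X *\<^sub>v x \<in> U0" if X: "X \<in> carrier_mat n n" "\<And>i. X *\<^sub>v f i \<in> U0" and x: "x \<in> U0" for X x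
  proof -
    have "U0 \<subseteq> {v \<in> V. X *\<^sub>v v \<in> U0}" by (rule U0min[OF subspace_preimage[OF sU0 X(1)]]) (use f X in auto)
    then show ?thesis using x by blast
  qed
  have AU: "A *\<^sub>v f i \<in> U0" "B *\<^sub>v f i \<in> U0" for i unfolding Af Bf using fU0 subspaceD(3,4)[OF sU0] by blast+
  have "U0 = {0\<^sub>v n} \<or> U0 = V" using irr sU0 inv[OF A AU(1)] inv[OF B AU(2)] unfolding irr_def by blast
  moreover have "v \<in> U0" using fU0[of 0] by (simp add: f_def)
  ultimately have U0V: "U0 = V" using v by blast
  have "is_subspace n {x \<in> V. L (B *\<^sub>v x) = B *\<^sub>v L x}"
    unfolding is_subspace_def
  proof (intro conjI ballI allI)
    have "L (0 \<cdot>\<^sub>v v) = 0 \<cdot>\<^sub>v L v" unfolding L_def using v by (intro chain_smult[OF A])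
    moreover have z: "0 \<cdot>\<^sub>v w = 0\<^sub>v n" if "w \<in> V" for w :: "'a vec" using that by auto
    ultimately have "L (0\<^sub>v n) = 0\<^sub>v n" using v(1) LV[OF v(1)] by simp
    then show "0\<^sub>v n \<in> {x \<in> V. L (B *\<^sub>v x) = B *\<^sub>v L x}" using mv_zero[OF B] by simp
  qed (auto simp: L_def lins chain_add[OF A] chain_smult[OF A])
  then have "V \<subseteq> {x \<in> V. L (B *\<^sub>v x) = B *\<^sub>v L x}" unfolding U0V[symmetric] 
    by (rule U0min) (use f LB U0V in auto)
  then have LBc: "L (B *\<^sub>v x) = B *\<^sub>v L x" if "x \<in> V" for x using that by blast
  define X where "X = mat n n (\<lambda>(i,j). L (unit_vec n j) $ i)"
  have X: "X \<in> carrier_mat n n" by (simp add: X_def)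
  have XL: "X *\<^sub>v x = L x" if x: "x \<in> V" for x
  proof -
    have "is_subspace n {x \<in> V. X *\<^sub>v x = L x}"
      unfolding is_subspace_def
    proof (intro conjI ballI allI)
      have "L (0 \<cdot>\<^sub>v v) = 0 \<cdot>\<^sub>v L v" unfolding L_def using v by (intro chain_smult[OF A])
      moreover have z: "0 \<cdot>\<^sub>v w = 0\<^sub>v n" if "w \<in> V" for w :: "'a vec" using that by auto
      ultimately have "L (0\<^sub>v n) = 0\<^sub>v n" using v(1) LV[OF v(1)] by simp
      then show "0\<^sub>v n \<in> {x \<in> V. X *\<^sub>v x = L x}" using mv_zero[OF X] by simp
    qed (auto simp: L_def chain_add[OF A] chain_smult[OF A] mv_add[OF X] mv_smult[OF X])
    moreover have "X *\<^sub>v unit_vec n j = L (unit_vec n j)" if "j < n" for j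
      by (rule eq_vecI) (use that LV[of "unit_vec n j"] in \<open>auto simp: X_def scalar_prod_right_unit\<close>)
    ultimately have "{x \<in> V. X *\<^sub>v x = L x} = V" by (intro subspace_finite_comb) auto
    then show ?thesis using x by blast
  qed
  have "\<exists>z. \<forall>v\<in>V. X *\<^sub>v v = z \<cdot>\<^sub>v v"
    by (rule schur[OF ac _ X, of "{A, B}"]) (use n3 A B irr LBc LV in \<open>auto simp: XL L_def chain_comm[OF A] irr_def\<close>)
  then obtain z where z: "\<And>v. v \<in> V \<Longrightarrow> L v = z \<cdot>\<^sub>v v" using XL by auto
  define D where "D = z + x1^n + inverse (x1^n)"
  have vl: "admissible (m, x1, x2, x3, x4, D)" using m0 xnz x(4) by (simp add: admissible_def)
  interpret W: w_module p n m x1 x2 x3 x4 D by (rule w_moduleI[OF vl])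
  have Wd: "W.\<delta> = z" "W.gm = g" "W.bt = b" "W.cv = c" 
    unfolding W.\<delta>_def W.gm_def W.bt_def W.cv_def W.e1_def W.e2_def W.e3_def x using gE bE cE by (simp_all add: D_def)
  obtain P where P: "P \<in> carrier_mat n n" "P * W.A = A * P" "P * W.B = B * P" "\<forall>i<n. P *\<^sub>v unit_vec n i = chain p A x1 v i"
    using W.hom_ex[OF A B, of v] r1 mv z[OF v(1)] unfolding Wd L_def by auto
  let ?S = "(\<lambda>v. P *\<^sub>v v) ` V"
  have "is_subspace n ?S" by (rule image_subspace[OF P(1)])
  moreover have "\<forall>w\<in>?S. A *\<^sub>v w \<in> ?S \<and> B *\<^sub>v w \<in> ?S" 
    using hom_mv[OF P(1) W.A_carrier A P(2)] hom_mv[OF P(1) W.B_carrier B P(3)] W.AV W.BV by (metis (no_types, lifting) image_iff)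
  ultimately have "?S = {0\<^sub>v n} \<or> ?S = V" using irr unfolding irr_def by blast
  moreover have "P *\<^sub>v unit_vec n 0 = v" using P(4) n3 by simp
  then have "v \<in> ?S" using unit_vec_carrier by blast
  ultimately have "?S = V" using v(2) by blast
  then have "\<exists>Q. iso n P Q W.A W.B A B" using hom_surj_iso[OF P(1) W.A_carrier W.B_carrier A B P(2,3)] by simp
  then show ?thesis using vl gE unfolding x[symmetric] es3_def by blast
qed

end

section \<open>From matrix pairs to modules\<close>

lemma tmod_iso_iff:
  assumes c: "A \<in> carrier_mat n n" "B \<in> carrier_mat n n" "C \<in> carrier_mat n n" "A' \<in> carrier_mat n n" "B' \<in> carrier_mat n n" "C' \<in> carrier_mat n n"
  shows "tmod_iso n (A, B, C) (A', B', C') \<longleftrightarrow> (\<exists>P Q. iso n P Q A B A' B' \<and> iso n P Q A C A' C')"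
proof
  assume "tmod_iso n (A, B, C) (A', B', C')"
  then obtain P where P: "P \<in> carrier_mat n n" "invertible_mat P" "P * A = A' * P" "P * B = B' * P" "P * C = C' * P"
    unfolding tmod_iso_def by auto
  obtain Q where Q: "inverts_mat P Q" "inverts_mat Q P" using P(2) unfolding invertible_mat_def by blast
  have "dim_col (P * Q) = dim_row P" "dim_row (Q * P) = dim_row Q" "dim_col (Q * P) = dim_row Q" using Q unfolding inverts_mat_def by simp_all
  then have Qc: "Q \<in> carrier_mat n n" using P(1) by (intro carrier_matI) auto
  then have "P * Q = 1\<^sub>m n" "Q * P = 1\<^sub>m n" using Q P(1) unfolding inverts_mat_def by auto
  then have "iso n P Q A B A' B' \<and> iso n P Q A C A' C'" unfolding iso_def using P Qc c by blast
  then show "\<exists>P Q. iso n P Q A B A' B' \<and> iso n P Q A C A' C'" by blast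
next
  assume "\<exists>P Q. iso n P Q A B A' B' \<and> iso n P Q A C A' C'"
  then obtain P Q where i: "iso n P Q A B A' B'" "iso n P Q A C A' C'" by blast
  then have "invertible_mat P" unfolding iso_def by (intro invertible_matI[of P n Q]) auto
  then show "tmod_iso n (A, B, C) (A', B', C')" using i unfolding tmod_iso_def iso_def by auto
qed

definition ccarr :: "nat \<Rightarrow> 'a::field tmod \<Rightarrow> bool" where
  "ccarr n M \<longleftrightarrow> (case M of (A, B, C) \<Rightarrow> A \<in> carrier_mat n n \<and> B \<in> carrier_mat n n \<and> C \<in> carrier_mat n n)"

lemma tmod_ccarr: "is_tmod q n M \<Longrightarrow> ccarr n M"
proof -
  assume t: "is_tmod q n M"
  obtain A B C where M: "M = (A, B, C)" by (cases M)
  show ?thesis using t unfolding M is_tmod_def ccarr_def prod.case by blast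
qed

lemma tmod_iso_refl: "ccarr n M \<Longrightarrow> tmod_iso n M M"
proof -
  assume c: "ccarr n M"
  obtain A B C where M: "M = (A, B, C)" by (cases M)
  have "iso n (1\<^sub>m n) (1\<^sub>m n) X Y X Y" if "X \<in> carrier_mat n n" "Y \<in> carrier_mat n n" for X Y :: "'a mat"
    using that unfolding iso_def by (simp add: left_mult_one_mat[OF that(1)] right_mult_one_mat[OF that(1)] left_mult_one_mat[OF that(2)] right_mult_one_mat[OF that(2)])
  then have "A \<in> carrier_mat n n \<Longrightarrow> B \<in> carrier_mat n n \<Longrightarrow> C \<in> carrier_mat n n \<Longrightarrow> \<exists>P Q. iso n P Q A B A B \<and> iso n P Q A C A C" by blast
  then show ?thesis using c tmod_iso_iff[of A n B C A B C] unfolding M ccarr_def by simp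
qed

lemma tmod_iso_sym: "ccarr n M \<Longrightarrow> ccarr n N \<Longrightarrow> tmod_iso n M N \<Longrightarrow> tmod_iso n N M"
proof -
  assume c: "ccarr n M" "ccarr n N" "tmod_iso n M N"
  obtain A B C A' B' C' where M: "M = (A, B, C)" "N = (A', B', C')" by (cases M, cases N)
  obtain P Q where "iso n P Q A B A' B'" "iso n P Q A C A' C'" using c tmod_iso_iff[of A n B C A' B' C'] unfolding M ccarr_def by auto
  then have "\<exists>P Q. iso n P Q A' B' A B \<and> iso n P Q A' C' A C" using iso_sym by blast
  then show ?thesis using c tmod_iso_iff[of A' n B' C' A B C] unfolding M ccarr_def by simp
qed

lemma tmod_iso_trans: "ccarr n M \<Longrightarrow> ccarr n N \<Longrightarrow> ccarr n K \<Longrightarrow> tmod_iso n M N \<Longrightarrow> tmod_iso n N K \<Longrightarrow> tmod_iso n M K"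
proof -
  assume c: "ccarr n M" "ccarr n N" "ccarr n K" "tmod_iso n M N" "tmod_iso n N K"
  obtain A B C A' B' C' A'' B'' C'' where M: "M = (A, B, C)" "N = (A', B', C')" "K = (A'', B'', C'')" by (cases M, cases N, cases K)
  obtain P Q where P: "iso n P Q A B A' B'" "iso n P Q A C A' C'" using c tmod_iso_iff[of A n B C A' B' C'] unfolding M ccarr_def by auto
  obtain P' Q' where P': "iso n P' Q' A' B' A'' B''" "iso n P' Q' A' C' A'' C''" using c tmod_iso_iff[of A' n B' C' A'' B'' C''] unfolding M ccarr_def by auto
  show ?thesis using c tmod_iso_iff[of A n B C A'' B'' C''] iso_trans[OF P(1) P'(1)] iso_trans[OF P(2) P'(2)] unfolding M ccarr_def by auto
qed

lemma iso_class_eq_iff: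
  assumes "is_tmod q n M" "is_tmod q n N"
  shows "iso_class q n M = iso_class q n N \<longleftrightarrow> tmod_iso n M N"
proof
  assume "iso_class q n M = iso_class q n N"
  moreover have "M \<in> iso_class q n M" unfolding iso_class_def using assms tmod_iso_refl tmod_ccarr by blast
  ultimately show "tmod_iso n M N" unfolding iso_class_def by blast
next
  assume i: "tmod_iso n M N"
  note c = tmod_ccarr[OF assms(1)] tmod_ccarr[OF assms(2)]
  show "iso_class q n M = iso_class q n N" unfolding iso_class_def
    using tmod_iso_trans[OF _ c] tmod_iso_trans[OF _ c(2,1)] i tmod_iso_sym[OF c i] tmod_ccarr by blast
qed

section \<open>Recovering C from the pair (A, B)\<close>

locale qroot = 
  fixes q :: "'a::field" and n :: nat
  assumes q0: "q \<noteq> 0" and q4: "q^4 \<noteq> 1"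
begin

definition kk where "kk = inverse (q^2 - inverse q ^ 2)"

lemma qq: "q^2 - inverse q^2 \<noteq> 0" "q + inverse q \<noteq> 0" "q - inverse q \<noteq> 0"
proof -
  have "q^2 * (q^2 - inverse q^2) = q^4 - 1" using q0 by (simp add: field_simps)
  then show 1: "q^2 - inverse q^2 \<noteq> 0" using q4 by auto
  have "(q + inverse q) * (q - inverse q) = q^2 - inverse q^2" by (simp add: algebra_simps power2_eq_square)
  then show "q + inverse q \<noteq> 0" "q - inverse q \<noteq> 0" using 1 by auto
qed

lemma kk0: "kk \<noteq> 0" using qq by (simp add: kk_def)

text \<open>The only matrix for which the gamma expression of the algebra acts as the scalar
  \<open>g\<close>.\<close>

definition Cg where "Cg g A B = (g / (q + inverse q)) \<cdot>\<^sub>m 1\<^sub>m n - kk \<cdot>\<^sub>m (q \<cdot>\<^sub>m (A * B) - inverse q \<cdot>\<^sub>m (B * A))"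

context
  fixes A B :: "'a mat" assumes A: "A \<in> carrier_mat n n" and B: "B \<in> carrier_mat n n"
begin

lemma comm_carrier: "X \<in> carrier_mat n n \<Longrightarrow> Y \<in> carrier_mat n n \<Longrightarrow> q \<cdot>\<^sub>m (X * Y) - inverse q \<cdot>\<^sub>m (Y * X) \<in> carrier_mat n n"
  by (rule minus_carrier_mat[OF smult_carrier_mat[OF mult_carrier_mat]])

lemma Cg_carrier: "Cg g A B \<in> carrier_mat n n"
  unfolding Cg_def by (rule minus_carrier_mat[OF smult_carrier_mat[OF comm_carrier[OF A B]]])

lemma comm_mv: 
  assumes v: "v \<in> carrier_vec n" and X: "X \<in> carrier_mat n n" and Y: "Y \<in> carrier_mat n n"
  shows "(q \<cdot>\<^sub>m (X * Y) - inverse q \<cdot>\<^sub>m (Y * X)) *\<^sub>v v = q \<cdot>\<^sub>v (X *\<^sub>v (Y *\<^sub>v v)) - inverse q \<cdot>\<^sub>v (Y *\<^sub>v (X *\<^sub>v v))"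
proof -
  note c = mult_carrier_mat[OF X Y] mult_carrier_mat[OF Y X]
  show ?thesis unfolding minus_mult_distrib_mat_vec[OF smult_carrier_mat[OF c(1)] smult_carrier_mat[OF c(2)] v]
    mv_smult_mat[OF c(1) v] mv_smult_mat[OF c(2) v] mv_mult[OF X Y v] mv_mult[OF Y X v] ..
qed

lemma O_mv: 
  assumes v: "v \<in> carrier_vec n" and X: "X \<in> carrier_mat n n" and Y: "Y \<in> carrier_mat n n" and Z: "Z \<in> carrier_mat n n"
  shows "(Z + kk \<cdot>\<^sub>m (q \<cdot>\<^sub>m (X * Y) - inverse q \<cdot>\<^sub>m (Y * X))) *\<^sub>v v = Z *\<^sub>v v + kk \<cdot>\<^sub>v (q \<cdot>\<^sub>v (X *\<^sub>v (Y *\<^sub>v v)) - inverse q \<cdot>\<^sub>v (Y *\<^sub>v (X *\<^sub>v v)))"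
  unfolding add_mult_distrib_mat_vec[OF Z smult_carrier_mat[OF comm_carrier[OF X Y]] v] mv_smult_mat[OF comm_carrier[OF X Y] v] comm_mv[OF v X Y] ..

lemma O_carrier: "X \<in> carrier_mat n n \<Longrightarrow> Y \<in> carrier_mat n n \<Longrightarrow> Z \<in> carrier_mat n n \<Longrightarrow> Z + kk \<cdot>\<^sub>m (q \<cdot>\<^sub>m (X * Y) - inverse q \<cdot>\<^sub>m (Y * X)) \<in> carrier_mat n n"
  by (rule add_carrier_mat[OF smult_carrier_mat[OF comm_carrier]])

lemma Cg_mv: 
  assumes v: "v \<in> carrier_vec n"
  shows "Cg g A B *\<^sub>v v = (g / (q + inverse q)) \<cdot>\<^sub>v v - kk \<cdot>\<^sub>v (q \<cdot>\<^sub>v (A *\<^sub>v (B *\<^sub>v v)) - inverse q \<cdot>\<^sub>v (B *\<^sub>v (A *\<^sub>v v)))"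
  unfolding Cg_def minus_mult_distrib_mat_vec[OF smult_carrier_mat[OF one_carrier_mat] smult_carrier_mat[OF comm_carrier[OF A B]] v]
    mv_smult_mat[OF one_carrier_mat v] mv_smult_mat[OF comm_carrier[OF A B] v] comm_mv[OF v A B] one_mult_mat_vec[OF v] ..

interpretation pair n A B "q^2" by standard (use A B q0 in auto)

lemma Oc_Cg: "v \<in> V \<Longrightarrow> (Cg g A B + kk \<cdot>\<^sub>m (q \<cdot>\<^sub>m (A * B) - inverse q \<cdot>\<^sub>m (B * A))) *\<^sub>v v = (g / (q + inverse q)) \<cdot>\<^sub>v v"
proof -
  assume v: "v \<in> V"
  define X where "X = q \<cdot>\<^sub>v (A *\<^sub>v (B *\<^sub>v v)) - inverse q \<cdot>\<^sub>v (B *\<^sub>v (A *\<^sub>v v))"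
  have "X \<in> V" unfolding X_def using v by simp
  then have "dim_vec X = n" "dim_vec v = n" using v by simp_all
  then show ?thesis unfolding O_mv[OF v A B Cg_carrier] Cg_mv[OF v] X_def[symmetric] by (intro eq_vecI) simp_all
qed

lemma scal: "kk * kk * ((q^2 - 2 + inverse (q^2)) * g) = kk * (q - inverse q) * (g / (q + inverse q))" "kk * kk * (q^2 - inverse (q^2))^2 = 1"
proof -
  define r where "r = inverse q"
  have qr: "q * r = 1" using q0 by (simp add: r_def)
  have k: "kk * ((q + r) * (q - r)) = 1"
  proof -
    have "(q + r) * (q - r) = q^2 - r^2" by (simp add: algebra_simps power2_eq_square)
    then show ?thesis using qq(1) by (simp add: kk_def r_def)
  qed
  have e: "q^2 - 2 + inverse (q^2) = (q - r)^2" "q^2 - inverse (q^2) = (q+r)*(q-r)" using qr 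
    by (simp_all add: r_def power2_eq_square algebra_simps)
  have "kk * (q - r) * (q + r) = 1" using k by (simp add: mult_ac)
  then have "kk * (q - r) = 1 / (q + r)" using qq(2) by (simp add: r_def nonzero_eq_divide_eq)
  then have "kk * (q - r) * g = g / (q + r)" by simp
  have "kk * kk * ((q - r)^2 * g) = kk * (q - r) * (kk * (q - r) * g)" by (simp add: power2_eq_square mult_ac)
  also have "\<dots> = kk * (q - r) * (g / (q + r))" using \<open>kk * (q - r) * g = g / (q + r)\<close> by simp
  finally show "kk * kk * ((q^2 - 2 + inverse (q^2)) * g) = kk * (q - inverse q) * (g / (q + inverse q))" unfolding e r_def .
  show "kk * kk * (q^2 - inverse (q^2))^2 = 1" 
  proof -
    have "kk * kk * (q^2 - inverse (q^2))^2 = (kk * ((q + r) * (q - r)))^2" unfolding e by (simp add: power_mult_distrib power2_eq_square)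
    then show ?thesis unfolding k by simp
  qed
qed

text \<open>Substituting \<open>C\<close> into the second central expression gives the cubic
  expression in \<open>A\<close> and \<open>B\<close> up to the factor \<open>kk * kk\<close>. So
  acting by a scalar is the same as the beta relation.\<close>

lemma Ob_Cg: 
  assumes v: "v \<in> V" and i: "i < n"
  shows "((B + kk \<cdot>\<^sub>m (q \<cdot>\<^sub>m (Cg g A B * A) - inverse q \<cdot>\<^sub>m (A * Cg g A B))) *\<^sub>v v) $ i = kk * kk * (E g b v i + b * v $ i)"
proof -
  define r where "r = inverse q"
  have qr: "q * r = 1" "r * q = 1" using q0 by (simp_all add: r_def)
  have rr: "inverse (q^2) = r * r" by (simp add: r_def power2_eq_square)
  define g0 where "g0 = g / (q + inverse q)"
  have CA: "Cg g A B *\<^sub>v (A *\<^sub>v v) = g0 \<cdot>\<^sub>v (A *\<^sub>v v) - kk \<cdot>\<^sub>v (q \<cdot>\<^sub>v (A *\<^sub>v (B *\<^sub>v (A *\<^sub>v v))) - r \<cdot>\<^sub>v (B *\<^sub>v (A *\<^sub>v (A *\<^sub>v v))))"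
    using Cg_mv[of "A *\<^sub>v v" g] v by (simp add: g0_def r_def)
  have AC: "A *\<^sub>v (Cg g A B *\<^sub>v v) = g0 \<cdot>\<^sub>v (A *\<^sub>v v) - kk \<cdot>\<^sub>v (q \<cdot>\<^sub>v (A *\<^sub>v (A *\<^sub>v (B *\<^sub>v v))) - r \<cdot>\<^sub>v (A *\<^sub>v (B *\<^sub>v (A *\<^sub>v v))))"
    unfolding Cg_mv[OF v] using v by (simp add: lins g0_def r_def)
  define a1 where "a1 = (A *\<^sub>v (B *\<^sub>v (A *\<^sub>v v))) $ i"
  define a2 where "a2 = (B *\<^sub>v (A *\<^sub>v (A *\<^sub>v v))) $ i"
  define a3 where "a3 = (A *\<^sub>v (A *\<^sub>v (B *\<^sub>v v))) $ i"
  define a4 where "a4 = (A *\<^sub>v v) $ i"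
  define a5 where "a5 = (B *\<^sub>v v) $ i"
  have "((B + kk \<cdot>\<^sub>m (q \<cdot>\<^sub>m (Cg g A B * A) - inverse q \<cdot>\<^sub>m (A * Cg g A B))) *\<^sub>v v) $ i
     = a5 + kk * (q * (g0 * a4 - kk * (q * a1 - r * a2)) - r * (g0 * a4 - kk * (q * a3 - r * a1)))"
    unfolding O_mv[OF v Cg_carrier A B] CA AC using i v
    by (simp add: a1_def a2_def a3_def a4_def a5_def r_def del: index_mult_mat_vec)
  also have "\<dots> = a5 + kk * (q - r) * g0 * a4 + kk * kk * ((r*q) * a2 + (r*q) * a3 - (q*q + r*r) * a1)"
    by (simp add: algebra_simps)
  also have "\<dots> = kk * kk * (q^2 - inverse (q^2))^2 * a5 + kk * kk * ((q^2 - 2 + inverse (q^2)) * g) * a4 + kk * kk * (a2 + a3 - (q^2 + inverse (q^2)) * a1)"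
    unfolding scal unfolding qr g0_def r_def[symmetric] rr by (simp add: power2_eq_square)
  also have "\<dots> = kk * kk * (E g b v i + b * v $ i)"
    unfolding E_def a1_def[symmetric] a2_def[symmetric] a3_def[symmetric] a4_def[symmetric] a5_def[symmetric] by (simp add: algebra_simps)
  finally show ?thesis .
qed

text \<open>The same for the first central expression and the alpha relation.\<close>

lemma Oa_Cg: 
  assumes v: "v \<in> V" and i: "i < n"
  shows "((A + kk \<cdot>\<^sub>m (q \<cdot>\<^sub>m (B * Cg g A B) - inverse q \<cdot>\<^sub>m (Cg g A B * B))) *\<^sub>v v) $ i = kk * kk * (E2 g b v i + b * v $ i)"
proof -
  define r where "r = inverse q"
  have qr: "q * r = 1" "r * q = 1" using q0 by (simp_all add: r_def)
  have rr: "inverse (q^2) = r * r" by (simp add: r_def power2_eq_square)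
  define g0 where "g0 = g / (q + inverse q)"
  have CA: "Cg g A B *\<^sub>v (B *\<^sub>v v) = g0 \<cdot>\<^sub>v (B *\<^sub>v v) - kk \<cdot>\<^sub>v (q \<cdot>\<^sub>v (A *\<^sub>v (B *\<^sub>v (B *\<^sub>v v))) - r \<cdot>\<^sub>v (B *\<^sub>v (A *\<^sub>v (B *\<^sub>v v))))"
    using Cg_mv[of "B *\<^sub>v v" g] v by (simp add: g0_def r_def)
  have AC: "B *\<^sub>v (Cg g A B *\<^sub>v v) = g0 \<cdot>\<^sub>v (B *\<^sub>v v) - kk \<cdot>\<^sub>v (q \<cdot>\<^sub>v (B *\<^sub>v (A *\<^sub>v (B *\<^sub>v v))) - r \<cdot>\<^sub>v (B *\<^sub>v (B *\<^sub>v (A *\<^sub>v v))))"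
    unfolding Cg_mv[OF v] using v by (simp add: lins g0_def r_def)
  define a1 where "a1 = (B *\<^sub>v (A *\<^sub>v (B *\<^sub>v v))) $ i"
  define a2 where "a2 = (B *\<^sub>v (B *\<^sub>v (A *\<^sub>v v))) $ i"
  define a3 where "a3 = (A *\<^sub>v (B *\<^sub>v (B *\<^sub>v v))) $ i"
  define a4 where "a4 = (B *\<^sub>v v) $ i"
  define a5 where "a5 = (A *\<^sub>v v) $ i"
  have "((A + kk \<cdot>\<^sub>m (q \<cdot>\<^sub>m (B * Cg g A B) - inverse q \<cdot>\<^sub>m (Cg g A B * B))) *\<^sub>v v) $ i
     = a5 + kk * (q * (g0 * a4 - kk * (q * a1 - r * a2)) - r * (g0 * a4 - kk * (q * a3 - r * a1)))"
    unfolding O_mv[OF v B Cg_carrier A] CA AC using i v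
    by (simp add: a1_def a2_def a3_def a4_def a5_def r_def del: index_mult_mat_vec)
  also have "\<dots> = a5 + kk * (q - r) * g0 * a4 + kk * kk * ((r*q) * a2 + (r*q) * a3 - (q*q + r*r) * a1)"
    by (simp add: algebra_simps)
  also have "\<dots> = kk * kk * (q^2 - inverse (q^2))^2 * a5 + kk * kk * ((q^2 - 2 + inverse (q^2)) * g) * a4 + kk * kk * (a2 + a3 - (q^2 + inverse (q^2)) * a1)"
    unfolding scal unfolding qr g0_def r_def[symmetric] rr by (simp add: power2_eq_square)
  also have "\<dots> = kk * kk * (E2 g b v i + b * v $ i)"
    unfolding E2_def a1_def[symmetric] a2_def[symmetric] a3_def[symmetric] a4_def[symmetric] a5_def[symmetric] by (simp add: algebra_simps)
  finally show ?thesis .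
qed

lemma relI_E: "(\<And>v i. v \<in> V \<Longrightarrow> i < n \<Longrightarrow> E g b v i = 0) \<Longrightarrow> rel (q^2) n A B g b"
  by (rule rel_linear_ext) (metis unit_vec_carrier)

lemma rel_E: "rel (q^2) n A B g b \<Longrightarrow> v \<in> V \<Longrightarrow> i < n \<Longrightarrow> E g b v i = 0" unfolding E_def by (rule relD)

interpretation sw: pair n B A "q^2" by standard (use A B q0 in auto)

lemma rel_E2: "rel (q^2) n B A g b \<Longrightarrow> v \<in> V \<Longrightarrow> i < n \<Longrightarrow> E2 g b v i = 0" unfolding E2_def by (rule sw.relD)

lemma relI_E2: "(\<And>v i. v \<in> V \<Longrightarrow> i < n \<Longrightarrow> E2 g b v i = 0) \<Longrightarrow> rel (q^2) n B A g b"
proof -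
  assume "\<And>v i. v \<in> V \<Longrightarrow> i < n \<Longrightarrow> E2 g b v i = 0"
  moreover have "sw.E g b v i = E2 g b v i" for v i unfolding sw.E_def E2_def ..
  ultimately show ?thesis by (intro sw.rel_linear_ext) (metis unit_vec_carrier)
qed

lemma scalar_comm:
  assumes Z: "Z \<in> carrier_mat n n" and s: "\<And>v. v \<in> V \<Longrightarrow> Z *\<^sub>v v = z \<cdot>\<^sub>v v" and X: "X \<in> carrier_mat n n"
  shows "Z * X = X * Z"
proof (rule mat_eqI_mv[OF mult_carrier_mat[OF Z X] mult_carrier_mat[OF X Z]])
  fix j
  let ?e = "unit_vec n j :: 'a vec"
  have e: "?e \<in> V" by simp
  show "Z * X *\<^sub>v ?e = X * Z *\<^sub>v ?e"
    unfolding mv_mult[OF Z X e] mv_mult[OF X Z e] s[OF e] s[OF mv_carrier[OF X e]] mv_smult[OF X e] ..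
qed

lemma tmod_of_rel:
  assumes r1: "rel (q^2) n A B g b" and r2: "rel (q^2) n B A g a"
  shows "is_tmod q n (A, B, Cg g A B)"
proof -
  note C = Cg_carrier[of g]
  have a: "(A + kk \<cdot>\<^sub>m (q \<cdot>\<^sub>m (B * Cg g A B) - inverse q \<cdot>\<^sub>m (Cg g A B * B))) *\<^sub>v v = (kk*kk*a) \<cdot>\<^sub>v v" if v: "v \<in> V" for v
    by (rule eq_vecI) (use Oa_Cg[OF v, of _ g a] rel_E2[OF r2 v] carrier_vecD[OF v] O_carrier[OF B C A] in \<open>auto simp del: index_mult_mat_vec\<close>)
  have b: "(B + kk \<cdot>\<^sub>m (q \<cdot>\<^sub>m (Cg g A B * A) - inverse q \<cdot>\<^sub>m (A * Cg g A B))) *\<^sub>v v = (kk*kk*b) \<cdot>\<^sub>v v" if v: "v \<in> V" for v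
    by (rule eq_vecI) (use Ob_Cg[OF v, of _ g b] rel_E[OF r1 v] carrier_vecD[OF v] O_carrier[OF C A B] in \<open>auto simp del: index_mult_mat_vec\<close>)
  show ?thesis unfolding is_tmod_def Let_def prod.case kk_def[symmetric]
    using A B C scalar_comm[OF O_carrier[OF B C A] a] scalar_comm[OF O_carrier[OF C A B] b] scalar_comm[OF O_carrier[OF A B C] Oc_Cg]
    by auto
qed

lemma C_from_scalar:
  assumes C: "C \<in> carrier_mat n n" and s: "\<And>v. v \<in> V \<Longrightarrow> (C + kk \<cdot>\<^sub>m (q \<cdot>\<^sub>m (A * B) - inverse q \<cdot>\<^sub>m (B * A))) *\<^sub>v v = z \<cdot>\<^sub>v v"
  shows "C = Cg (z * (q + inverse q)) A B"
proof (rule mat_eqI_mv[OF C Cg_carrier])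
  fix j
  let ?e = "unit_vec n j :: 'a vec"
  have e: "?e \<in> V" by simp
  have z: "z * (q + inverse q) / (q + inverse q) = z" using qq by simp
  have h: "C *\<^sub>v ?e + kk \<cdot>\<^sub>v (q \<cdot>\<^sub>v (A *\<^sub>v (B *\<^sub>v ?e)) - inverse q \<cdot>\<^sub>v (B *\<^sub>v (A *\<^sub>v ?e))) = z \<cdot>\<^sub>v ?e"
    using s[OF e] unfolding O_mv[OF e A B C] .
  have Ce: "C *\<^sub>v ?e \<in> V" by (rule mv_carrier[OF C e])
  show "C *\<^sub>v ?e = Cg (z * (q + inverse q)) A B *\<^sub>v ?e"
    unfolding Cg_mv[OF e] z h[symmetric] using Ce e C by (auto intro!: eq_vecI simp del: index_mult_mat_vec)
qed

end

lemma Cg_iso: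
  assumes i: "iso n P Q A B A' B'"
  shows "iso n P Q A (Cg g A B) A' (Cg g A' B')"
proof -
  note c = isoD(1-6)[OF i]
  have "P * Cg g A B = Cg g A' B' * P"
  proof (rule mat_eqI_mv[OF mult_carrier_mat[OF c(1) Cg_carrier[OF c(3,4)]] mult_carrier_mat[OF Cg_carrier[OF c(5,6)] c(1)]])
    fix j
    let ?e = "unit_vec n j :: 'a vec"
    have e: "?e \<in> carrier_vec n" by simp
    note cc = mv_carrier[OF c(3)] mv_carrier[OF c(4)] mv_carrier[OF c(1) e]
    show "P * Cg g A B *\<^sub>v ?e = Cg g A' B' * P *\<^sub>v ?e"
      unfolding mv_mult[OF c(1) Cg_carrier[OF c(3,4)] e] mv_mult[OF Cg_carrier[OF c(5,6)] c(1) e] Cg_mv[OF c(3,4) e] Cg_mv[OF c(5,6) cc(3)]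
      by (simp add: cc mv_minus[OF c(1)] mv_smult[OF c(1)] isoD(9,10)[OF i])
  qed
  then show ?thesis using i Cg_carrier[OF c(3,4)] Cg_carrier[OF c(5,6)] unfolding iso_def by blast
qed

end

section \<open>Parameters and their symmetries\<close>

context root_unity begin

inductive swap :: "'a \<times> 'a \<times> 'a \<times> 'a \<times> 'a \<times> 'a \<Rightarrow> 'a \<times> 'a \<times> 'a \<times> 'a \<times> 'a \<times> 'a \<Rightarrow> bool" where
  sw12: "swap (m, a, b, c, d, D) (m, b, a, c, d, D)"
| sw23: "swap (m, a, b, c, d, D) (m, a, c, b, d, D)"
| sw34: "swap (m, a, b, c, d, D) (m, a, b, d, c, D)"

lemma swap_link: "swap r r' \<Longrightarrow> link r r'"
  by (cases rule: swap.cases) (auto intro: swap12 swap23 swap34)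

lemma swaps_links: "swap\<^sup>*\<^sup>* r r' \<Longrightarrow> link\<^sup>*\<^sup>* r r'"
  by (induction rule: rtranclp_induct) (auto intro: rtranclp.rtrancl_into_rtrancl swap_link)

definition sym_data :: "'a \<times> 'a \<times> 'a \<times> 'a \<times> 'a \<times> 'a \<Rightarrow> 'a \<times> 'a \<times> 'a \<times> 'a \<times> 'a" where
  "sym_data r = (case r of (m, a, b, c, d, D) \<Rightarrow> (m, a+b+c+d, es2 a b c d, es3 a b c d, D))"

lemma swap_sym_data: "swap r r' \<Longrightarrow> sym_data r = sym_data r'"
  by (cases rule: swap.cases) (auto simp: sym_data_def es2_def es3_def algebra_simps)

lemma swaps_sym_data: "swap\<^sup>*\<^sup>* r r' \<Longrightarrow> sym_data r = sym_data r'"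
  by (induction rule: rtranclp_induct) (auto dest: swap_sym_data)

lemma swap_front:
  "\<exists>b' c' d'. swap\<^sup>*\<^sup>* (m, a, b, c, d, D) (m, a, b', c', d', D)"
  "\<exists>a' c' d'. swap\<^sup>*\<^sup>* (m, a, b, c, d, D) (m, b, a', c', d', D)"
  "\<exists>a' c' d'. swap\<^sup>*\<^sup>* (m, a, b, c, d, D) (m, c, a', c', d', D)"
  "\<exists>a' c' d'. swap\<^sup>*\<^sup>* (m, a, b, c, d, D) (m, d, a', c', d', D)"
proof -
  note t = converse_rtranclp_into_rtranclp[of swap]
  show "\<exists>b' c' d'. swap\<^sup>*\<^sup>* (m, a, b, c, d, D) (m, a, b', c', d', D)" by blast
  show "\<exists>a' c' d'. swap\<^sup>*\<^sup>* (m, a, b, c, d, D) (m, b, a', c', d', D)" by (blast intro: t[OF sw12])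
  show "\<exists>a' c' d'. swap\<^sup>*\<^sup>* (m, a, b, c, d, D) (m, c, a', c', d', D)" by (blast intro: t[OF sw23] t[OF sw12])
  show "\<exists>a' c' d'. swap\<^sup>*\<^sup>* (m, a, b, c, d, D) (m, d, a', c', d', D)" by (blast intro: t[OF sw34] t[OF sw23] t[OF sw12])
qed

lemma swap_front2:
  "\<exists>b' c' d'. swap\<^sup>*\<^sup>* (m, a, b, c, d, D) (m, a, b, c', d', D)"
  "\<exists>c' d'. swap\<^sup>*\<^sup>* (m, a, b, c, d, D) (m, a, c, c', d', D)"
  "\<exists>c' d'. swap\<^sup>*\<^sup>* (m, a, b, c, d, D) (m, a, d, c', d', D)"
proof -
  note t = converse_rtranclp_into_rtranclp[of swap]
  show "\<exists>b' c' d'. swap\<^sup>*\<^sup>* (m, a, b, c, d, D) (m, a, b, c', d', D)" by blast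
  show "\<exists>c' d'. swap\<^sup>*\<^sup>* (m, a, b, c, d, D) (m, a, c, c', d', D)" by (blast intro: t[OF sw23])
  show "\<exists>c' d'. swap\<^sup>*\<^sup>* (m, a, b, c, d, D) (m, a, d, c', d', D)" by (blast intro: t[OF sw34] t[OF sw23])
qed

text \<open>Both tuples list the roots of the same quartic, so a common root can be split off repeatedly.\<close>
lemma sym_data_swaps:
  assumes e: "a+b+c+d = a'+b'+c'+d'" "es2 a b c d = es2 a' b' c' d'" "es3 a b c d = es3 a' b' c' d'" "a*b*c*d = a'*b'*c'*d'"
  shows "swap\<^sup>*\<^sup>* (m, a, b, c, d, D) (m, a', b', c', d', D)"
proof -
  have ex1: "\<exists>b1 c1 d1. swap\<^sup>*\<^sup>* (m, a, b, c, d, D) (m, a', b1, c1, d1, D)"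
  proof -
    have "(a' - a) * (a' - b) * (a' - c) * (a' - d) = a'^4 - (a+b+c+d)*a'^3 + es2 a b c d * a'^2 - es3 a b c d * a' + a*b*c*d"
      unfolding es2_def es3_def by (simp add: algebra_simps eval_nat_numeral)
    also have "\<dots> = (a' - a') * (a' - b') * (a' - c') * (a' - d')"
      unfolding e unfolding es2_def es3_def by (simp add: algebra_simps eval_nat_numeral)
    finally have "a' = a \<or> a' = b \<or> a' = c \<or> a' = d" by simp
    then show ?thesis using swap_front[of m a b c d D] by metis
  qed
  then obtain b1 c1 d1 where s1: "swap\<^sup>*\<^sup>* (m, a, b, c, d, D) (m, a', b1, c1, d1, D)" by blast
  from swaps_sym_data[OF s1] have d1: "a+b+c+d = a'+b1+c1+d1" "es2 a b c d = es2 a' b1 c1 d1" "es3 a b c d = es3 a' b1 c1 d1" by (simp_all add: sym_data_def)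
  have f1: "b1+c1+d1 = b'+c'+d'" using d1(1) e(1) by (simp add: algebra_simps)
  have f2: "b1*c1+b1*d1+c1*d1 = b'*c'+b'*d'+c'*d'"
  proof -
    have "a'*(b1+c1+d1) + (b1*c1+b1*d1+c1*d1) = a'*(b'+c'+d') + (b'*c'+b'*d'+c'*d')" using d1(2) e(2) unfolding es2_def by (simp add: algebra_simps)
    then show ?thesis unfolding f1 by simp
  qed
  have f3: "b1*c1*d1 = b'*c'*d'"
  proof -
    have "a'*(b1*c1+b1*d1+c1*d1) + b1*c1*d1 = a'*(b'*c'+b'*d'+c'*d') + b'*c'*d'" using d1(3) e(3) unfolding es3_def by (simp add: algebra_simps)
    then show ?thesis unfolding f2 by simp
  qed
  have ex2: "\<exists>c2 d2. swap\<^sup>*\<^sup>* (m, a', b1, c1, d1, D) (m, a', b', c2, d2, D)"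
  proof -
    have "(b' - b1) * (b' - c1) * (b' - d1) = b'^3 - (b1+c1+d1)*b'^2 + (b1*c1+b1*d1+c1*d1) * b' - b1*c1*d1"
      by (simp add: algebra_simps eval_nat_numeral)
    also have "\<dots> = (b' - b') * (b' - c') * (b' - d')"
      unfolding f1 f2 f3 by (simp add: algebra_simps eval_nat_numeral)
    finally have "b' = b1 \<or> b' = c1 \<or> b' = d1" by simp
    then show ?thesis using swap_front2[of m a' b1 c1 d1 D] by metis
  qed
  then obtain c2 d2 where s2: "swap\<^sup>*\<^sup>* (m, a', b1, c1, d1, D) (m, a', b', c2, d2, D)" by blast
  from swaps_sym_data[OF s2] have d2: "b1+c1+d1 = b'+c2+d2" "es2 a' b1 c1 d1 = es2 a' b' c2 d2" by (simp_all add: sym_data_def algebra_simps)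
  have g1: "c2 + d2 = c' + d'" using d2(1) f1 by (simp add: algebra_simps)
  have g2: "c2 * d2 = c' * d'"
  proof -
    have "a'*(b'+(c2+d2)) + b'*(c2+d2) + c2*d2 = a'*(b1+c1+d1) + (b1*c1+b1*d1+c1*d1)" using d2(2) unfolding es2_def by (simp add: algebra_simps)
    also have "\<dots> = a'*(b'+(c'+d')) + b'*(c'+d') + c'*d'" unfolding f1 f2 by (simp add: algebra_simps)
    finally show ?thesis unfolding g1 by simp
  qed
  have "(c' - c2) * (c' - d2) = c'^2 - (c2+d2)*c' + c2*d2" by (simp add: algebra_simps eval_nat_numeral)
  also have "\<dots> = 0" unfolding g1 g2 by (simp add: algebra_simps eval_nat_numeral)
  finally have "c' = c2 \<or> c' = d2" by simp
  then have "swap\<^sup>*\<^sup>* (m, a', b', c2, d2, D) (m, a', b', c', d', D)"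
  proof
    assume "c' = c2" then show ?thesis using g1 by simp
  next
    assume "c' = d2" then have "d' = c2" using g1 by (simp add: algebra_simps)
    then show ?thesis using \<open>c' = d2\<close> r_into_rtranclp[of swap, OF sw34] by simp
  qed
  then show ?thesis using s1 s2 by (meson rtranclp_trans)
qed

lemma sym_data_eq_swaps:
  assumes "admissible r" "admissible r'" "sym_data r = sym_data r'" shows "swap\<^sup>*\<^sup>* r r'"
proof -
  obtain m a b c d D m' a' b' c' d' D' where r: "r = (m, a, b, c, d, D)" "r' = (m', a', b', c', d', D')" by (cases r, cases r')
  show ?thesis using assms sym_data_swaps[of a b c d a' b' c' d'] unfolding r sym_data_def admissible_def by auto
qed

lemma links_admissible: "link\<^sup>*\<^sup>* r r' \<Longrightarrow> admissible r \<Longrightarrow> admissible r'"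
  by (induction rule: rtranclp_induct) (auto intro: link_admissible)

end

section \<open>The change of coordinates from (a, b, c, lambda, delta) to (m, x1, x2, x3, x4,
  D)\<close>

locale aw_setting =
  fixes q :: "'a::field" and d :: nat and sr :: "'a \<Rightarrow> 'a"
  assumes ac: "alg_closed TYPE('a)" and ord: "root_of_unity_order q d" and d: "d \<notin> {1, 2, 4}" and sr: "\<forall>x. sr x ^ 2 = x"
begin

definition p where "p = q^2"
definition n where "n = dprime d"

lemma p_square: "p = q * q" by (simp add: p_def power2_eq_square)

lemma dpos: "0 < d" and qd: "q^d = 1" and qk: "0 < k \<Longrightarrow> k < d \<Longrightarrow> q^k \<noteq> 1"
  using ord by (auto simp: root_of_unity_order_def)

lemma qpow1: "q^k = 1 \<Longrightarrow> d dvd k"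
proof -
  assume k: "q^k = 1"
  have "q^k = (q^d)^(k div d) * q^(k mod d)" by (simp add: power_mult[symmetric] power_add[symmetric])
  then have "q^(k mod d) = 1" using k qd by simp
  then have "k mod d = 0" using qk[of "k mod d"] dpos by (metis gr0I mod_less_divisor)
  then show ?thesis by auto
qed

lemma q0: "q \<noteq> 0" using qd dpos by (metis power_0_left not_gr_zero zero_neq_one)

lemma n_cases: "(even d \<and> d = 2 * n) \<or> (odd d \<and> d = n)"
  by (auto simp: n_def dprime_def)

text \<open>The square of q has order exactly d', and excluding 1, 2 and 4 leaves d' at least
  3.\<close>

sublocale root_unity_closed p n
proof
  show "n \<ge> 3" using n_cases d dpos by auto
  have "p^n = (q^n)^2" "p^n = q^(2*n)" by (simp_all add: p_def power_mult[symmetric] mult.commute)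
  then show "p^n = 1" using n_cases qd by auto
  fix k assume k: "0 < k" "k < n"
  show "p^k \<noteq> 1"
  proof
    assume "p^k = 1"
    then have "d dvd 2 * k" using qpow1 by (simp add: p_def power_mult[symmetric])
    then show False using n_cases
    proof (elim disjE conjE)
      assume "d dvd 2 * k" "even d" "d = 2 * n"
      then have "n dvd k" using dvd_times_left_cancel_iff[of 2 n k] by fastforce
      then show False using k by (auto dest: dvd_imp_le)
    next
      assume "d dvd 2 * k" "odd d" "d = n"
      then have "n dvd k" by (metis coprime_dvd_mult_right_iff coprime_right_2_iff_odd)
      then show False using k by (auto dest: dvd_imp_le)
    qed
  qed
qed (rule ac)

lemma q4: "q^4 \<noteq> 1" using p2 by (simp add: p_def power_mult[symmetric])

sublocale qroot q n by standard (use q0 q4 in auto)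

fun params :: "'a \<times> 'a \<times> 'a \<times> 'a \<times> 'a \<Rightarrow> 'a \<times> 'a \<times> 'a \<times> 'a \<times> 'a \<times> 'a" where
  "params (a, b, c, l, \<delta>) = (b/l, a/l, 1/(a*l), b*c*q, b*q/c, \<delta> + (a/l)^n + inverse ((a/l)^n))"

lemma nz5_iff: "nz5 (a, b, c, l, \<delta>) \<longleftrightarrow> a \<noteq> 0 \<and> b \<noteq> 0 \<and> c \<noteq> 0 \<and> l \<noteq> 0" by (simp add: nz5_def nz4_def)

lemma params_admissible: "nz5 x \<Longrightarrow> admissible (params x)"
proof -
  assume nz: "nz5 x"
  obtain a b c l \<delta> where x: "x = (a, b, c, l, \<delta>)" by (cases x)
  have "(a/l) * (1/(a*l)) * (b*c*q) * (b*q/c) = (b/l)^2 * p" using nz unfolding p_square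
    by (simp add: x nz5_iff divide_simps power2_eq_square)
  then show ?thesis using nz by (simp add: admissible_def x nz5_iff q0)
qed

lemma inv_delta_par: "nz5 x \<Longrightarrow> params x = (m, x1, x2, x3, x4, D) \<Longrightarrow> inv_delta n x = D"
  by (cases x) (auto simp: nz5_iff inv_delta_def power_divide power_inverse divide_inverse power_mult_distrib)

text \<open>Since x1 x2 = 1/lambda^2, a square root gives lambda; then a, b, c come from x1, m, x3,
  and the product constraint yields x4.\<close>

lemma lift: assumes "admissible r" shows "\<exists>x. nz5 x \<and> params x = r"
proof -
  obtain m x1 x2 x3 x4 D where r: "r = (m, x1, x2, x3, x4, D)" by (cases r)
  have v: "m \<noteq> 0" "x1 \<noteq> 0" "x2 \<noteq> 0" "x3 \<noteq> 0" "x4 \<noteq> 0" "x1*x2*x3*x4 = m^2*p" using assms by (auto simp: r admissible_def)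
  define l where "l = sr (1/(x1*x2))"
  have l2: "l^2 = 1/(x1*x2)" using sr by (simp add: l_def)
  have l0: "l \<noteq> 0" using l2 v by auto
  define x where "x = (x1*l, m*l, x3/(m*l*q), l, D - x1^n - inverse (x1^n))"
  have "nz5 x" using v l0 q0 by (simp add: x_def nz5_iff)
  moreover have "params x = r"
  proof -
    have 1: "m*l*q/(x3/(m*l*q)) = x4"
    proof -
      have "m*l*q/(x3/(m*l*q)) = m^2 * l^2 * q^2 / x3" using v l0 q0 by (simp add: field_simps power2_eq_square)
      also have "\<dots> = (m^2 * p) / (x1*x2*x3)" unfolding l2 p_def by simp
      also have "\<dots> = x4" unfolding v(6)[symmetric] using v(2-5) by simp
      finally show ?thesis .
    qed
    have 2: "1/(x1*l*l) = x2" 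
    proof -
      have "1/(x1*l*l) = 1/(x1*l^2)" by (simp add: power2_eq_square mult.assoc)
      then show ?thesis unfolding l2 using v by simp
    qed
    show ?thesis unfolding x_def r params.simps 1 2 using v l0 q0 by simp
  qed
  ultimately show ?thesis by blast
qed

definition params4 :: "'a \<times> 'a \<times> 'a \<times> 'a \<Rightarrow> 'a \<times> 'a \<times> 'a \<times> 'a \<times> 'a" where
  "params4 y = (case y of (a, b, c, l) \<Rightarrow> (b/l, a/l, 1/(a*l), b*c*q, b*q/c))"

definition sym_data4 where "sym_data4 y = (case params4 y of (m, a, b, c, d) \<Rightarrow> (m, a+b+c+d, es2 a b c d, es3 a b c d))"

text \<open>In the new coordinates the sign change is invisible, and the three transpositions
  exchange x3 with x4, x1 with x2, and x2 with x3.\<close>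

lemma s4_step_sym_data4: 
  assumes y: "nz4 y" and s: "s4_step sr q y z" shows "sym_data4 y = sym_data4 z"
proof -
  obtain a b c l where yy: "y = (a, b, c, l)" by (cases y)
  have nz: "a \<noteq> 0" "b \<noteq> 0" "c \<noteq> 0" "l \<noteq> 0" using y by (auto simp: yy nz4_def)
  define s where "s = sr (a * b * c * l * q)"
  have s2: "s * s = a * b * c * l * q" using sr by (simp add: s_def power2_eq_square)
  have s0: "s \<noteq> 0" using s2 nz q0 by auto
  consider "z = (-a, -b, -c, -l)" | "z = (a, b, inverse c, l)" | "z = (inverse a, b, c, l)" | "z = (a/s, b/s, c/s, l/s)"
    using s unfolding yy s4_step_def Let_def s_def by auto
  then show ?thesis
  proof cases
    case 1 then show ?thesis by (simp add: yy sym_data4_def params4_def)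
  next
    case 2
    have "b * inverse c * q = b*q/c" "b * q / inverse c = b*c*q" using nz by (simp_all add: field_simps)
    then show ?thesis unfolding 2 yy by (simp add: sym_data4_def params4_def es2_def es3_def algebra_simps)
  next
    case 3
    have "inverse a / l = 1/(a*l)" "1 / (inverse a * l) = a/l" using nz by (simp_all add: field_simps)
    then show ?thesis unfolding 3 yy by (simp add: sym_data4_def params4_def es2_def es3_def algebra_simps)
  next
    case 4
    have "1/((a/s)*(l/s)) = s*s/(a*l)" using s0 by simp
    also have "\<dots> = b*c*q" unfolding s2 using nz by simp
    finally have x2: "1/((a/s)*(l/s)) = b*c*q" .
    have "b/s*(c/s)*q = b*c*q/(s*s)" by simp
    also have "\<dots> = 1/(a*l)" unfolding s2 using nz q0 by simp
    finally have x3: "b/s*(c/s)*q = 1/(a*l)" .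
    have x: "(b/s)/(l/s) = b/l" "(a/s)/(l/s) = a/l" "(b/s)*q/(c/s) = b*q/c" using s0 by simp_all
    show ?thesis unfolding 4 yy sym_data4_def params4_def prod.case x2 x3 x by (simp add: es2_def es3_def algebra_simps)
  qed
qed

lemma approx4_sym_data4: "approx4 sr q y z \<Longrightarrow> sym_data4 y = sym_data4 z"
  unfolding approx4_def
proof (elim conjE)
  assume "(\<lambda>u v. nz4 u \<and> nz4 v \<and> (s4_step sr q u v \<or> s4_step sr q v u))\<^sup>*\<^sup>* y z"
  then show ?thesis by (induction rule: rtranclp_induct) (auto dest: s4_step_sym_data4)
qed

lemma approx4_step: "nz4 y \<Longrightarrow> nz4 z \<Longrightarrow> s4_step sr q y z \<Longrightarrow> approx4 sr q y z"
  unfolding approx4_def by (auto intro!: r_into_rtranclp)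

text \<open>The coordinates determine lambda^2 and the ratios to lambda, so only a common sign is
  lost, and the action of {+1, -1} accounts for it.\<close>

lemma params4_inj:
  assumes "nz4 y" "nz4 z" "params4 y = params4 z"
  shows "approx4 sr q y z"
proof -
  obtain a b c l a' b' c' l' where yz: "y = (a, b, c, l)" "z = (a', b', c', l')" by (cases y, cases z)
  have nz: "a \<noteq> 0" "b \<noteq> 0" "c \<noteq> 0" "l \<noteq> 0" "a' \<noteq> 0" "b' \<noteq> 0" "c' \<noteq> 0" "l' \<noteq> 0" using assms by (auto simp: yz nz4_def)
  have e: "b/l = b'/l'" "a/l = a'/l'" "1/(a*l) = 1/(a'*l')" "b*c*q = b'*c'*q" using assms(3) by (auto simp: yz params4_def)
  have "1/(a*l) = 1/((a/l)*l^2)" "1/(a'*l') = 1/((a'/l')*l'^2)" using nz by (simp_all add: power2_eq_square)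
  then have "(a/l) * l^2 = (a/l)*l'^2" using e(2,3) nz by (simp add: field_simps)
  then have "l^2 = l'^2" using nz by simp
  then have "l' = l \<or> l' = - l" by (auto simp: power2_eq_iff)
  then have "z = y \<or> z = (-a, -b, -c, -l)"
  proof
    assume l: "l' = l"
    then have "a' = a" "b' = b" using e nz by (simp_all add: field_simps)
    then show ?thesis using e(4) l q0 nz by (simp add: yz)
  next
    assume l: "l' = - l"
    then have ab: "a' = - a" "b' = - b" using e nz by (simp_all add: field_simps)
    have "(b*q) * c = (b*q) * (-c')" using e(4) unfolding ab by (simp add: mult_ac)
    then have "c = - c'" using q0 nz(2) mult_left_cancel[of "b*q" c "-c'"] by simp
    then show ?thesis using l ab by (simp add: yz)
  qed
  then show ?thesis
  proof
    assume "z = y" then show ?thesis using assms(1) unfolding approx4_def by simp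
  next
    assume z: "z = (-a, -b, -c, -l)"
    have "s4_step sr q y z" unfolding z yz(1) s4_step_def by simp
    then show ?thesis using approx4_step assms by blast
  qed
qed

lemma approx4_trans: "approx4 sr q x y \<Longrightarrow> approx4 sr q y z \<Longrightarrow> approx4 sr q x z"
  unfolding approx4_def by auto

fun drop_delta where "drop_delta (a, b, c, l, \<delta>) = (a, b, c, l)"
fun params5 where "params5 (m, x1, x2, x3, x4, D) = (m, x1, x2, x3, x4)"

lemma params4_params: "params5 (params x) = params4 (drop_delta x)" by (cases x) (simp add: params4_def)

lemma nz5_nz4: "nz5 x = nz4 (drop_delta x)" by (cases x) (simp add: nz5_def)

lemma swap_approx: 
  assumes s: "swap (params x) (params y)" and nz: "nz5 x" "nz5 y"
  shows "approx4 sr q (drop_delta x) (drop_delta y)"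
proof -
  obtain a b c l \<delta> where x: "x = (a, b, c, l, \<delta>)" by (cases x)
  have nzx: "a \<noteq> 0" "b \<noteq> 0" "c \<noteq> 0" "l \<noteq> 0" using nz by (auto simp: x nz5_iff)
  define m x1 x2 x3 x4 where par: "m = b/l" "x1 = a/l" "x2 = 1/(a*l)" "x3 = b*c*q" "x4 = b*q/c"
  have px: "params4 (a, b, c, l) = (m, x1, x2, x3, x4)" by (simp add: params4_def par)
  have "params4 (drop_delta y) = (m, x2, x1, x3, x4) \<or> params4 (drop_delta y) = (m, x1, x3, x2, x4) \<or> params4 (drop_delta y) = (m, x1, x2, x4, x3)"
    using s unfolding params4_params[symmetric] x params.simps par[symmetric] by (cases rule: swap.cases) (metis params5.simps)+
  moreover have "\<exists>z. nz4 z \<and> s4_step sr q (a, b, c, l) z \<and> params4 z = (m, x2, x1, x3, x4)"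
    by (rule exI[of _ "(inverse a, b, c, l)"]) (use nzx in \<open>auto simp: nz4_def s4_step_def params4_def par field_simps\<close>)
  moreover have "\<exists>z. nz4 z \<and> s4_step sr q (a, b, c, l) z \<and> params4 z = (m, x1, x2, x4, x3)"
    by (rule exI[of _ "(a, b, inverse c, l)"]) (use nzx in \<open>auto simp: nz4_def s4_step_def params4_def par field_simps\<close>)
  moreover have "\<exists>z. nz4 z \<and> s4_step sr q (a, b, c, l) z \<and> params4 z = (m, x1, x3, x2, x4)"
  proof -
    define s where "s = sr (a * b * c * l * q)"
    have s2: "s * s = a * b * c * l * q" using sr by (simp add: s_def power2_eq_square)
    have s0: "s \<noteq> 0" using s2 nzx q0 by auto
    have "1/((a/s)*(l/s)) = s*s/(a*l)" using s0 by simp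
    also have "\<dots> = b*c*q" unfolding s2 using nzx by simp
    finally have x2: "1/((a/s)*(l/s)) = b*c*q" .
    have "b/s*(c/s)*q = b*c*q/(s*s)" by simp
    also have "\<dots> = 1/(a*l)" unfolding s2 using nzx q0 by simp
    finally have x3: "b/s*(c/s)*q = 1/(a*l)" .
    have x: "(b/s)/(l/s) = b/l" "(a/s)/(l/s) = a/l" "(b/s)*q/(c/s) = b*q/c" using s0 by simp_all
    have "params4 (a/s, b/s, c/s, l/s) = (m, x1, x3, x2, x4)" unfolding params4_def prod.case x2 x3 x par ..
    moreover have "nz4 (a/s, b/s, c/s, l/s)" using nzx s0 by (simp add: nz4_def)
    moreover have "s4_step sr q (a, b, c, l) (a/s, b/s, c/s, l/s)" by (simp add: s4_step_def s_def Let_def)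
    ultimately show ?thesis by blast
  qed
  ultimately obtain z where z: "nz4 z" "s4_step sr q (a, b, c, l) z" "params4 z = params4 (drop_delta y)" by metis
  have nzd: "nz4 (a, b, c, l)" using nzx by (simp add: nz4_def)
  show ?thesis unfolding x drop_delta.simps
    using approx4_trans[OF approx4_step[OF nzd z(1,2)] params4_inj[OF z(1) _ z(3)]] nz by (simp add: nz5_nz4)
qed

lemma swaps_approx:
  assumes "swap\<^sup>*\<^sup>* (params x) r" and "nz5 x" and "nz5 y" "params y = r"
  shows "approx4 sr q (drop_delta x) (drop_delta y)"
  using assms
proof (induction arbitrary: y rule: rtranclp_induct)
  case base then show ?case by (intro params4_inj) (auto simp: nz5_nz4 params4_params[symmetric])
next
  case (step r' r'')
  have "admissible r'" using step(1,4) params_admissible links_admissible by (metis step.hyps(1) swaps_links)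
  then obtain z where z: "nz5 z" "params z = r'" using lift by blast
  have "approx4 sr q (drop_delta x) (drop_delta z)" using step.IH[OF _ z] step by blast
  moreover have "approx4 sr q (drop_delta z) (drop_delta y)" using swap_approx[of z y] step z by simp
  ultimately show ?case by (rule approx4_trans)
qed

lemma sym_data_sym_data4: "nz5 x \<Longrightarrow> sym_data (params x) = sym_data (params y) \<longleftrightarrow> sym_data4 (drop_delta x) = sym_data4 (drop_delta y) \<and> snd (snd (snd (snd (snd (params x))))) = snd (snd (snd (snd (snd (params y)))))"
  by (cases x; cases y) (auto simp: sym_data_def sym_data4_def params4_def)

text \<open>Equal symmetric functions mean equal quadruples up to order, and every transposition of
  neighbours lifts to a generator of the group action. So this equivalence is decided by the
  symmetric data.\<close>

lemma simeq_pm_iff: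
  assumes "nz5 x" "nz5 y"
  shows "simeq_pmS4 sr q d x y \<longleftrightarrow> sym_data (params x) = sym_data (params y)"
proof -
  have inv: "inv_delta (dprime d) z = snd (snd (snd (snd (snd (params z)))))" if "nz5 z" for z
  proof -
    obtain m x1 x2 x3 x4 D where "params z = (m, x1, x2, x3, x4, D)" by (cases "params z")
    then show ?thesis using inv_delta_par[OF that] by (simp add: n_def)
  qed
  have s: "simeq_pmS4 sr q d x y \<longleftrightarrow> approx4 sr q (drop_delta x) (drop_delta y) \<and> inv_delta (dprime d) x = inv_delta (dprime d) y"
    by (cases x; cases y) (simp add: simeq_pmS4_def)
  show ?thesis
  proof
    assume "simeq_pmS4 sr q d x y"
    then show "sym_data (params x) = sym_data (params y)" unfolding s inv[OF assms(1)] inv[OF assms(2)] sym_data_sym_data4[OF assms(1)] using approx4_sym_data4 by blast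
  next
    assume dd: "sym_data (params x) = sym_data (params y)"
    from sym_data_eq_swaps[OF params_admissible[OF assms(1)] params_admissible[OF assms(2)] dd] swaps_approx assms
    have "approx4 sr q (drop_delta x) (drop_delta y)" by blast
    then show "simeq_pmS4 sr q d x y" unfolding s inv[OF assms(1)] inv[OF assms(2)] using dd sym_data_sym_data4[OF assms(1)] by blast
  qed
qed

end

section \<open>Invariants of isomorphism\<close>

lemma iso_rel:
  assumes i: "iso n P Q A B A' B'" and r: "rel p n A B g b" shows "rel p n A' B' g b"
  unfolding rel_def
proof
  fix v :: "'a vec" assume v: "v \<in> carrier_vec n"
  note d = isoD[OF i]
  define w where "w = Q *\<^sub>v v"
  have w: "w \<in> carrier_vec n" using mv_carrier[OF d(2) v] by (simp add: w_def)
  have vw: "v = P *\<^sub>v w" using d(7)[OF v] by (simp add: w_def)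
  have c: "x \<in> carrier_vec n \<Longrightarrow> A *\<^sub>v x \<in> carrier_vec n" "x \<in> carrier_vec n \<Longrightarrow> B *\<^sub>v x \<in> carrier_vec n" for x
    using mv_carrier d by blast+
  have "P *\<^sub>v (A *\<^sub>v (A *\<^sub>v (B *\<^sub>v w)) - (p + inverse p) \<cdot>\<^sub>v (A *\<^sub>v (B *\<^sub>v (A *\<^sub>v w))) + B *\<^sub>v (A *\<^sub>v (A *\<^sub>v w))
       + (p - inverse p)^2 \<cdot>\<^sub>v (B *\<^sub>v w) + ((p - 2 + inverse p) * g) \<cdot>\<^sub>v (A *\<^sub>v w)) = P *\<^sub>v (b \<cdot>\<^sub>v w)"
    using r w unfolding rel_def by simp
  then show "A' *\<^sub>v (A' *\<^sub>v (B' *\<^sub>v v)) - (p + inverse p) \<cdot>\<^sub>v (A' *\<^sub>v (B' *\<^sub>v (A' *\<^sub>v v))) + B' *\<^sub>v (A' *\<^sub>v (A' *\<^sub>v v))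
       + (p - inverse p)^2 \<cdot>\<^sub>v (B' *\<^sub>v v) + ((p - 2 + inverse p) * g) \<cdot>\<^sub>v (A' *\<^sub>v v) = b \<cdot>\<^sub>v v"
    unfolding vw by (simp add: mv_add[OF d(1)] mv_minus[OF d(1)] mv_smult[OF d(1)] c w d(9,10) del: index_mult_mat_vec)
qed

lemma hom_chain:
  assumes P: "P \<in> carrier_mat n n" and A: "A \<in> carrier_mat n n" "A' \<in> carrier_mat n n" and h: "P * A = A' * P" and v: "v \<in> carrier_vec n"
  shows "P *\<^sub>v chain p A x v i = chain p A' x (P *\<^sub>v (v :: 'a::field vec)) i"
proof (induction i)
  case (Suc i)
  have c: "chain p A x v i \<in> carrier_vec n" using A v by simp
  have c': "theta x (p^i) \<cdot>\<^sub>v chain p A x v i \<in> carrier_vec n" using c by simp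
  show ?case unfolding chain_Suc Suc[symmetric] mv_minus[OF P mv_carrier[OF A(1) c] c'] 
      mv_smult[OF P c] hom_mv[OF P A h c] by (rule refl)
qed simp

context w_module begin

lemma A_0_1: "(A *\<^sub>v unit_vec n 0) $ 1 = 1"
  using A_unit[of 0] n3 by (simp add: eb_less del: index_mult_mat_vec)

text \<open>Apply both relations to the bottom vector: its image under \<open>A\<close> has
  coordinate 1 equal to 1, where the vector itself has 0, so row 1 compares the gammas and row 0 the
  betas.\<close>

lemma rel_unique:
  assumes r: "rel p n A B g b" "rel p n A B g' b'" shows "g = g'" "b = b'"
proof -
  let ?e = "unit_vec n 0 :: 'a vec"
  have p20: "p - 2 + inverse p \<noteq> 0"
  proof
    assume "p - 2 + inverse p = 0"
    then have "(p - 2 + inverse p) * p = 0" by simp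
    then have "(p - 1) * (p - 1) = 0" using p0 by (simp add: algebra_simps)
    then show False using p1 by simp
  qed
  have n1: "1 < n" "0 < n" using n3 by auto
  have cancel: "X + s - t = 0 \<Longrightarrow> X + s' - t' = 0 \<Longrightarrow> s - t = s' - t'" for X s t s' t' :: 'a
    by (metis add_diff_eq add_left_cancel)
  have "((p - 2 + inverse p) * g) * (A *\<^sub>v ?e) $ i - b * ?e $ i = ((p - 2 + inverse p) * g') * (A *\<^sub>v ?e) $ i - b' * ?e $ i" if "i < n" for i
    by (rule cancel[OF relD[OF r(1) _ that] relD[OF r(2) _ that]]) simp_all
  from this[OF n1(1)] this[OF n1(2)] show g: "g = g'" and "b = b'" using A_0_1 p20 n1 by (simp_all del: index_mult_mat_vec)
qed

text \<open>The n-th step of the chain with parameter 1 is the scalar D - 2 on every vector of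
  either module.\<close>

lemma D_unique:
  assumes s: "w_module p n y y1 y2 y3 y4" and i: "iso n P Q (w_module.A p n y1 D') (w_module.B p n y y1 y2 y3 y4) A B"
  shows "D' = D"
proof -
  interpret y: w_module p n y y1 y2 y3 y4 D' by (rule s)
  let ?e = "unit_vec n 0 :: 'a vec"
  define w where "w = P *\<^sub>v ?e"
  note d = isoD[OF i]
  have w: "w \<in> V" using mv_carrier[OF d(1), of ?e] by (simp add: w_def)
  have "Q *\<^sub>v w = ?e" using d(8)[of ?e] by (simp add: w_def)
  moreover have "?e \<noteq> 0\<^sub>v n" using y.mvec0 by (simp add: marginal_vec_def)
  ultimately have w0: "w \<noteq> 0\<^sub>v n" using mv_zero[OF d(2)] by auto
  have h: "P * y.A = A * P" using i by (simp add: iso_def)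
  have "(D' - 1 - 1) \<cdot>\<^sub>v w = P *\<^sub>v chain p y.A 1 ?e n" using y.chain_all[of ?e 1] mv_smult[OF d(1), of ?e] by (simp add: w_def)
  also have "\<dots> = chain p A 1 w n" unfolding w_def by (rule hom_chain[OF d(1,3,5) h]) simp
  also have "\<dots> = (D - 1 - 1) \<cdot>\<^sub>v w" using chain_all[OF w, of 1] by simp
  finally have e: "(D' - 1 - 1) \<cdot>\<^sub>v w = (D - 1 - 1) \<cdot>\<^sub>v w" .
  obtain j where j: "j < n" "w $ j \<noteq> 0" using top_ex[OF w w0] by metis
  from arg_cong[OF e, of "\<lambda>u. u $ j"] show ?thesis using j w by simp
qed

lemma hom_irr_iso:
  assumes AB: "A' \<in> carrier_mat n n" "B' \<in> carrier_mat n n" and r: "rel p n A' B' gm bt" and mv: "marginal_vec p n A' B' m cv v" 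
    and ch: "chain p A' x1 v n = \<delta> \<cdot>\<^sub>v v" and irr: "irr n A' B'"
  shows "\<exists>P Q. iso n P Q A B A' B'"
proof -
  obtain P where P: "P \<in> carrier_mat n n" "P * A = A' * P" "P * B = B' * P" "\<forall>i<n. P *\<^sub>v unit_vec n i = chain p A' x1 v i"
    using hom_ex[OF AB r mv ch] by blast
  let ?U = "(\<lambda>u. P *\<^sub>v u) ` V"
  have "A' *\<^sub>v u \<in> ?U \<and> B' *\<^sub>v u \<in> ?U" if u: "u \<in> ?U" for u
  proof -
    obtain x where x: "x \<in> V" "u = P *\<^sub>v x" using u by blast
    have "A' *\<^sub>v u = P *\<^sub>v (A *\<^sub>v x)" "B' *\<^sub>v u = P *\<^sub>v (B *\<^sub>v x)" 
      using hom_mv[OF P(1) A_carrier AB(1) P(2) x(1)] hom_mv[OF P(1) B_carrier AB(2) P(3) x(1)] x by simp_all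
    moreover have "A *\<^sub>v x \<in> V" "B *\<^sub>v x \<in> V" using x mv_carrier A_carrier B_carrier by blast+
    ultimately show ?thesis by blast
  qed
  then have "?U = {0\<^sub>v n} \<or> ?U = V" using irr image_subspace[OF P(1)] unfolding irr_def by blast
  moreover have "v \<in> ?U"
  proof -
    have "P *\<^sub>v unit_vec n 0 = v" using P(4) n3 by simp
    then show ?thesis by (metis imageI unit_vec_carrier)
  qed
  ultimately have "?U = V" using mv by (auto simp: marginal_vec_def)
  then show ?thesis using hom_surj_iso[OF P(1) A_carrier B_carrier AB P(2,3)] by blast
qed

end

section \<open>Invariants that determine a tuple up to order\<close>

context root_unity_closed begin

definition repA where "repA r = (case r of (m, x1, x2, x3, x4, D) \<Rightarrow> w_module.A p n x1 D)"
definition repB where "repB r = (case r of (m, x1, x2, x3, x4, D) \<Rightarrow> w_module.B p n m x1 x2 x3 x4)"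
definition gamma_of where "gamma_of r = (case r of (m, x1, x2, x3, x4, D) \<Rightarrow> (x1 + x2 + x3 + x4 + es3 x1 x2 x3 x4 / p) / m)"
definition beta_of where "beta_of r = (case r of (m, x1, x2, x3, x4, D) \<Rightarrow> (es2 x1 x2 x3 x4 + m^2 + p) / m)"
definition coeff_of where "coeff_of r = (case r of (m, x1, x2, x3, x4, D) \<Rightarrow> marginal_coeff p m (x1 + x2 + x3 + x4) (es3 x1 x2 x3 x4))"
definition weight_of where "weight_of r = (case r of (m, x1, x2, x3, x4, D) \<Rightarrow> m)"
definition delta_of where "delta_of r = (case r of (m, x1, x2, x3, x4, D) \<Rightarrow> D)"
definition rep_iso where "rep_iso r s \<longleftrightarrow> (\<exists>P Q. iso n P Q (repA r) (repB r) (repA s) (repB s))"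

lemmas of_defs = repA_def repB_def gamma_of_def beta_of_def coeff_of_def weight_of_def delta_of_def

lemma pq: "p - inverse p \<noteq> 0" "1 - inverse p \<noteq> 0" "1 + inverse p \<noteq> 0"
proof -
  show a: "1 - inverse p \<noteq> 0" using p1 p0 by (metis eq_iff_diff_eq_0 inverse_1 inverse_inverse_eq)
  show b: "1 + inverse p \<noteq> 0"
  proof
    assume "1 + inverse p = 0"
    then have "p * (1 + inverse p) = 0" by simp
    then have "p = -1" using p0 by (simp add: algebra_simps eq_neg_iff_add_eq_0)
    then show False using p2 by simp
  qed
  have "p - inverse p = p * ((1 - inverse p) * (1 + inverse p))" using p0 by (simp add: algebra_simps)
  then show "p - inverse p \<noteq> 0" using a b p0 by simp
qed

lemma rep_iso_trans: "rep_iso r s \<Longrightarrow> rep_iso s t \<Longrightarrow> rep_iso r t" unfolding rep_iso_def using iso_trans by blast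
lemma rep_iso_sym: "rep_iso r s \<Longrightarrow> rep_iso s r" unfolding rep_iso_def using iso_sym by blast

lemma rep_iso_refl: assumes "admissible r" shows "rep_iso r r"
proof -
  obtain m x1 x2 x3 x4 D where r: "r = (m, x1, x2, x3, x4, D)" by (cases r)
  interpret w_module p n m x1 x2 x3 x4 D by (rule w_moduleI) (use assms r in simp)
  have "iso n (1\<^sub>m n) (1\<^sub>m n) A B A B" unfolding iso_def by (simp add: left_mult_one_mat[OF A_carrier] right_mult_one_mat[OF A_carrier] left_mult_one_mat[OF B_carrier] right_mult_one_mat[OF B_carrier])
  then show ?thesis unfolding rep_iso_def r repA_def repB_def prod.case by blast
qed

lemma rep_iso_inv:
  assumes v: "admissible r" "admissible s" and i: "rep_iso r s" shows "gamma_of r = gamma_of s" "beta_of r = beta_of s" "delta_of r = delta_of s"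
proof -
  obtain m x1 x2 x3 x4 D where r: "r = (m, x1, x2, x3, x4, D)" by (cases r)
  obtain y y1 y2 y3 y4 D' where s: "s = (y, y1, y2, y3, y4, D')" by (cases s)
  interpret r: w_module p n m x1 x2 x3 x4 D by (rule w_moduleI) (use v r in simp)
  interpret s: w_module p n y y1 y2 y3 y4 D' by (rule w_moduleI) (use v s in simp)
  obtain P Q where i: "iso n P Q r.A r.B s.A s.B" using i by (auto simp: rep_iso_def r s of_defs)
  have u: "r.gm = s.gm" "r.bt = s.bt" using s.rel_unique[OF iso_rel[OF i r.rel1] s.rel1] by blast+
  show "delta_of r = delta_of s" using s.D_unique[OF r.w_module_axioms i] by (simp add: r s of_defs)
  show "gamma_of r = gamma_of s" using u(1) by (simp add: r.gm_def s.gm_def gamma_of_def r s r.e1_def s.e1_def r.e3_es s.e3_es)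
  have "((p - inverse p) * (1 - inverse p)) * beta_of r = ((p - inverse p) * (1 - inverse p)) * beta_of s" 
    using u(2) by (simp add: r.bt_def s.bt_def beta_of_def r s r.e2_es s.e2_es)
  then show "beta_of r = beta_of s" using pq by simp
qed

text \<open>The marginal coefficient gives e3 - e1 and gamma gives e1 + e3/p, a linear system with
  determinant 1 + 1/p; beta gives e2.\<close>

lemma sym_data_from:
  assumes v: "admissible r" "admissible s" and e: "weight_of r = weight_of s" "coeff_of r = coeff_of s" "gamma_of r = gamma_of s" "beta_of r = beta_of s" "delta_of r = delta_of s"
  shows "sym_data r = sym_data s"
proof -
  obtain m x1 x2 x3 x4 D where r: "r = (m, x1, x2, x3, x4, D)" by (cases r)
  obtain y1 y2 y3 y4 where s: "s = (m, y1, y2, y3, y4, D)" using e by (cases s) (auto simp: r of_defs)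
  have m0: "m \<noteq> 0" using v by (simp add: r admissible_def)
  define E F E' F' where d: "E = x1+x2+x3+x4" "F = es3 x1 x2 x3 x4" "E' = y1+y2+y3+y4" "F' = es3 y1 y2 y3 y4"
  have "inverse p - 1 \<noteq> 0" using pq by (metis eq_iff_diff_eq_0)
  then have 1: "F - E = F' - E'" using e(2) m0 unfolding r s coeff_of_def prod.case marginal_coeff_def d[symmetric] by simp
  have 2: "E + F/p = E' + F'/p" using e(3) m0 unfolding r s gamma_of_def prod.case d[symmetric] by simp
  have "(1 + inverse p) * F = (F - E) + (E + F/p)" by (simp add: algebra_simps divide_inverse)
  also have "\<dots> = (1 + inverse p) * F'" unfolding 1 2 by (simp add: algebra_simps divide_inverse)
  finally have F: "F = F'" using pq by simp
  have E: "E = E'" using 1 F by simp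
  show ?thesis unfolding r s sym_data_def prod.case d[symmetric] E F using e(4) m0 by (simp add: r s beta_of_def)
qed

text \<open>For a shift the condition on D is what makes \<delta> nonzero, so that the shifted
  bottom vector generates.\<close>

lemma link_rep_iso:
  assumes l: "link r s" and PM: "irr_params r" shows "rep_iso r s"
proof -
  have v: "admissible r" using PM by (simp add: irr_params_def)
  have vs: "admissible s" using link_admissible[OF l v] .
  have perm: "rep_iso r s" if "sym_data r = sym_data s"
  proof -
    obtain m x1 x2 x3 x4 D where r: "r = (m, x1, x2, x3, x4, D)" by (cases r)
    obtain y y1 y2 y3 y4 D' where "s = (y, y1, y2, y3, y4, D')" by (cases s)
    then have s: "s = (m, y1, y2, y3, y4, D)" using that by (simp add: r sym_data_def)
    interpret r: w_module p n m x1 x2 x3 x4 D by (rule w_moduleI) (use v r in simp)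
    have "w_module p n m y1 y2 y3 y4" by (rule w_moduleI) (use vs s in simp)
    from r.perm_iso[OF this] have "rep_iso s r" using that by (auto simp: r s rep_iso_def repA_def repB_def sym_data_def r.e1_def r.e2_es r.e3_es es2_def es3_def)
    then show ?thesis by (rule rep_iso_sym)
  qed
  from l show ?thesis
  proof (cases rule: link.cases)
    case (shift k a b m c e D)
    interpret r: w_module p n m a b c e D by (rule w_moduleI) (use v shift in simp)
    have "D \<noteq> a^n + b^n" using PM shift unfolding irr_params_def irr_quad_def by auto
    from r.shift_iso[OF shift(3,4,5) r.delta_ne[OF shift(5) this]] have "rep_iso s r" by (auto simp: rep_iso_def shift repA_def repB_def)
    then show ?thesis by (rule rep_iso_sym)
  qed (rule perm; simp add: sym_data_def es2_def es3_def algebra_simps)+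
qed

lemma links_rep_iso: "link\<^sup>*\<^sup>* r s \<Longrightarrow> irr_params r \<Longrightarrow> rep_iso r s"
proof (induction rule: rtranclp_induct)
  case base then show ?case using rep_iso_refl by (simp add: irr_params_def)
next
  case (step y z) then show ?case using link_rep_iso links_irr_params rep_iso_trans by blast
qed

text \<open>A shift by k is undone by a shift by n - k along the same pair.\<close>

lemma link_sym: assumes l: "link r s" shows "link s r"
  using l
proof (cases rule: link.cases)
  case (shift k a b m c e D)
  have e: "p^k * p^(n-k) = 1" using pow_neg shift by simp
  have "a * p^k * (b * p^k) * p^(n-k) = a * b * p^k * (p^k * p^(n-k))" by (simp add: mult_ac)
  then have x: "a * p^k * (b * p^k) * p^(n-k) = p" unfolding e shift by simp
  have y: "x * p^k * p^(n-k) = x" for x unfolding mult.assoc e by simp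
  show ?thesis using link.shift[of "n-k" "a * p^k" "b * p^k" "m * p^k" c e D] x shift(3,4) unfolding y shift(1,2) by simp
qed (auto intro: link.intros)

lemma links_sym: "link\<^sup>*\<^sup>* r s \<Longrightarrow> link\<^sup>*\<^sup>* s r"
  by (induction rule: rtranclp_induct) (auto intro: converse_rtranclp_into_rtranclp link_sym)

end

section \<open>The reflection of parameters\<close>

context root_unity_closed begin

text \<open>Relation (iii) in these coordinates.\<close>
definition reflect where "reflect r = (case r of (m, x1, x2, x3, x4, D) \<Rightarrow> (p/m, p/x1, p/x2, p/x4, p/x3, D))"

lemma reflect_reflect: "admissible r \<Longrightarrow> reflect (reflect r) = r"
  by (cases r) (simp add: reflect_def admissible_def p0)

lemma reflect_admissible: assumes "admissible r" shows "admissible (reflect r)"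
proof -
  obtain m x1 x2 x3 x4 D where r: "r = (m, x1, x2, x3, x4, D)" by (cases r)
  have v: "m \<noteq> 0" "x1 \<noteq> 0" "x2 \<noteq> 0" "x3 \<noteq> 0" "x4 \<noteq> 0" "x1*x2*x3*x4 = m^2*p" using assms by (auto simp: admissible_def r)
  have "p/x1 * (p/x2) * (p/x4) * (p/x3) = p^4 / (x1*x2*x3*x4)" by (simp add: eval_nat_numeral mult_ac)
  also have "\<dots> = (p/m)^2 * p" unfolding v(6) using v(1) p0 by (simp add: field_simps eval_nat_numeral)
  finally have e: "p/x1 * (p/x2) * (p/x4) * (p/x3) = (p/m)^2 * p" .
  have "p/m \<noteq> 0" "p/x1 \<noteq> 0" "p/x2 \<noteq> 0" "p/x4 \<noteq> 0" "p/x3 \<noteq> 0" using v p0 by simp_all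
  then show ?thesis unfolding admissible_def r reflect_def prod.case using e by blast
qed

text \<open>The pair (p/x, p/y) with exponent k corresponds to (x, y) with exponent n - k, and the
  n-th powers change places because their product is 1.\<close>

lemma reflect_pair:
  assumes nz: "x \<noteq> 0" "y \<noteq> 0" and k: "0 < k" "k < n" and e: "p/x * (p/y) * p^k = p"
    and P: "\<And>k. 0 < k \<Longrightarrow> k < n \<Longrightarrow> x * y * p^k = p \<Longrightarrow> D \<noteq> x^n + y^n"
  shows "D \<noteq> (p/x)^n + (p/y)^n"
proof -
  have xy: "x * y = p * p^k"
  proof -
    have "p/x * (p/y) * p^k = p * (p * p^k) / (x * y)" by simp
    then have "p * (p * p^k) = p * (x * y)" using e nz by (simp add: divide_eq_eq)
    then show ?thesis using p0 by simp
  qed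
  have e: "p^k * p^(n-k) = 1" using pow_neg k by simp
  have "x * y * p^(n-k) = p" unfolding xy mult.assoc e by simp
  then have D: "D \<noteq> x^n + y^n" using P[of "n-k"] k by simp
  have "x^n * y^n = 1" using arg_cong[OF xy, of "\<lambda>t. t^n"] by (simp add: power_mult_distrib pn)
  then have "(p/x)^n = y^n" "(p/y)^n = x^n" using nz by (simp_all add: power_divide pn divide_eq_eq mult.commute)
  then show ?thesis using D add.commute by metis
qed

lemma reflect_irr_params: assumes "irr_params r" shows "irr_params (reflect r)"
proof -
  obtain m x1 x2 x3 x4 D where r: "r = (m, x1, x2, x3, x4, D)" by (cases r)
  have v: "m \<noteq> 0" "x1 \<noteq> 0" "x2 \<noteq> 0" "x3 \<noteq> 0" "x4 \<noteq> 0" using assms by (auto simp: irr_params_def admissible_def r)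
  have P: "irr_quad x1 x2 x3 x4 D" using assms by (simp add: irr_params_def r)
  have Q: "x1 * x2 * p^k = p \<Longrightarrow> D \<noteq> x1^n + x2^n" "x1 * x3 * p^k = p \<Longrightarrow> D \<noteq> x1^n + x3^n" "x1 * x4 * p^k = p \<Longrightarrow> D \<noteq> x1^n + x4^n"
    "x2 * x3 * p^k = p \<Longrightarrow> D \<noteq> x2^n + x3^n" "x2 * x4 * p^k = p \<Longrightarrow> D \<noteq> x2^n + x4^n" "x4 * x3 * p^k = p \<Longrightarrow> D \<noteq> x4^n + x3^n" if "0 < k" "k < n" for k
    using P that by (simp_all add: irr_quad_def add.commute mult.commute[of x4 x3])
  have "irr_quad (p/x1) (p/x2) (p/x4) (p/x3) D" unfolding irr_quad_def
  proof (intro allI impI, elim conjE, intro conjI impI)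
    fix k assume k: "0 < k" "k < n"
    show "p/x1 * (p/x2) * p^k = p \<Longrightarrow> D \<noteq> (p/x1)^n + (p/x2)^n" by (rule reflect_pair[OF v(2,3) k _ Q(1)])
    show "p/x1 * (p/x4) * p^k = p \<Longrightarrow> D \<noteq> (p/x1)^n + (p/x4)^n" by (rule reflect_pair[OF v(2,5) k _ Q(3)])
    show "p/x1 * (p/x3) * p^k = p \<Longrightarrow> D \<noteq> (p/x1)^n + (p/x3)^n" by (rule reflect_pair[OF v(2,4) k _ Q(2)])
    show "p/x2 * (p/x4) * p^k = p \<Longrightarrow> D \<noteq> (p/x2)^n + (p/x4)^n" by (rule reflect_pair[OF v(3,5) k _ Q(5)])
    show "p/x2 * (p/x3) * p^k = p \<Longrightarrow> D \<noteq> (p/x2)^n + (p/x3)^n" by (rule reflect_pair[OF v(3,4) k _ Q(4)])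
    show "p/x4 * (p/x3) * p^k = p \<Longrightarrow> D \<noteq> (p/x4)^n + (p/x3)^n" by (rule reflect_pair[OF v(5,4) k _ Q(6)])
  qed
  then show ?thesis using reflect_admissible[of r] assms by (simp add: irr_params_def reflect_def r)
qed

lemma reflect_irr_params_iff: "admissible r \<Longrightarrow> irr_params (reflect r) \<longleftrightarrow> irr_params r"
  using reflect_irr_params[of r] reflect_irr_params[of "reflect r"] reflect_reflect by metis

text \<open>When m^2 = p^2, a shift by k along (a, b) and one by n - 1 - k along (c, e) together
  produce the reflection: the product constraint makes the second pair admissible.\<close>

lemma reflect_links:
  assumes v: "admissible (m, a, b, c, e, D)" and m: "m^2 = p^2" and k: "k < n" "a * b * p^k = p"
  shows "link\<^sup>*\<^sup>* (m, a, b, c, e, D) (p/m, p/b, p/a, p/e, p/c, D)"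
proof -
  have nz: "m \<noteq> 0" "a \<noteq> 0" "b \<noteq> 0" "c \<noteq> 0" "e \<noteq> 0" "a*b*c*e = m^2*p" using v by (auto simp: admissible_def)
  have sh: "link\<^sup>*\<^sup>* (m, a, b, c, e, D) (m * p^k, a * p^k, b * p^k, c, e, D)" 
    if "k < n" "a * b * p^k = p" for m a b c e k
  proof (cases "k = 0")
    case True then show ?thesis by simp
  next
    case False then show ?thesis using r_into_rtranclp[of link, OF shift[of k a b m c e D]] that by simp
  qed
  define j where "j = n - 1 - k"
  have j: "j < n" using n3 by (simp add: j_def)
  have kj: "p^k * p^j = inverse p" using k n3 pow_n1(1) by (simp add: j_def power_add[symmetric])
  have ce: "c * e * p^j = p"
  proof -
    have "(a * b * p^k) * (c * e * p^j) = (a*b*c*e) * (p^k * p^j)" by (simp add: mult_ac)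
    also have "\<dots> = p * p" unfolding nz(6) m kj using p0 by (simp add: power2_eq_square)
    finally show ?thesis unfolding k using p0 by simp
  qed
  have swp: "link\<^sup>*\<^sup>* (m, a, b, c, e, D) (m, c, e, a, b, D)" for m a b c e by (rule link_perms)
  have "link\<^sup>*\<^sup>* (m, a, b, c, e, D) (m * p^k * p^j, c * p^j, e * p^j, a * p^k, b * p^k, D)"
    using sh[OF k, of m c e] swp[of "m * p^k" "a * p^k" "b * p^k" c e] sh[OF j ce, of "m*p^k" "a*p^k" "b*p^k"] by (meson rtranclp_trans)
  then have "link\<^sup>*\<^sup>* (m, a, b, c, e, D) (m * p^k * p^j, a * p^k, b * p^k, c * p^j, e * p^j, D)"
    using swp[of "m * p^k * p^j" "c * p^j" "e * p^j" "a * p^k" "b * p^k"] by (meson rtranclp_trans)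
  moreover have "m * p^k * p^j = p/m" unfolding mult.assoc kj using m nz p0 by (simp add: field_simps power2_eq_square)
  moreover have "a * p^k = p/b" "b * p^k = p/a" "c * p^j = p/e" "e * p^j = p/c" using k ce nz by (simp_all add: field_simps)
  ultimately show ?thesis by simp
qed

text \<open>A vanishing factor says that some x1 xj is an n-th root of unity, which supplies the
  pair for the two shifts.\<close>

lemma reflect_links_N1:
  assumes v: "admissible (m, x1, x2, x3, x4, D)" and m: "m^2 = p^2" 
    and pr: "(1 - x1^n * x2^n) * (1 - x1^n * x3^n) * (1 - x1^n * x4^n) = 0"
  shows "link\<^sup>*\<^sup>* (m, x1, x2, x3, x4, D) (reflect (m, x1, x2, x3, x4, D))"
proof -
  have ex: "\<exists>k<n. z * p^k = p" if z1: "z^n = 1" for z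
  proof -
    obtain l where l: "l < n" "z = p^l" using root_ex[OF z1] by blast
    have "p^l * p^((n - l) + 1) = (p^l * p^(n-l)) * p" by (simp add: mult_ac)
    then have "z * p^(((n - l) + 1) mod n) = p" unfolding pow_mod[symmetric] l(2) using pow_neg[OF l(1)] by simp
    then show ?thesis using n3 by (intro exI[of _ "((n - l) + 1) mod n"]) simp
  qed
  have sw1: "swap\<^sup>*\<^sup>* (m, a, b, c, e, D) (m, b, a, c, e, D)" and sw2: "swap\<^sup>*\<^sup>* (m, a, b, c, e, D) (m, b, e, c, a, D)"
    and sw3: "swap\<^sup>*\<^sup>* (m, a, b, c, e, D) (m, b, e, a, c, D)" and sw4: "swap\<^sup>*\<^sup>* (m, a, b, c, e, D) (m, a, c, b, e, D)" 
    and sw5: "swap\<^sup>*\<^sup>* (m, a, b, c, e, D) (m, a, e, b, c, D)" for m a b c e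
    by (rule sym_data_swaps; simp add: es2_def es3_def algebra_simps)+
  note sl = sw1[THEN swaps_links] sw2[THEN swaps_links] sw3[THEN swaps_links] sw4[THEN swaps_links] sw5[THEN swaps_links]
  consider "(x1*x2)^n = 1" | "(x1*x3)^n = 1" | "(x1*x4)^n = 1" using pr by (auto simp: power_mult_distrib)
  then show ?thesis
  proof cases
    case 1
    then obtain k where k: "k < n" "x1*x2*p^k = p" using ex by blast
    show ?thesis using rtranclp_trans[OF reflect_links[OF v m k] sl(1)] unfolding reflect_def prod.case .
  next
    case 2
    then obtain k where k: "k < n" "x1*x3*p^k = p" using ex by blast
    have v': "admissible (m, x1, x3, x2, x4, D)" using v by (simp add: admissible_def mult_ac)
    show ?thesis using rtranclp_trans[OF sl(4) rtranclp_trans[OF reflect_links[OF v' m k] sl(2)]] unfolding reflect_def prod.case .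
  next
    case 3
    then obtain k where k: "k < n" "x1*x4*p^k = p" using ex by blast
    have v': "admissible (m, x1, x4, x2, x3, D)" using v by (simp add: admissible_def mult_ac)
    show ?thesis using rtranclp_trans[OF sl(5) rtranclp_trans[OF reflect_links[OF v' m k] sl(3)]] unfolding reflect_def prod.case .
  qed
qed

end

context w_module begin

text \<open>Under x to p/x the symmetric functions of degree 1 and 3 change places up to factors and
  the one of degree 2 is rescaled; together with m to p/m this preserves gamma and beta.\<close>

lemma reflect_coeff_of: "c3 = coeff_of (reflect (m, x1, x2, x3, x4, D))"
  and reflect_gamma_of: "gamma_of (reflect (m, x1, x2, x3, x4, D)) = gamma_of (m, x1, x2, x3, x4, D)"
  and reflect_beta_of: "beta_of (reflect (m, x1, x2, x3, x4, D)) = beta_of (m, x1, x2, x3, x4, D)"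
proof -
  have P: "x1 * x2 * x3 * x4 = m^2 * p" by (rule prod)
  have nz2: "m^2 \<noteq> 0" using nz by simp
  have cancel: "S * (m^2*p) = p * t \<Longrightarrow> S = t/m^2" for S t using nz p0 by (simp add: field_simps)
  have 1: "p/x1 * (m^2*p) = p * (x2*x3*x4)" "p/x2 * (m^2*p) = p * (x1*x3*x4)" "p/x4 * (m^2*p) = p * (x1*x2*x3)" "p/x3 * (m^2*p) = p * (x1*x2*x4)"
    unfolding P[symmetric] using nz by simp_all
  have s1: "p/x1 + p/x2 + p/x4 + p/x3 = e3 / m^2"
    by (rule cancel) (unfold distrib_right 1, simp add: e3_def algebra_simps)
  have 2: "p/x1 * (p/x2) * (m^2*p) = p * (p * (x3*x4))" "p/x1 * (p/x4) * (m^2*p) = p * (p * (x2*x3))" "p/x1 * (p/x3) * (m^2*p) = p * (p * (x2*x4))"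
     "p/x2 * (p/x4) * (m^2*p) = p * (p * (x1*x3))" "p/x2 * (p/x3) * (m^2*p) = p * (p * (x1*x4))" "p/x4 * (p/x3) * (m^2*p) = p * (p * (x1*x2))"
    unfolding P[symmetric] using nz by simp_all
  have s2: "es2 (p/x1) (p/x2) (p/x4) (p/x3) = p * e2 / m^2"
    unfolding es2_def by (rule cancel) (unfold distrib_right 2, simp add: e2_def algebra_simps)
  have 3: "p/x1 * (p/x2) * (p/x4) * (m^2*p) = p * (p^2 * x3)" "p/x1 * (p/x2) * (p/x3) * (m^2*p) = p * (p^2 * x4)"
     "p/x1 * (p/x4) * (p/x3) * (m^2*p) = p * (p^2 * x2)" "p/x2 * (p/x4) * (p/x3) * (m^2*p) = p * (p^2 * x1)"
    unfolding P[symmetric] using nz by (simp_all add: power2_eq_square)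
  have s3: "es3 (p/x1) (p/x2) (p/x4) (p/x3) = p^2 * e1 / m^2"
    unfolding es3_def by (rule cancel) (unfold distrib_right 3, simp add: e1_def algebra_simps)
  show "c3 = coeff_of (reflect (m, x1, x2, x3, x4, D))" unfolding coeff_of_def reflect_def prod.case s1 s3 c3_def ..
  show "gamma_of (reflect (m, x1, x2, x3, x4, D)) = gamma_of (m, x1, x2, x3, x4, D)" 
    unfolding gamma_of_def reflect_def prod.case s1 s3 e3_es[symmetric] e1_def[symmetric] using nz p0 by (simp add: field_simps power2_eq_square)
  show "beta_of (reflect (m, x1, x2, x3, x4, D)) = beta_of (m, x1, x2, x3, x4, D)" 
    unfolding beta_of_def reflect_def prod.case s2 e2_es[symmetric] using nz p0 by (simp add: field_simps power2_eq_square)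
qed

text \<open>The exceptional vector of weight p/m has the coefficient of the reflected tuple, so it
  is the image of the bottom vector of the reflected module.\<close>

lemma reflect_rep_iso:
  assumes N1: "N \<noteq> 1" and D: "D * (N - 1) = E3 - E1" and PM: "irr_quad x1 x2 x3 x4 D"
  shows "rep_iso (reflect (m, x1, x2, x3, x4, D)) (m, x1, x2, x3, x4, D)"
proof -
  have v': "admissible (p/m, p/x1, p/x2, p/x4, p/x3, D)" using reflect_admissible[OF admissible] by (simp add: reflect_def)
  interpret y: w_module p n "p/m" "p/x1" "p/x2" "p/x4" "p/x3" D by (rule w_moduleI[OF v'])
  obtain v where mv: "marginal_vec p n A B (p/m) c3 v" using reflect_fwd[OF N1 D] by blast
  have cv: "c3 = y.cv" unfolding reflect_coeff_of y.cv_def by (simp add: coeff_of_def reflect_def y.e1_def y.e3_es)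
  have gm: "gm = y.gm" using reflect_gamma_of by (simp add: gamma_of_def reflect_def gm_def y.gm_def e3_es y.e3_es e1_def y.e1_def)
  have "bt = (p - inverse p) * (1 - inverse p) * beta_of (m, x1, x2, x3, x4, D)" by (simp add: bt_def beta_of_def e2_es)
  moreover have "y.bt = (p - inverse p) * (1 - inverse p) * beta_of (reflect (m, x1, x2, x3, x4, D))" by (simp add: y.bt_def beta_of_def y.e2_es reflect_def)
  ultimately have bt: "bt = y.bt" using reflect_beta_of by simp
  have v: "v \<in> V" using mv by (simp add: marginal_vec_def)
  have ch: "chain p A (p/x1) v n = y.\<delta> \<cdot>\<^sub>v v" using chain_all[OF v y.nz(2)] by (simp add: y.\<delta>_def)
  obtain P Q where "iso n P Q y.A y.B A B"
    using y.hom_irr_iso[OF A_carrier B_carrier rel1[unfolded gm bt] mv[unfolded cv] ch irreducible[OF PM]] by blast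
  then show ?thesis unfolding rep_iso_def reflect_def prod.case repA_def repB_def by blast
qed

text \<open>Valid for N = 1 as well, where the closing condition becomes the vanishing of the triple
  product.\<close>

lemma prod_E: "(D * (N - 1) - (E3 - E1)) * x1^n = \<delta> * (x1^n * (N - 1)) - (1 - x1^n*x2^n) * (1 - x1^n*x3^n) * (1 - x1^n*x4^n)"
proof -
  define X1 X2 X3 X4 where X: "X1 = x1^n" "X2 = x2^n" "X3 = x3^n" "X4 = x4^n"
  have X0: "X1 \<noteq> 0" using nz by (simp add: X)
  have N: "N = X1 * X2 * X3 * X4" using arg_cong[OF prod, of "\<lambda>t. t^n"] by (simp add: N_def X power_mult_distrib pn)
  have "\<delta> * (X1 * (N - 1)) = (D * X1 - X1 * X1 - 1) * (N - 1)" using X0 by (simp add: \<delta>_def X[symmetric] algebra_simps)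
  then show ?thesis unfolding E1_def E3_def es3_def X[symmetric] unfolding N by (simp add: algebra_simps)
qed

end

section \<open>The modules W\<close>

context aw_setting begin

lemma ppow: "p^i = (q^i)^2" "p^i = q^(2*i)"
  by (simp_all add: p_def power_mult[symmetric] mult.commute)

text \<open>Matching \<open>phi\<close> with \<open>varphi\<close> rests on t = q^j with t^2 = p^j:
  each of the four brackets of \<open>phi\<close> is a power of t times one factor of
  \<open>F\<close>.\<close>

lemma W_eq:
  assumes x: "nz5 x"
  shows "W q d x = (repA (params x), repB (params x), Cg (gamma_of (params x)) (repA (params x)) (repB (params x)))"
proof -
  obtain a b c l \<delta> where xx: "x = (a, b, c, l, \<delta>)" by (cases x)
  have nz: "a \<noteq> 0" "b \<noteq> 0" "c \<noteq> 0" "l \<noteq> 0" using x by (auto simp: xx nz5_iff)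
  define m x1 x2 x3 x4 D where r: "m = b/l" "x1 = a/l" "x2 = 1/(a*l)" "x3 = b*c*q" "x4 = b*q/c" "D = \<delta> + (a/l)^n + inverse ((a/l)^n)"
  have par: "params x = (m, x1, x2, x3, x4, D)" by (simp add: xx r)
  interpret w: w_module p n m x1 x2 x3 x4 D by (rule w_moduleI) (use params_admissible[OF x] par in simp)
  have del: "w.\<delta> = \<delta>" unfolding w.\<delta>_def by (simp add: r)
  have th: "th q y l j = theta (y/l) (p^j)" if "y \<noteq> 0" for y j
    using that nz by (simp add: th_def theta_def ppow(2) divide_inverse power_inverse mult_ac)
  have WA: "W_A q n x = repA (params x)"
    unfolding par repA_def prod.case w.A_def unfolding del W_A_def xx prod.case matA_def th[OF nz(1)] r(2)[symmetric] ..
  have ph: "phi q a b c l j = varphi p m x1 w.u w.w (p^j)" for j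
  proof -
    define t where "t = q^j"
    have t0: "t \<noteq> 0" using q0 by (simp add: t_def)
    have pw: "q powi int j = t" "q powi (- int j) = inverse t" "q powi (int j - 1) = t / q" "q powi (1 - int j) = q / t"
      using q0 by (simp_all add: t_def power_int_minus power_int_diff)
    have "phi q a b c l j = inverse a * inverse b * l * q * (t - inverse t) * (inverse l * (t/q) - l * (q/t)) * 
        (inverse t - a*b*c*inverse l*(t/q)) * (inverse t - a*b*inverse c*inverse l*(t/q))"
      unfolding phi_def pw ..
    also have "\<dots> = q^2 * (1 - t^2) * (1 - t^2/(l^2*q^2)) * (1 - a*b*c*t^2/(l*q)) * (1 - a*b*t^2/(c*l*q)) * l^2 / (a*b*t^4)"
    proof -
      have f: "t - inverse t = - (1 - t^2) / t" "inverse l * (t/q) - l * (q/t) = - (l*q/t) * (1 - t^2/(l^2*q^2))"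
        "inverse t - a*b*c*inverse l*(t/q) = (1 - a*b*c*t^2/(l*q)) / t" "inverse t - a*b*inverse c*inverse l*(t/q) = (1 - a*b*t^2/(c*l*q)) / t"
        using nz t0 q0 by (simp_all add: field_simps power2_eq_square)
      define f1 f2 f3 f4 where ff: "f1 = 1 - t^2" "f2 = 1 - t^2/(l^2*q^2)" "f3 = 1 - a*b*c*t^2/(l*q)" "f4 = 1 - a*b*t^2/(c*l*q)"
      show ?thesis unfolding f unfolding ff[symmetric] using nz t0 q0 by (simp add: field_simps eval_nat_numeral)
    qed
    also have "\<dots> = w.F j"
    proof -
      have Q: "p^j = t^2" "p = q^2" by (simp add: ppow(1) t_def, rule p_def)
      have y: "x1 * x2 * t^2/q^2 = t^2/(l^2*q^2)" "x1 * x3 * t^2/q^2 = a*b*c*t^2/(l*q)" "x1 * x4 * t^2/q^2 = a*b*t^2/(c*l*q)"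
        using nz q0 by (simp_all add: r power2_eq_square mult_ac)
      define f1 f2 f3 f4 where ff: "f1 = 1 - t^2" "f2 = 1 - t^2/(l^2*q^2)" "f3 = 1 - a*b*c*t^2/(l*q)" "f4 = 1 - a*b*t^2/(c*l*q)"
      have "x1 * m = a*b/l^2" by (simp add: r power2_eq_square)
      then show ?thesis unfolding w.F_factor Q(1) unfolding Q(2) y ff[symmetric] using nz t0 by (simp add: eval_nat_numeral mult_ac)
    qed
    finally show ?thesis by (simp add: w.F_def)
  qed
  have WB: "W_B q n x = repB (params x)"
    unfolding par repB_def prod.case w.B_def unfolding W_B_def xx prod.case matB_def th[OF nz(2)] r(1)[symmetric] ph ..
  have g: "gamma_val q x = gamma_of (params x)"
  proof -
    have pp: "p = q * q" by (simp add: p_def power2_eq_square)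
    define c' a' where ca: "c' = c + inverse c" "a' = a + inverse a"
    have 1: "x1 + x2 = a' / l" "x3 + x4 = b * q * c'" "x1 * x2 = 1/l^2" "x3 * x4 = b^2*p"
      using nz by (simp_all add: ca r pp field_simps power2_eq_square)
    have "x1 + x2 + x3 + x4 = (x1 + x2) + (x3 + x4)" "es3 x1 x2 x3 x4 = x1 * x2 * (x3 + x4) + x3 * x4 * (x1 + x2)" by (simp_all add: es3_def algebra_simps)
    then have "gamma_of (params x) = (a'/l + b*q*c' + (1/l^2 * (b*q*c') + b^2 * p * (a'/l))/p) / (b/l)" unfolding par gamma_of_def prod.case 1 r(1) by simp
    also have "\<dots> = a' * (b + inverse b) + c' * (l * q + inverse l * inverse q)"
      unfolding pp using nz q0 by (simp add: field_simps power2_eq_square)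
    finally show ?thesis by (simp add: gamma_val_def xx ca)
  qed
  show ?thesis unfolding W_def n_def[symmetric] W_C_def WA WB g Cg_def kk_def ..
qed

lemma repA_carrier: "admissible r \<Longrightarrow> repA r \<in> carrier_mat n n" and repB_carrier: "admissible r \<Longrightarrow> repB r \<in> carrier_mat n n"
proof -
  obtain m x1 x2 x3 x4 D where r: "r = (m, x1, x2, x3, x4, D)" by (cases r)
  assume v: "admissible r"
  interpret w: w_module p n m x1 x2 x3 x4 D by (rule w_moduleI) (use v r in simp)
  show "repA r \<in> carrier_mat n n" "repB r \<in> carrier_mat n n" by (simp_all add: r repA_def repB_def)
qed

lemma W_tmod: assumes x: "nz5 x" shows "is_tmod q n (W q d x)"
proof -
  obtain m x1 x2 x3 x4 D where r: "params x = (m, x1, x2, x3, x4, D)" by (cases "params x")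
  interpret w: w_module p n m x1 x2 x3 x4 D by (rule w_moduleI) (use params_admissible[OF x] r in simp)
  have g: "gamma_of (params x) = w.gm" by (simp add: r gamma_of_def w.gm_def w.e1_def w.e3_es)
  show ?thesis unfolding W_eq[OF x] g unfolding r repA_def repB_def prod.case
    by (rule tmod_of_rel[folded p_def, OF w.A_carrier w.B_carrier w.rel1 w.rel2])
qed

lemma W_iso_iff:
  assumes x: "nz5 x" and y: "nz5 y"
  shows "tmod_iso n (W q d x) (W q d y) \<longleftrightarrow> rep_iso (params x) (params y)"
proof -
  note v = params_admissible[OF x] params_admissible[OF y]
  note c = repA_carrier[OF v(1)] repB_carrier[OF v(1)] repA_carrier[OF v(2)] repB_carrier[OF v(2)]
  have i: "tmod_iso n (W q d x) (W q d y) \<longleftrightarrow> (\<exists>P Q. iso n P Q (repA (params x)) (repB (params x)) (repA (params y)) (repB (params y)) \<and>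
       iso n P Q (repA (params x)) (Cg (gamma_of (params x)) (repA (params x)) (repB (params x))) (repA (params y)) (Cg (gamma_of (params y)) (repA (params y)) (repB (params y))))"
    unfolding W_eq[OF x] W_eq[OF y] by (rule tmod_iso_iff[OF c(1,2) Cg_carrier[OF c(1,2)] c(3,4) Cg_carrier[OF c(3,4)]])
  show ?thesis
  proof
    assume "tmod_iso n (W q d x) (W q d y)"
    then show "rep_iso (params x) (params y)" unfolding i rep_iso_def by blast
  next
    assume a: "rep_iso (params x) (params y)"
    have g: "gamma_of (params x) = gamma_of (params y)" using rep_iso_inv[OF v a] by blast
    from a show "tmod_iso n (W q d x) (W q d y)" unfolding i g rep_iso_def using Cg_iso by blast
  qed
qed

text \<open>As x1 x2 = 1/lambda^2, the exponents are related by k = i + 1.\<close>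

lemma l2_iff: assumes x: "nz5 (a, b, c, l, \<delta>)"
  shows "(\<exists>i\<le>n-2. l^2 = q^(2*i)) \<longleftrightarrow> (\<exists>k. 0 < k \<and> k < n \<and> a/l * (1/(a*l)) * p^k = p)"
proof -
  have nz: "a \<noteq> 0" "l \<noteq> 0" using x by (auto simp: nz5_iff)
  have e: "a/l * (1/(a*l)) * p^(Suc i) = p \<longleftrightarrow> l^2 = q^(2*i)" for i
    unfolding ppow(2)[symmetric] using nz p0 by (auto simp: field_simps power2_eq_square)
  show ?thesis
  proof
    assume "\<exists>i\<le>n-2. l^2 = q^(2*i)"
    then obtain i where "i \<le> n-2" "l^2 = q^(2*i)" by blast
    then show "\<exists>k. 0 < k \<and> k < n \<and> a/l * (1/(a*l)) * p^k = p" using e n3 by (intro exI[of _ "Suc i"]) auto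
  next
    assume "\<exists>k. 0 < k \<and> k < n \<and> a/l * (1/(a*l)) * p^k = p"
    then obtain k where k: "0 < k" "k < n" "a/l * (1/(a*l)) * p^k = p" by blast
    then obtain i where "k = Suc i" using gr0_implies_Suc by blast
    then show "\<exists>i\<le>n-2. l^2 = q^(2*i)" using k e by (intro exI[of _ i]) auto
  qed
qed

lemma simeq_pm_nz: "simeq_pmS4 sr q d x y \<Longrightarrow> nz5 x \<and> nz5 y"
  by (cases x; cases y) (simp add: simeq_pmS4_def approx4_def nz5_def)

text \<open>Every pair of x's can be brought to the front by the group action; for that
  representative the condition on D is the condition on delta, since x2^n = x1^(-n).\<close>

lemma PM_iff: "x \<in> PM sr q d \<longleftrightarrow> nz5 x \<and> irr_params (params x)"
proof
  assume PM: "x \<in> PM sr q d"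
  then have x: "nz5 x" by (simp add: PM_def)
  obtain m x1 x2 x3 x4 D where r: "params x = (m, x1, x2, x3, x4, D)" by (cases "params x")
  note v = params_admissible[OF x, unfolded r]
  have main: "D \<noteq> y1^n + y2^n" if k: "0 < k" "k < n" and e: "y1 * y2 * p^k = p" and v': "admissible (m, y1, y2, y3, y4, D)" and
     dt: "sym_data (m, x1, x2, x3, x4, D) = sym_data (m, y1, y2, y3, y4, D)" for y1 y2 y3 y4 k
  proof
    assume D: "D = y1^n + y2^n"
    obtain y where y: "nz5 y" "params y = (m, y1, y2, y3, y4, D)" using lift[OF v'] by blast
    obtain a b c l \<delta> where yy: "y = (a, b, c, l, \<delta>)" by (cases y)
    have "simeq_pmS4 sr q d x y" using simeq_pm_iff[OF x y(1)] dt r y by simp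
    then have or: "\<delta> \<noteq> 0 \<or> \<not> (\<exists>i\<le>n - 2. l^2 = q^(2*i))" using PM unfolding PM_def yy n_def by fastforce
    have z: "y1 = a/l" "y2 = 1/(a*l)" "D = \<delta> + (a/l)^n + inverse ((a/l)^n)" using y(2) by (auto simp: yy)
    have "\<exists>k. 0 < k \<and> k < n \<and> a/l * (1/(a*l)) * p^k = p" using k e unfolding z by blast
    then have d0: "\<delta> \<noteq> 0" using or l2_iff y(1) yy by blast
    have nz: "y1 \<noteq> 0" "y2 \<noteq> 0" using v' by (auto simp: admissible_def)
    have "y1^n * y2^n = 1" using arg_cong[OF e, of "\<lambda>t. t^n"] by (simp add: power_mult_distrib pn)
    then have "y2^n = inverse (y1^n)" by (metis inverse_unique)
    then show False using D d0 unfolding z by simp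
  qed
  have V: "admissible (m, x1, x3, x2, x4, D)" "admissible (m, x1, x4, x2, x3, D)" "admissible (m, x2, x3, x1, x4, D)" "admissible (m, x2, x4, x1, x3, D)" "admissible (m, x3, x4, x1, x2, D)" 
    using v by (simp_all add: admissible_def mult_ac)
  have Dt: "sym_data (m, x1, x2, x3, x4, D) = sym_data (m, x1, x3, x2, x4, D)" "sym_data (m, x1, x2, x3, x4, D) = sym_data (m, x1, x4, x2, x3, D)"
    "sym_data (m, x1, x2, x3, x4, D) = sym_data (m, x2, x3, x1, x4, D)" "sym_data (m, x1, x2, x3, x4, D) = sym_data (m, x2, x4, x1, x3, D)" 
    "sym_data (m, x1, x2, x3, x4, D) = sym_data (m, x3, x4, x1, x2, D)" by (simp_all add: sym_data_def es2_def es3_def algebra_simps)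
  have "irr_quad x1 x2 x3 x4 D" unfolding irr_quad_def
  proof (intro allI impI, elim conjE, intro conjI impI)
    fix k assume k: "0 < k" "k < n"
    show "x1*x2*p^k = p \<Longrightarrow> D \<noteq> x1^n + x2^n" by (rule main[OF k _ v refl])
    show "x1*x3*p^k = p \<Longrightarrow> D \<noteq> x1^n + x3^n" by (rule main[OF k _ V(1) Dt(1)])
    show "x1*x4*p^k = p \<Longrightarrow> D \<noteq> x1^n + x4^n" by (rule main[OF k _ V(2) Dt(2)])
    show "x2*x3*p^k = p \<Longrightarrow> D \<noteq> x2^n + x3^n" by (rule main[OF k _ V(3) Dt(3)])
    show "x2*x4*p^k = p \<Longrightarrow> D \<noteq> x2^n + x4^n" by (rule main[OF k _ V(4) Dt(4)])
    show "x3*x4*p^k = p \<Longrightarrow> D \<noteq> x3^n + x4^n" by (rule main[OF k _ V(5) Dt(5)])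
  qed
  then show "nz5 x \<and> irr_params (params x)" using x v by (simp add: irr_params_def r)
next
  assume a: "nz5 x \<and> irr_params (params x)"
  have "\<delta> \<noteq> 0 \<or> \<not> (\<exists>i\<le>n - 2. l^2 = q^(2*i))" if s: "simeq_pmS4 sr q d x (a, b, c, l, \<delta>)" for a b c l \<delta>
  proof (rule ccontr)
    let ?y = "(a, b, c, l, \<delta>)"
    assume "\<not> ?thesis"
    then have d0: "\<delta> = 0" and l: "\<exists>i\<le>n - 2. l^2 = q^(2*i)" by auto
    have y: "nz5 ?y" and x: "nz5 x" using simeq_pm_nz s by auto
    have "sym_data (params x) = sym_data (params ?y)" using simeq_pm_iff[OF x y] s by simp
    then have "irr_params (params ?y)" using sym_data_eq_swaps[OF params_admissible[OF x] params_admissible[OF y]] swaps_links links_irr_params a by blast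
    then have P: "irr_quad (a/l) (1/(a*l)) (b*c*q) (b*q/c) (\<delta> + (a/l)^n + inverse ((a/l)^n))" by (simp add: irr_params_def)
    obtain k where k: "0 < k" "k < n" "a/l * (1/(a*l)) * p^k = p" using l l2_iff[OF y] by blast
    have ne: "\<delta> + (a/l)^n + inverse ((a/l)^n) \<noteq> (a/l)^n + (1/(a*l))^n" using P k unfolding irr_quad_def by blast
    have "(a/l)^n * (1/(a*l))^n = 1" using arg_cong[OF k(3), of "\<lambda>t. t^n"] unfolding power_mult_distrib pow_n_pow pn by simp
    then have "inverse ((a/l)^n) = (1/(a*l))^n" by (rule inverse_unique)
    then show False using ne d0 by simp
  qed
  then show "x \<in> PM sr q d" using a unfolding PM_def n_def by auto
qed

end

section \<open>The equivalence relation\<close>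

context aw_setting begin

lemma sim_basic_simeq: "sim_basic sr q d x y \<Longrightarrow> simeq sr q d x y" "sim_basic sr q d y x \<Longrightarrow> simeq sr q d x y"
  unfolding simeq_def by (simp_all add: r_into_rtranclp)

lemma simeq_trans: "simeq sr q d x y \<Longrightarrow> simeq sr q d y z \<Longrightarrow> simeq sr q d x z"
  unfolding simeq_def by (rule rtranclp_trans)

lemma simeq_sym: "simeq sr q d x y \<Longrightarrow> simeq sr q d y x"
  unfolding simeq_def by (induction rule: rtranclp_induct) (auto intro: converse_rtranclp_into_rtranclp)

lemma sym_data_simeq: "nz5 x \<Longrightarrow> nz5 y \<Longrightarrow> sym_data (params x) = sym_data (params y) \<Longrightarrow> simeq sr q d x y"
  using simeq_pm_iff by (intro sim_basic_simeq(1)) (cases x; auto simp: sim_basic_def Let_def)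

text \<open>From lambda^2 p = p^k, replacing lambda by 1/(lambda p) divides m by p^(-k); inverting a
  as well exchanges the two shifted entries.\<close>

lemma params_ii:
  assumes x: "nz5 (a, b, c, l, \<delta>)" and e: "a/l * (1/(a*l)) * p^k = p"
  shows "params (inverse a, b, c, inverse l * inverse q ^ 2, \<delta>) = (b/l * p^k, 1/(a*l) * p^k, a/l * p^k, b*c*q, b*q/c, \<delta> + (a/l)^n + inverse ((a/l)^n))"
    and "nz5 (inverse a, b, c, inverse l * inverse q ^ 2, \<delta>)"
proof -
  have nz: "a \<noteq> 0" "b \<noteq> 0" "c \<noteq> 0" "l \<noteq> 0" using x by (auto simp: nz5_iff)
  show "nz5 (inverse a, b, c, inverse l * inverse q ^ 2, \<delta>)" using nz q0 by (simp add: nz5_iff)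
  have pk: "p^k = l^2 * p" using e nz by (simp add: field_simps power2_eq_square)
  have L: "inverse l * inverse q ^ 2 = 1/(l * p)" using nz q0 by (simp add: p_def field_simps)
  have 1: "b/(1/(l*p)) = b/l * p^k" "inverse a/(1/(l*p)) = 1/(a*l) * p^k" "1/(inverse a * (1/(l*p))) = a/l * p^k"
    unfolding pk using nz p0 by (simp_all add: field_simps power2_eq_square)
  have 2: "(inverse a/(1/(l*p)))^n = inverse ((a/l)^n)" using nz by (simp add: power_mult_distrib power_divide pn field_simps)
  have "\<delta> + (inverse a/(1/(l*p)))^n + inverse ((inverse a/(1/(l*p)))^n) = \<delta> + (a/l)^n + inverse ((a/l)^n)" unfolding 2 by simp
  then show "params (inverse a, b, c, inverse l * inverse q ^ 2, \<delta>) = (b/l * p^k, 1/(a*l) * p^k, a/l * p^k, b*c*q, b*q/c, \<delta> + (a/l)^n + inverse ((a/l)^n))"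
    unfolding params.simps L using 1 by simp
qed

lemma params_iii:
  assumes x: "nz5 (a, b, c, l, \<delta>)" 
  shows "params (inverse a, inverse b, c, inverse l * inverse q ^ 2, \<delta>) = reflect (params (a, b, c, l, \<delta>))"
    and "nz5 (inverse a, inverse b, c, inverse l * inverse q ^ 2, \<delta>)"
proof -
  have nz: "a \<noteq> 0" "b \<noteq> 0" "c \<noteq> 0" "l \<noteq> 0" using x by (auto simp: nz5_iff)
  show "nz5 (inverse a, inverse b, c, inverse l * inverse q ^ 2, \<delta>)" using nz q0 by (simp add: nz5_iff)
  have pp: "p = q * q" by (simp add: p_def power2_eq_square)
  have L: "inverse l * inverse q ^ 2 = 1/(l * p)" using nz q0 by (simp add: p_def field_simps)
  have 1: "inverse b/(1/(l*p)) = p/(b/l)" "inverse a/(1/(l*p)) = p/(a/l)" "1/(inverse a * (1/(l*p))) = p/(1/(a*l))"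
    using nz p0 by (simp_all add: field_simps)
  have 3: "inverse b * c * q = p/(b*q/c)" "inverse b * q / c = p/(b*c*q)" unfolding pp using nz q0 by (simp_all add: field_simps)
  have 2: "(p/(a/l))^n = inverse ((a/l)^n)" using nz by (simp add: power_mult_distrib power_divide pn field_simps)
  show "params (inverse a, inverse b, c, inverse l * inverse q ^ 2, \<delta>) = reflect (params (a, b, c, l, \<delta>))"
    unfolding params.simps L reflect_def prod.case 1 2 3 by simp
qed

text \<open>A shift is relation (ii) followed by an exchange of the first two entries.\<close>

lemma link_simeq:
  assumes x: "nz5 x" and y: "nz5 y" and l: "link (params x) (params y)"
  shows "simeq sr q d x y"
proof (cases "sym_data (params x) = sym_data (params y)")
  case True then show ?thesis by (rule sym_data_simeq[OF x y])
next
  case False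
  obtain a b c l \<delta> where xx: "x = (a, b, c, l, \<delta>)" by (cases x)
  from l show ?thesis
  proof (cases rule: link.cases)
    case (shift k x1 x2 m x3 x4 D)
    have z: "m = b/l" "x1 = a/l" "x2 = 1/(a*l)" "x3 = b*c*q" "x4 = b*q/c" "D = \<delta> + (a/l)^n + inverse ((a/l)^n)" using shift(1) by (auto simp: xx)
    let ?z = "(inverse a, b, c, inverse l * inverse q ^ 2, \<delta>)"
    note ii = params_ii[OF x[unfolded xx] shift(5)[unfolded z]]
    have "\<exists>i\<le>n-2. l^2 = q^(2*i)" using l2_iff[OF x[unfolded xx]] shift(3,4,5) unfolding z by blast
    then have "sim_basic sr q d x ?z" using x ii(2) unfolding xx sim_basic_def Let_def prod.case n_def by blast
    moreover have "sym_data (params ?z) = sym_data (params y)" unfolding ii(1) shift(2) z sym_data_def by (simp add: es2_def es3_def algebra_simps)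
    ultimately show ?thesis using sym_data_simeq[OF ii(2) y] sim_basic_simeq simeq_trans by blast
  qed (use False in \<open>simp_all add: sym_data_def es2_def es3_def algebra_simps\<close>)
qed

lemma links_simeq:
  assumes "link\<^sup>*\<^sup>* (params x) r" "nz5 x" "nz5 y" "params y = r"
  shows "simeq sr q d x y"
  using assms
proof (induction arbitrary: y rule: rtranclp_induct)
  case base then show ?case by (intro sym_data_simeq) simp_all
next
  case (step r' r'')
  have "admissible r'" using links_admissible[OF step.hyps(1) params_admissible[OF step.prems(1)]] .
  then obtain z where z: "nz5 z" "params z = r'" using lift by blast
  have "simeq sr q d x z" using step.IH step.prems(1) z by blast
  moreover have "simeq sr q d z y" using link_simeq[OF z(1) step.prems(2)] step.hyps(2) z(2) step.prems(3) by simp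
  ultimately show ?case by (rule simeq_trans)
qed

text \<open>The exponents n - i + 1 run from 3 to n + 1, so the powers are all n-th roots of unity
  except p^2. The side condition of (iii) thus says that m^(2n) \<noteq> 1 or m^2 = p^2.\<close>

lemma excl_iff:
  assumes m: "m \<noteq> 0"
  shows "(\<exists>i\<le>n-2. m^2 = p^(n-i+1)) \<longleftrightarrow> (m^2)^n = 1 \<and> m^2 \<noteq> p^2"
proof
  assume "\<exists>i\<le>n-2. m^2 = p^(n-i+1)"
  then obtain i where i: "i \<le> n - 2" "m^2 = p^(n-i+1)" by blast
  have "p^(n-i+1) \<noteq> p^2"
  proof
    assume E: "p^(n-i+1) = p^2"
    have B: "p^(n-i+1) * p^i = p * p^(Suc i)" unfolding E by (simp add: power2_eq_square)
    have "n - i + 1 + i = n + 1" using i n3 by simp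
    then have "p^(n-i+1) * p^i = p^(n+1)" unfolding power_add[symmetric] by (rule arg_cong)
    also have "\<dots> = p * 1" by (simp add: pn)
    finally have "p * p^(Suc i) = p * 1" unfolding B .
    then have "p^(Suc i) = 1" using p0 by (metis mult_left_cancel)
    moreover have "Suc i < n" using i(1) n3 by linarith
    ultimately show False using pk[of "Suc i"] by blast
  qed
  then show "(m^2)^n = 1 \<and> m^2 \<noteq> p^2" unfolding i using pow_n_pow by blast
next
  assume a: "(m^2)^n = 1 \<and> m^2 \<noteq> p^2"
  then obtain j where j: "j < n" "m^2 = p^j" using root_ex by blast
  have "j \<noteq> 2" using a j by auto
  then consider "j = 0" | "j = 1" | "j \<ge> 3" by linarith
  then show "\<exists>i\<le>n-2. m^2 = p^(n-i+1)"
  proof cases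
    case 1
    have "n - 1 + 1 = n" using n3 by simp
    then have "p^(n-1+1) = 1" using pn by (rule ssubst)
    then show ?thesis using n3 by (intro exI[of _ 1]) (simp only: j 1, simp)
  next
    case 2
    have "p^(n-0+1) = p" by (simp add: pn)
    then show ?thesis using n3 by (intro exI[of _ 0]) (simp only: j 2, simp)
  next
    case 3
    have "n - (n + 1 - j) + 1 = j" using 3 j by simp
    then show ?thesis using 3 j by (intro exI[of _ "n + 1 - j"]) (simp only: j, simp)
  qed
qed

lemma cond_iii_iff:
  assumes x: "nz5 (a, b, c, l, \<delta>)" and par: "params (a, b, c, l, \<delta>) = (m, x1, x2, x3, x4, D)"
  shows "\<delta> * (b ^ n * inverse l ^ n - inverse b ^ n * l ^ n) =
            inverse a ^ n * inverse b ^ n * (l ^ (2*n) - 1) *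
            (a ^ n * b ^ n * c ^ n * inverse l ^ n * q ^ n - 1) *
            (a ^ n * b ^ n * inverse c ^ n * inverse l ^ n * q ^ n - 1)
     \<longleftrightarrow> D * (w_module.N n m - 1) = w_module.E3 n x1 x2 x3 x4 - w_module.E1 n x1 x2 x3 x4" (is "?L = ?R \<longleftrightarrow> _")
proof -
  interpret w: w_module p n m x1 x2 x3 x4 D by (rule w_moduleI) (use params_admissible[OF x] par in simp)
  have nz: "a \<noteq> 0" "b \<noteq> 0" "c \<noteq> 0" "l \<noteq> 0" using x by (auto simp: nz5_iff)
  have z: "m = b/l" "x1 = a/l" "x2 = 1/(a*l)" "x3 = b*c*q" "x4 = b*q/c" "D = \<delta> + (a/l)^n + inverse ((a/l)^n)" using par by auto
  have del: "w.\<delta> = \<delta>" unfolding w.\<delta>_def by (simp add: z)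
  define La Lb Lc Ll Lq where L: "La = a^n" "Lb = b^n" "Lc = c^n" "Ll = l^n" "Lq = q^n"
  have L0: "La \<noteq> 0" "Lb \<noteq> 0" "Lc \<noteq> 0" "Ll \<noteq> 0" using nz by (simp_all add: L)
  have X: "x1^n = La/Ll" "x2^n = 1/(La*Ll)" "x3^n = Lb*Lc*Lq" "x4^n = Lb*Lq/Lc" by (simp_all add: z L power_divide power_mult_distrib)
  have N: "w.N = (Lb/Ll)^2" unfolding w.N_def by (simp add: z L power_divide power_mult[symmetric] mult.commute)
  have l2: "l^(2*n) = Ll^2" by (simp add: L power_mult[symmetric] mult.commute)
  define f g where fg: "f = La * Lb * Lc * inverse Ll * Lq - 1" "g = La * Lb * inverse Lc * inverse Ll * Lq - 1"
  have F: "1 - x1^n*x3^n = - f" "1 - x1^n*x4^n = - g" unfolding X fg using L0 by (simp_all add: field_simps)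
  \<comment> \<open>The multiplier is (a b / lambda^2)^n, which clears the inverses and turns the
    difference into the two sides of \<open>prod_E\<close>.\<close>
  have "(?L - ?R) * (La * Lb / Ll^2) = (\<delta> * (Lb * inverse Ll - inverse Lb * Ll) - inverse La * inverse Lb * (Ll^2 - 1) * f * g) * (La * Lb / Ll^2)"
    unfolding power_inverse l2 L[symmetric] fg ..
  also have "\<dots> = \<delta> * (x1^n * (w.N - 1)) - (1 - x1^n*x2^n) * (1 - x1^n*x3^n) * (1 - x1^n*x4^n)"
    unfolding F unfolding N X(1,2) using L0 by (simp add: field_simps power2_eq_square)
  also have "\<dots> = (D * (w.N - 1) - (w.E3 - w.E1)) * x1^n" using w.prod_E del by simp
  finally have e: "(?L - ?R) * (La * Lb / Ll^2) = (D * (w.N - 1) - (w.E3 - w.E1)) * x1^n" .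
  have "La * Lb / Ll^2 \<noteq> 0" "x1^n \<noteq> 0" using L0 X by simp_all
  then show ?thesis using e by (metis eq_iff_diff_eq_0 mult_eq_0_iff)
qed

text \<open>Cases (i) and (ii) are links. In case (iii) the exceptional vector exists if m^(2n)
  \<noteq> 1; otherwise m^2 = p^2 and the reflection is again a chain of links.\<close>

lemma sim_basic_sound:
  assumes s: "sim_basic sr q d x y"
  shows "irr_params (params x) \<longleftrightarrow> irr_params (params y)" "irr_params (params x) \<Longrightarrow> rep_iso (params x) (params y)"
proof -
  obtain a b c l \<delta> where xx: "x = (a, b, c, l, \<delta>)" by (cases x)
  have x: "nz5 x" and y: "nz5 y" using s by (simp_all add: sim_basic_def)
  obtain m x1 x2 x3 x4 D where par: "params x = (m, x1, x2, x3, x4, D)" by (cases "params x")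
  have z: "m = b/l" "x1 = a/l" "x2 = 1/(a*l)" "x3 = b*c*q" "x4 = b*q/c" "D = \<delta> + (a/l)^n + inverse ((a/l)^n)" using par by (auto simp: xx)
  have v: "admissible (m, x1, x2, x3, x4, D)" using params_admissible[OF x] par by simp
  interpret w: w_module p n m x1 x2 x3 x4 D by (rule w_moduleI[OF v])
  have "(irr_params (params x) \<longleftrightarrow> irr_params (params y)) \<and> (irr_params (params x) \<longrightarrow> rep_iso (params x) (params y))"
  proof -
    have lk: ?thesis if "link\<^sup>*\<^sup>* (params x) (params y)"
      using links_irr_params[OF that] links_irr_params[OF links_sym[OF that]] links_rep_iso[OF that] by blast
    consider (1) "simeq_pmS4 sr q d x y" | (2) "y = (inverse a, b, c, inverse l * inverse q ^ 2, \<delta>)" "\<exists>i\<le>n-2. l^2 = q^(2*i)"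
      | (3) "y = (inverse a, inverse b, c, inverse l * inverse q ^ 2, \<delta>)" "\<not> (\<exists>i \<le> n - 2. b^2 * inverse l ^ 2 = q ^ (2 * (n - i + 1)))"
          "D * (w.N - 1) = w.E3 - w.E1"
      using s cond_iii_iff[OF x[unfolded xx] par[unfolded xx]] unfolding xx sim_basic_def Let_def prod.case n_def[symmetric] by blast
    then show ?thesis
    proof cases
      case 1
      then have "sym_data (params x) = sym_data (params y)" using simeq_pm_iff[OF x y] by simp
      then show ?thesis using lk swaps_links[OF sym_data_eq_swaps[OF params_admissible[OF x] params_admissible[OF y]]] by blast
    next
      case 2
      then obtain k where k: "0 < k" "k < n" "a/l * (1/(a*l)) * p^k = p" using l2_iff[OF x[unfolded xx]] by blast
      have "link (params x) (m * p^k, x1 * p^k, x2 * p^k, x3, x4, D)" unfolding par by (rule shift[OF k(1,2)]) (use k(3) z in simp)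
      moreover have "link (m * p^k, x1 * p^k, x2 * p^k, x3, x4, D) (params y)"
        unfolding 2(1) params_ii(1)[OF x[unfolded xx] k(3)] z by (rule swap12)
      ultimately show ?thesis using lk by (meson converse_rtranclp_into_rtranclp r_into_rtranclp)
    next
      case 3
      have y3: "params y = reflect (m, x1, x2, x3, x4, D)" unfolding 3(1) params_iii(1)[OF x[unfolded xx]] par[symmetric] xx ..
      have eqm: "b^2 * inverse l^2 = m^2" by (simp add: z power_mult_distrib power_inverse divide_inverse)
      have "\<not> ((m^2)^n = 1 \<and> m^2 \<noteq> p^2)" using 3(2) unfolding ppow(2)[symmetric] eqm excl_iff[OF w.nz(1)] .
      then consider "w.N \<noteq> 1" | "w.N = 1" "m^2 = p^2" unfolding w.N_def by blast
      then show ?thesis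
      proof cases
        case 1
        have "irr_params (params x) \<Longrightarrow> rep_iso (params y) (params x)" using w.reflect_rep_iso[OF 1 3(3)] unfolding par y3 irr_params_def by simp
        then show ?thesis using reflect_irr_params_iff[OF v] rep_iso_sym unfolding par y3 by blast
      next
        case 2
        have "(1 - x1^n * x2^n) * (1 - x1^n * x3^n) * (1 - x1^n * x4^n) = 0" using w.prod_E 2(1) 3(3) by simp
        from reflect_links_N1[OF v 2(2) this] show ?thesis using lk unfolding par y3 by blast
      qed
    qed
  qed
  then show "irr_params (params x) \<longleftrightarrow> irr_params (params y)" "irr_params (params x) \<Longrightarrow> rep_iso (params x) (params y)" by blast+
qed

lemma simeq_sound:
  assumes "simeq sr q d x y" "x \<in> PM sr q d"
  shows "y \<in> PM sr q d \<and> rep_iso (params x) (params y)"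
  using assms unfolding simeq_def
proof (induction rule: rtranclp_induct)
  case base then show ?case using rep_iso_refl by (simp add: PM_iff irr_params_def)
next
  case (step y z)
  have y: "irr_params (params y)" "rep_iso (params x) (params y)" using step by (auto simp: PM_iff)
  have "nz5 z" using step.hyps(2) by (auto simp: sim_basic_def)
  moreover have "irr_params (params z) \<and> rep_iso (params y) (params z)" using step.hyps(2) sim_basic_sound y(1) rep_iso_sym by blast
  ultimately show ?case using rep_iso_trans[OF y(2)] by (simp add: PM_iff)
qed

text \<open>The bottom vector of the second module becomes a marginal vector in the first one. Its
  top position leads to an equivalent tuple with the same weight and coefficient as
  \<open>y\<close>; the invariants gamma, beta and D then give equal symmetric data.\<close>

lemma simeq_complete:
  assumes PM: "x \<in> PM sr q d" "y \<in> PM sr q d" and i: "rep_iso (params x) (params y)"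
  shows "simeq sr q d x y"
proof -
  have x: "nz5 x" "irr_params (params x)" and y: "nz5 y" "irr_params (params y)" using PM by (simp_all add: PM_iff)
  note vx = params_admissible[OF x(1)] and vy = params_admissible[OF y(1)]
  obtain m x1 x2 x3 x4 D where r: "params x = (m, x1, x2, x3, x4, D)" by (cases "params x")
  obtain \<nu> y1 y2 y3 y4 D' where s: "params y = (\<nu>, y1, y2, y3, y4, D')" by (cases "params y")
  interpret w: w_module p n m x1 x2 x3 x4 D by (rule w_moduleI) (use vx r in simp)
  interpret y: w_module p n \<nu> y1 y2 y3 y4 D' by (rule w_moduleI) (use vy s in simp)
  have P: "irr_quad x1 x2 x3 x4 D" using x(2) by (simp add: r irr_params_def)
  define c where "c = coeff_of (params y)"
  have c: "y.cv = c" by (simp add: c_def s coeff_of_def y.cv_def y.e1_def y.e3_es)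
  obtain U Q where iso: "iso n U Q y.A y.B w.A w.B" using rep_iso_sym[OF i] by (auto simp: rep_iso_def r s repA_def repB_def)
  have "marginal_vec p n w.A w.B \<nu> c (U *\<^sub>v unit_vec n 0)" using iso_marginal_vec[OF iso y.mvec0] c by simp
  then obtain t l where tl: "l < n" "marginal_vec p n w.A w.B \<nu> c (t \<cdot>\<^sub>v (U *\<^sub>v unit_vec n 0))" "(t \<cdot>\<^sub>v (U *\<^sub>v unit_vec n 0)) $ l = 1" 
     "\<And>i. l < i \<Longrightarrow> i < n \<Longrightarrow> (t \<cdot>\<^sub>v (U *\<^sub>v unit_vec n 0)) $ i = 0" "\<nu> = m * p^l \<or> l = n - 1 \<and> \<nu> = p / m"
    using w.top_cases[OF _ y.nz(1)] by metis
  have fin: "simeq sr q d x y" if "simeq sr q d x z" "nz5 z" "weight_of (params z) = \<nu>" "coeff_of (params z) = c" for z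
  proof -
    have "rep_iso (params z) (params y)" using simeq_sound[OF that(1) PM(1)] i rep_iso_sym rep_iso_trans by blast
    note inv = rep_iso_inv[OF params_admissible[OF that(2)] vy this]
    have "sym_data (params z) = sym_data (params y)" by (rule sym_data_from[OF params_admissible[OF that(2)] vy _ _ inv]) (use that(3,4) in \<open>simp_all add: weight_of_def s c_def\<close>)
    then show ?thesis using sym_data_simeq[OF that(2) y(1)] simeq_trans[OF that(1)] by blast
  qed
  have gd: "simeq sr q d x y" if G: "linked (m, x1, x2, x3, x4, D) \<nu> c"
  proof -
    obtain a b e f D2 where g: "link\<^sup>*\<^sup>* (params x) (\<nu>, a, b, e, f, D2)" "c = marginal_coeff p \<nu> (a+b+e+f) (es3 a b e f)" using G unfolding linked_def r by blast
    have "admissible (\<nu>, a, b, e, f, D2)" using links_admissible[OF g(1) vx] .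
    then obtain z where z: "nz5 z" "params z = (\<nu>, a, b, e, f, D2)" using lift by blast
    show ?thesis by (rule fin[OF links_simeq[OF g(1) x(1) z] z(1)]) (simp_all add: z weight_of_def coeff_of_def g(2))
  qed
  show ?thesis
  proof (cases "\<nu> = m * p^l")
    case True
    then show ?thesis using gd w.marginal_vec_full[OF tl(2)[unfolded True] tl(1,3,4) P] by blast
  next
    case False
    then have l: "l = n - 1" and nu: "\<nu> = p/m" using tl(5) by blast+
    note mv = tl(2)[unfolded nu] and v1 = tl(3)[unfolded l]
    show ?thesis
    proof (cases "w.N = 1")
      case True
      have "p/m \<noteq> m * p^(n-1)" using False unfolding nu l .
      then show ?thesis using gd w.marginal_vec_bad[OF mv v1 _ True P] nu by blast
    next
      case N1: False
      note b = w.reflect_bwd[OF N1 mv v1]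
      obtain a b' c' l' \<delta> where xx: "x = (a, b', c', l', \<delta>)" by (cases x)
      let ?z = "(inverse a, inverse b', c', inverse l' * inverse q ^ 2, \<delta>)"
      have mm: "m = b'/l'" using r by (simp add: xx)
      have eqm: "b'^2 * inverse l'^2 = m^2" by (simp add: mm power_mult_distrib power_inverse divide_inverse)
      have "\<not> (\<exists>i \<le> n - 2. b'^2 * inverse l' ^ 2 = q ^ (2 * (n - i + 1)))" 
        using N1 unfolding ppow(2)[symmetric] eqm excl_iff[OF w.nz(1)] w.N_def by simp
      moreover note iii = params_iii[OF x(1)[unfolded xx]]
      ultimately have "sim_basic sr q d x ?z" using x(1) cond_iii_iff[OF x(1)[unfolded xx] r[unfolded xx]] b(1)
        unfolding xx sim_basic_def Let_def prod.case n_def[symmetric] by blast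
      then have sz: "simeq sr q d x ?z" by (rule sim_basic_simeq)
      have P: "params ?z = reflect (m, x1, x2, x3, x4, D)" unfolding iii(1) r[symmetric] xx ..
      show ?thesis
      proof (rule fin[OF sz iii(2)])
        show "weight_of (params ?z) = \<nu>" unfolding P by (simp add: weight_of_def reflect_def nu)
        show "coeff_of (params ?z) = c" unfolding P w.reflect_coeff_of[symmetric] b(2) ..
      qed
    qed
  qed
qed

end

section \<open>Classification\<close>

lemma shifted_twice_eq_0_iff:
  assumes B: "B \<in> carrier_mat n n" and w: "w \<in> carrier_vec n"
  shows "(B - t \<cdot>\<^sub>m 1\<^sub>m n) *\<^sub>v ((B - s \<cdot>\<^sub>m 1\<^sub>m n) *\<^sub>v w) = 0\<^sub>v n \<longleftrightarrow>
    B *\<^sub>v (B *\<^sub>v w) + (s * t) \<cdot>\<^sub>v w = (s + t) \<cdot>\<^sub>v (B *\<^sub>v (w :: 'a::field vec))"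
proof -
  have m: "(B - s \<cdot>\<^sub>m 1\<^sub>m n) *\<^sub>v x = B *\<^sub>v x - s \<cdot>\<^sub>v x" if "x \<in> carrier_vec n" for x s
    unfolding minus_mult_distrib_mat_vec[OF B smult_carrier_mat[OF one_carrier_mat] that] mv_smult_mat[OF one_carrier_mat that] one_mult_mat_vec[OF that] ..
  define b bb where "b = B *\<^sub>v w" and "bb = B *\<^sub>v b"
  have b: "b \<in> carrier_vec n" and bb: "bb \<in> carrier_vec n" using mv_carrier[OF B] w by (simp_all add: b_def bb_def)
  have swp: "s \<cdot>\<^sub>v w \<in> carrier_vec n" using w by simp
  have e: "(B - t \<cdot>\<^sub>m 1\<^sub>m n) *\<^sub>v ((B - s \<cdot>\<^sub>m 1\<^sub>m n) *\<^sub>v w) = (bb - s \<cdot>\<^sub>v b) - t \<cdot>\<^sub>v (b - s \<cdot>\<^sub>v w)"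
    unfolding m[OF w] b_def[symmetric] using m[OF minus_carrier_vec[OF b swp], of t] mv_minus[OF B b swp] mv_smult[OF B w] by (simp add: b_def[symmetric] bb_def[symmetric])
  have l: "(bb - s \<cdot>\<^sub>v b) - t \<cdot>\<^sub>v (b - s \<cdot>\<^sub>v w) = 0\<^sub>v n \<longleftrightarrow> (\<forall>i<n. bb $ i - s * b $ i - t * (b $ i - s * w $ i) = 0)"
    using w b bb by (auto simp: vec_eq_iff)
  have r: "bb + (s * t) \<cdot>\<^sub>v w = (s + t) \<cdot>\<^sub>v b \<longleftrightarrow> (\<forall>i<n. bb $ i + s * t * w $ i = (s + t) * b $ i)"
    using w b bb by (auto simp: vec_eq_iff)
  have k: "x - s * y - t * (y - s * z) = 0 \<longleftrightarrow> x + s * t * z = (s + t) * y" for x y z :: 'a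
    using eq_iff_diff_eq_0[of "x + s * t * z" "(s + t) * y"] by (simp add: algebra_simps)
  show ?thesis unfolding e b_def[symmetric] bb_def[symmetric] l r k ..
qed

context aw_setting begin

lemma marg_iff:
  assumes "B \<in> carrier_mat n n" "w \<in> carrier_vec n"
  shows "(B - (\<mu> * q^2 + inverse \<mu> * inverse q ^ 2) \<cdot>\<^sub>m 1\<^sub>m n) *\<^sub>v ((B - (\<mu> + inverse \<mu>) \<cdot>\<^sub>m 1\<^sub>m n) *\<^sub>v w) = 0\<^sub>v n \<longleftrightarrow>
    B *\<^sub>v (B *\<^sub>v w) + (theta \<mu> 1 * theta \<mu> p) \<cdot>\<^sub>v w = (theta \<mu> 1 + theta \<mu> p) \<cdot>\<^sub>v (B *\<^sub>v w)"
proof -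
  have t: "\<mu> + inverse \<mu> = theta \<mu> 1" "\<mu> * q^2 + inverse \<mu> * inverse q ^ 2 = theta \<mu> p" 
    by (simp_all add: theta_def p_def power_inverse)
  show ?thesis unfolding t by (rule shifted_twice_eq_0_iff[OF assms])
qed

lemma W_irr:
  assumes PM: "x \<in> PM sr q d" shows "tmod_irreducible n (W q d x)" "is_marginal_weight q n (W q d x) (weight_of (params x))"
proof -
  have x: "nz5 x" "irr_params (params x)" using PM by (simp_all add: PM_iff)
  obtain m x1 x2 x3 x4 D where r: "params x = (m, x1, x2, x3, x4, D)" by (cases "params x")
  interpret w: w_module p n m x1 x2 x3 x4 D by (rule w_moduleI) (use params_admissible[OF x(1)] r in simp)
  have W: "W q d x = (w.A, w.B, Cg (gamma_of (params x)) w.A w.B)" unfolding W_eq[OF x(1)] by (simp add: r repA_def repB_def)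
  have "irr n w.A w.B" by (rule w.irreducible) (use x(2) in \<open>simp add: r irr_params_def\<close>)
  then show "tmod_irreducible n (W q d x)" unfolding W tmod_irreducible_def irr_def prod.case using n3 by auto
  let ?e = "unit_vec n 0 :: 'a vec"
  have mv: "marginal_vec p n w.A w.B m w.cv ?e" by (rule w.mvec0)
  define z where "z = w.A *\<^sub>v ?e"
  have z: "z \<in> carrier_vec n" using mv_carrier[OF w.A_carrier] by (simp add: z_def)
  have e: "?e \<in> carrier_vec n" by simp
  have Bz: "w.B *\<^sub>v z = theta m p \<cdot>\<^sub>v z + w.cv \<cdot>\<^sub>v ?e" and Be: "w.B *\<^sub>v ?e = theta m 1 \<cdot>\<^sub>v ?e" using mv by (simp_all add: marginal_vec_def z_def)
  have "w.B *\<^sub>v (w.B *\<^sub>v z) = theta m p \<cdot>\<^sub>v (theta m p \<cdot>\<^sub>v z + w.cv \<cdot>\<^sub>v ?e) + w.cv \<cdot>\<^sub>v (theta m 1 \<cdot>\<^sub>v ?e)"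
    unfolding Bz mv_add[OF w.B_carrier smult_carrier_vec[THEN iffD2, OF z] smult_carrier_vec[THEN iffD2, OF e]] mv_smult[OF w.B_carrier z] mv_smult[OF w.B_carrier e] Be Bz ..
  then have "w.B *\<^sub>v (w.B *\<^sub>v z) + (theta m 1 * theta m p) \<cdot>\<^sub>v z = (theta m 1 + theta m p) \<cdot>\<^sub>v (w.B *\<^sub>v z)"
    unfolding Bz using z by (auto intro!: eq_vecI simp: algebra_simps simp del: index_mult_mat_vec)
  then have "(w.B - (m * q^2 + inverse m * inverse q ^ 2) \<cdot>\<^sub>m 1\<^sub>m n) *\<^sub>v ((w.B - (m + inverse m) \<cdot>\<^sub>m 1\<^sub>m n) *\<^sub>v z) = 0\<^sub>v n"
    unfolding marg_iff[OF w.B_carrier z] .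
  moreover have "?e \<noteq> 0\<^sub>v n" using mv by (simp add: marginal_vec_def)
  moreover have "w.B *\<^sub>v ?e = (m + inverse m) \<cdot>\<^sub>v ?e" using Be by (simp add: theta_def)
  ultimately show "is_marginal_weight q n (W q d x) (weight_of (params x))"
    unfolding is_marginal_weight_def W prod.case r weight_of_def using w.nz(1) e unfolding z_def by blast
qed

text \<open>The central expressions act by scalars. The one for gamma expresses \<open>C\<close>
  through \<open>A\<close> and \<open>B\<close>, so the pair is irreducible by itself, and the other
  two give the relations needed to apply the classification.\<close>

lemma W_surj:
  assumes M: "is_tmod q n M" and irr3: "tmod_irreducible n M" and mw: "is_marginal_weight q n M \<mu>"
  shows "\<exists>x\<in>PM sr q d. tmod_iso n M (W q d x)"
proof -
  obtain A B C where MM: "M = (A, B, C)" by (cases M)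
  have c: "A \<in> carrier_mat n n" "B \<in> carrier_mat n n" "C \<in> carrier_mat n n" using M unfolding MM is_tmod_def by auto
  define Oa Ob Oc where O: "Oa = A + kk \<cdot>\<^sub>m (q \<cdot>\<^sub>m (B * C) - inverse q \<cdot>\<^sub>m (C * B))"
    "Ob = B + kk \<cdot>\<^sub>m (q \<cdot>\<^sub>m (C * A) - inverse q \<cdot>\<^sub>m (A * C))" "Oc = C + kk \<cdot>\<^sub>m (q \<cdot>\<^sub>m (A * B) - inverse q \<cdot>\<^sub>m (B * A))"
  have Oc: "Oa \<in> carrier_mat n n" "Ob \<in> carrier_mat n n" "Oc \<in> carrier_mat n n"
    unfolding O by (rule O_carrier[OF c(1,2) c(2,3,1)] O_carrier[OF c(1,2) c(3,1,2)] O_carrier[OF c(1,2) c(1,2,3)])+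
  have com: "\<forall>Z\<in>{Oa, Ob, Oc}. \<forall>X\<in>{A, B, C}. Z * X = X * Z" using M unfolding MM is_tmod_def prod.case Let_def O kk_def by blast
  have sch: "\<exists>z. \<forall>v\<in>carrier_vec n. Z *\<^sub>v v = z \<cdot>\<^sub>v v" if Z: "Z \<in> {Oa, Ob, Oc}" for Z
  proof (rule schur[OF ac])
    show "0 < n" using n3 by simp
    show Zc: "Z \<in> carrier_mat n n" using Z Oc by blast
    show Yc: "Y \<in> carrier_mat n n" if "Y \<in> {A, B, C}" for Y using that c by blast
    show "Z *\<^sub>v (Y *\<^sub>v v) = Y *\<^sub>v (Z *\<^sub>v v)" if Y: "Y \<in> {A, B, C}" and v: "v \<in> carrier_vec n" for Y v
    proof -
      have "Z * Y = Y * Z" using com Z Y by blast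
      then show ?thesis unfolding mv_mult[OF Zc Yc[OF Y] v, symmetric] mv_mult[OF Yc[OF Y] Zc v, symmetric] by (rule arg_cong)
    qed
    show "U = {0\<^sub>v n} \<or> U = carrier_vec n" if U: "is_subspace n U" "\<And>Y v. Y \<in> {A, B, C} \<Longrightarrow> v \<in> U \<Longrightarrow> Y *\<^sub>v v \<in> U" for U
      using irr3 U unfolding tmod_irreducible_def MM prod.case by blast
  qed
  obtain za where za: "\<And>v. v \<in> carrier_vec n \<Longrightarrow> Oa *\<^sub>v v = za \<cdot>\<^sub>v v" using sch[of Oa] by blast
  obtain zb where zb: "\<And>v. v \<in> carrier_vec n \<Longrightarrow> Ob *\<^sub>v v = zb \<cdot>\<^sub>v v" using sch[of Ob] by blast
  obtain zc where zc: "\<And>v. v \<in> carrier_vec n \<Longrightarrow> Oc *\<^sub>v v = zc \<cdot>\<^sub>v v" using sch[of Oc] by blast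
  define g where "g = zc * (q + inverse q)"
  have C: "C = Cg g A B" unfolding g_def by (rule C_from_scalar[OF c(1,2,3)]) (use zc O(3) in simp)
  interpret pair n A B p by standard (use c p0 in auto)
  have kk2: "kk * kk \<noteq> 0" using kk0 by simp
  have solve: "e = 0" if "kk * kk * (e + z / (kk * kk) * y) = z * y" for e z y
  proof -
    have "kk * kk * (e + z / (kk * kk) * y) = kk * kk * e + z * y" using kk0 by (simp add: distrib_left)
    then show ?thesis using that kk2 by simp
  qed
  have r1: "rel p n A B g (zb / (kk*kk))" unfolding p_def
  proof (rule relI_E[OF c(1,2)])
    fix v i assume v: "v \<in> V" and i: "i < n"
    show "pair.E A B (q^2) g (zb / (kk*kk)) v i = 0"
    proof (rule solve[of _ zb "v $ i"])
      have h: "(Ob *\<^sub>v v) $ i = zb * v $ i" unfolding zb[OF v] using v i by simp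
      show "kk * kk * (pair.E A B (q^2) g (zb / (kk*kk)) v i + zb / (kk * kk) * v $ i) = zb * v $ i"
        by (rule trans[OF Ob_Cg[OF c(1,2) v i, symmetric] h[unfolded O(2)[unfolded C]]])
    qed
  qed
  have r2: "rel p n B A g (za / (kk*kk))" unfolding p_def
  proof (rule relI_E2[OF c(1,2)])
    fix v i assume v: "v \<in> V" and i: "i < n"
    show "pair.E2 A B (q^2) g (za / (kk*kk)) v i = 0"
    proof (rule solve[of _ za "v $ i"])
      have h: "(Oa *\<^sub>v v) $ i = za * v $ i" unfolding za[OF v] using v i by simp
      show "kk * kk * (pair.E2 A B (q^2) g (za / (kk*kk)) v i + za / (kk * kk) * v $ i) = za * v $ i"
        by (rule trans[OF Oa_Cg[OF c(1,2) v i, symmetric] h[unfolded O(1)[unfolded C]]])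
    qed
  qed
  have irr: "irr n A B" unfolding irr_def
  proof (intro allI impI, elim conjE)
    fix U assume U: "is_subspace n U" "\<forall>v\<in>U. A *\<^sub>v v \<in> U \<and> B *\<^sub>v v \<in> U"
    have "C *\<^sub>v v \<in> U" if v: "v \<in> U" for v
    proof -
      have vV: "v \<in> carrier_vec n" using subspaceD(1)[OF U(1)] v by blast
      have 1: "A *\<^sub>v (B *\<^sub>v v) \<in> U" "B *\<^sub>v (A *\<^sub>v v) \<in> U" using U(2) v by blast+
      show ?thesis unfolding C Cg_mv[OF c(1,2) vV] by (intro subspace_minus[OF U(1)] subspaceD(4)[OF U(1)] 1 v)
    qed
    then show "U = {0\<^sub>v n} \<or> U = carrier_vec n" using irr3 U unfolding tmod_irreducible_def MM prod.case by blast
  qed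
  obtain v where v: "\<mu> \<noteq> 0" "v \<in> carrier_vec n" "v \<noteq> 0\<^sub>v n" "B *\<^sub>v v = (\<mu> + inverse \<mu>) \<cdot>\<^sub>v v"
    "(B - (\<mu> * q^2 + inverse \<mu> * inverse q ^ 2) \<cdot>\<^sub>m 1\<^sub>m n) *\<^sub>v ((B - (\<mu> + inverse \<mu>) \<cdot>\<^sub>m 1\<^sub>m n) *\<^sub>v (A *\<^sub>v v)) = 0\<^sub>v n"
    using mw unfolding MM is_marginal_weight_def prod.case by blast
  have Bv: "B *\<^sub>v v = theta \<mu> 1 \<cdot>\<^sub>v v" using v(4) by (simp add: theta_def)
  obtain cc v' where mv: "marginal_vec p n A B \<mu> cc v'"
    using marginal_vec_from_marginal[OF ac r2 v(1,2,3) Bv v(5)[unfolded marg_iff[OF c(2) mv_carrier[OF c(1) v(2)]]]] by blast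
  obtain x1 x2 x3 x4 D P Q where cl: "admissible (\<mu>, x1, x2, x3, x4, D)" "(x1+x2+x3+x4 + es3 x1 x2 x3 x4 / p) / \<mu> = g"
      "iso n P Q (w_module.A p n x1 D) (w_module.B p n \<mu> x1 x2 x3 x4) A B"
    using classify[OF c(1,2) r1 mv v(1) irr] by blast
  obtain x where x: "nz5 x" "params x = (\<mu>, x1, x2, x3, x4, D)" using lift[OF cl(1)] by blast
  interpret w: w_module p n \<mu> x1 x2 x3 x4 D by (rule w_moduleI[OF cl(1)])
  have "irr_quad x1 x2 x3 x4 D" by (rule w.irr_irr_quad[OF iso_irr[OF iso_sym[OF cl(3)] irr]])
  then have PM: "x \<in> PM sr q d" using x cl(1) by (simp add: PM_iff irr_params_def)
  have g: "gamma_of (params x) = g" using cl(2) by (simp add: x gamma_of_def)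
  have W: "W q d x = (w.A, w.B, Cg g w.A w.B)" unfolding W_eq[OF x(1)] g unfolding x repA_def repB_def prod.case ..
  have i: "iso n Q P A B w.A w.B" by (rule iso_sym[OF cl(3)])
  have "tmod_iso n M (W q d x)" unfolding MM W tmod_iso_iff[OF c w.A_carrier w.B_carrier Cg_carrier[OF w.A_carrier w.B_carrier]]
    using i Cg_iso[OF i, of g, folded C] by blast
  then show ?thesis using PM by blast
qed

lemma iso_class_bij:
  "\<exists>f. bij_betw f (PM sr q d // simeq_rel sr q d) (IM q d) \<and>
             (\<forall>x \<in> PM sr q d. f (simeq_rel sr q d `` {x}) = iso_class q (dprime d) (W q d x))"
proof -
  let ?R = "simeq_rel sr q d" and ?P = "PM sr q d"
  have R: "y \<in> ?R `` {x} \<longleftrightarrow> simeq sr q d x y" for x y by (simp add: simeq_rel_def)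
  have cls: "iso_class q n (W q d x) = iso_class q n (W q d y) \<longleftrightarrow> simeq sr q d x y" if xy: "x \<in> ?P" "y \<in> ?P" for x y
  proof -
    have nz: "nz5 x" "nz5 y" using xy by (simp_all add: PM_iff)
    show ?thesis unfolding iso_class_eq_iff[OF W_tmod[OF nz(1)] W_tmod[OF nz(2)]] W_iso_iff[OF nz]
      using simeq_sound[of x y] simeq_complete[OF xy] xy(1) by blast
  qed
  \<comment> \<open>The choice is restricted to members of the class in \<open>PM\<close>; any two
    of them give the same isomorphism class.\<close>
  define f where "f K = iso_class q n (W q d (SOME x. x \<in> K \<and> x \<in> ?P))" for K
  have f: "f (?R `` {x}) = iso_class q n (W q d x)" if x: "x \<in> ?P" for x
  proof -
    define y where "y = (SOME y. y \<in> ?R `` {x} \<and> y \<in> ?P)"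
    have "x \<in> ?R `` {x} \<and> x \<in> ?P" unfolding R using x by (simp add: simeq_def)
    then have "y \<in> ?R `` {x} \<and> y \<in> ?P" unfolding y_def by (rule someI)
    then have y: "simeq sr q d x y" "y \<in> ?P" unfolding R by blast+
    show ?thesis unfolding f_def y_def[symmetric] by (rule cls[OF x y(2), THEN iffD2, OF y(1), symmetric])
  qed
  have "bij_betw f (?P // ?R) (IM q d)" unfolding bij_betw_def
  proof
    show "inj_on f (?P // ?R)"
    proof (rule inj_onI)
      fix K L assume "K \<in> ?P // ?R" "L \<in> ?P // ?R" and e: "f K = f L"
      then obtain x y where x: "x \<in> ?P" "K = ?R `` {x}" and y: "y \<in> ?P" "L = ?R `` {y}" by (auto elim!: quotientE)
      have xy: "simeq sr q d x y" by (rule e[unfolded x(2) y(2) f[OF x(1)] f[OF y(1)] cls[OF x(1) y(1)]])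
      have z: "simeq sr q d x z \<longleftrightarrow> simeq sr q d y z" for z using xy simeq_trans simeq_sym by blast
      show "K = L" unfolding x(2) y(2) by (rule Set.set_eqI) (unfold R, rule z)
    qed
    show "f ` (?P // ?R) = IM q d"
    proof
      show "f ` (?P // ?R) \<subseteq> IM q d"
      proof
        fix Z assume "Z \<in> f ` (?P // ?R)"
        then obtain x where x: "x \<in> ?P" "Z = iso_class q n (W q d x)" using f by (auto elim!: quotientE)
        have "is_tmod q n (W q d x)" by (rule W_tmod) (use x(1) PM_iff in blast)
        then show "Z \<in> IM q d" unfolding IM_def n_def[symmetric] x using W_irr[OF x(1)] by blast
      qed
      show "IM q d \<subseteq> f ` (?P // ?R)"
      proof
        fix Z assume "Z \<in> IM q d"
        then obtain M \<mu> where M: "Z = iso_class q n M" "is_tmod q n M" "tmod_irreducible n M" "is_marginal_weight q n M \<mu>"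
          unfolding IM_def n_def[symmetric] by blast
        obtain x where x: "x \<in> ?P" "tmod_iso n M (W q d x)" using W_surj[OF M(2-4)] by blast
        have nz: "nz5 x" using x(1) by (simp add: PM_iff)
        have "Z = f (?R `` {x})" unfolding f[OF x(1)] M(1) iso_class_eq_iff[OF M(2) W_tmod[OF nz]] by (rule x(2))
        then show "Z \<in> f ` (?P // ?R)" using quotientI[OF x(1)] by blast
      qed
    qed
  qed
  then show ?thesis using f unfolding n_def by blast
qed

end

theorem theorem1p14:
  fixes q :: "'a::field" and d :: nat and sr :: "'a \<Rightarrow> 'a"
  assumes "alg_closed TYPE('a)"
    and "root_of_unity_order q d" and "d \<notin> {1, 2, 4}"
    and "\<forall>x. sr x ^ 2 = x"
  shows "\<exists>f. bij_betw f (PM sr q d // simeq_rel sr q d) (IM q d) \<and>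
             (\<forall>x \<in> PM sr q d. f (simeq_rel sr q d `` {x}) = iso_class q (dprime d) (W q d x))"
  by (rule aw_setting.iso_class_bij) (unfold_locales, fact+)

end
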